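(* Let $U\subset\mathbb{R}^d$ be a non-empty open set and let $\omega_0,\omega_1$ be weight functions on $U$ that both satisfy the compact boundedness condition on $U$ and such that $r_\omega=\omega_0/\omega_1$ is locally Lipschitz on $U$. Let $p\in[1,\infty)$ and assume that $$W^{1,p}_0(U,\omega_j)=W^{1,p}(U,\omega_j),\quad j=0,1,\qquad\text{and}\qquad \mathcal{W}^p_0(U,\theta,r_\omega)=\mathcal{W}^p(U,\theta,r_\omega)\ \text{ for all }\theta\in(0,1).\qquad( * )$$ Then, for this $p$ and for all $\theta\in(0,1)$, as well as the inclusions $$\left[W^{1,p}(U,\omega_0),W^{1,p}(U,\omega_1)\right]_\theta\subset W^{1,p}(U,\omega_\theta),\qquad \mathcal{W}^p_0(U,\theta,r_\omega)\subset\left[W^{1,p}_0(U,\omega_0),W^{1,p}_0(U,\omega_1)\right]_\theta,$$ we also have $$\mathcal{W}^p(U,\theta,r_\omega)\subset\left[W^{1,p}(U,\omega_0),W^{1,p}(U,\omega_1)\right]_\theta\subset W^{1,p}(U,\omega_\theta).\qquad( ** )$$ In particular, if $U=\mathbb{R}^d$ and $\omega_0,\omega_1$ satisfy the compact boundedness condition on $\mathbb{R}^d$ and $r_\omega$ is locally Lipschitz on $\mathbb{R}^d$, then $( * )$ holds for every $p\in[1,\infty)$, and therefore so does $( ** )$ (for every $\theta\in(0,1)$).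
   Context: $d$ is a fixed positive integer. A weight function on $U$ is a Lebesgue measurable function $\omega:U\to(0,\infty)$. It satisfies the compact boundedness condition on $U$ if $0<\inf_{x\in K}\omega(x)\le\sup_{x\in K}\omega(x)<\infty$ for every compact $K\subset U$. Given $\omega_0,\omega_1$, put $\omega_\theta=\omega_0^{1-\theta}\omega_1^{\theta}$. For $p\in[1,\infty)$, $m\in\mathbb{N}$: $L^p(U,\omega,\mathbb{C}^m)$ is the space of measurable $\phi=(\phi_1,\dots,\phi_m):U\to\mathbb{C}^m$ with $\|\phi\|=\left(\sum_{i=1}^m\int_U|\phi_i|^p\omega\,dx\right)^{1/p}<\infty$; $L^p(U,\omega)$ is the case $m=1$. $W^{1,p}(U,\omega)$ is the space of $\phi:U\to\mathbb{C}$ having a weak (distributional) gradient $\nabla\phi$ on $U$ with $(\phi,\nabla\phi)\in L^p(U,\omega,\mathbb{C}^{d+1})$, normed by $\|\phi\|_{W^{1,p}(U,\omega)}=\|(\phi,\nabla\phi)\|_{L^p(U,\omega,\mathbb{C}^{d+1})}$. (Functions are identified when equal a.e.) A function on $U$ is locally Lipschitz if its restriction to each compact subset of $U$ is Lipschitz. $Lip_c(U)$ is the space of Lipschitz functions $U\to\mathbb{C}$ whose support is a compact subset of $U$. $W^{1,p}_0(U,\omega)$ is the closure of $Lip_c(U)$ in $W^{1,p}(U,\omega)$, with the same norm. (Under the compact boundedness condition $W^{1,p}(U,\omega)$ is a Banach space containing $Lip_c(U)$.) $\mathcal{W}^p(U,\theta,r_\omega)$ is the space of $\phi\in W^{1,p}(U,\omega_\theta)$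 such that $\phi|\nabla\log(r_\omega)|\in L^p(U,\omega_\theta)$, with norm $\left(\|\phi\|^p_{W^{1,p}(U,\omega_\theta)}+\int_U|\phi|^p|\nabla\log(r_\omega)|^p\omega_\theta\,dx\right)^{1/p}$, where $|\cdot|$ is the Euclidean norm on $\mathbb{C}^d$. $\mathcal{W}^p_0(U,\theta,r_\omega)$ is the closure of $Lip_c(U)$ in $\mathcal{W}^p(U,\theta,r_\omega)$. $[A_0,A_1]_\theta$ is Calderón's complex interpolation space of a Banach couple $(A_0,A_1)$: let $\mathbb{S}=\{z\in\mathbb{C}:0\le\mathrm{Re}\,z\le1\}$ and let $\mathcal{F}(A_0,A_1)$ be the space of functions $f:\mathbb{S}\to A_0+A_1$ that are continuous and bounded on $\mathbb{S}$, analytic in its interior, and such that $t\mapsto f(j+it)$ is a bounded continuous map of $\mathbb{R}$ into $A_j$, $j=0,1$, with norm $\|f\|_{\mathcal F}=\max_{j=0,1}\sup_{t\in\mathbb{R}}\|f(j+it)\|_{A_j}$. Then $[A_0,A_1]_\theta=\{f(\theta):f\in\mathcal{F}(A_0,A_1)\}$ with norm $\|a\|=\inf\{\|f\|_{\mathcal{F}}:f(\theta)=a\}$. *)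

theory Defs
  imports "HOL-Analysis.Analysis"
begin

text \<open>
  Functions and weights on a set \<open>U\<close> are represented by total functions on \<open>real ^ 'd\<close> of which
  only the values on \<open>U\<close> matter. Instead of passing to classes of almost everywhere equal
  functions, every space below is a set of representatives which contains, with \<open>\<phi>\<close>, every function
  almost everywhere equal to \<open>\<phi>\<close> on \<open>U\<close>; the norms are accordingly seminorms on representatives
  (with value \<open>0\<close> exactly at the functions vanishing almost everywhere on \<open>U\<close>). Inclusions and
  equalities of such sets are the same as those of the corresponding spaces of classes.
\<close>

section \<open>Weights\<close>

definition weight_function :: "(real ^ 'd) set \<Rightarrow> (real ^ 'd \<Rightarrow> real) \<Rightarrow> bool" where
  "weight_function U w \<longleftrightarrow> w \<in> borel_measurable (lebesgue_on U) \<and> (\<forall>x\<in>U. 0 < w x)"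

text \<open>For \<open>K = {}\<close> the conditions are void, the infimum being \<open>\<infinity>\<close> and the supremum \<open>-\<infinity>\<close>.\<close>

definition compactly_bounded :: "(real ^ 'd) set \<Rightarrow> (real ^ 'd \<Rightarrow> real) \<Rightarrow> bool" where
  "compactly_bounded U w \<longleftrightarrow>
     (\<forall>K. compact K \<and> K \<subseteq> U \<longrightarrow> 0 < (INF x\<in>K. ereal (w x)) \<and> (SUP x\<in>K. ereal (w x)) < \<infinity>)"

definition interp_weight ::
  "(real ^ 'd \<Rightarrow> real) \<Rightarrow> (real ^ 'd \<Rightarrow> real) \<Rightarrow> real \<Rightarrow> real ^ 'd \<Rightarrow> real" where
  "interp_weight w0 w1 \<theta> x = w0 x powr (1 - \<theta>) * w1 x powr \<theta>"

definition locally_lipschitz :: "(real ^ 'd) set \<Rightarrow> (real ^ 'd \<Rightarrow> real) \<Rightarrow> bool" where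
  "locally_lipschitz U r \<longleftrightarrow> (\<forall>K. compact K \<and> K \<subseteq> U \<longrightarrow> (\<exists>L. L-lipschitz_on K r))"


section \<open>Weighted Lebesgue spaces\<close>

definition Lp_space ::
  "(real ^ 'd) set \<Rightarrow> (real ^ 'd \<Rightarrow> real) \<Rightarrow> real \<Rightarrow> (real ^ 'd \<Rightarrow> complex ^ 'm) set" where
  "Lp_space U w p = {\<phi>. \<phi> \<in> borel_measurable (lebesgue_on U) \<and>
     (\<forall>i. integrable (lebesgue_on U) (\<lambda>x. norm (\<phi> x $ i) powr p * w x))}"

definition Lp_norm ::
  "(real ^ 'd) set \<Rightarrow> (real ^ 'd \<Rightarrow> real) \<Rightarrow> real \<Rightarrow> (real ^ 'd \<Rightarrow> complex ^ 'm) \<Rightarrow> real" where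
  "Lp_norm U w p \<phi> =
     (\<Sum>i\<in>UNIV. \<integral>x. norm (\<phi> x $ i) powr p * w x \<partial>lebesgue_on U) powr (1 / p)"

definition Lp_scalar ::
  "(real ^ 'd) set \<Rightarrow> (real ^ 'd \<Rightarrow> real) \<Rightarrow> real \<Rightarrow> (real ^ 'd \<Rightarrow> complex) set" where
  "Lp_scalar U w p = {\<phi>. (\<lambda>x. (vec (\<phi> x) :: complex ^ 1)) \<in> Lp_space U w p}"


section \<open>Weak gradients\<close>

definition partial_deriv :: "'d \<Rightarrow> (real ^ 'd \<Rightarrow> real) \<Rightarrow> real ^ 'd \<Rightarrow> real" where
  "partial_deriv i f x = frechet_derivative f (at x) (axis i 1)"

primrec C_order :: "nat \<Rightarrow> (real ^ 'd \<Rightarrow> real) \<Rightarrow> bool" where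
  "C_order 0 f \<longleftrightarrow> continuous_on UNIV f"
| "C_order (Suc n) f \<longleftrightarrow> f differentiable_on UNIV \<and> (\<forall>i. C_order n (partial_deriv i f))"

definition test_functions :: "(real ^ 'd) set \<Rightarrow> (real ^ 'd \<Rightarrow> real) set" where
  "test_functions U = {\<psi>. (\<forall>n. C_order n \<psi>) \<and>
     compact (closure {x. \<psi> x \<noteq> 0}) \<and> closure {x. \<psi> x \<noteq> 0} \<subseteq> U}"

definition locally_integrable ::
  "(real ^ 'd) set \<Rightarrow> (real ^ 'd \<Rightarrow> 'b::{banach, second_countable_topology}) \<Rightarrow> bool" where
  "locally_integrable U f \<longleftrightarrow> (\<forall>K. compact K \<and> K \<subseteq> U \<longrightarrow> set_integrable lebesgue K f)"

definition has_weak_gradient ::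
  "(real ^ 'd) set \<Rightarrow> (real ^ 'd \<Rightarrow> complex) \<Rightarrow> (real ^ 'd \<Rightarrow> complex ^ 'd) \<Rightarrow> bool" where
  "has_weak_gradient U \<phi> g \<longleftrightarrow> locally_integrable U \<phi> \<and> locally_integrable U g \<and>
     (\<forall>\<psi>\<in>test_functions U. \<forall>i.
        (LINT x:U|lebesgue. \<phi> x * complex_of_real (partial_deriv i \<psi> x)) =
        - (LINT x:U|lebesgue. g x $ i * complex_of_real (\<psi> x)))"

text \<open>Weak gradients are unique up to null sets; \<open>weak_gradient\<close> selects a representative and is
  meaningful only for functions that have a weak gradient.\<close>

definition weak_gradient ::
  "(real ^ 'd) set \<Rightarrow> (real ^ 'd \<Rightarrow> complex) \<Rightarrow> real ^ 'd \<Rightarrow> complex ^ 'd" where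
  "weak_gradient U \<phi> = (SOME g. has_weak_gradient U \<phi> g)"


section \<open>Weighted Sobolev spaces\<close>

text \<open>The map \<open>(\<phi>, g)\<close> into a space of dimension \<open>d + 1\<close>, with index type \<open>'d option\<close>.\<close>

definition with_gradient ::
  "(real ^ 'd \<Rightarrow> complex) \<Rightarrow> (real ^ 'd \<Rightarrow> complex ^ 'd) \<Rightarrow> real ^ 'd \<Rightarrow> complex ^ ('d option)" where
  "with_gradient \<phi> g x = (\<chi> j. case j of None \<Rightarrow> \<phi> x | Some i \<Rightarrow> g x $ i)"

definition W1p ::
  "(real ^ 'd) set \<Rightarrow> (real ^ 'd \<Rightarrow> real) \<Rightarrow> real \<Rightarrow> (real ^ 'd \<Rightarrow> complex) set" where
  "W1p U w p = {\<phi>. (\<exists>g. has_weak_gradient U \<phi> g) \<and>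
     with_gradient \<phi> (weak_gradient U \<phi>) \<in> Lp_space U w p}"

definition W1p_norm ::
  "(real ^ 'd) set \<Rightarrow> (real ^ 'd \<Rightarrow> real) \<Rightarrow> real \<Rightarrow> (real ^ 'd \<Rightarrow> complex) \<Rightarrow> real" where
  "W1p_norm U w p \<phi> = Lp_norm U w p (with_gradient \<phi> (weak_gradient U \<phi>))"

definition Lip_c :: "(real ^ 'd) set \<Rightarrow> (real ^ 'd \<Rightarrow> complex) set" where
  "Lip_c U = {\<phi>. (\<exists>L. L-lipschitz_on U \<phi>) \<and>
     compact (closure {x\<in>U. \<phi> x \<noteq> 0}) \<and> closure {x\<in>U. \<phi> x \<noteq> 0} \<subseteq> U}"

text \<open>The closure of \<open>S\<close> in the space \<open>A\<close> with respect to the (semi)norm \<open>N\<close>.\<close>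

definition closure_in ::
  "('a \<Rightarrow> complex) set \<Rightarrow> (('a \<Rightarrow> complex) \<Rightarrow> real) \<Rightarrow> ('a \<Rightarrow> complex) set \<Rightarrow> ('a \<Rightarrow> complex) set" where
  "closure_in A N S = {\<phi>\<in>A. \<forall>e>0. \<exists>\<psi>\<in>S \<inter> A. N (\<lambda>x. \<phi> x - \<psi> x) < e}"

definition W1p_0 ::
  "(real ^ 'd) set \<Rightarrow> (real ^ 'd \<Rightarrow> real) \<Rightarrow> real \<Rightarrow> (real ^ 'd \<Rightarrow> complex) set" where
  "W1p_0 U w p = closure_in (W1p U w p) (W1p_norm U w p) (Lip_c U)"

text \<open>The Euclidean length of the weak gradient of \<open>log (w0 / w1)\<close>. For locally Lipschitz
  \<open>w0 / w1\<close> and compactly bounded weights, the weak gradient exists and equals almost everywhere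
  the classical one.\<close>

definition abs_grad_log_ratio ::
  "(real ^ 'd) set \<Rightarrow> (real ^ 'd \<Rightarrow> real) \<Rightarrow> (real ^ 'd \<Rightarrow> real) \<Rightarrow> real ^ 'd \<Rightarrow> real" where
  "abs_grad_log_ratio U w0 w1 x =
     norm (weak_gradient U (\<lambda>y. complex_of_real (ln (w0 y / w1 y))) x)"

definition calW ::
  "(real ^ 'd) set \<Rightarrow> real \<Rightarrow> (real ^ 'd \<Rightarrow> real) \<Rightarrow> (real ^ 'd \<Rightarrow> real) \<Rightarrow> real
     \<Rightarrow> (real ^ 'd \<Rightarrow> complex) set" where
  "calW U \<theta> w0 w1 p = {\<phi> \<in> W1p U (interp_weight w0 w1 \<theta>) p.
     (\<lambda>x. \<phi> x * complex_of_real (abs_grad_log_ratio U w0 w1 x))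
       \<in> Lp_scalar U (interp_weight w0 w1 \<theta>) p}"

definition calW_norm ::
  "(real ^ 'd) set \<Rightarrow> real \<Rightarrow> (real ^ 'd \<Rightarrow> real) \<Rightarrow> (real ^ 'd \<Rightarrow> real) \<Rightarrow> real
     \<Rightarrow> (real ^ 'd \<Rightarrow> complex) \<Rightarrow> real" where
  "calW_norm U \<theta> w0 w1 p \<phi> =
     (W1p_norm U (interp_weight w0 w1 \<theta>) p \<phi> powr p +
      (\<integral>x. norm (\<phi> x) powr p * abs_grad_log_ratio U w0 w1 x powr p * interp_weight w0 w1 \<theta> x
         \<partial>lebesgue_on U)) powr (1 / p)"

definition calW_0 ::
  "(real ^ 'd) set \<Rightarrow> real \<Rightarrow> (real ^ 'd \<Rightarrow> real) \<Rightarrow> (real ^ 'd \<Rightarrow> real) \<Rightarrow> real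
     \<Rightarrow> (real ^ 'd \<Rightarrow> complex) set" where
  "calW_0 U \<theta> w0 w1 p = closure_in (calW U \<theta> w0 w1 p) (calW_norm U \<theta> w0 w1 p) (Lip_c U)"


section \<open>Complex interpolation\<close>

text \<open>A space is given by its carrier \<open>A\<close> and its (semi)norm \<open>N\<close>. Since the carriers
  consist of representatives, a pointwise decomposition \<open>f = a\<^sub>0 + a\<^sub>1\<close> is the same as an almost
  everywhere one.\<close>

definition sum_space ::
  "('a \<Rightarrow> complex) set \<Rightarrow> ('a \<Rightarrow> complex) set \<Rightarrow> ('a \<Rightarrow> complex) set" where
  "sum_space A0 A1 = {f. \<exists>a0\<in>A0. \<exists>a1\<in>A1. f = (\<lambda>x. a0 x + a1 x)}"

definition sum_norm ::
  "('a \<Rightarrow> complex) set \<Rightarrow> (('a \<Rightarrow> complex) \<Rightarrow> real) \<Rightarrow> ('a \<Rightarrow> complex) set \<Rightarrow> (('a \<Rightarrow> complex) \<Rightarrow> real)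
     \<Rightarrow> ('a \<Rightarrow> complex) \<Rightarrow> real" where
  "sum_norm A0 N0 A1 N1 f =
     Inf {N0 a0 + N1 a1 | a0 a1. a0 \<in> A0 \<and> a1 \<in> A1 \<and> f = (\<lambda>x. a0 x + a1 x)}"

definition bounded_in ::
  "(('a \<Rightarrow> complex) \<Rightarrow> real) \<Rightarrow> 'b set \<Rightarrow> ('b \<Rightarrow> 'a \<Rightarrow> complex) \<Rightarrow> bool" where
  "bounded_in N S f \<longleftrightarrow> (\<exists>B. \<forall>s\<in>S. N (f s) \<le> B)"

definition continuous_in ::
  "(('a \<Rightarrow> complex) \<Rightarrow> real) \<Rightarrow> 'b::topological_space set \<Rightarrow> ('b \<Rightarrow> 'a \<Rightarrow> complex) \<Rightarrow> bool" where
  "continuous_in N S f \<longleftrightarrow>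
     (\<forall>s\<in>S. ((\<lambda>t. N (\<lambda>x. f t x - f s x)) \<longlongrightarrow> 0) (at s within S))"

definition analytic_in ::
  "('a \<Rightarrow> complex) set \<Rightarrow> (('a \<Rightarrow> complex) \<Rightarrow> real) \<Rightarrow> complex set \<Rightarrow> (complex \<Rightarrow> 'a \<Rightarrow> complex)
     \<Rightarrow> bool" where
  "analytic_in A N S f \<longleftrightarrow>
     (\<forall>z\<in>S. \<exists>D\<in>A. ((\<lambda>w. N (\<lambda>x. (f w x - f z x) / (w - z) - D x)) \<longlongrightarrow> 0) (at z))"

definition strip :: "complex set" where
  "strip = {z. 0 \<le> Re z \<and> Re z \<le> 1}"

definition calderon_functions ::
  "('a \<Rightarrow> complex) set \<Rightarrow> (('a \<Rightarrow> complex) \<Rightarrow> real) \<Rightarrow> ('a \<Rightarrow> complex) set \<Rightarrow> (('a \<Rightarrow> complex) \<Rightarrow> real)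
     \<Rightarrow> (complex \<Rightarrow> 'a \<Rightarrow> complex) set" where
  "calderon_functions A0 N0 A1 N1 = {f.
     (\<forall>z\<in>strip. f z \<in> sum_space A0 A1) \<and>
     continuous_in (sum_norm A0 N0 A1 N1) strip f \<and>
     bounded_in (sum_norm A0 N0 A1 N1) strip f \<and>
     analytic_in (sum_space A0 A1) (sum_norm A0 N0 A1 N1) (interior strip) f \<and>
     (\<forall>t. f (Complex 0 t) \<in> A0) \<and> (\<forall>t. f (Complex 1 t) \<in> A1) \<and>
     continuous_in N0 UNIV (\<lambda>t. f (Complex 0 t)) \<and> bounded_in N0 UNIV (\<lambda>t. f (Complex 0 t)) \<and>
     continuous_in N1 UNIV (\<lambda>t. f (Complex 1 t)) \<and> bounded_in N1 UNIV (\<lambda>t. f (Complex 1 t))}"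

definition complex_interpolation ::
  "('a \<Rightarrow> complex) set \<Rightarrow> (('a \<Rightarrow> complex) \<Rightarrow> real) \<Rightarrow> ('a \<Rightarrow> complex) set \<Rightarrow> (('a \<Rightarrow> complex) \<Rightarrow> real)
     \<Rightarrow> real \<Rightarrow> ('a \<Rightarrow> complex) set" where
  "complex_interpolation A0 N0 A1 N1 \<theta> =
     {f (complex_of_real \<theta>) | f. f \<in> calderon_functions A0 N0 A1 N1}"

end

theory Submission
  imports Defs "HOL-Complex_Analysis.Conformal_Mappings"
begin

text \<open>
  Upper inclusion: pairing a component of \<open>(f(z), \<nabla> f(z))\<close> with a function of compact support that depends
  analytically on \<open>z\<close> (the extremal one of Hoelder's inequality, twisted by powers of the weights) gives a
  bounded continuous function on the strip, analytic in its interior, and the maximum principle bounds its value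
  at \<open>\<theta>\<close>; monotone convergence then yields the integrability with respect to the interpolated weight.

  Lower inclusion: with \<open>s = ln (w0 / w1)\<close>, the function
  \<open>f z = \<phi> * exp ((z - \<theta>) * s / p + (z - \<theta>)\<^sup>2)\<close> takes the value \<open>\<phi>\<close> at \<open>\<theta>\<close>, its modulus turns the interpolated
  weight into \<open>w0\<close> and \<open>w1\<close> on the two sides of the strip, and its gradient has the additional term
  \<open>\<phi> \<nabla> s\<close> controlled by the norm of \<open>calW\<close>. Inside the strip \<open>f\<close> is split by a partition of unity in the
  variable \<open>s\<close>.

  On the whole space, truncation and mollification show the density of Lipschitz functions of compact support;
  the extra weight of \<open>calW\<close> is harmless because \<open>\<nabla> s\<close> is locally bounded.
\<close>


section \<open>Directional derivatives and smooth bump functions\<close>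

text \<open>Multiplication by a function of \<open>s\<close> needs a product rule for weak gradients
  with an explicit gradient of the merely locally Lipschitz \<open>s\<close>. That gradient is built
  as an almost everywhere limit of convex combinations of difference quotients, so no theorem on
  pointwise differentiability of Lipschitz functions enters; the product rule is then reached by
  mollifying both factors and removing the two mollifications one after the other. Conjugate
  exponents never appear: \<open>young_powr\<close> replaces Hoelder's inequality, which keeps p = 1
  inside the same argument. For the upper inclusion the truncated integral A satisfies A <= B^p / p
  + (1 - 1 / p) A, with B bounding the norms of f on the two sides of the strip; truncation makes A
  finite, so the last term can be absorbed. The splitting inside the strip is forced: relative to
  the interpolated weight, the p-th power of the modulus of f z gains the factor exp (Re z * s)
  against \<open>w0\<close> and exp ((Re z - 1) * s) against \<open>w1\<close>. The first is bounded
  only where s is bounded above, the second only where s is bounded below.\<close>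

definition C1_along ::
 "'a::real_normed_vector \<Rightarrow> ('a \<Rightarrow> 'b::real_normed_vector) \<Rightarrow> ('a \<Rightarrow> 'b) \<Rightarrow> bool" where
 "C1_along e F D \<longleftrightarrow> continuous_on UNIV F \<and> continuous_on UNIV D \<and>
   (\<forall>x. ((\<lambda>t. F (x + t *\<^sub>R e)) has_vector_derivative D x) (at 0))"

text \<open>All base points are quantified in the definition, so a derivative at parameter 0 is
  enough: the chain rule with the shift \<open>u - t\<close> moves it along the line.\<close>

lemma C1_along_line:
 assumes "C1_along e F D"
 shows "((\<lambda>t. F (x + t *\<^sub>R e)) has_vector_derivative D (x + t *\<^sub>R e)) (at t)"
proof -
 have *: "((\<lambda>s. F ((x + t *\<^sub>R e) + s *\<^sub>R e)) has_vector_derivative D (x + t *\<^sub>R e)) (at 0)"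
  using assms unfolding C1_along_def by blast
 have "((\<lambda>u. u - t) has_vector_derivative 1) (at t)"
  by (auto intro!: derivative_eq_intros)
 from vector_diff_chain_at[OF this, of "\<lambda>s. F ((x + t *\<^sub>R e) + s *\<^sub>R e)"] *
 show ?thesis by (simp add: o_def algebra_simps)
qed

text \<open>Mean value inequality; it dominates difference quotients whenever a limit is taken under
  an integral.\<close>

lemma C1_along_bound:
 assumes "C1_along e F D" and "\<And>x. norm (D x) \<le> B"
 shows "norm (F (x + t *\<^sub>R e) - F x) \<le> B * \<bar>t\<bar>"
proof -
 have "norm (F (x + t *\<^sub>R e) - F (x + 0 *\<^sub>R e)) \<le> B * norm (t - 0)"
 proof (rule differentiable_bound[where S = UNIV and f = "\<lambda>t. F (x + t *\<^sub>R e)"])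
  fix s :: real
  show "((\<lambda>t. F (x + t *\<^sub>R e)) has_derivative (\<lambda>h. h *\<^sub>R D (x + s *\<^sub>R e))) (at s within UNIV)"
   using C1_along_line[OF assms(1), of x s] by (simp add: has_vector_derivative_def)
  show "onorm (\<lambda>h. h *\<^sub>R D (x + s *\<^sub>R e)) \<le> B"
   by (rule onorm_le) (use assms(2)[of "x + s *\<^sub>R e"] in \<open>simp add: mult.commute[of B] mult_left_mono\<close>)
 qed auto
 then show ?thesis by simp
qed

text \<open>The sequential form matches the dominated convergence theorem, in which it supplies the
  pointwise limit.\<close>

lemma C1_along_quotient:
 assumes "C1_along e F D" and "X \<longlonglongrightarrow> 0" and "\<And>n. X n \<noteq> 0"
 shows "(\<lambda>n. (1 / X n) *\<^sub>R (F (x + X n *\<^sub>R e) - F x)) \<longlonglongrightarrow> D x"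
proof -
 have "((\<lambda>t. F (x + t *\<^sub>R e)) has_vector_derivative D x) (at 0)"
  using assms(1) unfolding C1_along_def by blast
 then have "((\<lambda>y. (1 / (y - 0)) *\<^sub>R (F (x + y *\<^sub>R e) - (F (x + 0 *\<^sub>R e) + (y - 0) *\<^sub>R D x))) \<longlongrightarrow> 0) (at 0)"
 proof -
  assume "((\<lambda>t. F (x + t *\<^sub>R e)) has_vector_derivative D x) (at 0)"
  then have "((\<lambda>y. (F (x + y *\<^sub>R e) - (F x + y *\<^sub>R D x)) /\<^sub>R \<bar>y\<bar>) \<longlongrightarrow> 0) (at 0)"
   by (auto simp: has_vector_derivative_def has_derivative_within divide_inverse)
  from tendsto_norm_zero[OF this] show ?thesis
   by (subst tendsto_norm_zero_iff[symmetric]) (simp add: divide_inverse)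
 qed
 then have "(\<lambda>n. (1 / X n) *\<^sub>R (F (x + X n *\<^sub>R e) - (F x + X n *\<^sub>R D x))) \<longlonglongrightarrow> 0"
  using assms(2,3) by (auto simp: tendsto_at_iff_sequentially o_def)
 then have "(\<lambda>n. (1 / X n) *\<^sub>R (F (x + X n *\<^sub>R e) - (F x + X n *\<^sub>R D x)) + D x) \<longlonglongrightarrow> 0 + D x"
  by (intro tendsto_add tendsto_const)
 then show ?thesis using assms(3)
  by (simp add: scaleR_diff_right scaleR_add_right algebra_simps)
qed

lemma C1_along_mult:
 fixes F G :: "'a::real_normed_vector \<Rightarrow> 'b::real_normed_algebra"
 assumes "C1_along e F D" "C1_along e G H"
 shows "C1_along e (\<lambda>x. F x * G x) (\<lambda>x. F x * H x + D x * G x)"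
proof -
 have "((\<lambda>t. F (x + t *\<^sub>R e) * G (x + t *\<^sub>R e)) has_vector_derivative
     (F (x + 0 *\<^sub>R e) * H x + D x * G (x + 0 *\<^sub>R e))) (at 0)" for x
  by (rule has_vector_derivative_mult) (use assms in \<open>auto simp: C1_along_def\<close>)
 then show ?thesis using assms by (auto simp: C1_along_def intro!: continuous_intros)
qed

lemma C1_along_of_real:
 assumes "C1_along e f f'"
 shows "C1_along e (\<lambda>x. complex_of_real (f x)) (\<lambda>x. complex_of_real (f' x))"
 using assms has_vector_derivative_of_real
 by (auto simp: C1_along_def has_real_derivative_iff_has_vector_derivative intro!: continuous_intros)

lemma C1_along_compose:
 fixes m m' :: "real \<Rightarrow> 'b::real_normed_vector"
 assumes "C1_along e f f'" "\<And>s. (m has_vector_derivative m' s) (at s)" "continuous_on UNIV m'"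
 shows "C1_along e (\<lambda>x. m (f x)) (\<lambda>x. f' x *\<^sub>R m' (f x))"
proof -
 have m: "continuous_on UNIV m"
  using assms(2) by (meson continuous_at_imp_continuous_on has_vector_derivative_continuous)
 have "((\<lambda>t. m (f (x + t *\<^sub>R e))) has_vector_derivative f' x *\<^sub>R m' (f x)) (at 0)" for x
  using vector_diff_chain_at[of "\<lambda>t. f (x + t *\<^sub>R e)" "f' x" 0 m "m' (f x)"] assms
  by (auto simp: C1_along_def o_def)
 then show ?thesis using assms(1,3) m
  by (auto simp: C1_along_def intro!: continuous_intros continuous_on_compose2[of UNIV m] continuous_on_compose2[of UNIV m'])
qed

lemma C1_along_eq_0:
 assumes "C1_along e F D" "closed K" "\<And>x. x \<notin> K \<Longrightarrow> F x = 0" "x \<notin> K"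
 shows "D x = 0"
proof -
 have "open (- K)" using assms(2) by auto
 have "((\<lambda>t. F (x + t *\<^sub>R e)) has_vector_derivative D x) (at 0)"
  using assms(1) unfolding C1_along_def by blast
 moreover have "open ((\<lambda>t. x + t *\<^sub>R e) -` (- K))"
  by (intro open_vimage \<open>open (- K)\<close> continuous_intros)
 ultimately have "((\<lambda>_. 0) has_vector_derivative D x) (at 0)"
  by (rule has_vector_derivative_transform_within_open) (use assms(3,4) in auto)
 then show ?thesis
  using vector_derivative_unique_at has_vector_derivative_const by blast
qed

section \<open>Functions with continuous iterated partial derivatives\<close>

lemma partial_deriv_eq:
 "(f has_derivative f') (at x) \<Longrightarrow> partial_deriv i f x = f' (axis i 1)"
 unfolding partial_deriv_def by (metis frechet_derivative_at)

lemma C_order_continuous: "C_order n f \<Longrightarrow> continuous_on UNIV f"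
 by (cases n) (auto intro: differentiable_imp_continuous_on)

lemma C_order_SucD: "C_order (Suc n) f \<Longrightarrow> C_order n f"
proof (induction n arbitrary: f)
 case 0
 then show ?case by (auto intro: differentiable_imp_continuous_on)
qed auto

lemma partial_deriv_const [simp]: "partial_deriv i (\<lambda>x. c) = (\<lambda>x. 0)"
 using partial_deriv_eq[OF has_derivative_const] by auto

lemma C_order_const: "C_order n (\<lambda>x. c)"
 by (induction n arbitrary: c) auto

lemma C_order_add:
 assumes "C_order n f" "C_order n g"
 shows "C_order n (\<lambda>x. f x + g x)"
 using assms
proof (induction n arbitrary: f g)
 case (Suc n)
 have "partial_deriv i (\<lambda>x. f x + g x) = (\<lambda>x. partial_deriv i f x + partial_deriv i g x)" for i
 proof
  fix x
  have "f differentiable (at x)" "g differentiable (at x)"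
   using Suc.prems by (auto simp: differentiable_on_def)
  then show "partial_deriv i (\<lambda>x. f x + g x) x = partial_deriv i f x + partial_deriv i g x"
   by (subst partial_deriv_eq[OF has_derivative_add[OF iffD1[OF frechet_derivative_works]
      iffD1[OF frechet_derivative_works]]]) (auto simp: partial_deriv_def)
 qed
 with Suc show ?case by (auto simp: differentiable_on_add)
qed (auto intro: continuous_intros)

lemma partial_deriv_mult:
 assumes "f differentiable (at x)" "g differentiable (at x)"
 shows "partial_deriv i (\<lambda>x. f x * g x) x = f x * partial_deriv i g x + partial_deriv i f x * g x"
 using assms by (subst partial_deriv_eq[OF has_derivative_mult[OF iffD1[OF frechet_derivative_works]
      iffD1[OF frechet_derivative_works]]]) (auto simp: partial_deriv_def)

lemma C_order_mult:
 assumes "C_order n f" "C_order n g"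
 shows "C_order n (\<lambda>x. f x * g x)"
 using assms
proof (induction n arbitrary: f g)
 case (Suc n)
 have "partial_deriv i (\<lambda>x. f x * g x) =
   (\<lambda>x. f x * partial_deriv i g x + partial_deriv i f x * g x)" for i
  using Suc.prems by (auto simp: differentiable_on_def intro!: partial_deriv_mult)
 moreover have "C_order n f" "C_order n g"
  using Suc.prems by (blast dest: C_order_SucD)+
 ultimately show ?case using Suc by (auto simp: differentiable_on_mult intro!: C_order_add Suc.IH)
qed (auto intro: continuous_intros)

lemma C_order_prod:
 assumes "finite I" "\<And>i. i \<in> I \<Longrightarrow> C_order n (f i)"
 shows "C_order n (\<lambda>x. \<Prod>i\<in>I. f i x)"
 using assms by (induction I rule: finite_induct) (auto intro: C_order_const C_order_mult)

text \<open>Makes \<open>y \<mapsto> \<rho> (x - y)\<close> a candidate for a test function; through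
  it a weak gradient is evaluated by a convolution.\<close>

lemma C_order_reflect:
 assumes "C_order n f"
 shows "C_order n (\<lambda>y. f (x - y))"
 using assms
proof (induction n arbitrary: f)
 case 0
 then show ?case by (auto intro!: continuous_on_compose2[of UNIV f] continuous_intros)
next
 case (Suc n)
 have *: "((\<lambda>y. f (x - y)) has_derivative (\<lambda>h. frechet_derivative f (at (x - y)) (- h))) (at y)" for y
 proof -
  have 1: "((\<lambda>y. x - y) has_derivative uminus) (at y)"
   by (auto intro!: derivative_eq_intros)
  have 2: "(f has_derivative frechet_derivative f (at (x - y))) (at (x - y))"
   using Suc.prems by (auto simp: differentiable_on_def frechet_derivative_works)
  show ?thesis using diff_chain_at[OF 1 2] by (simp add: o_def)
 qed
 have "partial_deriv i (\<lambda>y. f (x - y)) = (\<lambda>y. (- 1) * partial_deriv i f (x - y))" for i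
 proof
  fix y
  have "linear (frechet_derivative f (at (x - y)))"
   using Suc.prems by (auto simp: differentiable_on_def intro!: linear_frechet_derivative)
  then show "partial_deriv i (\<lambda>y. f (x - y)) y = (- 1) * partial_deriv i f (x - y)"
   using partial_deriv_eq[OF *, of i y] by (simp add: partial_deriv_def linear_neg)
 qed
 moreover have "C_order n (\<lambda>y. (- 1) * partial_deriv i f (x - y))" for i
  using Suc by (intro C_order_mult C_order_const) auto
 ultimately show ?case using * by (auto simp: differentiable_on_def differentiable_def)
qed

lemma C_order_C1_along:
 assumes "C_order (Suc 0) f"
 shows "C1_along (axis i 1) f (partial_deriv i f)"
proof -
 have "((\<lambda>t. f (x + t *\<^sub>R axis i 1)) has_vector_derivative partial_deriv i f x) (at 0)" for x
 proof -
  have f: "(f has_derivative frechet_derivative f (at x)) (at x)"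
   using assms by (auto simp: differentiable_on_def frechet_derivative_works)
  have g: "((\<lambda>t. x + t *\<^sub>R axis i 1) has_derivative (\<lambda>t. t *\<^sub>R axis i 1)) (at 0)"
   by (auto intro!: derivative_eq_intros)
  have "linear (frechet_derivative f (at x))"
   using f has_derivative_linear by blast
  with diff_chain_at[OF g, of f "frechet_derivative f (at x)"] f show ?thesis
   by (simp add: o_def has_vector_derivative_def partial_deriv_def linear_scale)
 qed
 then show ?thesis using assms by (auto simp: C1_along_def intro: C_order_continuous differentiable_imp_continuous_on)
qed

lemma test_functionsI:
 assumes "\<And>n. C_order n \<psi>" "compact K" "K \<subseteq> U" "\<And>x. x \<notin> K \<Longrightarrow> \<psi> x = 0"
 shows "\<psi> \<in> test_functions U"
proof -
 have "{x. \<psi> x \<noteq> 0} \<subseteq> K" using assms(4) by auto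
 then have "closure {x. \<psi> x \<noteq> 0} \<subseteq> K"
  by (simp add: assms(2) closure_minimal compact_imp_closed)
 then show ?thesis using assms
  by (auto simp: test_functions_def intro: compact_closure[THEN iffD2] bounded_subset[OF compact_imp_bounded])
qed

lemma test_functionsE:
 assumes "\<psi> \<in> test_functions U"
 obtains K where "compact K" "K \<subseteq> U" "\<And>x. x \<notin> K \<Longrightarrow> \<psi> x = 0" "\<And>x i. x \<notin> K \<Longrightarrow> partial_deriv i \<psi> x = 0"
  "\<And>i. C1_along (axis i 1) \<psi> (partial_deriv i \<psi>)" 
proof -
 let ?K = "closure {x. \<psi> x \<noteq> 0}"
 have C: "C1_along (axis i 1) \<psi> (partial_deriv i \<psi>)" for i
  using assms by (intro C_order_C1_along) (auto simp: test_functions_def)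
 show ?thesis
 proof (rule that[of ?K])
  show 0: "x \<notin> ?K \<Longrightarrow> \<psi> x = 0" for x using closure_subset[of "{x. \<psi> x \<noteq> 0}"] by auto
  show "x \<notin> ?K \<Longrightarrow> partial_deriv i \<psi> x = 0" for x i
   by (rule C1_along_eq_0[OF C _ 0]) auto
 qed (use assms C in \<open>auto simp: test_functions_def\<close>)
qed

section \<open>The flat exponential and smooth bumps on boxes\<close>

definition exp_flat :: "nat \<Rightarrow> real \<Rightarrow> real" where
 "exp_flat k t = (if 0 < t then (1 / t) ^ k * exp (- (1 / t)) else 0)"

lemma exp_flat_0_tendsto: "(exp_flat k \<longlongrightarrow> 0) (at 0)"
proof -
 have "((\<lambda>t. (inverse t) ^ k / exp (inverse t)) \<longlongrightarrow> 0) (at_right (0::real))"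
  by (rule filterlim_compose[OF tendsto_power_div_exp_0 filterlim_inverse_at_top_right])
 then have "(exp_flat k \<longlongrightarrow> 0) (at_right 0)"
  by (rule Lim_transform_eventually)
    (auto simp: eventually_at_filter exp_flat_def exp_minus divide_inverse)
 moreover have "(exp_flat k \<longlongrightarrow> 0) (at_left 0)"
  by (rule Lim_transform_eventually[OF tendsto_const])
    (auto simp: eventually_at_filter exp_flat_def)
 ultimately show ?thesis by (simp add: filterlim_split_at)
qed

text \<open>The functions t^(-k) exp (-1/t), continued by 0 to t <= 0, are closed under
  differentiation up to linear combinations. This is what lets the induction on the order in
  \<open>C_order_exp_flat\<close> run with \<open>k\<close> generalised.\<close>

lemma exp_flat_deriv:
 "(exp_flat k has_real_derivative exp_flat (Suc (Suc k)) t - real k * exp_flat (Suc k) t) (at t)"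
proof -
 consider "t > 0" | "t < 0" | "t = 0" by linarith
 then show ?thesis
 proof cases
  case 1
  have "((\<lambda>t. (1 / t) ^ k * exp (- (1 / t))) has_real_derivative
    exp_flat (Suc (Suc k)) t - real k * exp_flat (Suc k) t) (at t)"
  proof (cases k)
   case (Suc l)
   have "((\<lambda>t. 1 / t) has_real_derivative - (1 / t\<^sup>2)) (at t)"
    using 1 by (auto intro!: derivative_eq_intros simp: field_simps power2_eq_square)
   note DERIV_power_Suc[OF this, of l]
   moreover have "((\<lambda>t. exp (- (1 / t))) has_real_derivative exp (- (1 / t)) * (1 / t\<^sup>2)) (at t)"
    using 1 by (auto intro!: derivative_eq_intros simp: field_simps power2_eq_square)
   ultimately show ?thesis unfolding Suc
    by (rule DERIV_cong[OF DERIV_mult]) (use 1 in \<open>simp add: exp_flat_def field_simps power2_eq_square\<close>)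
  qed (use 1 in \<open>auto intro!: derivative_eq_intros simp: exp_flat_def field_simps power2_eq_square\<close>)
  then show ?thesis
   by (rule has_field_derivative_transform_within_open[where S = "{0<..}"]) (use 1 in \<open>auto simp: exp_flat_def\<close>)
 next
  case 2
  have "((\<lambda>t. 0) has_real_derivative exp_flat (Suc (Suc k)) t - real k * exp_flat (Suc k) t) (at t)"
   using 2 by (auto simp: exp_flat_def)
  then show ?thesis
   by (rule has_field_derivative_transform_within_open[where S = "{..<0}"]) (use 2 in \<open>auto simp: exp_flat_def\<close>)
 next
  case 3
  \<comment> \<open>At the origin the difference quotient is itself the next member of the family,
    and its limit 0 is the value prescribed by the formula.\<close>
  have "(\<lambda>h. (exp_flat k (0 + h) - exp_flat k 0) / h) = exp_flat (Suc k)"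
   by (auto simp: exp_flat_def field_simps)
  then show ?thesis using exp_flat_0_tendsto[of "Suc k"] 3
   by (simp add: DERIV_def) (simp add: exp_flat_def)
 qed
qed

lemma C_order_exp_flat: "C_order n (\<lambda>x. exp_flat k (c * x $ j + d))"
proof (induction n arbitrary: k)
 have *: "((\<lambda>x. exp_flat k (c * x $ j + d)) has_derivative
   (\<lambda>h. (exp_flat (Suc (Suc k)) (c * x $ j + d) - real k * exp_flat (Suc k) (c * x $ j + d)) * (c * h $ j))) (at x)"
  for k and x :: "real ^ 'a"
 proof -
  have 1: "((\<lambda>x. c * x $ j + d) has_derivative (\<lambda>h. c * h $ j)) (at x)"
   by (auto intro!: derivative_eq_intros bounded_linear_imp_has_derivative bounded_linear_vec_nth)
  show ?thesis
   using diff_chain_at[OF 1 exp_flat_deriv[unfolded has_field_derivative_def]]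
   by (simp add: o_def)
 qed
 then have d: "(\<lambda>x. exp_flat k (c * x $ j + d)) differentiable_on UNIV" for k
  unfolding differentiable_on_def differentiable_def by fastforce
 {
  case 0
  show ?case using d by (auto intro: differentiable_imp_continuous_on)
 next
  case (Suc n)
  have "partial_deriv i (\<lambda>x. exp_flat k (c * x $ j + d)) = (\<lambda>x. (if i = j then c else 0) *
    (exp_flat (Suc (Suc k)) (c * x $ j + d) + (- real k) * exp_flat (Suc k) (c * x $ j + d)))" for i
   using partial_deriv_eq[OF *] by (auto simp: axis_def)
  moreover have "C_order n (\<lambda>x. (if i = j then c else 0) *
    (exp_flat (Suc (Suc k)) (c * x $ j + d) + (- real k) * exp_flat (Suc k) (c * x $ j + d)))" for i
   by (intro C_order_mult C_order_add C_order_const Suc.IH)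
  ultimately show ?case using d by simp
 }
qed

text \<open>For every scale \<open>n\<close> > 0 the bump is positive exactly on the open box; a
  growing scale only steepens the edges, so that the limit is the indicator of the box.\<close>

definition bump :: "real ^ 'd \<Rightarrow> real ^ 'd \<Rightarrow> real \<Rightarrow> real ^ 'd \<Rightarrow> real" where
 "bump a b n x = (\<Prod>i\<in>UNIV. exp_flat 0 (n * (x $ i - a $ i)) * exp_flat 0 (n * (b $ i - x $ i)))"

lemma exp_flat_0_bounds: "0 \<le> exp_flat 0 t" "exp_flat 0 t \<le> 1"
 by (auto simp: exp_flat_def)

lemma bump_nonneg: "0 \<le> bump a b n x"
 unfolding bump_def by (intro prod_nonneg ballI mult_nonneg_nonneg exp_flat_0_bounds)

lemma bump_le_1: "bump a b n x \<le> 1"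
 unfolding bump_def
 by (intro prod_le_1 conjI mult_le_one mult_nonneg_nonneg exp_flat_0_bounds)

lemma bump_pos_iff: "0 < n \<Longrightarrow> 0 < bump a b n x \<longleftrightarrow> x \<in> box a b"
proof
 assume n: "0 < n" and "0 < bump a b n x"
 then have "bump a b n x \<noteq> 0" by simp
 then show "x \<in> box a b" using n
  by (auto simp: bump_def mem_box_cart exp_flat_def zero_less_mult_iff split: if_splits)
next
 assume "0 < n" "x \<in> box a b"
 then show "0 < bump a b n x"
  unfolding bump_def by (intro prod_pos) (auto simp: mem_box_cart exp_flat_def)
qed

lemma bump_eq_0: "0 < n \<Longrightarrow> x \<notin> box a b \<Longrightarrow> bump a b n x = 0"
 using bump_pos_iff[of n a b x] bump_nonneg[of a b n x] by linarith

lemma C_order_bump: "C_order k (bump a b n)"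
proof -
 have "C_order k (\<lambda>x. \<Prod>i\<in>UNIV. exp_flat 0 (n * x $ i + (- n * a $ i)) * exp_flat 0 ((-n) * x $ i + n * b $ i))"
  by (intro C_order_prod C_order_mult C_order_exp_flat) auto
 then show ?thesis unfolding bump_def[abs_def] by (simp add: algebra_simps)
qed

lemma bump_test_function: "0 < n \<Longrightarrow> cbox a b \<subseteq> U \<Longrightarrow> bump a b n \<in> test_functions U"
 by (rule test_functionsI[of _ "cbox a b"]) (auto simp: C_order_bump intro!: bump_eq_0 dest: subsetD[OF box_subset_cbox])

lemma exp_flat_0_at_top: "(exp_flat 0 \<longlongrightarrow> 1) at_top"
proof -
 have "((\<lambda>t::real. exp (- inverse t)) \<longlongrightarrow> exp (- 0)) at_top"
  by (intro tendsto_intros tendsto_inverse_0_at_top filterlim_ident)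
 then have "((\<lambda>t::real. exp (- inverse t)) \<longlongrightarrow> 1) at_top" by simp
 then show ?thesis
  by (rule Lim_transform_eventually)
    (use eventually_gt_at_top[of "0::real"] in eventually_elim, auto simp: exp_flat_def divide_inverse)
qed

lemma bump_tendsto_indicator:
 fixes x :: "real ^ 'd"
 shows "(\<lambda>n. bump a b (real (Suc n)) x) \<longlonglongrightarrow> indicator (box a b) x"
proof (cases "x \<in> box a b")
 case True
 have lim: "filterlim (\<lambda>n. real (Suc n) * c) at_top sequentially" if "0 < c" for c :: real
  using that by (intro filterlim_at_top_mult_tendsto_pos[where c = c] tendsto_const)
   (auto intro!: filterlim_tendsto_add_at_top[OF tendsto_const filterlim_real_sequentially])
 have "(\<lambda>n. bump a b (real (Suc n)) x) \<longlonglongrightarrow> (\<Prod>i\<in>(UNIV::'d set). 1 * 1)"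
  unfolding bump_def
  by (intro tendsto_prod tendsto_mult filterlim_compose[OF exp_flat_0_at_top] lim) (use True in \<open>auto simp: mem_box_cart\<close>)
 then show ?thesis using True by simp
qed (simp add: bump_eq_0)

section \<open>Integration by parts\<close>

lemma integrable_lebesgue_compact_support:
 fixes f :: "'a::euclidean_space \<Rightarrow> 'b::euclidean_space"
 assumes "f \<in> borel_measurable lebesgue" "compact K" "\<And>x. x \<notin> K \<Longrightarrow> f x = 0"
  "\<And>x. norm (f x) \<le> B"
 shows "integrable lebesgue f"
proof (rule Bochner_Integration.integrable_bound)
 show "integrable lebesgue (\<lambda>x. B * indicator K x :: real)"
  using lmeasurable_compact[OF assms(2)] by (auto simp: fmeasurable_def)
 show "AE x in lebesgue. norm (f x) \<le> norm (B * indicator K x :: real)"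
  by (rule AE_I2) (use assms(3) order_trans[OF assms(4) abs_ge_self] in \<open>auto simp: indicator_def\<close>)
qed (fact assms(1))

lemma borel_measurable_lebesgue_continuous:
 fixes f :: "'a::euclidean_space \<Rightarrow> 'b::topological_space"
 assumes "continuous_on UNIV f"
 shows "f \<in> borel_measurable lebesgue"
 using borel_measurable_continuous_onI[OF assms] by (simp add: measurable_completion)

lemma continuous_compact_support_bounded:
 fixes f :: "'a::topological_space \<Rightarrow> 'b::real_normed_vector"
 assumes "continuous_on UNIV f" "compact K" "\<And>x. x \<notin> K \<Longrightarrow> f x = 0"
 obtains B where "0 \<le> B" "\<And>x. norm (f x) \<le> B"
proof -
 have "compact (f ` K)" using assms by (auto intro: compact_continuous_image continuous_on_subset)
 then obtain B where "\<And>x. x \<in> K \<Longrightarrow> norm (f x) \<le> B"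
  using compact_imp_bounded[OF \<open>compact (f ` K)\<close>] unfolding bounded_iff by auto
 then have "norm (f x) \<le> max B 0" for x
  using assms(3)[of x] by (cases "x \<in> K") (auto simp: le_max_iff_disj)
 then show ?thesis using that[of "max B 0"] by auto
qed

lemma integrable_lebesgue_continuous_compact_support:
 fixes f :: "'a::euclidean_space \<Rightarrow> 'b::euclidean_space"
 assumes "continuous_on UNIV f" "compact K" "\<And>x. x \<notin> K \<Longrightarrow> f x = 0"
 shows "integrable lebesgue f"
proof -
 obtain B where "\<And>x. norm (f x) \<le> B" using continuous_compact_support_bounded[OF assms] by blast
 then show ?thesis
  using assms by (intro integrable_lebesgue_compact_support[of f K B] borel_measurable_lebesgue_continuous)
qed

text \<open>The two cases are translations (a = 1) and the reflections \<open>c - x\<close> (a = -1)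
  that occur in the kernel of a convolution.\<close>

lemma lebesgue_isometry_scalar:
 fixes c :: "'a::euclidean_space" and a :: real
 assumes "\<bar>a\<bar> = 1"
 shows "(\<lambda>x. c + a *\<^sub>R x) \<in> lebesgue \<rightarrow>\<^sub>M lebesgue"
  "distr lebesgue lebesgue (\<lambda>x. c + a *\<^sub>R x) = lebesgue"
proof -
 have "a \<noteq> 0" using assms by auto
 \<comment> \<open>The affine change of variables is formulated coordinate by coordinate; with equal
   factors it collapses to a scalar multiple.\<close>
 have eq: "(\<lambda>x. c + (\<Sum>j\<in>Basis. (a * (x \<bullet> j)) *\<^sub>R j)) = (\<lambda>x. c + a *\<^sub>R x)"
  unfolding scaleR_scaleR[symmetric] scaleR_sum_right[symmetric] euclidean_representation ..
 show "(\<lambda>x. c + a *\<^sub>R x) \<in> lebesgue \<rightarrow>\<^sub>M lebesgue"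
  using lebesgue_affine_measurable[of "\<lambda>_. a" c] \<open>a \<noteq> 0\<close> unfolding eq by simp
 show "distr lebesgue lebesgue (\<lambda>x. c + a *\<^sub>R x) = lebesgue"
  using lebesgue_affine_euclidean[of "\<lambda>_. a" c] \<open>a \<noteq> 0\<close> assms unfolding eq by (simp add: density_1)
qed

lemma integral_lebesgue_isometry:
 fixes f :: "'a::euclidean_space \<Rightarrow> 'b::euclidean_space" and a :: real
 assumes "integrable lebesgue f" "\<bar>a\<bar> = 1"
 shows "integrable lebesgue (\<lambda>x. f (c + a *\<^sub>R x))" "(LINT x|lebesgue. f (c + a *\<^sub>R x)) = (LINT x|lebesgue. f x)"
proof -
 note m = lebesgue_isometry_scalar[OF assms(2), of c]
 show "integrable lebesgue (\<lambda>x. f (c + a *\<^sub>R x))"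
  using integrable_distr[OF m(1), of f] assms m(2) by simp
 show "(LINT x|lebesgue. f (c + a *\<^sub>R x)) = (LINT x|lebesgue. f x)"
  using integral_distr[OF m(1), of f] assms m(2) by simp
qed

lemma integral_lebesgue_translate:
 fixes f :: "'a::euclidean_space \<Rightarrow> 'b::euclidean_space"
 assumes "integrable lebesgue f"
 shows "integrable lebesgue (\<lambda>x. f (c + x))" "(LINT x|lebesgue. f (c + x)) = (LINT x|lebesgue. f x)"
 using integral_lebesgue_isometry[OF assms, of 1 c] by simp_all

text \<open>By translation invariance every difference quotient of \<open>F\<close> has integral 0,
  and the quotients converge dominatedly to \<open>D\<close>.\<close>

lemma integral_C1_along_eq_0:
 fixes F D :: "'a::euclidean_space \<Rightarrow> 'b::euclidean_space"
 assumes C1: "C1_along e F D" and K: "compact K" and F0: "\<And>x. x \<notin> K \<Longrightarrow> F x = 0"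
 shows "(LINT x|lebesgue. D x) = 0"
proof -
 have contF: "continuous_on UNIV F" and contD: "continuous_on UNIV D"
  using C1 by (auto simp: C1_along_def)
 have D0: "x \<notin> K \<Longrightarrow> D x = 0" for x
  using C1_along_eq_0[OF C1 compact_imp_closed[OF K] F0] .
 obtain B where B: "\<And>x. norm (D x) \<le> B"
  using continuous_compact_support_bounded[OF contD K D0] by blast
 define X where "X n = 1 / real (Suc n)" for n
 \<comment> \<open>The steps \<open>X n\<close> lie in [0, 1], so a point outside this compact set
   is neither in \<open>K\<close> nor moved into \<open>K\<close> by a step: all quotients vanish
   there.\<close>
 define K' where "K' = (\<lambda>(x, t). x - t *\<^sub>R e) ` (K \<times> {0..1})"
 have K': "compact K'" unfolding K'_def
  by (intro compact_continuous_image compact_Times K) (auto simp: case_prod_unfold intro!: continuous_intros)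
 have intF: "integrable lebesgue F"
  by (rule integrable_lebesgue_continuous_compact_support[OF contF K F0])
 have "(\<lambda>n. LINT x|lebesgue. (1 / X n) *\<^sub>R (F (x + X n *\<^sub>R e) - F x)) \<longlonglongrightarrow> (LINT x|lebesgue. D x)"
 proof (rule integral_dominated_convergence[where w = "\<lambda>x. B * indicator K' x"])
  show "D \<in> borel_measurable lebesgue"
   by (rule borel_measurable_lebesgue_continuous[OF contD])
  show "(\<lambda>x. (1 / X n) *\<^sub>R (F (x + X n *\<^sub>R e) - F x)) \<in> borel_measurable lebesgue" for n
   by (intro borel_measurable_lebesgue_continuous continuous_intros continuous_on_compose2[OF contF]) auto
  show "integrable lebesgue (\<lambda>x. B * indicator K' x :: real)"
   using lmeasurable_compact[OF K'] by (auto simp: fmeasurable_def)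
  show "AE x in lebesgue. (\<lambda>n. (1 / X n) *\<^sub>R (F (x + X n *\<^sub>R e) - F x)) \<longlonglongrightarrow> D x"
   using LIMSEQ_inverse_real_of_nat
   by (intro AE_I2 C1_along_quotient[OF C1]) (auto simp: X_def inverse_eq_divide)
  show "AE x in lebesgue. norm ((1 / X n) *\<^sub>R (F (x + X n *\<^sub>R e) - F x)) \<le> B * indicator K' x" for n
  proof (rule AE_I2)
   fix x
   show "norm ((1 / X n) *\<^sub>R (F (x + X n *\<^sub>R e) - F x)) \<le> B * indicator K' x"
   proof (cases "x \<in> K'")
    case True
    have "norm (F (x + X n *\<^sub>R e) - F x) \<le> B * X n"
     using C1_along_bound[OF C1 B, of x "X n"] by (simp add: X_def)
    then have "norm (F (x + X n *\<^sub>R e) - F x) / X n \<le> B"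
     by (simp add: X_def field_simps)
    then show ?thesis using True by (simp add: X_def divide_inverse mult.commute)
   next
    case False
    have "x \<notin> K" using False unfolding K'_def by force
    moreover have "x + X n *\<^sub>R e \<notin> K"
    proof
     assume "x + X n *\<^sub>R e \<in> K"
     then have "(x + X n *\<^sub>R e, X n) \<in> K \<times> {0..1}" by (auto simp: X_def)
     then have "(x + X n *\<^sub>R e) - X n *\<^sub>R e \<in> K'" unfolding K'_def by (force simp del: add_diff_cancel)
     then show False using False by simp
    qed
    ultimately show ?thesis using F0 False by simp
   qed
  qed
 qed
 moreover have "(LINT x|lebesgue. (1 / X n) *\<^sub>R (F (x + X n *\<^sub>R e) - F x)) = 0" for n
 proof -
  have "integrable lebesgue (\<lambda>x. F (x + X n *\<^sub>R e))" "(LINT x|lebesgue. F (x + X n *\<^sub>R e)) = (LINT x|lebesgue. F x)"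
   using integral_lebesgue_translate[OF intF, of "X n *\<^sub>R e"] by (simp_all add: add.commute)
  then have "(LINT x|lebesgue. F (x + X n *\<^sub>R e) - F x) = 0"
   using Bochner_Integration.integral_diff[OF _ intF, of "\<lambda>x. F (x + X n *\<^sub>R e)"] by (simp only:) simp
  then show ?thesis by (simp only: integral_scaleR_right scaleR_zero_right)
 qed
 ultimately have "(\<lambda>n. 0) \<longlonglongrightarrow> (LINT x|lebesgue. D x)" by (simp only:)
 from LIMSEQ_unique[OF tendsto_const this] show ?thesis by simp
qed

lemma set_integral_support:
 fixes f :: "'a \<Rightarrow> 'b::{banach, second_countable_topology}"
 assumes "\<And>x. x \<notin> U \<Longrightarrow> f x = 0"
 shows "(LINT x:U|M. f x) = (LINT x|M. f x)"
 unfolding set_lebesgue_integral_def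
 by (rule Bochner_Integration.integral_cong) (use assms in \<open>auto simp: indicator_def\<close>)

text \<open>The product of \<open>F\<close> with the test function has compact support, so the
  integral of its directional derivative is 0.\<close>

lemma integration_by_parts_test:
 fixes F D :: "real ^ 'd \<Rightarrow> complex"
 assumes "C1_along (axis i 1) F D" "\<psi> \<in> test_functions U"
 shows "(LINT x:U|lebesgue. F x * complex_of_real (partial_deriv i \<psi> x)) =
     - (LINT x:U|lebesgue. D x * complex_of_real (\<psi> x))"
proof -
 obtain K where K: "compact K" "K \<subseteq> U" "\<And>x. x \<notin> K \<Longrightarrow> \<psi> x = 0" "\<And>x. x \<notin> K \<Longrightarrow> partial_deriv i \<psi> x = 0"
  "C1_along (axis i 1) \<psi> (partial_deriv i \<psi>)"
  using test_functionsE[OF assms(2)] by metis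
 note C1 = C1_along_mult[OF assms(1) C1_along_of_real[OF K(5)]]
 have c: "continuous_on UNIV F" "continuous_on UNIV D" "continuous_on UNIV \<psi>" "continuous_on UNIV (partial_deriv i \<psi>)"
  using assms(1) K(5) by (auto simp: C1_along_def)
 have i1: "integrable lebesgue (\<lambda>x. F x * complex_of_real (partial_deriv i \<psi> x))"
  by (rule integrable_lebesgue_continuous_compact_support[OF _ K(1)]) (use K c in \<open>auto intro!: continuous_intros\<close>)
 have i2: "integrable lebesgue (\<lambda>x. D x * complex_of_real (\<psi> x))"
  by (rule integrable_lebesgue_continuous_compact_support[OF _ K(1)]) (use K c in \<open>auto intro!: continuous_intros\<close>)
 have "(LINT x|lebesgue. F x * complex_of_real (partial_deriv i \<psi> x) + D x * complex_of_real (\<psi> x)) = 0"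
  by (rule integral_C1_along_eq_0[OF C1 K(1)]) (use K in auto)
 then have "(LINT x|lebesgue. F x * complex_of_real (partial_deriv i \<psi> x)) + (LINT x|lebesgue. D x * complex_of_real (\<psi> x)) = 0"
  by (simp add: Bochner_Integration.integral_add[OF i1 i2])
 then show ?thesis using K
  by (subst (1 2) set_integral_support) (auto simp: add_eq_0_iff2)
qed

lemma locally_integrable_continuous:
 fixes f :: "real ^ 'd \<Rightarrow> 'b::euclidean_space"
 assumes "continuous_on UNIV f"
 shows "locally_integrable U f"
proof -
 have "set_integrable lebesgue K f" if K: "compact K" for K
 proof -
  obtain B where "\<And>x. x \<in> K \<Longrightarrow> norm (f x) \<le> B"
   using compact_imp_bounded[OF compact_continuous_image[OF continuous_on_subset[OF assms] K]] unfolding bounded_iff by auto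
  then have *: "norm (indicator K x *\<^sub>R f x) \<le> max B 0" for x
   by (cases "x \<in> K") (auto simp: le_max_iff_disj)
  have [measurable]: "f \<in> borel_measurable lebesgue" "K \<in> sets lebesgue"
   using borel_measurable_lebesgue_continuous[OF assms] lmeasurable_compact[OF K] by auto
  show ?thesis unfolding set_integrable_def
   by (rule integrable_lebesgue_compact_support[OF _ K _ *]) auto
 qed
 then show ?thesis by (auto simp: locally_integrable_def)
qed

lemma has_weak_gradient_C1:
 fixes F :: "real ^ 'd \<Rightarrow> complex"
 assumes "\<And>i. C1_along (axis i 1) F (\<lambda>x. D x $ i)"
 shows "has_weak_gradient U F D"
proof -
 have "continuous_on UNIV (\<lambda>x. \<chi> i. D x $ i)"
  using assms by (intro continuous_on_vec_lambda) (auto simp: C1_along_def)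
 then have "continuous_on UNIV D" by simp
 then show ?thesis unfolding has_weak_gradient_def
  using assms integration_by_parts_test[OF assms]
  by (auto intro!: locally_integrable_continuous simp: C1_along_def)
qed

section \<open>Convolution\<close>

text \<open>Young's inequality with the conjugate exponent eliminated, which includes p = 1. It
  serves twice: for the convexity bound \<open>conv_powr_le\<close>, and on the two sides of the
  strip in the upper inclusion.\<close>

lemma young_powr:
 fixes a b p :: real
 assumes "0 \<le> a" "0 \<le> b" "1 \<le> p"
 shows "a * b powr (p - 1) \<le> a powr p / p + (1 - 1 / p) * b powr p"
proof (cases "a = 0 \<or> b = 0")
 case True
 then show ?thesis using assms by (auto simp: field_simps mult_le_cancel_right1)
next
 case False
 then have pos: "0 < a" "0 < b" using assms by auto
 have "(a powr p) powr (1 / p) * (b powr p) powr (1 - 1 / p) \<le> (1 / p) * a powr p + (1 - 1 / p) * b powr p"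
  using assms pos by (intro Youngs_inequality_0) auto
 moreover have "(a powr p) powr (1 / p) = a" "(b powr p) powr (1 - 1 / p) = b powr (p - 1)"
  using assms pos by (simp_all add: powr_powr right_diff_distrib)
 ultimately show ?thesis by simp
qed

text \<open>The factor 2^p comes from estimating a sum by twice the larger term. Wherever it is used
  only the finiteness of the constant matters.\<close>

lemma norm_add_powr_le:
 fixes a b :: "'a::real_normed_vector"
 assumes "0 \<le> p"
 shows "norm (a + b) powr p \<le> 2 powr p * (norm a powr p + norm b powr p)"
proof -
 have "norm (a + b) powr p \<le> (2 * max (norm a) (norm b)) powr p"
  using assms by (intro powr_mono2) (auto intro: order_trans[OF norm_triangle_ineq])
 also have "\<dots> = 2 powr p * max (norm a) (norm b) powr p"
  by (simp add: powr_mult)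
 also have "\<dots> \<le> 2 powr p * (norm a powr p + norm b powr p)"
  by (intro mult_left_mono) (auto simp: max_def)
 finally show ?thesis .
qed

lemma norm_diff_powr_le:
 fixes a b :: "'a::real_normed_vector"
 assumes "0 \<le> p"
 shows "norm (a - b) powr p \<le> 2 powr p * (norm a powr p + norm b powr p)"
 using norm_add_powr_le[OF assms, of a "- b"] by simp

definition conv :: "('a::euclidean_space \<Rightarrow> 'b::euclidean_space) \<Rightarrow> ('a \<Rightarrow> real) \<Rightarrow> 'a \<Rightarrow> 'b" where
 "conv u \<rho> x = (LINT y|lebesgue. \<rho> (x - y) *\<^sub>R u y)"

lemma measurable_reflect [measurable]:
 fixes \<rho> :: "'a::euclidean_space \<Rightarrow> real"
 assumes "continuous_on UNIV \<rho>"
 shows "(\<lambda>y. \<rho> (x - y)) \<in> borel_measurable lebesgue"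
 by (intro borel_measurable_lebesgue_continuous continuous_on_compose2[OF assms] continuous_intros) auto

lemma conv_integrable:
 fixes u :: "'a::euclidean_space \<Rightarrow> 'b::euclidean_space"
 assumes "integrable lebesgue u" "continuous_on UNIV \<rho>" "\<And>x. norm (\<rho> x) \<le> B"
 shows "integrable lebesgue (\<lambda>y. \<rho> (x - y) *\<^sub>R u y)"
proof (rule Bochner_Integration.integrable_bound)
 show "integrable lebesgue (\<lambda>y. B *\<^sub>R norm (u y))"
  using assms(1) by auto
 show "(\<lambda>y. \<rho> (x - y) *\<^sub>R u y) \<in> borel_measurable lebesgue"
  using measurable_reflect[OF assms(2)] assms(1) by auto
 have "0 \<le> B" using assms(3)[of undefined] norm_ge_zero order_trans by blast
 then show "AE y in lebesgue. norm (\<rho> (x - y) *\<^sub>R u y) \<le> norm (B *\<^sub>R norm (u y))"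
  using assms(3) by (intro AE_I2) (auto intro!: mult_right_mono simp: abs_mult)
qed

text \<open>Kernel and evaluation point may both vary: a fixed kernel with moving point gives
  continuity of the convolution, a fixed point with difference quotients as kernels gives its
  derivative.\<close>

lemma conv_tendsto:
 fixes u :: "'a::euclidean_space \<Rightarrow> 'b::euclidean_space"
 assumes u: "integrable lebesgue u" and r: "\<And>n. continuous_on UNIV (r n)" "\<And>n x. norm (r n x) \<le> B"
  and q: "continuous_on UNIV q" and lim: "\<And>y. (\<lambda>n. r n (X n - y)) \<longlonglongrightarrow> q (x - y)"
 shows "(\<lambda>n. conv u (r n) (X n)) \<longlonglongrightarrow> conv u q x"
 unfolding conv_def
proof (rule integral_dominated_convergence[where w = "\<lambda>y. B *\<^sub>R norm (u y)"])
 have "0 \<le> B" using r(2)[of undefined undefined] norm_ge_zero order_trans by blast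
 then show "AE y in lebesgue. norm (r n (X n - y) *\<^sub>R u y) \<le> B *\<^sub>R norm (u y)" for n
  using r(2) by (intro AE_I2) (auto intro!: mult_right_mono simp: abs_mult)
 show "AE y in lebesgue. (\<lambda>n. r n (X n - y) *\<^sub>R u y) \<longlonglongrightarrow> q (x - y) *\<^sub>R u y"
  by (intro AE_I2 tendsto_intros lim)
qed (use u measurable_reflect[OF r(1)] measurable_reflect[OF q] in auto)

lemma continuous_on_conv:
 fixes u :: "'a::euclidean_space \<Rightarrow> 'b::euclidean_space"
 assumes "integrable lebesgue u" "continuous_on UNIV \<rho>" "\<And>x. norm (\<rho> x) \<le> B"
 shows "continuous_on UNIV (conv u \<rho>)"
proof -
 have "(\<lambda>n. conv u \<rho> (X n)) \<longlonglongrightarrow> conv u \<rho> x" if "X \<longlonglongrightarrow> x" for X x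
 proof (rule conv_tendsto[OF assms(1,2,3,2)])
  show "(\<lambda>n. \<rho> (X n - y)) \<longlonglongrightarrow> \<rho> (x - y)" for y
   by (rule continuous_on_tendsto_compose[OF assms(2)]) (auto intro!: tendsto_intros that)
 qed
 then show ?thesis
  by (auto simp: continuous_on_eq_continuous_at continuous_at_sequentially o_def)
qed

text \<open>Reduces differentiability to sequences of steps, to which dominated convergence
  applies.\<close>

lemma has_vector_derivative_at_0_sequentially:
 fixes f :: "real \<Rightarrow> 'b::real_normed_vector"
 assumes "\<And>X. X \<longlonglongrightarrow> 0 \<Longrightarrow> (\<And>n. X n \<noteq> 0) \<Longrightarrow> (\<lambda>n. (1 / X n) *\<^sub>R (f (X n) - f 0)) \<longlonglongrightarrow> D"
 shows "(f has_vector_derivative D) (at 0)"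
proof -
 have "(\<lambda>n. (1 / \<bar>X n\<bar>) *\<^sub>R (f (X n) - (f 0 + X n *\<^sub>R D))) \<longlonglongrightarrow> 0"
  if X: "X \<longlonglongrightarrow> 0" "\<And>n. X n \<noteq> 0" for X
 proof -
  have "(\<lambda>n. norm ((1 / X n) *\<^sub>R (f (X n) - f 0) - D)) \<longlonglongrightarrow> 0"
   using assms[OF X] by (simp add: LIM_zero tendsto_norm_zero)
  moreover have "norm ((1 / X n) *\<^sub>R (f (X n) - f 0) - D) = norm ((1 / \<bar>X n\<bar>) *\<^sub>R (f (X n) - (f 0 + X n *\<^sub>R D)))" for n
  proof -
   have "(1 / X n) *\<^sub>R (f (X n) - f 0) - D = (1 / X n) *\<^sub>R (f (X n) - (f 0 + X n *\<^sub>R D))"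
    using X(2)[of n] by (simp add: algebra_simps)
   then show ?thesis by (simp only: norm_scaleR) simp
  qed
  ultimately show ?thesis by (subst tendsto_norm_zero_iff[symmetric]) simp
 qed
 then show ?thesis
  by (auto simp: has_vector_derivative_def has_derivative_within tendsto_at_iff_sequentially o_def
    bounded_linear_scaleR_left divide_inverse)
qed

lemma conv_scaleR: "conv u (\<lambda>x. c * \<rho> x) x = c *\<^sub>R conv u \<rho> x"
 unfolding conv_def by (simp flip: scaleR_scaleR)

text \<open>A difference quotient of the convolution is the convolution with a difference quotient
  of the kernel, so all derivatives fall on the kernel.\<close>

lemma C1_along_conv:
 fixes u :: "'a::euclidean_space \<Rightarrow> 'b::euclidean_space"
 assumes u: "integrable lebesgue u" and C1: "C1_along e \<rho> \<rho>'"
  and B: "\<And>x. norm (\<rho> x) \<le> B" and B': "\<And>x. norm (\<rho>' x) \<le> B'"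
 shows "C1_along e (conv u \<rho>) (conv u \<rho>')"
proof -
 have c: "continuous_on UNIV \<rho>" "continuous_on UNIV \<rho>'" using C1 by (auto simp: C1_along_def)
 have "((\<lambda>t. conv u \<rho> (x + t *\<^sub>R e)) has_vector_derivative conv u \<rho>' x) (at 0)" for x
 proof (rule has_vector_derivative_at_0_sequentially)
  fix X :: "nat \<Rightarrow> real" assume X: "X \<longlonglongrightarrow> 0" "\<And>n. X n \<noteq> 0"
  define q where "q n z = (1 / X n) * (\<rho> (z + X n *\<^sub>R e) - \<rho> z)" for n z
  have "(\<lambda>n. conv u (q n) x) \<longlonglongrightarrow> conv u \<rho>' x"
  proof (rule conv_tendsto[OF u _ _ c(2), where B = B'])
   show "continuous_on UNIV (q n)" for n unfolding q_def
    by (intro continuous_intros continuous_on_compose2[OF c(1)]) auto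
   show "norm (q n z) \<le> B'" for n z
   proof -
    have "norm (\<rho> (z + X n *\<^sub>R e) - \<rho> z) \<le> B' * \<bar>X n\<bar>"
     by (rule C1_along_bound[OF C1 B'])
    then show ?thesis using X(2)[of n] by (simp add: q_def abs_mult field_simps)
   qed
   show "(\<lambda>n. q n (x - y)) \<longlonglongrightarrow> \<rho>' (x - y)" for y
    using C1_along_quotient[OF C1 X, of "x - y"] by (simp add: q_def)
  qed
  moreover have "conv u (q n) x = (1 / X n) *\<^sub>R (conv u \<rho> (x + X n *\<^sub>R e) - conv u \<rho> (x + 0 *\<^sub>R e))" for n
  proof -
   have "conv u (\<lambda>z. \<rho> (z + X n *\<^sub>R e) - \<rho> z) x = conv u \<rho> (x + X n *\<^sub>R e) - conv u \<rho> x"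
    unfolding conv_def
    using conv_integrable[OF u c(1) B, of "x + X n *\<^sub>R e"] conv_integrable[OF u c(1) B, of x]
    by (subst Bochner_Integration.integral_diff[symmetric]) (auto simp: algebra_simps)
   then show ?thesis unfolding q_def by (subst conv_scaleR) simp
  qed
  ultimately show "(\<lambda>n. (1 / X n) *\<^sub>R (conv u \<rho> (x + X n *\<^sub>R e) - conv u \<rho> (x + 0 *\<^sub>R e))) \<longlonglongrightarrow> conv u \<rho>' x"
   by simp
 qed
 then show ?thesis
  using continuous_on_conv[OF u c(1) B] continuous_on_conv[OF u c(2) B'] by (auto simp: C1_along_def)
qed

lemma conv_diff:
 fixes u v :: "'a::euclidean_space \<Rightarrow> 'b::euclidean_space"
 assumes "integrable lebesgue u" "integrable lebesgue v" "continuous_on UNIV \<rho>" "\<And>x. norm (\<rho> x) \<le> B"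
 shows "conv (\<lambda>x. u x - v x) \<rho> x = conv u \<rho> x - conv v \<rho> x"
 unfolding conv_def scaleR_diff_right
 by (intro Bochner_Integration.integral_diff conv_integrable[OF assms(1,3,4)] conv_integrable[OF assms(2,3,4)])

lemma conv_eq_0:
 assumes "\<And>y. y \<notin> K \<Longrightarrow> u y = 0" "\<And>z. z \<notin> H \<Longrightarrow> \<rho> z = 0" "\<And>y. y \<in> K \<Longrightarrow> x - y \<notin> H"
 shows "conv u \<rho> x = 0"
proof -
 have "\<rho> (x - y) *\<^sub>R u y = 0" for y using assms by (cases "y \<in> K") auto
 then have "(\<lambda>y. \<rho> (x - y) *\<^sub>R u y) = (\<lambda>y. 0)" by (rule ext)
 then show ?thesis unfolding conv_def by (simp only: integral_zero)
qed

section \<open>Convolution with probability densities contracts the norm of L^p\<close>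

definition density_kernel :: "('a::euclidean_space \<Rightarrow> real) \<Rightarrow> real \<Rightarrow> bool" where
 "density_kernel \<rho> r \<longleftrightarrow> continuous_on UNIV \<rho> \<and> (\<forall>x. 0 \<le> \<rho> x) \<and> (\<forall>x. x \<notin> cball 0 r \<longrightarrow> \<rho> x = 0) \<and>
   (LINT x|lebesgue. \<rho> x) = 1"

lemma density_kernel_integrable:
 assumes "density_kernel \<rho> r"
 shows "integrable lebesgue \<rho>" "integrable lebesgue (\<lambda>y. \<rho> (x - y))" "(LINT y|lebesgue. \<rho> (x - y)) = 1"
proof -
 show *: "integrable lebesgue \<rho>"
  by (rule integrable_lebesgue_continuous_compact_support[where K = "cball 0 r"]) (use assms in \<open>auto simp: density_kernel_def\<close>)
 show "integrable lebesgue (\<lambda>y. \<rho> (x - y))"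
  using integral_lebesgue_isometry(1)[OF *, of "-1" x] by simp
 show "(LINT y|lebesgue. \<rho> (x - y)) = 1"
  using integral_lebesgue_isometry(2)[OF *, of "-1" x] assms by (simp add: density_kernel_def)
qed

lemma density_kernel_bounded:
 assumes "density_kernel \<rho> r"
 obtains B where "0 \<le> B" "\<And>x. norm (\<rho> x) \<le> B"
 by (rule continuous_compact_support_bounded[of \<rho> "cball 0 r"]) (use assms in \<open>auto simp: density_kernel_def\<close>)

lemma norm_conv_le_bound:
 fixes u :: "'a::euclidean_space \<Rightarrow> 'b::euclidean_space"
 assumes k: "density_kernel \<rho> r" and u: "integrable lebesgue u" "AE y in lebesgue. norm (u y) \<le> M"
 shows "norm (conv u \<rho> x) \<le> M"
proof -
 obtain B where B: "\<And>x. norm (\<rho> x) \<le> B" using density_kernel_bounded[OF k] by blast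
 have c: "continuous_on UNIV \<rho>" "\<And>x. 0 \<le> \<rho> x" using k by (auto simp: density_kernel_def)
 have "norm (conv u \<rho> x) \<le> (LINT y|lebesgue. norm (\<rho> (x - y) *\<^sub>R u y))"
  unfolding conv_def by (rule integral_norm_bound)
 also have "\<dots> \<le> (LINT y|lebesgue. \<rho> (x - y) * M)"
  using u(2) c(2) by (intro integral_mono_AE integrable_norm conv_integrable[OF u(1) c(1) B] integrable_mult_left
    density_kernel_integrable(2)[OF k]) (auto elim!: eventually_mono intro!: mult_left_mono)
 also have "\<dots> = M" using density_kernel_integrable(3)[OF k] by simp
 finally show ?thesis .
qed

text \<open>Jensen's inequality for the density \<open>\<rho> (x - y)\<close>. With A the average of
  the norm of \<open>u\<close>, apply \<open>young_powr\<close> to the integrand multiplied by A^(p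
  - 1); A^p then stands on both sides.\<close>

lemma conv_powr_le:
 fixes u :: "'a::euclidean_space \<Rightarrow> 'b::euclidean_space"
 assumes k: "density_kernel \<rho> r" and u: "integrable lebesgue u" "integrable lebesgue (\<lambda>x. norm (u x) powr p)" and p: "1 \<le> p"
 shows "norm (conv u \<rho> x) powr p \<le> conv (\<lambda>y. norm (u y) powr p) \<rho> x"
proof -
 obtain B where B: "\<And>x. norm (\<rho> x) \<le> B" using density_kernel_bounded[OF k] by blast
 have c: "continuous_on UNIV \<rho>" "\<And>x. 0 \<le> \<rho> x" using k by (auto simp: density_kernel_def)
 define A where "A = (LINT y|lebesgue. \<rho> (x - y) * norm (u y))"
 have i1: "integrable lebesgue (\<lambda>y. \<rho> (x - y) * norm (u y))"
  using conv_integrable[OF integrable_norm[OF u(1)] c(1) B] by simp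
 have i2: "integrable lebesgue (\<lambda>y. \<rho> (x - y) * norm (u y) powr p)"
  using conv_integrable[OF u(2) c(1) B] by simp
 note i3 = density_kernel_integrable(2)[OF k, of x]
 have "A \<ge> 0" unfolding A_def by (intro Bochner_Integration.integral_nonneg) (use c in auto)
 have "norm (conv u \<rho> x) \<le> (LINT y|lebesgue. norm (\<rho> (x - y) *\<^sub>R u y))"
  unfolding conv_def by (rule integral_norm_bound)
 also have "\<dots> = A" using c(2) by (simp add: A_def)
 finally have 1: "norm (conv u \<rho> x) \<le> A" .
 have "(LINT y|lebesgue. A powr (p - 1) * (\<rho> (x - y) * norm (u y)))
   \<le> (LINT y|lebesgue. (1 / p) * (\<rho> (x - y) * norm (u y) powr p) + ((1 - 1 / p) * A powr p) * \<rho> (x - y))"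
 proof (rule integral_mono)
  fix y
  have "\<rho> (x - y) * (norm (u y) * A powr (p - 1)) \<le> \<rho> (x - y) * (norm (u y) powr p / p + (1 - 1 / p) * A powr p)"
   using c(2) p \<open>A \<ge> 0\<close> by (intro mult_left_mono young_powr) auto
  then show "A powr (p - 1) * (\<rho> (x - y) * norm (u y))
    \<le> (1 / p) * (\<rho> (x - y) * norm (u y) powr p) + ((1 - 1 / p) * A powr p) * \<rho> (x - y)"
   by (simp add: algebra_simps)
 qed (intro Bochner_Integration.integrable_add integrable_mult_right i1 i2 i3)+
 also have "\<dots> = (1 / p) * (LINT y|lebesgue. \<rho> (x - y) * norm (u y) powr p) + (1 - 1 / p) * A powr p"
  by (subst Bochner_Integration.integral_add)
    (use i1 i2 i3 density_kernel_integrable(3)[OF k, of x] in \<open>auto intro!: integrable_mult_right\<close>)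
 \<comment> \<open>The term with factor 1 - 1/p is absorbed on the left, which leaves A^p bounded by
   the average of the p-th power.\<close>
 finally have "A powr (p - 1) * A \<le> (1 / p) * conv (\<lambda>y. norm (u y) powr p) \<rho> x + (1 - 1 / p) * A powr p"
  by (simp add: A_def conv_def)
 moreover have "A powr (p - 1) * A = A powr p"
  using \<open>A \<ge> 0\<close> p by (cases "A = 0") (auto simp: powr_diff)
 ultimately have "A powr p \<le> (1 / p) * conv (\<lambda>y. norm (u y) powr p) \<rho> x + (1 - 1 / p) * A powr p"
  by (simp only:)
 then have "A powr p \<le> conv (\<lambda>y. norm (u y) powr p) \<rho> x"
  using p by (simp add: field_simps)
 moreover have "norm (conv u \<rho> x) powr p \<le> A powr p"
  using 1 p by (intro powr_mono2) auto
 ultimately show ?thesis by simp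
qed

lemma nn_integral_conv:
 fixes v :: "'a::euclidean_space \<Rightarrow> real"
 assumes k: "density_kernel \<rho> r" and v: "integrable lebesgue v" "\<And>x. 0 \<le> v x"
 shows "(\<integral>\<^sup>+x. conv v \<rho> x \<partial>lebesgue) = (\<integral>\<^sup>+x. v x \<partial>lebesgue)"
proof -
 obtain B where B: "\<And>x. norm (\<rho> x) \<le> B" using density_kernel_bounded[OF k] by blast
 have c: "continuous_on UNIV \<rho>" "\<And>x. 0 \<le> \<rho> x" using k by (auto simp: density_kernel_def)
 have [measurable]: "\<rho> \<in> borel_measurable borel" using c(1) by (rule borel_measurable_continuous_onI)
 have [measurable]: "\<rho> \<in> borel_measurable lebesgue" using c(1) by (rule borel_measurable_lebesgue_continuous)
 \<comment> \<open>The order of integration is exchanged for Borel measures, so \<open>v\<close> is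
   first replaced by a Borel function that equals it almost everywhere.\<close>
 obtain v' where v'[measurable]: "v' \<in> borel_measurable lborel" "AE x in lborel. ennreal (v x) = v' x"
  using completion_ex_borel_measurable[of "\<lambda>x. ennreal (v x)" lborel] v(1) by auto
 have AE: "AE x in lebesgue. ennreal (v x) = v' x"
  using v'(2) by (rule AE_completion)
 have eq: "ennreal (conv v \<rho> x) = (\<integral>\<^sup>+y. ennreal (\<rho> (x - y)) * v' y \<partial>lborel)" for x
 proof -
  have "ennreal (conv v \<rho> x) = (\<integral>\<^sup>+y. ennreal (\<rho> (x - y) * v y) \<partial>lebesgue)"
   unfolding conv_def using conv_integrable[OF v(1) c(1) B, of x] v(2) c(2)
   by (subst nn_integral_eq_integral) auto
  also have "\<dots> = (\<integral>\<^sup>+y. ennreal (\<rho> (x - y)) * v' y \<partial>lebesgue)"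
   by (rule nn_integral_cong_AE) (use AE c(2) v(2) in \<open>auto elim!: eventually_mono simp: ennreal_mult\<close>)
  also have "\<dots> = (\<integral>\<^sup>+y. ennreal (\<rho> (x - y)) * v' y \<partial>lborel)"
   by (rule nn_integral_completion)
  finally show ?thesis .
 qed
 have "(\<integral>\<^sup>+x. conv v \<rho> x \<partial>lebesgue) = (\<integral>\<^sup>+x. (\<integral>\<^sup>+y. ennreal (\<rho> (x - y)) * v' y \<partial>lborel) \<partial>lborel)"
  by (simp add: nn_integral_completion eq)
 also have "\<dots> = (\<integral>\<^sup>+y. (\<integral>\<^sup>+x. ennreal (\<rho> (x - y)) * v' y \<partial>lborel) \<partial>lborel)"
  by (rule lborel_pair.Fubini') measurable
 also have "\<dots> = (\<integral>\<^sup>+y. v' y \<partial>lborel)"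
 proof (rule nn_integral_cong)
  fix y
  have "(\<integral>\<^sup>+x. ennreal (\<rho> (x - y)) \<partial>lborel) = (\<integral>\<^sup>+x. ennreal (\<rho> (x - y)) \<partial>lebesgue)"
   by (simp add: nn_integral_completion)
  also have "\<dots> = ennreal (LINT x|lebesgue. \<rho> (- y + x))"
   using integral_lebesgue_translate(1)[OF density_kernel_integrable(1)[OF k], of "- y"] c(2)
   by (subst nn_integral_eq_integral) auto
  also have "\<dots> = 1"
   using integral_lebesgue_translate(2)[OF density_kernel_integrable(1)[OF k], of "- y"] k by (simp add: density_kernel_def)
  finally show "(\<integral>\<^sup>+x. ennreal (\<rho> (x - y)) * v' y \<partial>lborel) = v' y"
   by (subst nn_integral_multc) auto
 qed
 also have "\<dots> = (\<integral>\<^sup>+x. v x \<partial>lebesgue)"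
  by (subst nn_integral_completion[symmetric]) (rule nn_integral_cong_AE, use AE in \<open>auto elim!: eventually_mono\<close>)
 finally show ?thesis .
qed

text \<open>Integrate the pointwise bound \<open>conv_powr_le\<close>; by
  \<open>nn_integral_conv\<close> the convolution on its right side has the same integral as the
  p-th power itself.\<close>

lemma conv_Lp:
 fixes u :: "'a::euclidean_space \<Rightarrow> 'b::euclidean_space"
 assumes k: "density_kernel \<rho> r" and u: "integrable lebesgue u" "integrable lebesgue (\<lambda>x. norm (u x) powr p)" and p: "1 \<le> p"
 shows "integrable lebesgue (\<lambda>x. norm (conv u \<rho> x) powr p)"
  "(LINT x|lebesgue. norm (conv u \<rho> x) powr p) \<le> (LINT x|lebesgue. norm (u x) powr p)"
proof -
 obtain B where B: "\<And>x. norm (\<rho> x) \<le> B" using density_kernel_bounded[OF k] by blast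
 have c: "continuous_on UNIV \<rho>" "\<And>x. 0 \<le> \<rho> x" using k by (auto simp: density_kernel_def)
 have m: "conv u \<rho> \<in> borel_measurable lebesgue"
  by (rule borel_measurable_lebesgue_continuous[OF continuous_on_conv[OF u(1) c(1) B]])
 have "(\<integral>\<^sup>+x. ennreal (norm (conv u \<rho> x) powr p) \<partial>lebesgue) \<le> (\<integral>\<^sup>+x. conv (\<lambda>y. norm (u y) powr p) \<rho> x \<partial>lebesgue)"
  by (intro nn_integral_mono ennreal_leI conv_powr_le[OF k u p])
 also have "\<dots> = (\<integral>\<^sup>+x. norm (u x) powr p \<partial>lebesgue)"
  by (rule nn_integral_conv[OF k u(2)]) auto
 also have "\<dots> = ennreal (LINT x|lebesgue. norm (u x) powr p)"
  by (rule nn_integral_eq_integral[OF u(2)]) auto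
 finally have le: "(\<integral>\<^sup>+x. ennreal (norm (conv u \<rho> x) powr p) \<partial>lebesgue) \<le> ennreal (LINT x|lebesgue. norm (u x) powr p)" .
 show *: "integrable lebesgue (\<lambda>x. norm (conv u \<rho> x) powr p)"
  using m le by (intro integrableI_nonneg) (auto intro: le_less_trans)
 show "(LINT x|lebesgue. norm (conv u \<rho> x) powr p) \<le> (LINT x|lebesgue. norm (u x) powr p)"
  using le by (subst (asm) nn_integral_eq_integral[OF *]) (auto simp: Bochner_Integration.integral_nonneg)
qed

section \<open>Mollification in \<open>L\<^sup>p\<close>\<close>

lemma integrable_norm_powr_diff:
 fixes u v :: "'a \<Rightarrow> 'b::{banach, second_countable_topology}"
 assumes "u \<in> borel_measurable M" "v \<in> borel_measurable M" "0 \<le> p"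
  "integrable M (\<lambda>x. norm (u x) powr p)" "integrable M (\<lambda>x. norm (v x) powr p)"
 shows "integrable M (\<lambda>x. norm (u x - v x) powr p)"
proof (rule Bochner_Integration.integrable_bound)
 show "integrable M (\<lambda>x. 2 powr p * (norm (u x) powr p + norm (v x) powr p))"
  using assms by auto
 show "(\<lambda>x. norm (u x - v x) powr p) \<in> borel_measurable M" using assms(1,2) by measurable
 show "AE x in M. norm (norm (u x - v x) powr p) \<le> norm (2 powr p * (norm (u x) powr p + norm (v x) powr p))"
  using norm_diff_powr_le[OF assms(3)] by (auto intro!: AE_I2)
qed

lemma le_1_plus_powr: "0 \<le> (a::real) \<Longrightarrow> 1 \<le> p \<Longrightarrow> a \<le> 1 + a powr p"
proof (cases "a \<le> 1")
 case False
 assume "1 \<le> p"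
 then have "a powr 1 \<le> a powr p" using False by (intro powr_mono) auto
 then show ?thesis using False by simp
qed (use powr_ge_zero[of a p] in linarith)

text \<open>Since a <= 1 + a^p, compact support puts an L^p function into L^1, where convolution is
  defined.\<close>

lemma integrable_of_powr:
 fixes u :: "'a::euclidean_space \<Rightarrow> 'b::euclidean_space"
 assumes "u \<in> borel_measurable lebesgue" "1 \<le> p" "integrable lebesgue (\<lambda>x. norm (u x) powr p)"
  and K: "compact K" "\<And>x. x \<notin> K \<Longrightarrow> u x = 0"
 shows "integrable lebesgue u"
proof (rule Bochner_Integration.integrable_bound)
 show "integrable lebesgue (\<lambda>x. indicator K x + norm (u x) powr p)"
  using assms lmeasurable_compact[OF K(1)] by (auto simp: fmeasurable_def)
 show "AE x in lebesgue. norm (u x) \<le> norm (indicator K x + norm (u x) powr p :: real)"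
 proof (rule AE_I2)
  fix x show "norm (u x) \<le> norm (indicator K x + norm (u x) powr p :: real)"
   using le_1_plus_powr[of "norm (u x)" p] K(2)[of x] assms(2) by (cases "x \<in> K") auto
 qed
qed (fact assms(1))

lemma tendsto_norm_powr_0:
 fixes f :: "'i \<Rightarrow> 'a::real_normed_vector"
 assumes "((\<lambda>n. f n) \<longlongrightarrow> 0) F" "0 < (p::real)"
 shows "((\<lambda>n. norm (f n) powr p) \<longlongrightarrow> 0) F"
proof -
 have "((\<lambda>n. norm (f n) powr p) \<longlongrightarrow> norm (0::'a) powr p) F"
  by (rule tendsto_powr') (use assms in \<open>auto intro: tendsto_norm_zero\<close>)
 then show ?thesis using assms by simp
qed

text \<open>The values are cut at a level M; the bounded function is an almost everywhere limit of
  continuous ones, which are corrected to be uniformly bounded and supported in a fixed ball. Both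
  approximations end with dominated convergence.\<close>

lemma Lp_continuous_dense:
 fixes u :: "'a::euclidean_space \<Rightarrow> 'b::euclidean_space"
 assumes u: "u \<in> borel_measurable lebesgue" and p: "1 \<le> p" and up: "integrable lebesgue (\<lambda>x. norm (u x) powr p)"
  and R: "\<And>x. x \<notin> cball 0 R \<Longrightarrow> u x = 0" and e: "0 < e"
 obtains g where "continuous_on UNIV g" "\<And>x. x \<notin> cball 0 (R + 1) \<Longrightarrow> g x = 0"
  "(LINT x|lebesgue. norm (u x - g x) powr p) < e"
proof -
 define v where "v M x = (if norm (u x) \<le> real M then u x else 0)" for M x
 have [measurable]: "u \<in> borel_measurable lebesgue" by (rule u)
 have [measurable]: "v M \<in> borel_measurable lebesgue" for M unfolding v_def by measurable
 \<comment> \<open>Two errors below \<delta> are added and multiplied by the constant 2^p of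
   \<open>norm_add_powr_le\<close>.\<close>
 define \<delta> where "\<delta> = e / 2 powr p / 2"
 have \<delta>: "0 < \<delta>" using e by (simp add: \<delta>_def)
 have "(\<lambda>M. LINT x|lebesgue. norm (u x - v M x) powr p) \<longlonglongrightarrow> (LINT x|(lebesgue::'a measure). 0)"
 proof (rule integral_dominated_convergence[OF _ _ up])
  show "AE x in lebesgue. (\<lambda>M. norm (u x - v M x) powr p) \<longlonglongrightarrow> 0"
  proof (rule AE_I2)
   fix x
   have "\<forall>\<^sub>F M in sequentially. norm (u x - v M x) powr p = 0"
    using eventually_ge_at_top[of "nat \<lceil>norm (u x)\<rceil>"] by eventually_elim (auto simp: v_def)
   then show "(\<lambda>M. norm (u x - v M x) powr p) \<longlonglongrightarrow> 0" by (rule tendsto_eventually)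
  qed
  show "AE x in lebesgue. norm (norm (u x - v M x) powr p) \<le> norm (u x) powr p" for M
   by (rule AE_I2) (auto simp: v_def)
 qed auto
 from LIMSEQ_D[OF this[unfolded Bochner_Integration.integral_zero] \<delta>] obtain M where M: "norm (LINT x|lebesgue. norm (u x - v M x) powr p) < \<delta>"
  unfolding diff_0_right by blast
 \<comment> \<open>In this notion of measurability a function is by definition an almost everywhere
   limit of continuous ones.\<close>
 have "v M measurable_on UNIV" by (rule lebesgue_measurable_imp_measurable_on) auto
 then obtain N G where N: "negligible N" and G: "\<And>n. continuous_on UNIV (G n)" "\<And>x. x \<notin> N \<Longrightarrow> (\<lambda>n. G n x) \<longlonglongrightarrow> v M x"
  unfolding measurable_on_def by auto
 define c where "c = real M + 1"
 have c: "0 < c" by (simp add: c_def)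
 \<comment> \<open>Continuous, equal to 1 on the ball of radius \<open>R\<close> and to 0 outside
   the ball of radius \<open>R + 1\<close>.\<close>
 define \<kappa> where "\<kappa> x = max 0 (min 1 (R + 1 - norm x))" for x :: 'a
 \<comment> \<open>The quotient retracts onto the ball of radius \<open>c\<close> and is the
   identity there. The limit \<open>v M\<close> is unaffected, its values having norm at most
   \<open>M\<close>, which is less than \<open>c\<close>.\<close>
 define g where "g n x = \<kappa> x *\<^sub>R ((c / max c (norm (G n x))) *\<^sub>R G n x)" for n x
 have gc: "continuous_on UNIV (g n)" for n
  unfolding g_def \<kappa>_def by (intro continuous_intros G(1)) (use c in auto)
 have gb: "norm (g n x) \<le> c" for n x
 proof -
  have "norm (g n x) \<le> 1 * norm ((c / max c (norm (G n x))) *\<^sub>R G n x)"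
   unfolding g_def norm_scaleR[of "\<kappa> x"] by (intro mult_right_mono) (auto simp: \<kappa>_def)
  also have "\<dots> \<le> c" using c by (auto simp: max_def field_simps)
  finally show ?thesis .
 qed
 have g0: "x \<notin> cball 0 (R + 1) \<Longrightarrow> g n x = 0" for n x by (simp add: g_def \<kappa>_def)
 have v0: "x \<notin> cball 0 R \<Longrightarrow> v M x = 0" for x using R[of x] by (simp add: v_def)
 have vb: "norm (v M x) \<le> c" for x by (simp add: v_def c_def)
 have "(\<lambda>n. LINT x|lebesgue. norm (v M x - g n x) powr p) \<longlonglongrightarrow> (LINT x|(lebesgue::'a measure). 0)"
 proof (rule integral_dominated_convergence[where w = "\<lambda>x. (2 * c) powr p * indicator (cball 0 (R + 1)) x"])
  show "integrable lebesgue (\<lambda>x. (2 * c) powr p * indicator (cball 0 (R + 1)) (x::'a) :: real)"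
   using lmeasurable_compact[of "cball 0 (R + 1) :: 'a set"] by (auto simp: fmeasurable_def)
  have [measurable]: "g n \<in> borel_measurable lebesgue" for n by (rule borel_measurable_lebesgue_continuous[OF gc])
  show "(\<lambda>x. norm (v M x - g n x) powr p) \<in> borel_measurable lebesgue" for n by measurable
  show "AE x in lebesgue. norm (norm (v M x - g n x) powr p) \<le> (2 * c) powr p * indicator (cball 0 (R + 1)) x" for n
  proof (rule AE_I2)
   fix x
   show "norm (norm (v M x - g n x) powr p) \<le> (2 * c) powr p * indicator (cball 0 (R + 1)) x"
   proof (cases "x \<in> cball 0 (R + 1)")
    case True
    have "norm (v M x - g n x) \<le> 2 * c" using gb[of n x] vb[of x] norm_triangle_ineq4[of "v M x" "g n x"] by linarith
    then show ?thesis using True p by (auto intro: powr_mono2)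
   qed (use g0 v0 p in auto)
  qed
  show "AE x in lebesgue. (\<lambda>n. norm (v M x - g n x) powr p) \<longlonglongrightarrow> 0"
  proof (rule AE_I')
   show "N \<in> null_sets lebesgue" using N by (simp add: negligible_iff_null_sets)
   show "{x \<in> space lebesgue. \<not> (\<lambda>n. norm (v M x - g n x) powr p) \<longlonglongrightarrow> 0} \<subseteq> N"
   proof (rule subsetI, rule ccontr)
    fix x assume "x \<notin> N"
    assume "x \<in> {x \<in> space lebesgue. \<not> (\<lambda>n. norm (v M x - g n x) powr p) \<longlonglongrightarrow> 0}"
    then have H: "\<not> (\<lambda>n. norm (v M x - g n x) powr p) \<longlonglongrightarrow> 0" by simp
    have "(\<lambda>n. g n x) \<longlonglongrightarrow> \<kappa> x *\<^sub>R ((c / max c (norm (v M x))) *\<^sub>R v M x)"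
     unfolding g_def by (intro tendsto_intros G(2) \<open>x \<notin> N\<close>) (use c in auto)
    moreover have "\<kappa> x *\<^sub>R ((c / max c (norm (v M x))) *\<^sub>R v M x) = v M x"
     using v0[of x] vb[of x] c by (cases "x \<in> cball 0 R") (auto simp: \<kappa>_def max_def)
    ultimately have "(\<lambda>n. v M x - g n x) \<longlonglongrightarrow> v M x - v M x"
     using tendsto_diff[OF tendsto_const] by metis
    then show False using H p tendsto_norm_powr_0[of "\<lambda>n. v M x - g n x" sequentially p] by auto
   qed
  qed
 qed auto
 from LIMSEQ_D[OF this[unfolded Bochner_Integration.integral_zero] \<delta>] obtain n where n: "norm (LINT x|lebesgue. norm (v M x - g n x) powr p) < \<delta>"
  unfolding diff_0_right by blast
 have [measurable]: "g n \<in> borel_measurable lebesgue" by (rule borel_measurable_lebesgue_continuous[OF gc])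
 have iv: "integrable lebesgue (\<lambda>x. norm (v M x) powr p)"
  by (rule Bochner_Integration.integrable_bound[OF up]) (auto simp: v_def)
 have ig: "integrable lebesgue (\<lambda>x. norm (g n x) powr p)"
  by (rule integrable_lebesgue_compact_support[where K = "cball 0 (R + 1)" and B = "c powr p"])
    (use g0 gb p in \<open>auto intro: powr_mono2\<close>)
 have i1: "integrable lebesgue (\<lambda>x. norm (u x - v M x) powr p)"
  using iv up p by (intro integrable_norm_powr_diff) auto
 have i2: "integrable lebesgue (\<lambda>x. norm (v M x - g n x) powr p)"
  using iv ig p by (intro integrable_norm_powr_diff) auto
 have i3: "integrable lebesgue (\<lambda>x. norm (u x - g n x) powr p)"
  using up ig p by (intro integrable_norm_powr_diff) auto
 have "(LINT x|lebesgue. norm (u x - g n x) powr p) \<le>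
  (LINT x|lebesgue. 2 powr p * (norm (u x - v M x) powr p + norm (v M x - g n x) powr p))"
 proof (rule integral_mono[OF i3])
  fix x show "norm (u x - g n x) powr p \<le> 2 powr p * (norm (u x - v M x) powr p + norm (v M x - g n x) powr p)"
   using norm_add_powr_le[of p "u x - v M x" "v M x - g n x"] p by simp
 qed (use i1 i2 in auto)
 also have "\<dots> = 2 powr p * ((LINT x|lebesgue. norm (u x - v M x) powr p) + (LINT x|lebesgue. norm (v M x - g n x) powr p))"
  using i1 i2 by simp
 also have "\<dots> < 2 powr p * (\<delta> + \<delta>)"
  using M n by (intro mult_strict_left_mono add_strict_mono) (auto simp: abs_less_iff)
 also have "\<dots> = e" by (simp add: \<delta>_def)
 finally show ?thesis using that[of "g n"] gc g0 by blast
qed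

lemma conv_tendsto_self:
 fixes g :: "'a::euclidean_space \<Rightarrow> 'b::euclidean_space"
 assumes k: "\<And>n. density_kernel (\<rho> n) (r n)" and r: "r \<longlonglongrightarrow> 0"
  and g: "continuous_on UNIV g" "integrable lebesgue g"
 shows "(\<lambda>n. conv g (\<rho> n) x) \<longlonglongrightarrow> g x"
proof (rule LIMSEQ_I)
 fix e :: real assume e: "0 < e"
 obtain d where d: "0 < d" "\<And>y. dist y x < d \<Longrightarrow> dist (g y) (g x) < e / 2"
  using g(1) half_gt_zero[OF e] unfolding continuous_on_iff by (metis UNIV_I)
 obtain n0 where n0: "\<And>n. n \<ge> n0 \<Longrightarrow> r n < d"
  using order_tendstoD(2)[OF r d(1)] by (auto simp: eventually_sequentially)
 have "norm (conv g (\<rho> n) x - g x) < e" if n: "n \<ge> n0" for n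
 proof -
  obtain B where B: "\<And>x. norm (\<rho> n x) \<le> B" using density_kernel_bounded[OF k] by blast
  have c: "continuous_on UNIV (\<rho> n)" "\<And>x. 0 \<le> \<rho> n x" "\<And>x. x \<notin> cball 0 (r n) \<Longrightarrow> \<rho> n x = 0"
   using k[of n] by (auto simp: density_kernel_def)
  note i = density_kernel_integrable(2)[OF k[of n], of x]
  have i2: "integrable lebesgue (\<lambda>y. \<rho> n (x - y) *\<^sub>R g y)" by (rule conv_integrable[OF g(2) c(1) B])
  have i3: "integrable lebesgue (\<lambda>y. \<rho> n (x - y) *\<^sub>R g x)" using i by auto
  have eq: "conv g (\<rho> n) x - g x = (LINT y|lebesgue. \<rho> n (x - y) *\<^sub>R (g y - g x))"
   using density_kernel_integrable(3)[OF k[of n], of x] integral_scaleR_left[of "g x" lebesgue "\<lambda>y. \<rho> n (x - y)"] i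
   unfolding scaleR_diff_right Bochner_Integration.integral_diff[OF i2 i3] conv_def by simp
  have "norm (conv g (\<rho> n) x - g x) \<le> (LINT y|lebesgue. norm (\<rho> n (x - y) *\<^sub>R (g y - g x)))"
   unfolding eq by (rule integral_norm_bound)
  also have "\<dots> \<le> (LINT y|lebesgue. \<rho> n (x - y) * (e / 2))"
  proof (rule integral_mono)
   show "integrable lebesgue (\<lambda>y. norm (\<rho> n (x - y) *\<^sub>R (g y - g x)))"
    unfolding scaleR_diff_right by (intro integrable_norm Bochner_Integration.integrable_diff i2 i3)
   fix y
   show "norm (\<rho> n (x - y) *\<^sub>R (g y - g x)) \<le> \<rho> n (x - y) * (e / 2)"
   proof (cases "x - y \<in> cball 0 (r n)")
    case True
    then have "dist y x < d" using n0[OF n] by (simp add: dist_norm norm_minus_commute)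
    then have "norm (g y - g x) \<le> e / 2" using d(2)[of y] by (simp add: dist_norm)
    from mult_left_mono[OF this c(2)[of "x - y"]] show ?thesis using c(2)[of "x - y"] by simp
   qed (use c in auto)
  qed (use i in auto)
  also have "\<dots> = e / 2" using density_kernel_integrable(3)[OF k[of n], of x] by simp
  finally show ?thesis using e by simp
 qed
 then show "\<exists>no. \<forall>n\<ge>no. norm (conv g (\<rho> n) x - g x) < e" by blast
qed

lemma conv_support_cball:
 assumes "\<And>x. x \<notin> cball 0 R \<Longrightarrow> u x = 0" "density_kernel \<rho> r" "x \<notin> cball 0 (R + r)"
 shows "conv u \<rho> x = 0"
proof (rule conv_eq_0[of "cball 0 R" u "cball 0 r"])
 show "x - y \<notin> cball 0 r" if "y \<in> cball 0 R" for y
  using that assms(3) norm_triangle_ineq[of "x - y" y] by auto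
qed (use assms in \<open>auto simp: density_kernel_def\<close>)

lemma conv_Lp_tendsto_continuous:
 fixes g :: "'a::euclidean_space \<Rightarrow> 'b::euclidean_space"
 assumes k: "\<And>n. density_kernel (\<rho> n) (r n)" and r: "r \<longlonglongrightarrow> 0" "\<And>n. r n \<le> 1"
  and g: "continuous_on UNIV g" "\<And>x. x \<notin> cball 0 R \<Longrightarrow> g x = 0" and p: "1 \<le> p"
 shows "(\<lambda>n. LINT x|lebesgue. norm (conv g (\<rho> n) x - g x) powr p) \<longlonglongrightarrow> 0"
proof -
 have gi: "integrable lebesgue g"
  by (rule integrable_lebesgue_continuous_compact_support[OF g(1) compact_cball g(2)])
 obtain c where c: "0 \<le> c" "\<And>x. norm (g x) \<le> c"
  using continuous_compact_support_bounded[OF g(1) compact_cball g(2)] by blast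
 have cb: "norm (conv g (\<rho> n) x) \<le> c" for n x
  by (rule norm_conv_le_bound[OF k gi]) (use c in auto)
 have cc: "continuous_on UNIV (conv g (\<rho> n))" for n
 proof -
  obtain B where B: "\<And>x. norm (\<rho> n x) \<le> B" using density_kernel_bounded[OF k] by blast
  show ?thesis using k[of n] by (intro continuous_on_conv[OF gi _ B]) (auto simp: density_kernel_def)
 qed
 have c0: "conv g (\<rho> n) x = 0" if "x \<notin> cball 0 (R + 1)" for n x
  by (rule conv_support_cball[OF g(2) k[of n]]) (use that r(2)[of n] in auto)
 have "(\<lambda>n. LINT x|lebesgue. norm (conv g (\<rho> n) x - g x) powr p) \<longlonglongrightarrow> (LINT x|(lebesgue::'a measure). 0)"
 proof (rule integral_dominated_convergence[where w = "\<lambda>x. (2 * c) powr p * indicator (cball 0 (R + 1)) x"])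
  show "integrable lebesgue (\<lambda>x. (2 * c) powr p * indicator (cball 0 (R + 1)) (x::'a) :: real)"
   using lmeasurable_compact[of "cball 0 (R + 1) :: 'a set"] by (auto simp: fmeasurable_def)
  have [measurable]: "g \<in> borel_measurable lebesgue" "conv g (\<rho> n) \<in> borel_measurable lebesgue" for n
   using borel_measurable_lebesgue_continuous[OF g(1)] borel_measurable_lebesgue_continuous[OF cc] by auto
  show "(\<lambda>x. norm (conv g (\<rho> n) x - g x) powr p) \<in> borel_measurable lebesgue" for n by measurable
  show "AE x in lebesgue. norm (norm (conv g (\<rho> n) x - g x) powr p) \<le> (2 * c) powr p * indicator (cball 0 (R + 1)) x" for n
  proof (rule AE_I2)
   fix x
   show "norm (norm (conv g (\<rho> n) x - g x) powr p) \<le> (2 * c) powr p * indicator (cball 0 (R + 1)) x"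
   proof (cases "x \<in> cball 0 (R + 1)")
    case True
    have "norm (conv g (\<rho> n) x - g x) \<le> 2 * c"
     using cb[of n x] c(2)[of x] norm_triangle_ineq4[of "conv g (\<rho> n) x" "g x"] by linarith
    then show ?thesis using True p by (auto intro: powr_mono2)
   next
    case False
    then have "g x = 0" "conv g (\<rho> n) x = 0" using g(2)[of x] c0 by auto
    then show ?thesis using p by simp
   qed
  qed
  show "AE x in lebesgue. (\<lambda>n. norm (conv g (\<rho> n) x - g x) powr p) \<longlonglongrightarrow> 0"
   using p by (intro AE_I2 tendsto_norm_powr_0 LIM_zero conv_tendsto_self[OF k r(1) g(1) gi]) auto
 qed auto
 then show ?thesis by simp
qed

text \<open>For a continuous \<open>g\<close> near \<open>u\<close>, the error is conv (u - g) +
  (conv g - g) - (u - g). The first term is no larger than the last because convolution contracts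
  the norm, and the middle one tends to 0.\<close>

lemma conv_Lp_tendsto:
 fixes u :: "'a::euclidean_space \<Rightarrow> 'b::euclidean_space"
 assumes k: "\<And>n. density_kernel (\<rho> n) (r n)" and r: "r \<longlonglongrightarrow> 0" "\<And>n. r n \<le> 1"
  and u: "u \<in> borel_measurable lebesgue" "integrable lebesgue (\<lambda>x. norm (u x) powr p)"
  and K: "compact K" "\<And>x. x \<notin> K \<Longrightarrow> u x = 0" and p: "1 \<le> p"
 shows "\<And>n. integrable lebesgue (\<lambda>x. norm (conv u (\<rho> n) x - u x) powr p)"
  "(\<lambda>n. LINT x|lebesgue. norm (conv u (\<rho> n) x - u x) powr p) \<longlonglongrightarrow> 0"
proof -
 obtain R where "K \<subseteq> cball 0 R" using compact_imp_bounded[OF K(1)] by (auto simp: bounded_iff subset_eq)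
 then have R: "x \<notin> cball 0 R \<Longrightarrow> u x = 0" for x using K(2) by blast
 have cc: "conv v (\<rho> n) \<in> borel_measurable lebesgue" if "integrable lebesgue v" for n and v :: "'a \<Rightarrow> 'b"
 proof -
  obtain B where B: "\<And>x. norm (\<rho> n x) \<le> B" using density_kernel_bounded[OF k] by blast
  show ?thesis using k[of n]
   by (intro borel_measurable_lebesgue_continuous continuous_on_conv[OF that _ B]) (auto simp: density_kernel_def)
 qed
 have ui: "integrable lebesgue u" by (rule integrable_of_powr[OF u(1) p u(2) K])
 show *: "integrable lebesgue (\<lambda>x. norm (conv u (\<rho> n) x - u x) powr p)" for n
 proof (rule integrable_norm_powr_diff[OF cc[OF ui] u(1) _ _ u(2)])
  show "0 \<le> p" using p by simp
  show "integrable lebesgue (\<lambda>x. norm (conv u (\<rho> n) x) powr p)" by (rule conv_Lp(1)[OF k ui u(2) p])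
 qed
 show "(\<lambda>n. LINT x|lebesgue. norm (conv u (\<rho> n) x - u x) powr p) \<longlonglongrightarrow> 0"
 proof (rule LIMSEQ_I)
  fix e :: real assume e: "0 < e"
  \<comment> \<open>One factor 2^p for each of two splittings into two terms. With \<delta> = e / (4
    C) the three errors add up to at most 3/4 of e.\<close>
  define C where "C = 2 powr p * 2 powr p"
  have C: "0 < C" by (simp add: C_def)
  define \<delta> where "\<delta> = e / (4 * C)"
  have \<delta>: "0 < \<delta>" using e C by (simp add: \<delta>_def)
  obtain g where g: "continuous_on UNIV g" "\<And>x. x \<notin> cball 0 (R + 1) \<Longrightarrow> g x = 0"
   "(LINT x|lebesgue. norm (u x - g x) powr p) < \<delta>"
   using Lp_continuous_dense[OF u(1) p u(2) R \<delta>] by blast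
  have gi: "integrable lebesgue g" 
   by (rule integrable_lebesgue_continuous_compact_support[OF g(1) compact_cball g(2)])
  have gp: "integrable lebesgue (\<lambda>x. norm (g x) powr p)"
  proof -
   obtain c where c: "0 \<le> c" "\<And>x. norm (g x) \<le> c"
    using continuous_compact_support_bounded[OF g(1) compact_cball g(2)] by blast
   have "g \<in> borel_measurable lebesgue" using gi by auto
   then have m: "(\<lambda>x. norm (g x) powr p) \<in> borel_measurable lebesgue" by measurable
   show ?thesis
   proof (rule integrable_lebesgue_compact_support[OF m compact_cball])
    show "norm (g x) powr p = 0" if "x \<notin> cball 0 (R + 1)" for x using g(2)[OF that] p by simp
    show "norm (norm (g x) powr p) \<le> c powr p" for x using c(2)[of x] p by (simp add: powr_mono2)
   qed
  qed
  have gm: "g \<in> borel_measurable lebesgue" using gi by auto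
  have p0: "0 \<le> p" using p by simp
  from LIMSEQ_D[OF conv_Lp_tendsto_continuous[OF k r g(1,2) p] \<delta>] obtain n0
   where n0: "\<And>n. n \<ge> n0 \<Longrightarrow> norm (LINT x|lebesgue. norm (conv g (\<rho> n) x - g x) powr p) < \<delta>"
   by auto
  have ugp: "integrable lebesgue (\<lambda>x. norm (u x - g x) powr p)"
   by (rule integrable_norm_powr_diff[OF u(1) gm p0 u(2) gp])
  have ugi: "integrable lebesgue (\<lambda>x. u x - g x)" using ui gi by auto
  have "norm ((LINT x|lebesgue. norm (conv u (\<rho> n) x - u x) powr p) - 0) < e" if n: "n \<ge> n0" for n
  proof -
   obtain B where B: "\<And>x. norm (\<rho> n x) \<le> B" using density_kernel_bounded[OF k] by blast
   have cr: "continuous_on UNIV (\<rho> n)" using k[of n] by (auto simp: density_kernel_def)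
   have i1: "integrable lebesgue (\<lambda>x. norm (conv (\<lambda>x. u x - g x) (\<rho> n) x) powr p)"
    by (rule conv_Lp(1)[OF k ugi ugp p])
   have i2: "integrable lebesgue (\<lambda>x. norm (conv g (\<rho> n) x - g x) powr p)"
    by (rule integrable_norm_powr_diff[OF cc[OF gi] gm p0 conv_Lp(1)[OF k[of n] gi gp p] gp])
   have "(LINT x|lebesgue. norm (conv u (\<rho> n) x - u x) powr p) \<le>
     (LINT x|lebesgue. C * (norm (conv (\<lambda>x. u x - g x) (\<rho> n) x) powr p +
      norm (conv g (\<rho> n) x - g x) powr p + norm (u x - g x) powr p))"
   proof (rule integral_mono[OF *])
    fix x
    let ?a = "conv (\<lambda>x. u x - g x) (\<rho> n) x" and ?b = "conv g (\<rho> n) x - g x" and ?c = "u x - g x"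
    have "conv u (\<rho> n) x - u x = ?a + ?b - ?c"
     by (simp add: conv_diff[OF ui gi cr B])
    then have "norm (conv u (\<rho> n) x - u x) powr p \<le> 2 powr p * (norm (?a + ?b) powr p + norm ?c powr p)"
     using norm_diff_powr_le[OF p0, of "?a + ?b" ?c] by simp
    also have "\<dots> \<le> 2 powr p * (2 powr p * (norm ?a powr p + norm ?b powr p) + 2 powr p * norm ?c powr p)"
    proof (intro mult_left_mono add_mono)
     have "1 * norm ?c powr p \<le> 2 powr p * norm ?c powr p"
      using p by (intro mult_right_mono ge_one_powr_ge_zero) auto
     then show "norm ?c powr p \<le> 2 powr p * norm ?c powr p" by simp
    qed (use norm_add_powr_le[OF p0, of ?a ?b] in auto)
    finally show "norm (conv u (\<rho> n) x - u x) powr p \<le> C * (norm ?a powr p + norm ?b powr p + norm ?c powr p)"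
     by (simp add: C_def algebra_simps)
   qed (use i1 i2 ugp in auto)
   also have "\<dots> = C * ((LINT x|lebesgue. norm (conv (\<lambda>x. u x - g x) (\<rho> n) x) powr p) +
      (LINT x|lebesgue. norm (conv g (\<rho> n) x - g x) powr p) + (LINT x|lebesgue. norm (u x - g x) powr p))"
    using i1 i2 ugp by simp
   also have "\<dots> \<le> C * (\<delta> + \<delta> + \<delta>)"
    using g(3) n0[OF n] conv_Lp(2)[OF k[of n] ugi ugp p] C(1)
    by (intro mult_left_mono add_mono) (auto simp: abs_less_iff)
   also have "\<dots> < e" using e C by (simp add: \<delta>_def field_simps)
   finally show ?thesis by (simp add: Bochner_Integration.integral_nonneg)
  qed
  then show "\<exists>no. \<forall>n\<ge>no. norm ((LINT x|lebesgue. norm (conv u (\<rho> n) x - u x) powr p) - 0) < e" by blast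
 qed
qed

section \<open>Smooth kernels of small support\<close>

lemma smooth_kernel_exists:
 assumes "0 < r"
 shows "\<exists>\<rho> :: real ^ 'd \<Rightarrow> real. density_kernel \<rho> r \<and> (\<forall>k. C_order k \<rho>)"
proof -
 \<comment> \<open>With half side r / d the sum of the absolute coordinates, hence the Euclidean
   norm, is at most r on the cube.\<close>
 define c where "c = r / real CARD('d)"
 have c: "0 < c" using assms by (simp add: c_def)
 define a b :: "real ^ 'd" where "a = (\<chi> i. - c)" and "b = (\<chi> i. c)"
 define I where "I = (LINT x|lebesgue. bump a b 1 x)"
 have cont: "continuous_on UNIV (bump a b 1)" by (rule C_order_continuous[OF C_order_bump])
 have z: "bump a b 1 x = 0" if "x \<notin> cbox a b" for x
  using that bump_eq_0[of 1 x a b] box_subset_cbox[of a b] by auto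
 have int: "integrable lebesgue (bump a b 1)"
  by (rule integrable_lebesgue_continuous_compact_support[OF cont _ z]) auto
 have "I \<noteq> 0"
 proof
  assume "I = 0"
  then have "AE x in lebesgue. bump a b 1 x = 0"
   unfolding I_def using integral_nonneg_eq_0_iff_AE[OF int AE_I2[OF bump_nonneg]] by simp
  then have "AE x in lebesgue. x \<notin> box a b"
   by eventually_elim (metis bump_pos_iff less_irrefl zero_less_one)
  then have "negligible (box a b)"
   by (auto simp: negligible_iff_null_sets AE_iff_null_sets)
  moreover have "0 \<in> box a b" using c by (simp add: mem_box_cart a_def b_def)
  ultimately show False using negligible_interval(2)[of a b] by auto
 qed
 moreover have "0 \<le> I" unfolding I_def by (intro Bochner_Integration.integral_nonneg bump_nonneg)
 ultimately have I: "0 < I" by simp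
 have sub: "cbox a b \<subseteq> cball 0 r"
 proof
  fix x assume "x \<in> cbox a b"
  then have "\<bar>x $ i\<bar> \<le> c" for i
   unfolding mem_box_cart a_def b_def by (simp add: abs_le_iff) (metis minus_le_iff)
  then have "(\<Sum>i\<in>UNIV. \<bar>x $ i\<bar>) \<le> (\<Sum>i\<in>(UNIV::'d set). c)" by (intro sum_mono)
  also have "\<dots> = r" by (simp add: c_def)
  finally show "x \<in> cball 0 r" using norm_le_l1_cart[of x] by auto
 qed
 have "density_kernel (\<lambda>x. (1 / I) * bump a b 1 x) r"
  unfolding density_kernel_def
  using cont I z subsetD[OF sub] bump_nonneg[of a b 1] int by (auto intro!: continuous_intros simp flip: I_def)
 moreover have "C_order k (\<lambda>x. (1 / I) * bump a b 1 x)" for k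
  by (intro C_order_mult C_order_const C_order_bump)
 ultimately show ?thesis by blast
qed

definition mollifier :: "nat \<Rightarrow> real ^ 'd \<Rightarrow> real" where
 "mollifier n = (SOME \<rho>. density_kernel \<rho> (1 / real (Suc n)) \<and> (\<forall>k. C_order k \<rho>))"

lemma mollifier: "density_kernel (mollifier n) (1 / real (Suc n))" "C_order k (mollifier n)"
proof -
 have "density_kernel (mollifier n :: real ^ 'd \<Rightarrow> real) (1 / real (Suc n)) \<and> (\<forall>k. C_order k (mollifier n :: real ^ 'd \<Rightarrow> real))"
  unfolding mollifier_def by (rule someI_ex[OF smooth_kernel_exists]) auto
 then show "density_kernel (mollifier n :: real ^ 'd \<Rightarrow> real) (1 / real (Suc n))" "C_order k (mollifier n :: real ^ 'd \<Rightarrow> real)"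
  by auto
qed

lemma mollifier_radius: "(\<lambda>n. 1 / real (Suc n)) \<longlonglongrightarrow> 0" "1 / real (Suc n) \<le> 1"
 using LIMSEQ_inverse_real_of_nat by (auto simp: inverse_eq_divide)

section \<open>Weak gradients\<close>

lemma AE_lebesgue_on_iff:
 "U \<in> sets lebesgue \<Longrightarrow> (AE x in lebesgue_on U. P x) \<longleftrightarrow> (AE x in lebesgue. x \<in> U \<longrightarrow> P x)"
 by (subst AE_restrict_space_iff) auto

lemma open_sets_lebesgue: "open U \<Longrightarrow> U \<in> sets lebesgue"
 by (simp add: borel_open)

lemma compact_sets_lebesgue: "compact K \<Longrightarrow> K \<in> sets lebesgue"
 using lmeasurable_compact by (auto simp: fmeasurable_def)

section \<open>Exhaustions by compact sets and local integrability\<close>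

definition exhaustion :: "'a::euclidean_space set \<Rightarrow> (nat \<Rightarrow> 'a set) \<Rightarrow> bool" where
 "exhaustion U C \<longleftrightarrow> (\<forall>n. compact (C n) \<and> C n \<subseteq> U \<and> C n \<subseteq> interior (C (Suc n))) \<and>
   \<Union>(range C) = U \<and> (\<forall>K. compact K \<longrightarrow> K \<subseteq> U \<longrightarrow> (\<exists>N. \<forall>n\<ge>N. K \<subseteq> C n))"

lemma exhaustion_exists:
 assumes "open U"
 shows "\<exists>C. exhaustion U C"
proof (rule open_Union_compact_subsets[OF assms])
 fix C :: "nat \<Rightarrow> 'a set"
 assume *: "\<And>n. compact (C n)" "\<And>n. C n \<subseteq> U" "\<And>n. C n \<subseteq> interior (C (Suc n))" "\<Union>(range C) = U"
  "\<And>K. compact K \<Longrightarrow> K \<subseteq> U \<Longrightarrow> \<exists>N. \<forall>n\<ge>N. K \<subseteq> C n"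
 show "\<exists>C. exhaustion U C"
  unfolding exhaustion_def by (intro exI[of _ C] conjI allI impI * ) assumption
qed

lemma exhaustionD:
 assumes "exhaustion U C"
 shows "compact (C n)" "C n \<subseteq> U" "C n \<subseteq> interior (C (Suc n))" "\<Union>(range C) = U"
  "compact K \<Longrightarrow> K \<subseteq> U \<Longrightarrow> \<exists>N. \<forall>n\<ge>N. K \<subseteq> C n"
 using assms unfolding exhaustion_def by blast+

lemma locally_integrable_mult_test:
 fixes f :: "real ^ 'd \<Rightarrow> complex"
 assumes f: "locally_integrable U f" and K: "compact K" "K \<subseteq> U"
  and h: "h \<in> borel_measurable lebesgue" "\<And>x. norm (h x) \<le> B" "\<And>x. x \<notin> K \<Longrightarrow> h x = 0"
 shows "integrable lebesgue (\<lambda>x. f x * h x)"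
proof (rule Bochner_Integration.integrable_bound)
 have i: "integrable lebesgue (\<lambda>x. indicator K x *\<^sub>R f x)"
  using f K by (auto simp: locally_integrable_def set_integrable_def)
 then show "integrable lebesgue (\<lambda>x. B * norm (indicator K x *\<^sub>R f x))"
  by (intro integrable_mult_right integrable_norm)
 have "(\<lambda>x. (indicator K x *\<^sub>R f x) * h x) \<in> borel_measurable lebesgue"
  using borel_measurable_integrable[OF i] h(1) by (rule borel_measurable_times)
 also have "(\<lambda>x. (indicator K x *\<^sub>R f x) * h x) = (\<lambda>x. f x * h x)"
  using h(3) by (auto simp: indicator_def)
 finally show "(\<lambda>x. f x * h x) \<in> borel_measurable lebesgue" .
 show "AE x in lebesgue. norm (f x * h x) \<le> norm (B * norm (indicator K x *\<^sub>R f x))"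
 proof (rule AE_I2)
  fix x
  have "0 \<le> B" using h(2)[of x] norm_ge_zero order_trans by blast
  then show "norm (f x * h x) \<le> norm (B * norm (indicator K x *\<^sub>R f x))"
   using h(2)[of x] h(3)[of x] by (cases "x \<in> K") (auto simp: norm_mult abs_mult mult.commute[of B] intro: mult_left_mono)
 qed
qed

lemma test_function_integrable:
 fixes f :: "real ^ 'd \<Rightarrow> complex"
 assumes f: "locally_integrable U f" and \<psi>: "\<psi> \<in> test_functions U"
 shows "integrable lebesgue (\<lambda>x. f x * complex_of_real (\<psi> x))"
  "integrable lebesgue (\<lambda>x. f x * complex_of_real (partial_deriv i \<psi> x))"
  "(LINT x:U|lebesgue. f x * complex_of_real (\<psi> x)) = (LINT x|lebesgue. f x * complex_of_real (\<psi> x))"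
  "(LINT x:U|lebesgue. f x * complex_of_real (partial_deriv i \<psi> x)) = (LINT x|lebesgue. f x * complex_of_real (partial_deriv i \<psi> x))"
proof -
 obtain K where K: "compact K" "K \<subseteq> U" "\<And>x. x \<notin> K \<Longrightarrow> \<psi> x = 0" "\<And>x. x \<notin> K \<Longrightarrow> partial_deriv i \<psi> x = 0"
  "C1_along (axis i 1) \<psi> (partial_deriv i \<psi>)"
  using test_functionsE[OF \<psi>] by metis
 have c: "continuous_on UNIV \<psi>" "continuous_on UNIV (partial_deriv i \<psi>)"
  using K(5) by (auto simp: C1_along_def)
 obtain B1 B2 where B: "\<And>x. norm (\<psi> x) \<le> B1" "\<And>x. norm (partial_deriv i \<psi> x) \<le> B2"
  using continuous_compact_support_bounded[OF c(1) K(1,3)] continuous_compact_support_bounded[OF c(2) K(1,4)] by metis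
 show "integrable lebesgue (\<lambda>x. f x * complex_of_real (\<psi> x))"
  using K B c by (intro locally_integrable_mult_test[OF f K(1,2), where B = B1])
   (auto intro!: borel_measurable_lebesgue_continuous continuous_intros)
 show "integrable lebesgue (\<lambda>x. f x * complex_of_real (partial_deriv i \<psi> x))"
  using K B c by (intro locally_integrable_mult_test[OF f K(1,2), where B = B2])
   (auto intro!: borel_measurable_lebesgue_continuous continuous_intros)
 show "(LINT x:U|lebesgue. f x * complex_of_real (\<psi> x)) = (LINT x|lebesgue. f x * complex_of_real (\<psi> x))"
  "(LINT x:U|lebesgue. f x * complex_of_real (partial_deriv i \<psi> x)) = (LINT x|lebesgue. f x * complex_of_real (partial_deriv i \<psi> x))"
 proof -
  have "f x * complex_of_real (\<psi> x) = 0" "f x * complex_of_real (partial_deriv i \<psi> x) = 0" if "x \<notin> U" for x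
   using K(3)[of x] K(4)[of x] that K(2) by auto
  then show "(LINT x:U|lebesgue. f x * complex_of_real (\<psi> x)) = (LINT x|lebesgue. f x * complex_of_real (\<psi> x))"
   "(LINT x:U|lebesgue. f x * complex_of_real (partial_deriv i \<psi> x)) = (LINT x|lebesgue. f x * complex_of_real (partial_deriv i \<psi> x))"
   by (intro set_integral_support; blast)+
 qed
qed

lemma locally_integrable_bounded_linear:
 assumes "locally_integrable U f" "bounded_linear T"
 shows "locally_integrable U (\<lambda>x. T (f x))"
 using assms(1) integrable_bounded_linear[OF assms(2), where M = lebesgue]
 unfolding locally_integrable_def set_integrable_def linear_scale[OF bounded_linear.linear[OF assms(2)], symmetric]
 by blast

lemma locally_integrable_add:
 "locally_integrable U f \<Longrightarrow> locally_integrable U g \<Longrightarrow> locally_integrable U (\<lambda>x. f x + g x)"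
 by (auto simp: locally_integrable_def intro: set_integral_add)

lemma locally_integrable_diff:
 "locally_integrable U f \<Longrightarrow> locally_integrable U g \<Longrightarrow> locally_integrable U (\<lambda>x. f x - g x)"
 by (auto simp: locally_integrable_def intro: set_integral_diff)

lemma locally_integrable_component:
 fixes g :: "real ^ 'd \<Rightarrow> complex ^ 'n"
 assumes "locally_integrable U g"
 shows "locally_integrable U (\<lambda>x. g x $ i)"
 by (rule locally_integrable_bounded_linear[OF assms bounded_linear_vec_nth])

lemma borel_measurable_vec_componentwise:
 fixes f :: "'a \<Rightarrow> complex ^ 'n"
 assumes "\<And>i. (\<lambda>x. f x $ i) \<in> borel_measurable M"
 shows "f \<in> borel_measurable M"
 unfolding borel_measurable_euclidean_space[of f]
proof
 fix b :: "complex ^ 'n" assume "b \<in> Basis"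
 then obtain i u where "b = axis i u" by (auto simp: Basis_vec_def)
 then have "(\<lambda>x. f x \<bullet> b) = (\<lambda>x. f x $ i \<bullet> u)" by (simp add: inner_axis)
 then show "(\<lambda>x. f x \<bullet> b) \<in> borel_measurable M" using assms by simp
qed

lemma locally_integrable_vec_componentwise:
 fixes g :: "real ^ 'd \<Rightarrow> complex ^ 'n"
 assumes "\<And>i. locally_integrable U (\<lambda>x. g x $ i)"
 shows "locally_integrable U g"
proof -
 have "integrable lebesgue (\<lambda>x. indicator K x *\<^sub>R g x)" if K: "compact K" "K \<subseteq> U" for K
 proof (rule Bochner_Integration.integrable_bound)
  have i: "integrable lebesgue (\<lambda>x. indicator K x *\<^sub>R g x $ i)" for i
   using assms[of i] K by (auto simp: locally_integrable_def set_integrable_def)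
  then show "integrable lebesgue (\<lambda>x. \<Sum>i\<in>UNIV. norm (indicator K x *\<^sub>R g x $ i))"
   by (intro Bochner_Integration.integrable_sum integrable_norm)
  show "(\<lambda>x. indicator K x *\<^sub>R g x) \<in> borel_measurable lebesgue"
   by (rule borel_measurable_vec_componentwise) (use i in auto)
  show "AE x in lebesgue. norm (indicator K x *\<^sub>R g x) \<le> norm (\<Sum>i\<in>UNIV. norm (indicator K x *\<^sub>R g x $ i))"
  proof (rule AE_I2)
   fix x
   have "norm (indicator K x *\<^sub>R g x) \<le> (\<Sum>i\<in>UNIV. norm ((indicator K x *\<^sub>R g x) $ i))"
    unfolding norm_vec_def by (rule L2_set_le_sum) auto
   then show "norm (indicator K x *\<^sub>R g x) \<le> norm (\<Sum>i\<in>UNIV. norm (indicator K x *\<^sub>R g x $ i))"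
    by simp
  qed
 qed
 then show ?thesis by (auto simp: locally_integrable_def set_integrable_def)
qed

lemma locally_integrable_measurable:
 fixes f :: "real ^ 'd \<Rightarrow> 'b::{banach, second_countable_topology}"
 assumes "open U" "locally_integrable U f"
 shows "f \<in> borel_measurable (lebesgue_on U)"
proof -
 obtain C where "exhaustion U C" using exhaustion_exists[OF assms(1)] by blast
 note C = exhaustionD[OF this]
 show ?thesis
 proof (rule borel_measurable_LIMSEQ_metric)
  show "(\<lambda>x. indicator (C n) x *\<^sub>R f x) \<in> borel_measurable (lebesgue_on U)" for n
  proof (rule measurable_restrict_space1)
   have "set_integrable lebesgue (C n) f"
    using assms(2) C(1,2) unfolding locally_integrable_def by blast
   then show "(\<lambda>x. indicator (C n) x *\<^sub>R f x) \<in> borel_measurable lebesgue"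
    unfolding set_integrable_def by (rule borel_measurable_integrable)
  qed
  fix x assume "x \<in> space (lebesgue_on U)"
  then have "{x} \<subseteq> U" by (auto simp: space_restrict_space)
  then obtain N where N: "\<forall>n\<ge>N. {x} \<subseteq> C n" using C(5)[of "{x}"] by auto
  have "\<forall>\<^sub>F n in sequentially. indicator (C n) x *\<^sub>R f x = f x"
   using eventually_ge_at_top[of N] by eventually_elim (use N in auto)
  then show "(\<lambda>n. indicator (C n) x *\<^sub>R f x) \<longlonglongrightarrow> f x" by (rule tendsto_eventually)
 qed
qed

text \<open>Bumps converge to indicators of boxes, so the integral of \<open>f\<close> over every
  closed box inside \<open>U\<close> is 0. By Lebesgue differentiation almost every value of
  \<open>f\<close> is a limit of averages over shrinking cubes.\<close>

lemma AE_eq_0_of_test_functions: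
 fixes f :: "real ^ 'd \<Rightarrow> complex"
 assumes U: "open U" and f: "locally_integrable U f"
  and 0: "\<And>\<psi>. \<psi> \<in> test_functions U \<Longrightarrow> (LINT x|lebesgue. f x * complex_of_real (\<psi> x)) = 0"
 shows "AE x in lebesgue. x \<in> U \<longrightarrow> f x = 0"
proof -
 have box0: "integral (cbox a b) f = 0" if ab: "cbox a b \<subseteq> U" for a b
 proof -
  have fi: "set_integrable lebesgue (cbox a b) f" using f ab by (auto simp: locally_integrable_def)
  have "(\<lambda>n. LINT x|lebesgue. f x * complex_of_real (bump a b (real (Suc n)) x)) \<longlonglongrightarrow>
   (LINT x|lebesgue. indicator (box a b) x *\<^sub>R f x)"
  proof (rule integral_dominated_convergence[where w = "\<lambda>x. norm (indicator (cbox a b) x *\<^sub>R f x)"])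
   show "integrable lebesgue (\<lambda>x. norm (indicator (cbox a b) x *\<^sub>R f x))"
    using integrable_norm[OF fi[unfolded set_integrable_def]] .
   show "(\<lambda>x. f x * complex_of_real (bump a b (real (Suc n)) x)) \<in> borel_measurable lebesgue" for n
    using test_function_integrable(1)[OF f bump_test_function[OF _ ab, of "real (Suc n)"]] by auto
   have "set_integrable lebesgue (box a b) f"
    by (rule set_integrable_subset[OF fi]) (auto intro: subsetD[OF box_subset_cbox])
   then show "(\<lambda>x. indicator (box a b) x *\<^sub>R f x) \<in> borel_measurable lebesgue"
    by (auto simp: set_integrable_def)
   show "AE x in lebesgue. (\<lambda>n. f x * complex_of_real (bump a b (real (Suc n)) x)) \<longlonglongrightarrow> indicator (box a b) x *\<^sub>R f x"
   proof (rule AE_I2)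
    fix x
    have "(\<lambda>n. f x * complex_of_real (bump a b (real (Suc n)) x)) \<longlonglongrightarrow> f x * complex_of_real (indicator (box a b) x)"
     by (intro tendsto_intros bump_tendsto_indicator)
    then show "(\<lambda>n. f x * complex_of_real (bump a b (real (Suc n)) x)) \<longlonglongrightarrow> indicator (box a b) x *\<^sub>R f x"
     by (simp add: scaleR_conv_of_real mult.commute)
   qed
   show "AE x in lebesgue. norm (f x * complex_of_real (bump a b (real (Suc n)) x)) \<le> norm (indicator (cbox a b) x *\<^sub>R f x)" for n
   proof (rule AE_I2)
    fix x
    show "norm (f x * complex_of_real (bump a b (real (Suc n)) x)) \<le> norm (indicator (cbox a b) x *\<^sub>R f x)"
    proof (cases "x \<in> box a b")
     case True
     then have "x \<in> cbox a b" using box_subset_cbox by blast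
     then show ?thesis using bump_nonneg[of a b "real (Suc n)" x] bump_le_1[of a b "real (Suc n)" x]
      by (simp add: norm_mult mult_left_le)
    next
     case False
     then have "bump a b (real (Suc n)) x = 0" by (intro bump_eq_0) auto
     then show ?thesis by simp
    qed
   qed
  qed
  moreover have "(LINT x|lebesgue. f x * complex_of_real (bump a b (real (Suc n)) x)) = 0" for n
   by (rule 0[OF bump_test_function[OF _ ab]]) auto
  ultimately have "(\<lambda>n. 0) \<longlonglongrightarrow> (LINT x|lebesgue. indicator (box a b) x *\<^sub>R f x)" by (simp only:)
  then have *: "(LINT x|lebesgue. indicator (box a b) x *\<^sub>R f x) = 0" by (simp add: LIMSEQ_const_iff)
  have "set_integrable lebesgue (box a b) f"
   by (rule set_integrable_subset[OF fi]) (auto intro: subsetD[OF box_subset_cbox])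
  from set_lebesgue_integral_eq_integral(2)[OF this] * have "integral (box a b) f = 0"
   by (simp add: set_lebesgue_integral_def)
  then show ?thesis by (simp add: integral_open_interval)
 qed
 obtain C where "exhaustion U C" using exhaustion_exists[OF U] by blast
 note C = exhaustionD[OF this]
 have "\<exists>N. negligible N \<and> (\<forall>x. x \<in> interior (C n) - N \<longrightarrow> f x = 0)" for n
 proof -
  \<comment> \<open>The differentiation theorem is applied on the whole space, hence the extension
    by 0; near an interior point of \<open>C n\<close> small cubes do not notice it.\<close>
  define F where "F x = indicator (C n) x *\<^sub>R f x" for x
  have "integrable lebesgue F" using f C by (auto simp: F_def[abs_def] locally_integrable_def set_integrable_def)
  then have "F absolutely_integrable_on UNIV" by (simp add: set_integrable_def)
  then have "F absolutely_integrable_on cbox a b" for a b by (rule set_integrable_subset) auto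
  then have "F integrable_on cbox a b" for a b using set_lebesgue_integral_eq_integral(1) by blast
  then obtain N where N: "negligible N"
    "\<And>x e. \<lbrakk>x \<notin> N; 0 < e\<rbrakk> \<Longrightarrow> \<exists>d>0. \<forall>h. 0 < h \<and> h < d \<longrightarrow>
      norm (integral (cbox x (x + h *\<^sub>R One)) F /\<^sub>R h ^ DIM(real ^ 'd) - F x) < e"
   using integrable_ccontinuous_explicit[of F] by metis
  have "f x = 0" if x: "x \<in> interior (C n)" "x \<notin> N" for x
  proof (rule ccontr)
   assume "f x \<noteq> 0"
   then have "0 < norm (F x)" using x interior_subset[of "C n"] by (auto simp: F_def)
   from N(2)[OF x(2) this] obtain d where d: "0 < d" "\<And>h. 0 < h \<Longrightarrow> h < d \<Longrightarrow>
      norm (integral (cbox x (x + h *\<^sub>R One)) F /\<^sub>R h ^ DIM(real ^ 'd) - F x) < norm (F x)" by blast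
   obtain \<epsilon> where \<epsilon>: "0 < \<epsilon>" "ball x \<epsilon> \<subseteq> interior (C n)"
    using x(1) open_interior open_contains_ball by blast
   \<comment> \<open>Below the radius given by differentiation, and so small that the cube with
     corner x and side h stays in the ball of radius \<epsilon>.\<close>
   define h where "h = min (d / 2) (\<epsilon> / 2 / (norm (One :: real ^ 'd) + 1))"
   have n0: "0 < norm (One :: real ^ 'd) + 1" by (smt (verit) norm_ge_zero)
   have h: "0 < h" "h < d" "h * (norm (One :: real ^ 'd) + 1) < \<epsilon>"
   proof -
    show "0 < h" "h < d" using d(1) \<epsilon>(1) n0 by (auto simp: h_def)
    have "h * (norm (One :: real ^ 'd) + 1) \<le> (\<epsilon> / 2 / (norm (One :: real ^ 'd) + 1)) * (norm (One :: real ^ 'd) + 1)"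
     using n0 by (intro mult_right_mono) (auto simp: h_def)
    also have "\<dots> = \<epsilon> / 2" using n0 by (metis less_irrefl nonzero_eq_divide_eq)
    also have "\<dots> < \<epsilon>" using \<epsilon>(1) by simp
    finally show "h * (norm (One :: real ^ 'd) + 1) < \<epsilon>" .
   qed
   have sub: "cbox x (x + h *\<^sub>R One) \<subseteq> ball x \<epsilon>"
   proof
    fix y assume y: "y \<in> cbox x (x + h *\<^sub>R One)"
    have "norm (y - x) \<le> norm (h *\<^sub>R One :: real ^ 'd)"
    proof (rule norm_le_componentwise)
     fix b :: "real ^ 'd" assume b: "b \<in> Basis"
     then have "x \<bullet> b \<le> y \<bullet> b" "y \<bullet> b \<le> x \<bullet> b + h"
      using y by (auto simp: mem_box inner_add_left)
     then show "\<bar>(y - x) \<bullet> b\<bar> \<le> \<bar>(h *\<^sub>R One) \<bullet> b\<bar>" using b h(1) by (simp add: inner_diff_left)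
    qed
    also have "\<dots> < \<epsilon>" using h by (simp add: algebra_simps)
    finally show "y \<in> ball x \<epsilon>" by (simp add: dist_norm norm_minus_commute)
   qed
   then have sub': "cbox x (x + h *\<^sub>R One) \<subseteq> C n" using \<epsilon>(2) interior_subset by blast
   have "integral (cbox x (x + h *\<^sub>R One)) F = integral (cbox x (x + h *\<^sub>R One)) f"
    by (rule Henstock_Kurzweil_Integration.integral_cong) (use sub' in \<open>auto simp: F_def\<close>)
   also have "\<dots> = 0" by (rule box0) (use sub' C in blast)
   finally show False using d(2)[OF h(1,2)] by simp
  qed
  then show ?thesis using N(1) by auto
 qed
 then obtain N where N: "\<And>n. negligible (N n)" "\<And>n x. x \<in> interior (C n) \<Longrightarrow> x \<notin> N n \<Longrightarrow> f x = 0"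
  by (metis Diff_iff)
 have "negligible (\<Union>n. N n)" using N(1) by (intro negligible_Union_nat)
 moreover have "f x = 0" if xU: "x \<in> U" "x \<notin> (\<Union>n. N n)" for x
 proof -
  obtain n where "x \<in> C n" using xU(1) unfolding C(4)[symmetric] by blast
  then show ?thesis using C(3)[of n] N(2)[of x "Suc n"] xU by blast
 qed
 ultimately show ?thesis
  by (intro AE_I'[of "\<Union>n. N n"]) (auto simp: negligible_iff_null_sets)
qed

section \<open>Uniqueness and linearity of weak gradients\<close>

lemma has_weak_gradient_iff:
 "has_weak_gradient U \<phi> g \<longleftrightarrow> locally_integrable U \<phi> \<and> locally_integrable U g \<and>
   (\<forall>\<psi>\<in>test_functions U. \<forall>i.
    (LINT x|lebesgue. \<phi> x * complex_of_real (partial_deriv i \<psi> x)) =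
    - (LINT x|lebesgue. g x $ i * complex_of_real (\<psi> x)))"
 unfolding has_weak_gradient_def
 by (intro conj_cong refl ball_cong iff_allI)
   (simp add: test_function_integrable(3)[OF locally_integrable_component] test_function_integrable(4))

lemma weak_gradient_unique:
 assumes U: "open U" and g: "has_weak_gradient U \<phi> g" "has_weak_gradient U \<phi> h"
 shows "AE x in lebesgue. x \<in> U \<longrightarrow> g x = h x"
proof -
 have "AE x in lebesgue. x \<in> U \<longrightarrow> g x $ i - h x $ i = 0" for i
 proof (rule AE_eq_0_of_test_functions[OF U])
  have l: "locally_integrable U (\<lambda>x. g x $ i)" "locally_integrable U (\<lambda>x. h x $ i)"
   using g by (auto simp: has_weak_gradient_def intro: locally_integrable_component)
  show "locally_integrable U (\<lambda>x. g x $ i - h x $ i)"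
   by (intro locally_integrable_diff l)
  fix \<psi> assume \<psi>: "\<psi> \<in> test_functions U"
  have "(LINT x|lebesgue. \<phi> x * complex_of_real (partial_deriv i \<psi> x)) = - (LINT x|lebesgue. g x $ i * complex_of_real (\<psi> x))"
   "(LINT x|lebesgue. \<phi> x * complex_of_real (partial_deriv i \<psi> x)) = - (LINT x|lebesgue. h x $ i * complex_of_real (\<psi> x))"
   using g \<psi> unfolding has_weak_gradient_iff by blast+
  then have "(LINT x|lebesgue. g x $ i * complex_of_real (\<psi> x)) = (LINT x|lebesgue. h x $ i * complex_of_real (\<psi> x))"
   by simp
  then show "(LINT x|lebesgue. (g x $ i - h x $ i) * complex_of_real (\<psi> x)) = 0"
   unfolding left_diff_distrib
   using test_function_integrable(1)[OF l(1) \<psi>] test_function_integrable(1)[OF l(2) \<psi>] by simp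
 qed
 then have "AE x in lebesgue. \<forall>i. x \<in> U \<longrightarrow> g x $ i - h x $ i = 0"
  unfolding AE_all_countable by blast
 then show ?thesis by eventually_elim (auto simp: vec_eq_iff)
qed

text \<open>Allows any weak gradient known by a formula to replace the selected one under an
  integral.\<close>

lemma weak_gradient_AE:
 assumes "open U" "has_weak_gradient U \<phi> g"
 shows "has_weak_gradient U \<phi> (weak_gradient U \<phi>)" "AE x in lebesgue_on U. weak_gradient U \<phi> x = g x"
proof -
 show *: "has_weak_gradient U \<phi> (weak_gradient U \<phi>)"
  unfolding weak_gradient_def using assms(2) by (rule someI[of "has_weak_gradient U \<phi>"])
 show "AE x in lebesgue_on U. weak_gradient U \<phi> x = g x"
  using weak_gradient_unique[OF assms(1) * assms(2)] assms(1) by (simp add: AE_lebesgue_on_iff borel_open)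
qed

lemma has_weak_gradient_add:
 assumes "has_weak_gradient U \<phi> g" "has_weak_gradient U \<psi> h"
 shows "has_weak_gradient U (\<lambda>x. \<phi> x + \<psi> x) (\<lambda>x. g x + h x)"
 unfolding has_weak_gradient_iff
proof (intro conjI ballI allI)
 have l: "locally_integrable U \<phi>" "locally_integrable U \<psi>" "locally_integrable U g" "locally_integrable U h"
  using assms by (auto simp: has_weak_gradient_def)
 then show "locally_integrable U (\<lambda>x. \<phi> x + \<psi> x)" "locally_integrable U (\<lambda>x. g x + h x)"
  by (auto intro: locally_integrable_add)
 fix \<eta> i assume \<eta>: "\<eta> \<in> test_functions U"
 note lc = locally_integrable_component[OF l(3), of i] locally_integrable_component[OF l(4), of i]
 show "(LINT x|lebesgue. (\<phi> x + \<psi> x) * complex_of_real (partial_deriv i \<eta> x)) =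
   - (LINT x|lebesgue. (g x + h x) $ i * complex_of_real (\<eta> x))"
  using test_function_integrable(2)[OF l(1) \<eta>, of i] test_function_integrable(2)[OF l(2) \<eta>, of i]
   test_function_integrable(1)[OF lc(1) \<eta>] test_function_integrable(1)[OF lc(2) \<eta>] assms \<eta>
  unfolding has_weak_gradient_iff by (simp add: distrib_right)
qed

lemma has_weak_gradient_cmult:
 fixes c :: complex
 assumes "has_weak_gradient U \<phi> g"
 shows "has_weak_gradient U (\<lambda>x. c * \<phi> x) (\<lambda>x. \<chi> i. c * g x $ i)"
 unfolding has_weak_gradient_iff
proof (intro conjI ballI allI)
 have l: "locally_integrable U \<phi>" "locally_integrable U g"
  using assms by (auto simp: has_weak_gradient_def)
 show "locally_integrable U (\<lambda>x. c * \<phi> x)"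
  by (rule locally_integrable_bounded_linear[OF l(1) bounded_linear_mult_right])
 show "locally_integrable U (\<lambda>x. \<chi> i. c * g x $ i)"
  by (rule locally_integrable_vec_componentwise)
    (simp add: locally_integrable_bounded_linear[OF locally_integrable_component[OF l(2)] bounded_linear_mult_right])
 fix \<eta> i assume \<eta>: "\<eta> \<in> test_functions U"
 show "(LINT x|lebesgue. c * \<phi> x * complex_of_real (partial_deriv i \<eta> x)) =
   - (LINT x|lebesgue. (\<chi> i. c * g x $ i) $ i * complex_of_real (\<eta> x))"
  using assms \<eta> unfolding has_weak_gradient_iff by (simp add: mult.assoc)
qed

lemma has_weak_gradient_diff:
 assumes "has_weak_gradient U \<phi> g" "has_weak_gradient U \<psi> h"
 shows "has_weak_gradient U (\<lambda>x. \<phi> x - \<psi> x) (\<lambda>x. g x - h x)"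
proof -
 have "(\<lambda>x. g x - h x) = (\<lambda>x. g x + (\<chi> i. (- 1) * h x $ i))"
  by (auto simp: vec_eq_iff fun_eq_iff)
 then show ?thesis
  using has_weak_gradient_add[OF assms(1) has_weak_gradient_cmult[OF assms(2), of "- 1"]] by simp
qed

text \<open>The p-th power of the Sobolev norm with the gradient as an explicit argument, so that it
  can be evaluated for gradients given by a formula.\<close>

definition energy ::
 "(real ^ 'd) set \<Rightarrow> (real ^ 'd \<Rightarrow> real) \<Rightarrow> real \<Rightarrow> (real ^ 'd \<Rightarrow> complex) \<Rightarrow> (real ^ 'd \<Rightarrow> complex ^ 'd) \<Rightarrow> real" where
 "energy U w p \<phi> g = (\<integral>x. norm (\<phi> x) powr p * w x \<partial>lebesgue_on U) +
   (\<Sum>i\<in>UNIV. \<integral>x. norm (g x $ i) powr p * w x \<partial>lebesgue_on U)"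

lemma sum_UNIV_option: "(\<Sum>j\<in>(UNIV :: 'd::finite option set). f j) = f None + (\<Sum>i\<in>UNIV. f (Some i))"
 by (simp add: UNIV_option_conv sum.reindex)

lemma weak_gradient_integral_cong:
 assumes "open U" "has_weak_gradient U \<phi> g" "w \<in> borel_measurable (lebesgue_on U)"
 shows "integrable (lebesgue_on U) (\<lambda>x. norm (weak_gradient U \<phi> x $ i) powr p * w x) \<longleftrightarrow>
   integrable (lebesgue_on U) (\<lambda>x. norm (g x $ i) powr p * w x)"
  "(\<integral>x. norm (weak_gradient U \<phi> x $ i) powr p * w x \<partial>lebesgue_on U) =
   (\<integral>x. norm (g x $ i) powr p * w x \<partial>lebesgue_on U)"
proof -
 note wg = weak_gradient_AE[OF assms(1,2)]
 have m: "(\<lambda>x. weak_gradient U \<phi> x $ i) \<in> borel_measurable (lebesgue_on U)" "(\<lambda>x. g x $ i) \<in> borel_measurable (lebesgue_on U)"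
  using wg(1) assms(2) unfolding has_weak_gradient_def
  by (auto intro!: locally_integrable_measurable[OF assms(1)] locally_integrable_component)
 have AE: "AE x in lebesgue_on U. norm (weak_gradient U \<phi> x $ i) powr p * w x = norm (g x $ i) powr p * w x"
  using wg(2) by eventually_elim simp
 have m1: "(\<lambda>x. norm (weak_gradient U \<phi> x $ i) powr p * w x) \<in> borel_measurable (lebesgue_on U)"
  using m(1) assms(3) by measurable
 have m2: "(\<lambda>x. norm (g x $ i) powr p * w x) \<in> borel_measurable (lebesgue_on U)"
  using m(2) assms(3) by measurable
 show "integrable (lebesgue_on U) (\<lambda>x. norm (weak_gradient U \<phi> x $ i) powr p * w x) \<longleftrightarrow>
   integrable (lebesgue_on U) (\<lambda>x. norm (g x $ i) powr p * w x)"
  by (rule integrable_cong_AE[OF m1 m2 AE])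
 show "(\<integral>x. norm (weak_gradient U \<phi> x $ i) powr p * w x \<partial>lebesgue_on U) =
   (\<integral>x. norm (g x $ i) powr p * w x \<partial>lebesgue_on U)"
  by (rule integral_cong_AE[OF m1 m2 AE])
qed

lemma W1p_iff:
 assumes "open U" "has_weak_gradient U \<phi> g" "w \<in> borel_measurable (lebesgue_on U)"
 shows "\<phi> \<in> W1p U w p \<longleftrightarrow> integrable (lebesgue_on U) (\<lambda>x. norm (\<phi> x) powr p * w x) \<and>
   (\<forall>i. integrable (lebesgue_on U) (\<lambda>x. norm (g x $ i) powr p * w x))"
proof -
 note wg = weak_gradient_AE(1)[OF assms(1,2)]
 have m: "\<phi> \<in> borel_measurable (lebesgue_on U)" "(\<lambda>x. weak_gradient U \<phi> x $ i) \<in> borel_measurable (lebesgue_on U)" for i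
  using wg unfolding has_weak_gradient_def
  by (auto intro!: locally_integrable_measurable[OF assms(1)] locally_integrable_component)
 have "with_gradient \<phi> (weak_gradient U \<phi>) \<in> borel_measurable (lebesgue_on U)"
 proof (intro borel_measurable_vec_componentwise)
  fix j :: "'a option"
  show "(\<lambda>x. with_gradient \<phi> (weak_gradient U \<phi>) x $ j) \<in> borel_measurable (lebesgue_on U)"
   using m by (cases j) (auto simp: with_gradient_def)
 qed
 moreover have "(\<forall>j. P j) \<longleftrightarrow> P None \<and> (\<forall>i. P (Some i))" for P :: "'a option \<Rightarrow> bool"
  by (metis not_None_eq)
 ultimately show ?thesis using assms(2) weak_gradient_integral_cong(1)[OF assms, of _ p]
  by (auto simp: W1p_def Lp_space_def with_gradient_def)
qed

lemma W1p_norm_eq: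
 assumes "open U" "has_weak_gradient U \<phi> g" "w \<in> borel_measurable (lebesgue_on U)"
 shows "W1p_norm U w p \<phi> = energy U w p \<phi> g powr (1 / p)"
 using weak_gradient_integral_cong(2)[OF assms, of _ p]
 by (simp add: W1p_norm_def Lp_norm_def energy_def with_gradient_def sum_UNIV_option)

section \<open>Local Lipschitz functions\<close>

text \<open>A finite convex combination of the functions with index at least \<open>k\<close>. The
  weights form one sequence on all natural numbers, zero below \<open>k\<close> and from
  \<open>N\<close> on, so that two combinations can be added after enlarging
  \<open>N\<close>.\<close>

definition tail_average :: "(nat \<Rightarrow> 'a \<Rightarrow> real) \<Rightarrow> nat \<Rightarrow> ('a \<Rightarrow> real) \<Rightarrow> bool" where
 "tail_average q k h \<longleftrightarrow> (\<exists>N a. (\<forall>n. 0 \<le> a n) \<and> (\<forall>n<k. a n = 0) \<and> (\<forall>n\<ge>N. a n = 0) \<and>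
   (\<Sum>n<N. a n) = 1 \<and> (\<forall>x. h x = (\<Sum>n<N. a n * q n x)))"

lemma tail_average_self: "tail_average q k (q k)"
proof -
 have "(\<Sum>n<Suc k. (if n = k then 1 else 0) * q n x) = q k x" for x
  by (subst sum.cong[OF refl, of _ _ "\<lambda>n. if n = k then q n x else 0"]) auto
 then show ?thesis unfolding tail_average_def
  by (intro exI[of _ "Suc k"] exI[of _ "\<lambda>n. if n = k then 1 else 0"]) auto
qed

lemma tail_average_mono:
 assumes "tail_average q k h" "j \<le> k"
 shows "tail_average q j h"
 using assms unfolding tail_average_def by (meson order_less_le_trans)

lemma tail_average_midpoint:
 assumes "tail_average q k f" "tail_average q k g"
 shows "tail_average q k (\<lambda>x. (f x + g x) / 2)"
proof -
 obtain N a where a: "\<And>n. 0 \<le> a n" "\<And>n. n < k \<Longrightarrow> a n = 0" "\<And>n. n \<ge> N \<Longrightarrow> a n = 0"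
   "(\<Sum>n<N. a n) = 1" "\<And>x. f x = (\<Sum>n<N. a n * q n x)"
  using assms(1) unfolding tail_average_def by blast
 obtain N' b where b: "\<And>n. 0 \<le> b n" "\<And>n. n < k \<Longrightarrow> b n = 0" "\<And>n. n \<ge> N' \<Longrightarrow> b n = 0"
   "(\<Sum>n<N'. b n) = 1" "\<And>x. g x = (\<Sum>n<N'. b n * q n x)"
  using assms(2) unfolding tail_average_def by blast
 define H where "H = max N N'"
 have sa: "(\<Sum>n<N. a n * c n) = (\<Sum>n<H. a n * c n)" for c
  by (rule sum.mono_neutral_left) (auto simp: H_def a)
 have sb: "(\<Sum>n<N'. b n * c n) = (\<Sum>n<H. b n * c n)" for c
  by (rule sum.mono_neutral_left) (auto simp: H_def b)
 have "(\<Sum>n<H. (a n + b n) / 2) = 1"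
  using a(4) b(4) sa[of "\<lambda>_. 1"] sb[of "\<lambda>_. 1"] by (simp add: sum.distrib flip: sum_divide_distrib)
 moreover have "(f x + g x) / 2 = (\<Sum>n<H. (a n + b n) / 2 * q n x)" for x
  unfolding a(5) b(5) sa sb by (simp add: sum.distrib distrib_right add_divide_distrib sum_divide_distrib)
 ultimately show ?thesis unfolding tail_average_def
  by (intro exI[of _ H] exI[of _ "\<lambda>n. (a n + b n) / 2"]) (auto simp: a b H_def)
qed

lemma tail_average_measurable:
 assumes "tail_average q k h" "\<And>n. q n \<in> borel_measurable M"
 shows "h \<in> borel_measurable M"
proof -
 obtain N a where "\<And>x. h x = (\<Sum>n<N. a n * q n x)"
  using assms(1) unfolding tail_average_def by blast
 then have "h = (\<lambda>x. \<Sum>n<N. a n * q n x)" by auto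
 then show ?thesis using assms(2) by auto
qed

text \<open>With y = 0 this gives uniform bounds; with y the limit of the sequence it shows that
  averages over later and later tails have the same limit.\<close>

lemma tail_average_bound:
 assumes "tail_average q k h" "\<And>n. k \<le> n \<Longrightarrow> \<bar>q n x - y\<bar> \<le> e"
 shows "\<bar>h x - y\<bar> \<le> e"
proof -
 obtain N a where a: "\<And>n. 0 \<le> a n" "\<And>n. n < k \<Longrightarrow> a n = 0"
   "(\<Sum>n<N. a n) = 1" "\<And>x. h x = (\<Sum>n<N. a n * q n x)"
  using assms(1) unfolding tail_average_def by blast
 have "h x - y = (\<Sum>n<N. a n * q n x) - (\<Sum>n<N. a n) * y" using a by simp
 also have "\<dots> = (\<Sum>n<N. a n * (q n x - y))"
  by (simp add: sum_distrib_right sum_subtractf right_diff_distrib)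
 finally have "\<bar>h x - y\<bar> \<le> (\<Sum>n<N. \<bar>a n * (q n x - y)\<bar>)" by simp
 also have "\<dots> \<le> (\<Sum>n<N. a n * e)"
 proof (rule sum_mono)
  fix n show "\<bar>a n * (q n x - y)\<bar> \<le> a n * e"
   using a(1)[of n] a(2)[of n] assms(2)[of n] by (cases "n < k") (auto simp: abs_mult intro: mult_left_mono)
 qed
 also have "\<dots> = e" using a(3) by (simp flip: sum_distrib_right)
 finally show ?thesis .
qed

text \<open>Near-minimisers of the L2 norm over the convex hulls of the tails form a Cauchy sequence,
 by the parallelogram identity.\<close>

lemma tail_averages_converge_AE:
 fixes q :: "nat \<Rightarrow> 'a \<Rightarrow> real"
 assumes "finite_measure M" and q: "\<And>n. q n \<in> borel_measurable M" "\<And>n x. \<bar>q n x\<bar> \<le> 1"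
 obtains v where "\<And>k. tail_average q k (v k)" "AE x in M. Cauchy (\<lambda>k. v k x)"
proof -
 interpret finite_measure M by fact
 define J where "J h = (LINT x|M. (h x)\<^sup>2)" for h :: "'a \<Rightarrow> real"
 define S where "S k = {J h | h. tail_average q k h}" for k
 define d where "d k = Inf (S k)" for k
 have bd: "\<bar>h x\<bar> \<le> 1" if "tail_average q k h" for h k x
  using tail_average_bound[OF that, of x 0 1] q(2) by simp
 have int: "integrable M (\<lambda>x. (f x)\<^sup>2)" if "f \<in> borel_measurable M" "\<And>x. \<bar>f x\<bar> \<le> 2" for f :: "'a \<Rightarrow> real"
 proof (rule integrable_const_bound[where B = 4])
  show "AE x in M. norm ((f x)\<^sup>2) \<le> 4"
  proof (rule AE_I2)
   fix x
   have "\<bar>f x\<bar>\<^sup>2 \<le> 2\<^sup>2" by (rule power_mono) (use that in auto)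
   then show "norm ((f x)\<^sup>2) \<le> 4" by simp
  qed
 qed (use that in measurable)
 have nonneg: "0 \<le> J h" for h by (simp add: J_def)
 have bdd: "bdd_below (S k)" for k using nonneg by (auto simp: S_def intro!: bdd_belowI[of _ 0])
 have ne: "S k \<noteq> {}" for k using tail_average_self[of q k] by (auto simp: S_def)
 have dle: "d k \<le> J h" if "tail_average q k h" for k h
  unfolding d_def by (rule cInf_lower[OF _ bdd]) (use that in \<open>auto simp: S_def\<close>)
 have "incseq d"
 proof (rule incseq_SucI)
  fix k
  have "S (Suc k) \<subseteq> S k" using tail_average_mono[of q "Suc k" _ k] unfolding S_def by auto
  then show "d k \<le> d (Suc k)" unfolding d_def by (rule cInf_superset_mono[OF ne bdd])
 qed
 have dub: "d k \<le> measure M (space M)" for k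
 proof -
  have "J (q k) \<le> (LINT x|M. 1)" unfolding J_def
  proof (rule integral_mono)
   show "integrable M (\<lambda>x. (q k x)\<^sup>2)" by (intro int q(1) order_trans[OF q(2)]) simp
   show "(q k x)\<^sup>2 \<le> 1" for x using q(2)[of k x] by (simp add: abs_square_le_1)
  qed auto
  then show ?thesis using dle[OF tail_average_self[of q k]] by simp
 qed
 obtain D where D: "d \<longlonglongrightarrow> D" "\<And>k. d k \<le> D"
  using incseq_convergent[OF \<open>incseq d\<close>, of "measure M (space M)"] dub by blast
 have "\<exists>h. tail_average q k h \<and> J h < d k + 1 / real (Suc k)" for k
  using cInf_lessD[OF ne[of k], of "d k + 1 / real (Suc k)"] by (auto simp: S_def d_def)
 then obtain v where v: "\<And>k. tail_average q k (v k)" "\<And>k. J (v k) < d k + 1 / real (Suc k)"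
  by metis
 have vm[measurable]: "v k \<in> borel_measurable M" for k
  using tail_average_measurable[OF v(1) q(1)] .
 have vb: "\<bar>v k x\<bar> \<le> 1" for k x using bd[OF v(1)] .
 \<comment> \<open>The midpoint of \<open>v k\<close> and \<open>v m\<close> is again an average
   over the tail from \<open>k\<close>, so its energy is at least \<open>d k\<close>. The
   parallelogram identity turns this into a bound on their distance.\<close>
 have diffle: "(LINT x|M. (v k x - v m x)\<^sup>2) \<le> 2 * (D - d k) + 4 / real (Suc k)" if "k \<le> m" for k m
 proof -
  have i1: "integrable M (\<lambda>x. (v k x)\<^sup>2)" for k by (intro int vm order_trans[OF vb]) simp
  have i2: "integrable M (\<lambda>x. ((v k x + v m x) / 2)\<^sup>2)"
  proof (rule int)
   show "\<bar>(v k x + v m x) / 2\<bar> \<le> 2" for x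
    using vb[of k x] vb[of m x] abs_triangle_ineq[of "v k x" "v m x"] by simp
  qed measurable
  have "(LINT x|M. (v k x - v m x)\<^sup>2) = (LINT x|M. 2 * (v k x)\<^sup>2 + 2 * (v m x)\<^sup>2 - 4 * ((v k x + v m x) / 2)\<^sup>2)"
   by (rule Bochner_Integration.integral_cong) (auto simp: power2_eq_square field_simps)
  also have "\<dots> = 2 * J (v k) + 2 * J (v m) - 4 * J (\<lambda>x. (v k x + v m x) / 2)"
   using i1[of k] i1[of m] i2 by (simp add: J_def)
  also have "\<dots> \<le> 2 * (d k + 1 / real (Suc k)) + 2 * (d m + 1 / real (Suc m)) - 4 * d k"
  proof -
   have "tail_average q k (\<lambda>x. (v k x + v m x) / 2)"
    by (intro tail_average_midpoint v(1) tail_average_mono[OF v(1) that])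
   from dle[OF this] show ?thesis
    by (intro diff_mono add_mono mult_left_mono less_imp_le[OF v(2)]) auto
  qed
  also have "\<dots> \<le> 2 * (D - d k) + 4 / real (Suc k)"
  proof -
   have "1 / real (Suc m) \<le> 1 / real (Suc k)" using that by (simp add: frac_le)
   moreover have "2 * (a + x) + 2 * (b + y) - 4 * a \<le> 2 * (c - a) + 4 * x" if "y \<le> x" "b \<le> c" for a b c x y :: real
    using that by argo
   ultimately show ?thesis using D(2)[of m] by (metis (no_types, opaque_lifting) mult.right_neutral times_divide_eq_right)
  qed
  finally show ?thesis .
 qed
 have lim: "(\<lambda>k. 2 * (D - d k) + 4 / real (Suc k)) \<longlonglongrightarrow> 0"
 proof -
  have "(\<lambda>k. 2 * (D - d k) + 4 * inverse (real (Suc k))) \<longlonglongrightarrow> 2 * (D - D) + 4 * 0"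
   by (intro tendsto_intros D LIMSEQ_inverse_real_of_nat)
  then show ?thesis by (simp add: divide_inverse)
 qed
 have vi: "integrable M (v k)" for k
  by (rule integrable_const_bound[where B = 1]) (use vb in auto)
 have cauchy: "\<exists>N. \<forall>i\<ge>N. \<forall>j\<ge>N. (LINT x|M. norm (v i x - v j x)) < e" if e: "0 < e" for e :: real
 proof -
  define \<delta> where "\<delta> = e / (2 * (measure M (space M) + 1))"
  have mu: "0 < measure M (space M) + 1" by (smt (verit) measure_nonneg)
  have \<delta>: "0 < \<delta>" using e mu by (simp add: \<delta>_def)
  obtain N where N: "\<And>k. k \<ge> N \<Longrightarrow> 2 * (D - d k) + 4 / real (Suc k) < \<delta> * (e / 2)"
   using order_tendstoD(2)[OF lim, of "\<delta> * (e / 2)"] \<delta> e by (auto simp: eventually_sequentially)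
  have *: "(LINT x|M. norm (v i x - v j x)) < e" if "N \<le> i" "i \<le> j" for i j
  proof -
   have i2: "integrable M (\<lambda>x. (v i x - v j x)\<^sup>2)"
   proof (rule int)
    show "\<bar>v i x - v j x\<bar> \<le> 2" for x using vb[of i x] vb[of j x] by linarith
   qed measurable
   \<comment> \<open>The inequality |y| <= \<delta> + y^2 / \<delta> converts the quadratic estimate
     into one in L^1, where a subsequence converging almost everywhere can be extracted.\<close>
   have "(LINT x|M. norm (v i x - v j x)) \<le> (LINT x|M. \<delta> + (v i x - v j x)\<^sup>2 / \<delta>)"
   proof (rule integral_mono)
    fix x
    show "norm (v i x - v j x) \<le> \<delta> + (v i x - v j x)\<^sup>2 / \<delta>"
    proof (cases "\<bar>v i x - v j x\<bar> \<le> \<delta>")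
     case True
     then show ?thesis using \<delta> by (smt (verit) divide_nonneg_pos real_norm_def zero_le_power2)
    next
     case False
     then have "\<delta> * \<bar>v i x - v j x\<bar> \<le> \<bar>v i x - v j x\<bar> * \<bar>v i x - v j x\<bar>" by (intro mult_right_mono) auto
     then have "\<bar>v i x - v j x\<bar> \<le> (v i x - v j x)\<^sup>2 / \<delta>" using \<delta> by (simp add: field_simps power2_eq_square)
     then show ?thesis using \<delta> by simp
    qed
   qed (use vi i2 in auto)
   also have "\<dots> = \<delta> * measure M (space M) + (LINT x|M. (v i x - v j x)\<^sup>2) / \<delta>"
    using i2 by simp
   also have "\<dots> < \<delta> * (measure M (space M) + 1) + e / 2"
   proof -
    have "(LINT x|M. (v i x - v j x)\<^sup>2) < \<delta> * (e / 2)" using diffle[OF that(2)] N[OF that(1)] by linarith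
    then have "(LINT x|M. (v i x - v j x)\<^sup>2) / \<delta> < e / 2" using \<delta> by (simp add: field_simps)
    then show ?thesis using \<delta> by (simp add: algebra_simps)
   qed
   also have "\<delta> * (measure M (space M) + 1) = e / 2"
   proof -
    have "e / (2 * a) * a = e / 2" if "0 < a" for a :: real using that by simp
    then show ?thesis unfolding \<delta>_def using mu .
   qed
   also have "e / 2 + e / 2 = e" by simp
   finally show ?thesis .
  qed
  have "(LINT x|M. norm (v i x - v j x)) < e" if "N \<le> i" "N \<le> j" for i j
  proof (cases "i \<le> j")
   case False
   then show ?thesis using *[of j i] that by (simp add: abs_minus_commute)
  qed (use * that in auto)
  then show ?thesis by blast
 qed
 obtain r where r: "strict_mono r" "AE x in M. Cauchy (\<lambda>i. v (r i) x)"
  using cauchy_L1_AE_cauchy_subseq[OF vi cauchy] by blast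
 \<comment> \<open>Passing to the subsequence is harmless since r k >= k: an average over the tail
   from \<open>r k\<close> is also one over the tail from \<open>k\<close>.\<close>
 show ?thesis
  by (rule that[of "\<lambda>k. v (r k)"])
    (use r tail_average_mono[OF v(1) seq_suble[OF r(1)]] in auto)
qed

section \<open>Difference quotients against test functions\<close>

lemma integral_difference_quotient_tendsto:
 fixes \<sigma> :: "'a::euclidean_space \<Rightarrow> real"
 assumes \<sigma>: "\<sigma> \<in> borel_measurable lebesgue" "\<And>x. \<bar>\<sigma> x\<bar> \<le> B"
  and C1: "C1_along e \<psi> \<psi>'" and K: "compact K" "\<And>x. x \<notin> K \<Longrightarrow> \<psi> x = 0"
  and X: "X \<longlonglongrightarrow> 0" "\<And>n. X n \<noteq> 0" "\<And>n. \<bar>X n\<bar> \<le> (1::real)"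
 shows "(\<lambda>n. LINT x|lebesgue. (1 / X n) * (\<sigma> (x + X n *\<^sub>R e) - \<sigma> x) * \<psi> x) \<longlonglongrightarrow> - (LINT x|lebesgue. \<sigma> x * \<psi>' x)"
proof -
 have c: "continuous_on UNIV \<psi>" "continuous_on UNIV \<psi>'" using C1 by (auto simp: C1_along_def)
 have "0 \<le> B" using \<sigma>(2)[of undefined] abs_ge_zero order_trans by blast
 have D0: "x \<notin> K \<Longrightarrow> \<psi>' x = 0" for x
  using C1_along_eq_0[OF C1 compact_imp_closed[OF K(1)] K(2)] .
 obtain P where P: "0 \<le> P" "\<And>x. norm (\<psi>' x) \<le> P"
  using continuous_compact_support_bounded[OF c(2) K(1) D0] by blast
 have \<psi>i: "integrable lebesgue \<psi>" by (rule integrable_lebesgue_continuous_compact_support[OF c(1) K])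
 have \<sigma>\<psi>: "integrable lebesgue (\<lambda>x. \<sigma> (x + c) * \<psi> (x + d))" for c d
 proof (rule Bochner_Integration.integrable_bound)
  have t: "integrable lebesgue (\<lambda>x. \<psi> (x + d))" using integral_lebesgue_translate(1)[OF \<psi>i, of d] by (simp add: add.commute)
  then show "integrable lebesgue (\<lambda>x. B * \<psi> (x + d))" by simp
  have "(\<lambda>x. x + c) \<in> lebesgue \<rightarrow>\<^sub>M lebesgue" using lebesgue_isometry_scalar(1)[of 1 c] by (simp add: add.commute)
  from measurable_compose[OF this \<sigma>(1)] t show "(\<lambda>x. \<sigma> (x + c) * \<psi> (x + d)) \<in> borel_measurable lebesgue"
   by (intro borel_measurable_times) auto
  show "AE x in lebesgue. norm (\<sigma> (x + c) * \<psi> (x + d)) \<le> norm (B * \<psi> (x + d))"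
   using \<sigma>(2) \<open>0 \<le> B\<close> by (intro AE_I2) (auto simp: abs_mult intro!: mult_right_mono)
 qed
 \<comment> \<open>Discrete integration by parts: a translation moves the quotient from \<sigma> to
   \<psi> with the step reversed, so that the limit only involves the derivative of \<psi>.\<close>
 have eq: "(LINT x|lebesgue. (1 / X n) * (\<sigma> (x + X n *\<^sub>R e) - \<sigma> x) * \<psi> x) =
   - (LINT x|lebesgue. \<sigma> x * ((1 / (- X n)) * (\<psi> (x + (- X n) *\<^sub>R e) - \<psi> x)))" for n
 proof -
  have "(LINT x|lebesgue. \<sigma> (x + X n *\<^sub>R e) * \<psi> x) = (LINT x|lebesgue. \<sigma> x * \<psi> (x + (- X n) *\<^sub>R e))"
   using integral_lebesgue_translate(2)[OF \<sigma>\<psi>[of 0 "(- X n) *\<^sub>R e"], of "X n *\<^sub>R e"] by (simp add: add.commute)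
  then have 1: "(LINT x|lebesgue. \<sigma> (x + X n *\<^sub>R e) * \<psi> x - \<sigma> x * \<psi> x) =
    (LINT x|lebesgue. \<sigma> x * \<psi> (x + (- X n) *\<^sub>R e) - \<sigma> x * \<psi> x)"
   using \<sigma>\<psi>[of "X n *\<^sub>R e" 0] \<sigma>\<psi>[of 0 0] \<sigma>\<psi>[of 0 "(- X n) *\<^sub>R e"] by simp
  have "(LINT x|lebesgue. (1 / X n) * (\<sigma> (x + X n *\<^sub>R e) - \<sigma> x) * \<psi> x) =
    (LINT x|lebesgue. (1 / X n) * (\<sigma> (x + X n *\<^sub>R e) * \<psi> x - \<sigma> x * \<psi> x))"
   by (simp only: left_diff_distrib mult.assoc)
  also have "\<dots> = (1 / X n) * (LINT x|lebesgue. \<sigma> x * \<psi> (x + (- X n) *\<^sub>R e) - \<sigma> x * \<psi> x)"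
   by (simp only: integral_mult_right_zero 1)
  also have "\<dots> = - ((1 / (- X n)) * (LINT x|lebesgue. \<sigma> x * (\<psi> (x + (- X n) *\<^sub>R e) - \<psi> x)))"
   by (simp add: right_diff_distrib)
  also have "\<dots> = - (LINT x|lebesgue. (1 / (- X n)) * (\<sigma> x * (\<psi> (x + (- X n) *\<^sub>R e) - \<psi> x)))"
   by (simp only: integral_mult_right_zero)
  finally show ?thesis by (simp only: mult.left_commute)
 qed
 \<comment> \<open>Steps of either sign and of size at most 1 have to be covered here.\<close>
 define K' where "K' = (\<lambda>(x, t). x - t *\<^sub>R e) ` (K \<times> {-1..1})"
 have K': "compact K'" unfolding K'_def
  by (intro compact_continuous_image compact_Times K) (auto simp: case_prod_unfold intro!: continuous_intros)
 have "(\<lambda>n. LINT x|lebesgue. \<sigma> x * ((1 / (- X n)) * (\<psi> (x + (- X n) *\<^sub>R e) - \<psi> x))) \<longlonglongrightarrow> (LINT x|lebesgue. \<sigma> x * \<psi>' x)"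
 proof (rule integral_dominated_convergence[where w = "\<lambda>x. (B * P) * indicator K' x"])
  have "\<psi>' \<in> borel_measurable lebesgue" by (rule borel_measurable_lebesgue_continuous[OF c(2)])
  then show "(\<lambda>x. \<sigma> x * \<psi>' x) \<in> borel_measurable lebesgue" using \<sigma>(1) by (rule borel_measurable_times[rotated])
  show "(\<lambda>x. \<sigma> x * ((1 / (- X n)) * (\<psi> (x + (- X n) *\<^sub>R e) - \<psi> x))) \<in> borel_measurable lebesgue" for n
   by (intro borel_measurable_times \<sigma>(1) borel_measurable_lebesgue_continuous continuous_intros
     continuous_on_compose2[OF c(1)]) auto
  show "integrable lebesgue (\<lambda>x. (B * P) * indicator K' x :: real)"
   using lmeasurable_compact[OF K'] by (auto simp: fmeasurable_def)
  show "AE x in lebesgue. (\<lambda>n. \<sigma> x * ((1 / (- X n)) * (\<psi> (x + (- X n) *\<^sub>R e) - \<psi> x))) \<longlonglongrightarrow> \<sigma> x * \<psi>' x"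
  proof (rule AE_I2)
   fix x
   have "(\<lambda>n. (1 / (- X n)) *\<^sub>R (\<psi> (x + (- X n) *\<^sub>R e) - \<psi> x)) \<longlonglongrightarrow> \<psi>' x"
    by (rule C1_along_quotient[OF C1]) (use X tendsto_minus[OF X(1)] in auto)
   then show "(\<lambda>n. \<sigma> x * ((1 / (- X n)) * (\<psi> (x + (- X n) *\<^sub>R e) - \<psi> x))) \<longlonglongrightarrow> \<sigma> x * \<psi>' x"
    by (intro tendsto_mult tendsto_const) simp
  qed
  show "AE x in lebesgue. norm (\<sigma> x * ((1 / (- X n)) * (\<psi> (x + (- X n) *\<^sub>R e) - \<psi> x))) \<le> (B * P) * indicator K' x" for n
  proof (rule AE_I2)
   fix x
   show "norm (\<sigma> x * ((1 / (- X n)) * (\<psi> (x + (- X n) *\<^sub>R e) - \<psi> x))) \<le> (B * P) * indicator K' x"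
   proof (cases "x \<in> K'")
    case True
    have "norm (\<psi> (x + (- X n) *\<^sub>R e) - \<psi> x) \<le> P * \<bar>- X n\<bar>"
     by (rule C1_along_bound[OF C1 P(2)])
    then have "\<bar>(1 / (- X n)) * (\<psi> (x + (- X n) *\<^sub>R e) - \<psi> x)\<bar> \<le> P"
     using X(2)[of n] by (simp add: abs_mult pos_divide_le_eq)
    then have "norm (\<sigma> x * ((1 / (- X n)) * (\<psi> (x + (- X n) *\<^sub>R e) - \<psi> x))) \<le> B * P"
     unfolding real_norm_def abs_mult[of "\<sigma> x"] using \<sigma>(2)[of x] \<open>0 \<le> B\<close> by (intro mult_mono) auto
    then show ?thesis using True by simp
   next
    case False
    have "x \<notin> K"
    proof
     assume "x \<in> K"
     then have "(x, 0) \<in> K \<times> {-1..1::real}" by auto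
     then have "x - 0 *\<^sub>R e \<in> K'" unfolding K'_def by (rule image_eqI[rotated]) simp
     then show False using False by simp
    qed
    moreover have "x + (- X n) *\<^sub>R e \<notin> K"
    proof
     assume "x + (- X n) *\<^sub>R e \<in> K"
     then have "(x + (- X n) *\<^sub>R e, - X n) \<in> K \<times> {-1..1}" using X(3)[of n] by (auto simp: abs_le_iff)
     then have "x \<in> K'" unfolding K'_def by (rule image_eqI[rotated]) simp
     then show False using False by simp
    qed
    ultimately show ?thesis using K(2) False by simp
   qed
  qed
 qed
 from tendsto_minus[OF this] show ?thesis unfolding eq .
qed

text \<open>The integrals are plain numbers; viewing them as functions on \<open>unit\<close> lets
  \<open>tail_average_bound\<close> be applied to them.\<close>

lemma tail_average_integral:
 assumes "tail_average q k h" "\<And>n. integrable M (\<lambda>x. q n x * f x)"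
 shows "tail_average (\<lambda>n (_::unit). LINT x|M. q n x * f x) k (\<lambda>_. LINT x|M. h x * f x)"
proof -
 obtain N a where a: "\<And>n. 0 \<le> a n" "\<And>n. n < k \<Longrightarrow> a n = 0" "\<And>n. n \<ge> N \<Longrightarrow> a n = 0"
   "(\<Sum>n<N. a n) = 1" "\<And>x. h x = (\<Sum>n<N. a n * q n x)"
  using assms(1) unfolding tail_average_def by blast
 have "(LINT x|M. h x * f x) = (LINT x|M. (\<Sum>n<N. a n * (q n x * f x)))"
  by (simp add: a(5) sum_distrib_right mult.assoc)
 also have "\<dots> = (\<Sum>n<N. a n * (LINT x|M. q n x * f x))"
  using assms(2) by (subst Bochner_Integration.integral_sum) auto
 finally show ?thesis unfolding tail_average_def
  by (intro exI[of _ N] exI[of _ a]) (use a in auto)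
qed

text \<open>\<open>tail_averages_converge_AE\<close> works on finite measure spaces, while its
  conclusion depends only on the null sets; a positive integrable density transports it to Lebesgue
  measure.\<close>

lemma lebesgue_equivalent_finite_measure:
 obtains M :: "'a::euclidean_space measure" where "finite_measure M" "sets M = sets lebesgue"
  "\<And>P. (AE x in M. P x) \<longleftrightarrow> (AE x in lebesgue. P x)"
proof -
 obtain f :: "'a \<Rightarrow> real" where f: "f \<in> borel_measurable lborel" "\<And>x. f x > 0" "integrable lborel f"
  using sigma_finite_measure.obtain_positive_integrable_function[OF sigma_finite_lborel] by metis
 have fi: "integrable lebesgue f" using f by (simp add: integrable_completion)
 have fm: "(\<lambda>x. ennreal (f x)) \<in> borel_measurable lebesgue" using fi by auto
 show ?thesis
 proof (rule that[of "density lebesgue (\<lambda>x. ennreal (f x))"])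
  have "emeasure (density lebesgue (\<lambda>x. ennreal (f x))) UNIV = (\<integral>\<^sup>+x. ennreal (f x) \<partial>lebesgue)"
   using fm by (subst emeasure_density) auto
  also have "\<dots> = ennreal (LINT x|lebesgue. f x)"
   using f(2) by (intro nn_integral_eq_integral fi) (auto intro: less_imp_le)
  finally show "finite_measure (density lebesgue (\<lambda>x. ennreal (f x)))"
   by (intro finite_measureI) auto
 qed (use f(2) in \<open>auto simp: AE_density[OF fm]\<close>)
qed

text \<open>Difference quotients are locally bounded by Lipschitz constants. After normalisation
  some convex combinations of their tails converge almost everywhere; tested against \<psi> the
  quotients already converge by discrete integration by parts, so the limit function is the weak
  derivative.\<close>

lemma locally_lipschitz_partial_derivative:
 fixes s :: "real ^ 'd \<Rightarrow> real"
 assumes U: "open U" and s: "locally_lipschitz U s"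
 obtains g where "g \<in> borel_measurable lebesgue"
  "\<And>K. compact K \<Longrightarrow> K \<subseteq> U \<Longrightarrow> \<exists>B. \<forall>x\<in>K. \<bar>g x\<bar> \<le> B"
  "\<And>\<psi>. \<psi> \<in> test_functions U \<Longrightarrow> (LINT x|lebesgue. s x * partial_deriv i \<psi> x) = - (LINT x|lebesgue. g x * \<psi> x)"
proof -
 define e :: "real ^ 'd" where "e = axis i 1"
 define X where "X n = 1 / real (Suc n)" for n
 have X: "X \<longlonglongrightarrow> 0" "0 < X n" "X n \<le> 1" for n
  using LIMSEQ_inverse_real_of_nat by (auto simp: X_def[abs_def] inverse_eq_divide)
 obtain C where "exhaustion U C" using exhaustion_exists[OF U] by blast
 note C = exhaustionD[OF this]
 have "\<exists>L. L-lipschitz_on (C n) s" for n using s C(1,2) by (auto simp: locally_lipschitz_def)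
 then obtain L where L: "\<And>n. (L n)-lipschitz_on (C n) s" by metis
 \<comment> \<open>A point first reached by \<open>C l\<close> and its translates by small steps lie
   in \<open>C (Suc l)\<close>, where \<open>L (Suc l)\<close> is a Lipschitz constant. So \<Lambda>
   is a measurable, locally bounded majorant of the quotients.\<close>
 define lev where "lev x = (LEAST n. x \<in> C n)" for x
 define \<Lambda> where "\<Lambda> x = max 1 (L (Suc (lev x)))" for x
 have \<Lambda>1: "1 \<le> \<Lambda> x" for x by (simp add: \<Lambda>_def)
 have [measurable]: "C n \<in> sets lebesgue" for n using compact_sets_lebesgue[OF C(1)] .
 have \<Lambda>m[measurable]: "\<Lambda> \<in> borel_measurable lebesgue"
  unfolding \<Lambda>_def lev_def by measurable
 have levle: "lev x \<le> n" if "x \<in> C n" for x n unfolding lev_def using that by (rule Least_le)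
 have \<Lambda>bd: "\<exists>B. \<forall>x\<in>K. \<Lambda> x \<le> B" if K: "compact K" "K \<subseteq> U" for K
 proof -
  obtain n where n: "K \<subseteq> C n" using C(5)[OF K] by auto
  have "\<Lambda> x \<le> 1 + (\<Sum>l\<le>Suc n. \<bar>L l\<bar>)" if "x \<in> K" for x
  proof -
   have "Suc (lev x) \<le> Suc n" using levle[of x n] n that by auto
   then have "\<bar>L (Suc (lev x))\<bar> \<le> (\<Sum>l\<le>Suc n. \<bar>L l\<bar>)"
    by (intro member_le_sum) auto
   then show ?thesis by (simp add: \<Lambda>_def)
  qed
  then show ?thesis by blast
 qed
 have sc: "continuous_on U s"
 proof -
  have "isCont s x" if xU: "x \<in> U" for x
  proof -
   obtain n where "x \<in> C n" using xU unfolding C(4)[symmetric] by blast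
   then have "x \<in> interior (C (Suc n))" using C(3) by blast
   moreover have "continuous_on (C (Suc n)) s" using L lipschitz_on_continuous_on by blast
   ultimately show ?thesis by (rule continuous_on_interior[rotated])
  qed
  then show ?thesis by (simp add: continuous_at_imp_continuous_on)
 qed
 \<comment> \<open>The values of \<open>s\<close> outside \<open>U\<close> are arbitrary; the
   extension by 0 is Borel measurable, hence so are the quotients.\<close>
 define t where "t x = indicator U x *\<^sub>R s x" for x
 have tm: "t \<in> borel_measurable borel" unfolding t_def
  using U by (intro borel_measurable_continuous_on_indicator sc) auto
 define Q where "Q n x = (1 / X n) * (t (x + X n *\<^sub>R e) - t x)" for n x
 have "Q n \<in> borel_measurable borel" for n
 proof -
  have "(\<lambda>x. x + X n *\<^sub>R e) \<in> borel_measurable borel"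
   by (intro borel_measurable_continuous_onI continuous_intros)
  from measurable_compose[OF this tm] show ?thesis
   unfolding Q_def by (intro borel_measurable_times borel_measurable_diff tm) auto
 qed
 then have [measurable]: "Q n \<in> borel_measurable lebesgue" for n by (simp add: measurable_completion)
 \<comment> \<open>The averaging lemma asks for functions bounded by 1 everywhere. Values above
   \<Lambda> are discarded, which on a given compact subset of \<open>U\<close> happens for finitely
   many n only.\<close>
 define q where "q n x = (if \<bar>Q n x\<bar> \<le> \<Lambda> x then Q n x / \<Lambda> x else 0)" for n x
 have qm[measurable]: "q n \<in> borel_measurable lebesgue" for n unfolding q_def by measurable
 have qb: "\<bar>q n x\<bar> \<le> 1" for n x
 proof (cases "\<bar>Q n x\<bar> \<le> \<Lambda> x")
  case True
  have "\<bar>q n x\<bar> = \<bar>Q n x\<bar> / \<Lambda> x" using True \<Lambda>1[of x] by (simp add: q_def)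
  also have "\<dots> \<le> 1" using True \<Lambda>1[of x] by (subst divide_le_eq_1_pos) auto
  finally show ?thesis .
 qed (simp add: q_def)
 have shift: "\<exists>N. \<forall>n\<ge>N. \<forall>x\<in>C l. x + X n *\<^sub>R e \<in> C (Suc l)" for l
 proof -
  obtain r where r: "0 < r" "(\<Union>x\<in>C l. ball x r) \<subseteq> interior (C (Suc l))"
   using compact_subset_open_imp_ball_epsilon_subset[OF C(1) open_interior C(3)] by blast
  have ne: "norm e = 1" by (simp add: e_def)
  obtain N where N: "\<And>n. n \<ge> N \<Longrightarrow> X n < r"
   using order_tendstoD(2)[OF X(1) r(1)] by (auto simp: eventually_sequentially)
  have "x + X n *\<^sub>R e \<in> C (Suc l)" if "n \<ge> N" "x \<in> C l" for n x
  proof -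
   have "x + X n *\<^sub>R e \<in> ball x r" using N[OF that(1)] X(2)[of n] ne by (simp add: dist_norm)
   then show ?thesis using r(2) that(2) interior_subset by blast
  qed
  then show ?thesis by blast
 qed
 have qQ: "\<exists>N. \<forall>n\<ge>N. \<forall>x\<in>K. q n x * \<Lambda> x = Q n x" if K: "compact K" "K \<subseteq> U" for K
 proof -
  obtain j where j: "K \<subseteq> C j" using C(5)[OF K] by auto
  obtain N where N: "\<And>l n x. n \<ge> N l \<Longrightarrow> x \<in> C l \<Longrightarrow> x + X n *\<^sub>R e \<in> C (Suc l)"
   using shift by metis
  \<comment> \<open>The threshold \<open>N l\<close> depends on the first index reached; the sum
    over l <= j exceeds each of those that occur on \<open>K\<close>.\<close>
  have "q n x * \<Lambda> x = Q n x" if n: "n \<ge> (\<Sum>l\<le>j. N l)" and x: "x \<in> K" for n x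
  proof -
   have "x \<in> C j" using j x by auto
   then have l: "x \<in> C (lev x)" "lev x \<le> j" unfolding lev_def by (auto intro: LeastI Least_le)
   have "N (lev x) \<le> (\<Sum>l\<le>j. N l)" using l(2) by (intro member_le_sum) auto
   then have "x + X n *\<^sub>R e \<in> C (Suc (lev x))" using N[OF _ l(1)] n by simp
   moreover have "x \<in> C (Suc (lev x))" using l(1) C(3) interior_subset by blast
   ultimately have "\<bar>t (x + X n *\<^sub>R e) - t x\<bar> \<le> L (Suc (lev x)) * dist (x + X n *\<^sub>R e) x" "x \<in> U"
    using lipschitz_onD[OF L[of "Suc (lev x)"]] C(2) unfolding t_def
    by (auto simp: dist_real_def subset_eq)
   then have "\<bar>t (x + X n *\<^sub>R e) - t x\<bar> \<le> L (Suc (lev x)) * X n"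
    using X(2)[of n] by (simp add: e_def dist_norm)
   then have "\<bar>Q n x\<bar> \<le> L (Suc (lev x))" using X(2)[of n] by (simp add: Q_def abs_mult field_simps)
   then have "\<bar>Q n x\<bar> \<le> \<Lambda> x" by (simp add: \<Lambda>_def)
   then show ?thesis using \<Lambda>1[of x] by (simp add: q_def)
  qed
  then show ?thesis by blast
 qed
 obtain M :: "(real ^ 'd) measure" where M: "finite_measure M" "sets M = sets lebesgue"
  "\<And>P. (AE x in M. P x) \<longleftrightarrow> (AE x in lebesgue. P x)"
  using lebesgue_equivalent_finite_measure by blast
 have qM: "q n \<in> borel_measurable M" for n using qm measurable_cong_sets[OF M(2) refl] by blast
 obtain v where v: "\<And>k. tail_average q k (v k)" "AE x in M. Cauchy (\<lambda>k. v k x)"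
  using tail_averages_converge_AE[where q = q, OF M(1) qM qb] by blast
 have vm[measurable]: "v k \<in> borel_measurable lebesgue" for k by (rule tail_average_measurable[OF v(1) qm])
 have vb: "\<bar>v k x\<bar> \<le> 1" for k x using tail_average_bound[OF v(1), of k x 0 1] qb by simp
 \<comment> \<open>The clamp does not change a limit of functions bounded by 1, and it keeps
   \<open>g0\<close> bounded where there is no limit.\<close>
 define g0 where "g0 x = max (- 1) (min 1 (lim (\<lambda>k. v k x)))" for x
 have g0m[measurable]: "g0 \<in> borel_measurable lebesgue" unfolding g0_def by measurable
 have g0lim: "AE x in lebesgue. (\<lambda>k. v k x) \<longlonglongrightarrow> g0 x"
  using v(2) unfolding M(3)
 proof eventually_elim
  fix x assume "Cauchy (\<lambda>k. v k x)"
  then obtain l where l: "(\<lambda>k. v k x) \<longlonglongrightarrow> l" using Cauchy_convergent convergent_def by blast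
  have "\<bar>l\<bar> \<le> 1" using tendsto_le[OF _ tendsto_const tendsto_rabs[OF l]] vb by simp
  then have "g0 x = l" using limI[OF l] by (auto simp: g0_def)
  then show "(\<lambda>k. v k x) \<longlonglongrightarrow> g0 x" using l by simp
 qed
 show ?thesis
 proof (rule that[of "\<lambda>x. g0 x * \<Lambda> x"])
  show "(\<lambda>x. g0 x * \<Lambda> x) \<in> borel_measurable lebesgue" by measurable
  show "\<exists>B. \<forall>x\<in>K. \<bar>g0 x * \<Lambda> x\<bar> \<le> B" if K: "compact K" "K \<subseteq> U" for K
  proof -
   obtain B where B: "\<And>x. x \<in> K \<Longrightarrow> \<Lambda> x \<le> B" using \<Lambda>bd[OF K] by blast
   have "\<bar>g0 x * \<Lambda> x\<bar> \<le> B" if "x \<in> K" for x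
   proof -
    have "\<bar>g0 x\<bar> * \<bar>\<Lambda> x\<bar> \<le> 1 * B"
     using B[OF that] \<Lambda>1[of x] by (intro mult_mono) (auto simp: g0_def)
    then show ?thesis by (simp add: abs_mult)
   qed
   then show ?thesis by blast
  qed
  fix \<psi> assume \<psi>: "\<psi> \<in> test_functions U"
  obtain K where K: "compact K" "K \<subseteq> U" "\<And>x. x \<notin> K \<Longrightarrow> \<psi> x = 0" "\<And>x. x \<notin> K \<Longrightarrow> partial_deriv i \<psi> x = 0"
   "C1_along (axis i 1) \<psi> (partial_deriv i \<psi>)"
   using test_functionsE[OF \<psi>] by metis
  have pc: "continuous_on UNIV \<psi>" using K(5) by (simp add: C1_along_def)
  have \<psi>m[measurable]: "\<psi> \<in> borel_measurable lebesgue" by (rule borel_measurable_lebesgue_continuous[OF pc])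
  obtain P where P: "0 \<le> P" "\<And>x. norm (\<psi> x) \<le> P" using continuous_compact_support_bounded[OF pc K(1,3)] by blast
  obtain B where B: "\<And>x. x \<in> K \<Longrightarrow> \<Lambda> x \<le> B" using \<Lambda>bd[OF K(1,2)] by blast
  have dom: "\<bar>h x * (\<Lambda> x * \<psi> x)\<bar> \<le> (B * P) * indicator K x" if "\<And>x. \<bar>h x\<bar> \<le> 1" for h :: "real ^ 'd \<Rightarrow> real" and x
  proof (cases "x \<in> K")
   case True
   have "\<bar>h x\<bar> * (\<Lambda> x * \<bar>\<psi> x\<bar>) \<le> 1 * (B * P)"
    using that[of x] B[OF True] P(2)[of x] \<Lambda>1[of x] by (intro mult_mono) auto
   then show ?thesis using True \<Lambda>1[of x] by (simp add: abs_mult)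
  qed (use K(3) in simp)
  have iK: "integrable lebesgue (\<lambda>x. (B * P) * indicator K x :: real)"
   using lmeasurable_compact[OF K(1)] by (auto simp: fmeasurable_def)
  have hi: "integrable lebesgue (\<lambda>x. h x * (\<Lambda> x * \<psi> x))" if "h \<in> borel_measurable lebesgue" "\<And>x. \<bar>h x\<bar> \<le> 1" for h
  proof (rule Bochner_Integration.integrable_bound[OF iK])
   show "(\<lambda>x. h x * (\<Lambda> x * \<psi> x)) \<in> borel_measurable lebesgue" using that(1) by measurable
   show "AE x in lebesgue. norm (h x * (\<Lambda> x * \<psi> x)) \<le> norm ((B * P) * indicator K x :: real)"
    unfolding real_norm_def by (rule AE_I2, rule order_trans[OF dom[OF that(2)] abs_ge_self])
  qed
  have 1: "(\<lambda>k. LINT x|lebesgue. v k x * (\<Lambda> x * \<psi> x)) \<longlonglongrightarrow> (LINT x|lebesgue. g0 x * (\<Lambda> x * \<psi> x))"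
  proof (rule integral_dominated_convergence[OF _ _ iK])
   show "AE x in lebesgue. (\<lambda>k. v k x * (\<Lambda> x * \<psi> x)) \<longlonglongrightarrow> g0 x * (\<Lambda> x * \<psi> x)"
    using g0lim by eventually_elim (intro tendsto_intros)
   show "AE x in lebesgue. norm (v k x * (\<Lambda> x * \<psi> x)) \<le> (B * P) * indicator K x" for k
    using dom[OF vb] by (intro AE_I2) simp
  qed measurable
  obtain r where r: "0 < r" "(\<Union>x\<in>K. cball x r) \<subseteq> U"
   using compact_subset_open_imp_cball_epsilon_subset[OF K(1) U K(2)] by blast
  obtain j where j: "K \<subseteq> C j" using C(5)[OF K(1,2)] by auto
  \<comment> \<open>Cut to \<open>C (Suc j)\<close> the function is bounded and measurable on the
    whole space, and it agrees with \<open>s\<close> on \<open>K\<close> and on the translates of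
    \<open>K\<close> by small steps.\<close>
  define \<sigma> where "\<sigma> x = indicator (C (Suc j)) x * s x" for x
  have \<sigma>t: "\<sigma> x = indicator (C (Suc j)) x * t x" for x using C(2)[of "Suc j"] by (auto simp: \<sigma>_def t_def indicator_def)
  have "t \<in> borel_measurable lebesgue" using tm by (simp add: measurable_completion)
  then have \<sigma>m: "\<sigma> \<in> borel_measurable lebesgue" unfolding \<sigma>t by measurable
  have "compact (s ` C (Suc j))" by (intro compact_continuous_image C(1) continuous_on_subset[OF sc] C(2))
  then have "bounded (s ` C (Suc j))" by (rule compact_imp_bounded)
  then obtain S where "\<forall>y\<in>s ` C (Suc j). norm y \<le> S" unfolding bounded_iff by blast
  then have S: "\<And>x. x \<in> C (Suc j) \<Longrightarrow> \<bar>s x\<bar> \<le> S" by simp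
  have \<sigma>b: "\<bar>\<sigma> x\<bar> \<le> \<bar>S\<bar>" for x using S[of x] by (auto simp: \<sigma>_def indicator_def)
  obtain N1 where N1: "\<And>n x. n \<ge> N1 \<Longrightarrow> x \<in> C j \<Longrightarrow> x + X n *\<^sub>R e \<in> C (Suc j)" using shift[of j] by blast
  obtain N2 where N2: "\<And>n x. n \<ge> N2 \<Longrightarrow> x \<in> K \<Longrightarrow> q n x * \<Lambda> x = Q n x" using qQ[OF K(1,2)] by blast
  have 2: "(\<lambda>n. LINT x|lebesgue. q n x * (\<Lambda> x * \<psi> x)) \<longlonglongrightarrow> - (LINT x|lebesgue. \<sigma> x * partial_deriv i \<psi> x)"
  proof (rule Lim_transform_eventually)
   show "(\<lambda>n. LINT x|lebesgue. (1 / X n) * (\<sigma> (x + X n *\<^sub>R e) - \<sigma> x) * \<psi> x) \<longlonglongrightarrow> - (LINT x|lebesgue. \<sigma> x * partial_deriv i \<psi> x)"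
    unfolding e_def using X(2,3) less_imp_neq[OF X(2)]
    by (intro integral_difference_quotient_tendsto[OF \<sigma>m \<sigma>b K(5,1,3) X(1)]) (auto simp: less_imp_le)
   show "\<forall>\<^sub>F n in sequentially. (LINT x|lebesgue. (1 / X n) * (\<sigma> (x + X n *\<^sub>R e) - \<sigma> x) * \<psi> x) = (LINT x|lebesgue. q n x * (\<Lambda> x * \<psi> x))"
    using eventually_ge_at_top[of "max N1 N2"]
   proof eventually_elim
    fix n assume n: "max N1 N2 \<le> n"
    have "(1 / X n) * (\<sigma> (x + X n *\<^sub>R e) - \<sigma> x) * \<psi> x = q n x * (\<Lambda> x * \<psi> x)" for x
    proof (cases "x \<in> K")
     case True
     then have "x \<in> C j" "x \<in> C (Suc j)" using j C(3) interior_subset by blast+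
     then have "\<sigma> (x + X n *\<^sub>R e) = t (x + X n *\<^sub>R e)" "\<sigma> x = t x"
      using N1[of n x] n by (auto simp: \<sigma>t)
     then show ?thesis using N2[of n x] n True by (simp add: Q_def flip: mult.assoc)
    qed (simp add: K(3))
    then show "(LINT x|lebesgue. (1 / X n) * (\<sigma> (x + X n *\<^sub>R e) - \<sigma> x) * \<psi> x) = (LINT x|lebesgue. q n x * (\<Lambda> x * \<psi> x))"
     by simp
   qed
  qed
  have "(LINT x|lebesgue. \<sigma> x * partial_deriv i \<psi> x) = (LINT x|lebesgue. s x * partial_deriv i \<psi> x)"
  proof (rule Bochner_Integration.integral_cong[OF refl])
   fix x
   show "\<sigma> x * partial_deriv i \<psi> x = s x * partial_deriv i \<psi> x"
    using j C(3)[of j] interior_subset[of "C (Suc j)"] K(4)[of x] by (cases "x \<in> K") (auto simp: \<sigma>_def subset_eq)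
  qed
  with 2 have 2: "(\<lambda>n. LINT x|lebesgue. q n x * (\<Lambda> x * \<psi> x)) \<longlonglongrightarrow> - (LINT x|lebesgue. s x * partial_deriv i \<psi> x)"
   (is "_ \<longlonglongrightarrow> ?l") by simp
  \<comment> \<open>The integrals of \<open>v k\<close> are averages over the tail from
    \<open>k\<close> of a convergent sequence of numbers.\<close>
  have 3: "(\<lambda>k. LINT x|lebesgue. v k x * (\<Lambda> x * \<psi> x)) \<longlonglongrightarrow> ?l"
  proof (rule LIMSEQ_I)
   fix \<epsilon> :: real assume \<epsilon>: "0 < \<epsilon>"
   obtain n0 where n0: "\<And>n. n \<ge> n0 \<Longrightarrow> norm ((LINT x|lebesgue. q n x * (\<Lambda> x * \<psi> x)) - ?l) < \<epsilon> / 2"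
    using LIMSEQ_D[OF 2 half_gt_zero[OF \<epsilon>]] by blast
   have "\<bar>(LINT x|lebesgue. v k x * (\<Lambda> x * \<psi> x)) - ?l\<bar> \<le> \<epsilon> / 2" if "k \<ge> n0" for k
    by (rule tail_average_bound[OF tail_average_integral[OF v(1)[of k] hi[OF qm qb]]])
      (use n0 that in \<open>force simp: less_imp_le\<close>)
   then show "\<exists>no. \<forall>k\<ge>no. norm ((LINT x|lebesgue. v k x * (\<Lambda> x * \<psi> x)) - ?l) < \<epsilon>"
    using \<epsilon> by (intro exI[of _ n0]) fastforce
  qed
  show "(LINT x|lebesgue. s x * partial_deriv i \<psi> x) = - (LINT x|lebesgue. g0 x * \<Lambda> x * \<psi> x)"
   using LIMSEQ_unique[OF 1 3] by (simp add: mult.assoc)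
 qed
qed

text \<open>The bound on compact sets holds at every point, not just almost everywhere, thanks to
  the clamped representatives of the partial derivatives.\<close>

lemma has_weak_gradient_locally_lipschitz:
 fixes s :: "real ^ 'd \<Rightarrow> real"
 assumes U: "open U" and s: "locally_lipschitz U s"
 obtains \<sigma> where "has_weak_gradient U (\<lambda>x. complex_of_real (s x)) \<sigma>"
  "\<And>K. compact K \<Longrightarrow> K \<subseteq> U \<Longrightarrow> \<exists>B. \<forall>x\<in>K. \<forall>i. norm (\<sigma> x $ i) \<le> B"
proof -
 define P where "P i g \<longleftrightarrow> g \<in> borel_measurable lebesgue \<and> (\<forall>K. compact K \<and> K \<subseteq> U \<longrightarrow> (\<exists>B. \<forall>x\<in>K. \<bar>g x\<bar> \<le> B)) \<and>
   (\<forall>\<psi>\<in>test_functions U. (LINT x|lebesgue. s x * partial_deriv i \<psi> x) = - (LINT x|lebesgue. g x * \<psi> x))"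
  for i and g :: "real ^ 'd \<Rightarrow> real"
 have "\<exists>g. P i g" for i
 proof (rule locally_lipschitz_partial_derivative[OF assms, of i])
  fix g :: "real ^ 'd \<Rightarrow> real"
  assume *: "g \<in> borel_measurable lebesgue" "\<And>K. compact K \<Longrightarrow> K \<subseteq> U \<Longrightarrow> \<exists>B. \<forall>x\<in>K. \<bar>g x\<bar> \<le> B"
   "\<And>\<psi>. \<psi> \<in> test_functions U \<Longrightarrow> (LINT x|lebesgue. s x * partial_deriv i \<psi> x) = - (LINT x|lebesgue. g x * \<psi> x)"
  show ?thesis unfolding P_def by (intro exI[of _ g] conjI ballI allI impI * ) auto
 qed
 then obtain G where "\<And>i. P i (G i)" by metis
 then have G: "\<And>i. G i \<in> borel_measurable lebesgue"
  "\<And>i K. compact K \<Longrightarrow> K \<subseteq> U \<Longrightarrow> \<exists>B. \<forall>x\<in>K. \<bar>G i x\<bar> \<le> B"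
  "\<And>i \<psi>. \<psi> \<in> test_functions U \<Longrightarrow> (LINT x|lebesgue. s x * partial_deriv i \<psi> x) = - (LINT x|lebesgue. G i x * \<psi> x)"
  unfolding P_def by blast+
 define \<sigma> where "\<sigma> x = (\<chi> i. complex_of_real (G i x))" for x
 have bd: "\<exists>B. \<forall>x\<in>K. \<forall>i. norm (\<sigma> x $ i) \<le> B" if K: "compact K" "K \<subseteq> U" for K
 proof -
  obtain B where B: "\<And>i x. x \<in> K \<Longrightarrow> \<bar>G i x\<bar> \<le> B i" using G(2)[OF K] by metis
  have "norm (\<sigma> x $ i) \<le> (\<Sum>i\<in>UNIV. \<bar>B i\<bar>)" if "x \<in> K" for x i
  proof -
   have "norm (\<sigma> x $ i) \<le> \<bar>B i\<bar>" using B[OF that, of i] by (simp add: \<sigma>_def)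
   also have "\<dots> \<le> (\<Sum>i\<in>UNIV. \<bar>B i\<bar>)" by (intro member_le_sum) auto
   finally show ?thesis .
  qed
  then show ?thesis by blast
 qed
 have ls: "locally_integrable U (\<lambda>x. complex_of_real (s x))"
  unfolding locally_integrable_def set_integrable_def
 proof (intro allI impI)
  fix K assume K: "compact K \<and> K \<subseteq> U"
  then obtain L where "L-lipschitz_on K s" using s by (auto simp: locally_lipschitz_def)
  then have c: "continuous_on K (\<lambda>x. complex_of_real (s x))"
   by (intro continuous_intros lipschitz_on_continuous_on)
  show "integrable lebesgue (\<lambda>x. indicator K x *\<^sub>R complex_of_real (s x))"
   using borel_integrable_compact[of K "\<lambda>x. complex_of_real (s x)"] K c
   by (subst integrable_completion) (auto intro!: borel_measurable_continuous_on_indicator simp: compact_imp_closed borel_closed)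
 qed
 have l\<sigma>: "locally_integrable U \<sigma>"
 proof (rule locally_integrable_vec_componentwise)
  fix i
  show "locally_integrable U (\<lambda>x. \<sigma> x $ i)" unfolding locally_integrable_def set_integrable_def
  proof (intro allI impI)
   fix K assume K: "compact K \<and> K \<subseteq> U"
   then have "compact K" "K \<subseteq> U" by auto
   from bd[OF this] obtain B where "\<forall>x\<in>K. \<forall>i. norm (\<sigma> x $ i) \<le> B" by (rule exE)
   then have B: "\<And>x. x \<in> K \<Longrightarrow> norm (\<sigma> x $ i) \<le> B" by (simp only: simp_thms)
   have "norm (indicator K x *\<^sub>R \<sigma> x $ i) \<le> \<bar>B\<bar>" for x
   proof (cases "x \<in> K")
    case True
    have "norm (\<sigma> x $ i) \<le> \<bar>B\<bar>" by (rule order_trans[OF B[OF True] abs_ge_self])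
    then show ?thesis using True by simp
   qed simp
   moreover have "(\<lambda>x. indicator K x *\<^sub>R \<sigma> x $ i) \<in> borel_measurable lebesgue"
    unfolding \<sigma>_def using G(1)[of i] K compact_sets_lebesgue[of K] by simp
   ultimately show "integrable lebesgue (\<lambda>x. indicator K x *\<^sub>R \<sigma> x $ i)"
    using K by (intro integrable_lebesgue_compact_support[of _ K]) auto
  qed
 qed
 have "has_weak_gradient U (\<lambda>x. complex_of_real (s x)) \<sigma>"
  unfolding has_weak_gradient_iff using ls l\<sigma> G(3)
  by (simp add: \<sigma>_def integral_complex_of_real flip: of_real_mult of_real_minus)
 then show ?thesis using that bd by blast
qed

section \<open>Products with functions of a Lipschitz function\<close>

definition zero_extend :: "'a set \<Rightarrow> ('a \<Rightarrow> 'b::real_vector) \<Rightarrow> 'a \<Rightarrow> 'b" where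
 "zero_extend K f x = indicator K x *\<^sub>R f x"

lemma zero_extend_integrable:
 "locally_integrable U f \<Longrightarrow> compact K \<Longrightarrow> K \<subseteq> U \<Longrightarrow> integrable lebesgue (zero_extend K f)"
 by (simp add: locally_integrable_def set_integrable_def zero_extend_def[abs_def])

lemma smooth_kernel_C1_along:
 assumes "density_kernel \<rho> r" "\<And>k. C_order k \<rho>"
 shows "C1_along (axis i 1) \<rho> (partial_deriv i \<rho>)" "\<And>x. x \<notin> cball 0 r \<Longrightarrow> partial_deriv i \<rho> x = 0"
  "\<exists>B. \<forall>x. norm (partial_deriv i \<rho> x) \<le> B"
proof -
 show C: "C1_along (axis i 1) \<rho> (partial_deriv i \<rho>)" by (rule C_order_C1_along[OF assms(2)])
 show 0: "x \<notin> cball 0 r \<Longrightarrow> partial_deriv i \<rho> x = 0" for x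
  by (rule C1_along_eq_0[OF C closed_cball[of 0 r]]) (use assms(1) in \<open>auto simp: density_kernel_def\<close>)
 show "\<exists>B. \<forall>x. norm (partial_deriv i \<rho> x) \<le> B"
 proof -
  have "continuous_on UNIV (partial_deriv i \<rho>)" using C unfolding C1_along_def by blast
  from continuous_compact_support_bounded[OF this compact_cball 0] show ?thesis by blast
 qed
qed

lemma C1_along_conv_kernel:
 fixes u :: "real ^ 'd \<Rightarrow> complex"
 assumes "density_kernel \<rho> r" "\<And>k. C_order k \<rho>" "integrable lebesgue u"
 shows "C1_along (axis i 1) (conv u \<rho>) (conv u (partial_deriv i \<rho>))"
proof -
 obtain B where "\<And>x. norm (\<rho> x) \<le> B" using density_kernel_bounded[OF assms(1)] by blast
 moreover obtain B' where "\<And>x. norm (partial_deriv i \<rho> x) \<le> B'" using smooth_kernel_C1_along(3)[OF assms(1,2)] by blast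
 ultimately show ?thesis by (rule C1_along_conv[OF assms(3) smooth_kernel_C1_along(1)[OF assms(1,2)]])
qed

text \<open>Since the ball of radius r about x lies in \<open>K'\<close>, the function \<rho> (x -
  y) of y is a test function on \<open>U\<close>. The minus sign in the weak derivative cancels
  against the one from the reflection.\<close>

lemma conv_partial_deriv:
 fixes \<phi> :: "real ^ 'd \<Rightarrow> complex"
 assumes \<phi>: "has_weak_gradient U \<phi> g" and K': "compact K'" "K' \<subseteq> U"
  and \<rho>: "density_kernel \<rho> r" "\<And>k. C_order k \<rho>" and x: "cball x r \<subseteq> K'"
 shows "conv (zero_extend K' \<phi>) (partial_deriv i \<rho>) x = conv (zero_extend K' (\<lambda>x. g x $ i)) \<rho> x"
proof -
 have z: "\<rho> (x - y) = 0" "partial_deriv i \<rho> (x - y) = 0" if "y \<notin> K'" for y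
 proof -
  have "x - y \<notin> cball 0 r"
  proof
   assume "x - y \<in> cball 0 r"
   then have "y \<in> cball x r" by (simp add: dist_norm norm_minus_commute)
   then show False using x that by blast
  qed
  then show "\<rho> (x - y) = 0" "partial_deriv i \<rho> (x - y) = 0"
   using \<rho>(1) smooth_kernel_C1_along(2)[OF \<rho>] by (auto simp: density_kernel_def)
 qed
 have t: "(\<lambda>y. \<rho> (x - y)) \<in> test_functions U"
  by (rule test_functionsI[OF C_order_reflect[OF \<rho>(2)] K']) (rule z)
 have pd: "partial_deriv i (\<lambda>y. \<rho> (x - y)) y = - partial_deriv i \<rho> (x - y)" for y
 proof -
  have d: "\<rho> differentiable (at (x - y))"
   using \<rho>(2)[of "Suc 0"] by (auto simp: differentiable_on_def)
  have 1: "((\<lambda>y. x - y) has_derivative uminus) (at y)"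
   by (auto intro!: derivative_eq_intros)
  have 2: "(\<rho> has_derivative frechet_derivative \<rho> (at (x - y))) (at (x - y))"
   using d by (simp add: frechet_derivative_works)
  have "((\<lambda>y. \<rho> (x - y)) has_derivative (\<lambda>h. frechet_derivative \<rho> (at (x - y)) (- h))) (at y)"
   using diff_chain_at[OF 1 2] by (simp add: o_def)
  from partial_deriv_eq[OF this, of i] show ?thesis
   using linear_frechet_derivative[OF d] by (simp add: partial_deriv_def linear_neg)
 qed
 have "(LINT y|lebesgue. \<phi> y * complex_of_real (partial_deriv i (\<lambda>y. \<rho> (x - y)) y)) =
   - (LINT y|lebesgue. g y $ i * complex_of_real (\<rho> (x - y)))"
  using \<phi> t unfolding has_weak_gradient_iff by blast
 then have *: "(LINT y|lebesgue. \<phi> y * complex_of_real (partial_deriv i \<rho> (x - y))) =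
   (LINT y|lebesgue. g y $ i * complex_of_real (\<rho> (x - y)))"
  unfolding pd by simp
 have "conv (zero_extend K' \<phi>) (partial_deriv i \<rho>) x = (LINT y|lebesgue. \<phi> y * complex_of_real (partial_deriv i \<rho> (x - y)))"
  unfolding conv_def
 proof (rule Bochner_Integration.integral_cong[OF refl])
  fix y show "partial_deriv i \<rho> (x - y) *\<^sub>R zero_extend K' \<phi> y = \<phi> y * complex_of_real (partial_deriv i \<rho> (x - y))"
   using z(2)[of y] by (cases "y \<in> K'") (auto simp: zero_extend_def scaleR_conv_of_real)
 qed
 also have "\<dots> = (LINT y|lebesgue. g y $ i * complex_of_real (\<rho> (x - y)))" by (rule *)
 also have "\<dots> = conv (zero_extend K' (\<lambda>x. g x $ i)) \<rho> x"
  unfolding conv_def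
 proof (rule Bochner_Integration.integral_cong[OF refl])
  fix y show "g y $ i * complex_of_real (\<rho> (x - y)) = \<rho> (x - y) *\<^sub>R zero_extend K' (\<lambda>x. g x $ i) y"
   using z(1)[of y] by (cases "y \<in> K'") (auto simp: zero_extend_def scaleR_conv_of_real)
 qed
 finally show ?thesis .
qed

section \<open>Product and chain rule for weak gradients\<close>

lemma conv_L1_tendsto:
 fixes u :: "'a::euclidean_space \<Rightarrow> 'b::euclidean_space"
 assumes k: "\<And>n. density_kernel (\<rho> n) (r n)" and r: "r \<longlonglongrightarrow> 0" "\<And>n. r n \<le> 1"
  and u: "integrable lebesgue u" and K: "compact K" "\<And>x. x \<notin> K \<Longrightarrow> u x = 0"
 shows "\<And>n. integrable lebesgue (\<lambda>x. norm (conv u (\<rho> n) x - u x))"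
  "(\<lambda>n. LINT x|lebesgue. norm (conv u (\<rho> n) x - u x)) \<longlonglongrightarrow> 0"
 using conv_Lp_tendsto[OF k r borel_measurable_integrable[OF u] _ K order_refl] u by simp_all

lemma integral_L1_limit:
 fixes F :: "nat \<Rightarrow> 'a \<Rightarrow> complex"
 assumes u: "\<And>n. integrable M (u n)" "(\<lambda>n. LINT x|M. u n x) \<longlonglongrightarrow> 0"
  and F: "\<And>n. integrable M (\<lambda>x. F n x)" "integrable M (\<lambda>x. G x)"
  and le: "\<And>n x. norm (F n x - G x) \<le> P * u n x"
 shows "(\<lambda>n. LINT x|M. F n x) \<longlonglongrightarrow> (LINT x|M. G x)"
proof (rule Lim_null[THEN iffD2], rule Lim_null_comparison)
 show "(\<lambda>n. P * (LINT x|M. u n x)) \<longlonglongrightarrow> 0" using tendsto_mult[OF tendsto_const u(2), of P] by simp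
 show "\<forall>\<^sub>F n in sequentially. norm ((LINT x|M. F n x) - (LINT x|M. G x)) \<le> P * (LINT x|M. u n x)"
 proof (rule always_eventually, rule allI)
  fix n
  have "norm ((LINT x|M. F n x) - (LINT x|M. G x)) = norm (LINT x|M. F n x - G x)"
   by (simp add: Bochner_Integration.integral_diff[OF F])
  also have "\<dots> \<le> (LINT x|M. norm (F n x - G x))" by (rule integral_norm_bound)
  also have "\<dots> \<le> (LINT x|M. P * u n x)"
   by (intro integral_mono integrable_norm Bochner_Integration.integrable_diff F integrable_mult_right u le)
  finally show "norm ((LINT x|M. F n x) - (LINT x|M. G x)) \<le> P * (LINT x|M. u n x)" by simp
 qed
qed

lemma C1_along_Re:
 assumes "C1_along e F D"
 shows "C1_along e (\<lambda>x. Re (F x)) (\<lambda>x. Re (D x))"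
 using assms bounded_linear.has_vector_derivative[OF bounded_linear_Re]
 by (auto simp: C1_along_def intro!: continuous_intros)

text \<open>For mollified \<phi> and s the formula is classical. The mollification of s is removed
  first, along an almost everywhere convergent subsequence and with the mollified \<phi> held fixed
  and bounded; then that of \<phi>, for which convergence in L^1 against bounded factors is enough.
  A simultaneous limit would have to cope with a product of two functions that converge only in
  mean.\<close>

lemma has_weak_gradient_mult_compose:
 fixes \<phi> :: "real ^ 'd \<Rightarrow> complex" and m m' :: "real \<Rightarrow> complex"
 assumes U: "open U" and \<phi>: "has_weak_gradient U \<phi> g"
  and s: "has_weak_gradient U (\<lambda>x. complex_of_real (s x)) \<sigma>"
  and sb: "\<And>K. compact K \<Longrightarrow> K \<subseteq> U \<Longrightarrow> \<exists>B. \<forall>x\<in>K. \<bar>s x\<bar> \<le> B"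
  and \<sigma>b: "\<And>K. compact K \<Longrightarrow> K \<subseteq> U \<Longrightarrow> \<exists>B. \<forall>x\<in>K. \<forall>i. norm (\<sigma> x $ i) \<le> B"
  and m: "\<And>t. (m has_vector_derivative m' t) (at t)" "continuous_on UNIV m'"
 shows "has_weak_gradient U (\<lambda>x. \<phi> x * m (s x))
  (\<lambda>x. \<chi> i. g x $ i * m (s x) + \<phi> x * (complex_of_real (Re (\<sigma> x $ i)) * m' (s x)))"
proof -
 have mc: "continuous_on UNIV m"
  using m(1) by (meson continuous_at_imp_continuous_on has_vector_derivative_continuous)
 have mb: "m \<in> borel_measurable borel" "m' \<in> borel_measurable borel"
  using mc m(2) by (auto intro: borel_measurable_continuous_onI)
 have l: "locally_integrable U \<phi>" "locally_integrable U g" "locally_integrable U (\<lambda>x. complex_of_real (s x))" "locally_integrable U \<sigma>"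
  using \<phi> s by (auto simp: has_weak_gradient_def)
 have lg: "locally_integrable U (\<lambda>x. g x $ i)" "locally_integrable U (\<lambda>x. \<sigma> x $ i)" for i
  using l by (auto intro: locally_integrable_component)
 have bdd: "\<exists>M\<ge>0. \<forall>t. \<bar>t\<bar> \<le> B \<longrightarrow> norm (m t) \<le> M \<and> norm (m' t) \<le> M" for B
 proof -
  have "compact (m ` {-B..B})" "compact (m' ` {-B..B})"
   by (intro compact_continuous_image continuous_on_subset[OF mc] continuous_on_subset[OF m(2)]; simp)+
  then have "bounded (m ` {-B..B})" "bounded (m' ` {-B..B})" by (auto intro: compact_imp_bounded)
  then obtain M1 M2 where "\<forall>y\<in>m ` {-B..B}. norm y \<le> M1" "\<forall>y\<in>m' ` {-B..B}. norm y \<le> M2"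
   unfolding bounded_iff by blast
  then have M12: "norm (m t) \<le> M1" "norm (m' t) \<le> M2" if "\<bar>t\<bar> \<le> B" for t
   using that unfolding abs_le_iff by (auto simp del: real_norm_def simp: minus_le_iff)
  show ?thesis
  proof (intro exI[of _ "\<bar>M1\<bar> + \<bar>M2\<bar>"] conjI allI impI)
   show "norm (m t) \<le> \<bar>M1\<bar> + \<bar>M2\<bar>" "norm (m' t) \<le> \<bar>M1\<bar> + \<bar>M2\<bar>" if "\<bar>t\<bar> \<le> B" for t
    using M12[OF that] by linarith+
  qed simp
 qed
 have zextm: "(\<lambda>x. zero_extend K s x) \<in> borel_measurable lebesgue" "(\<lambda>x. zero_extend K (\<lambda>x. Re (\<sigma> x $ i)) x) \<in> borel_measurable lebesgue"
  if "compact K" "K \<subseteq> U" for K i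
 proof -
  have "(\<lambda>x. Re (zero_extend K (\<lambda>x. complex_of_real (s x)) x)) \<in> borel_measurable lebesgue"
   by (rule measurable_compose[OF borel_measurable_integrable[OF zero_extend_integrable[OF l(3) that]] borel_measurable_Re])
  then show "(\<lambda>x. zero_extend K s x) \<in> borel_measurable lebesgue" by (simp add: zero_extend_def)
  have "(\<lambda>x. Re (zero_extend K (\<lambda>x. \<sigma> x $ i) x)) \<in> borel_measurable lebesgue"
   by (rule measurable_compose[OF borel_measurable_integrable[OF zero_extend_integrable[OF lg(2) that]] borel_measurable_Re])
  then show "(\<lambda>x. zero_extend K (\<lambda>x. Re (\<sigma> x $ i)) x) \<in> borel_measurable lebesgue" by (simp add: zero_extend_def)
 qed
 have main: "integrable lebesgue (\<lambda>x. f x * (zero_extend K (\<lambda>x. m (s x)) x * \<zeta> x))"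
   "integrable lebesgue (\<lambda>x. f x * (zero_extend K (\<lambda>x. complex_of_real (Re (\<sigma> x $ i)) * m' (s x)) x * \<zeta> x))"
  if K: "compact K" "K \<subseteq> U" and f: "locally_integrable U f" and \<zeta>: "\<zeta> \<in> borel_measurable lebesgue" "\<And>x. norm (\<zeta> x) \<le> P"
  for K f i P and \<zeta> :: "real ^ 'd \<Rightarrow> complex"
 proof -
  obtain B where B: "\<And>x. x \<in> K \<Longrightarrow> \<bar>s x\<bar> \<le> B" using sb[OF K] by blast
  obtain B' where B': "\<And>x i. x \<in> K \<Longrightarrow> norm (\<sigma> x $ i) \<le> B'" using \<sigma>b[OF K] by blast
  obtain M where M: "0 \<le> M" "\<And>t. \<bar>t\<bar> \<le> B \<Longrightarrow> norm (m t) \<le> M" "\<And>t. \<bar>t\<bar> \<le> B \<Longrightarrow> norm (m' t) \<le> M"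
   using bdd[of B] by blast
  have "0 \<le> P" using \<zeta>(2)[of undefined] norm_ge_zero order_trans by blast
  have Km: "indicator K \<in> borel_measurable lebesgue" using compact_sets_lebesgue[OF K(1)] by simp
  show "integrable lebesgue (\<lambda>x. f x * (zero_extend K (\<lambda>x. m (s x)) x * \<zeta> x))"
  proof (rule locally_integrable_mult_test[OF f K])
   have "(\<lambda>x. indicator K x *\<^sub>R m (zero_extend K s x) * \<zeta> x) \<in> borel_measurable lebesgue"
    by (intro borel_measurable_times borel_measurable_scaleR Km \<zeta> measurable_compose[OF zextm(1)[OF K] mb(1)])
   also have "(\<lambda>x. indicator K x *\<^sub>R m (zero_extend K s x) * \<zeta> x) = (\<lambda>x. zero_extend K (\<lambda>x. m (s x)) x * \<zeta> x)"
    by (auto simp: zero_extend_def indicator_def)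
   finally show "(\<lambda>x. zero_extend K (\<lambda>x. m (s x)) x * \<zeta> x) \<in> borel_measurable lebesgue" .
   show "norm (zero_extend K (\<lambda>x. m (s x)) x * \<zeta> x) \<le> M * P" for x
    using B[of x] M(2)[of "s x"] \<zeta>(2)[of x] M(1) \<open>0 \<le> P\<close>
    by (cases "x \<in> K") (auto simp: zero_extend_def norm_mult intro: mult_mono)
  qed (simp add: zero_extend_def)
  show "integrable lebesgue (\<lambda>x. f x * (zero_extend K (\<lambda>x. complex_of_real (Re (\<sigma> x $ i)) * m' (s x)) x * \<zeta> x))"
  proof (rule locally_integrable_mult_test[OF f K])
   have "(\<lambda>x. complex_of_real (zero_extend K (\<lambda>x. Re (\<sigma> x $ i)) x) * m' (zero_extend K s x) * \<zeta> x) \<in> borel_measurable lebesgue"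
    using zextm(2)[OF K, of i] measurable_compose[OF zextm(1)[OF K] mb(2)] \<zeta>(1) by simp
   also have "(\<lambda>x. complex_of_real (zero_extend K (\<lambda>x. Re (\<sigma> x $ i)) x) * m' (zero_extend K s x) * \<zeta> x) = (\<lambda>x. zero_extend K (\<lambda>x. complex_of_real (Re (\<sigma> x $ i)) * m' (s x)) x * \<zeta> x)"
    by (auto simp: zero_extend_def indicator_def)
   finally show "(\<lambda>x. zero_extend K (\<lambda>x. complex_of_real (Re (\<sigma> x $ i)) * m' (s x)) x * \<zeta> x) \<in> borel_measurable lebesgue" .
   show "norm (zero_extend K (\<lambda>x. complex_of_real (Re (\<sigma> x $ i)) * m' (s x)) x * \<zeta> x) \<le> (\<bar>B'\<bar> * M) * P" for x
   proof (cases "x \<in> K")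
    case True
    have "\<bar>Re (\<sigma> x $ i)\<bar> \<le> \<bar>B'\<bar>" using B'[OF True, of i] abs_Re_le_cmod[of "\<sigma> x $ i"] by linarith
    then have "\<bar>Re (\<sigma> x $ i)\<bar> * norm (m' (s x)) * norm (\<zeta> x) \<le> (\<bar>B'\<bar> * M) * P"
     using B[OF True] M(3)[of "s x"] \<zeta>(2)[of x] M(1) by (intro mult_mono) auto
    then show ?thesis using True by (simp add: zero_extend_def norm_mult)
   qed (use M \<open>0 \<le> P\<close> in \<open>simp add: zero_extend_def\<close>)
  qed (simp add: zero_extend_def)
 qed
 have li: "locally_integrable U (\<lambda>x. f x * m (s x))" "locally_integrable U (\<lambda>x. f x * (complex_of_real (Re (\<sigma> x $ i)) * m' (s x)))"
  if f: "locally_integrable U f" for f i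
 proof -
  show "locally_integrable U (\<lambda>x. f x * m (s x))"
   unfolding locally_integrable_def set_integrable_def
  proof (intro allI impI)
   fix K assume "compact K \<and> K \<subseteq> U"
   then show "integrable lebesgue (\<lambda>x. indicator K x *\<^sub>R (f x * m (s x)))"
    using main(1)[of K f "\<lambda>_. 1" 1] f by (simp add: zero_extend_def)
  qed
  show "locally_integrable U (\<lambda>x. f x * (complex_of_real (Re (\<sigma> x $ i)) * m' (s x)))"
   unfolding locally_integrable_def set_integrable_def
  proof (intro allI impI)
   fix K assume "compact K \<and> K \<subseteq> U"
   then show "integrable lebesgue (\<lambda>x. indicator K x *\<^sub>R (f x * (complex_of_real (Re (\<sigma> x $ i)) * m' (s x))))"
    using main(2)[of K f "\<lambda>_. 1" 1 i] f by (simp add: zero_extend_def)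
  qed
 qed
 show ?thesis unfolding has_weak_gradient_iff
 proof (intro conjI ballI allI)
  show "locally_integrable U (\<lambda>x. \<phi> x * m (s x))" by (rule li(1)[OF l(1)])
  show "locally_integrable U (\<lambda>x. \<chi> i. g x $ i * m (s x) + \<phi> x * (complex_of_real (Re (\<sigma> x $ i)) * m' (s x)))"
   by (rule locally_integrable_vec_componentwise) (simp add: locally_integrable_add li lg l)
  fix \<psi> i assume \<psi>: "\<psi> \<in> test_functions U"
  obtain K where K: "compact K" "K \<subseteq> U" "\<And>x. x \<notin> K \<Longrightarrow> \<psi> x = 0" "\<And>x. x \<notin> K \<Longrightarrow> partial_deriv i \<psi> x = 0"
   "C1_along (axis i 1) \<psi> (partial_deriv i \<psi>)"
   using test_functionsE[OF \<psi>] by metis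
  have pc: "continuous_on UNIV \<psi>" "continuous_on UNIV (partial_deriv i \<psi>)" using K(5) by (auto simp: C1_along_def)
  obtain P where P: "0 \<le> P" "\<And>x. norm (\<psi> x) \<le> P" "\<And>x. norm (partial_deriv i \<psi> x) \<le> P"
  proof -
   obtain P1 P2 where "0 \<le> P1" "\<And>x. norm (\<psi> x) \<le> P1" "\<And>x. norm (partial_deriv i \<psi> x) \<le> P2"
    using continuous_compact_support_bounded[OF pc(1) K(1,3)] continuous_compact_support_bounded[OF pc(2) K(1,4)] by metis
   then show ?thesis by (intro that[of "max P1 P2"]) (auto simp: le_max_iff_disj)
  qed
  have pm: "(\<lambda>x. complex_of_real (\<psi> x)) \<in> borel_measurable lebesgue" "(\<lambda>x. complex_of_real (partial_deriv i \<psi> x)) \<in> borel_measurable lebesgue"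
   using pc by (auto intro!: borel_measurable_lebesgue_continuous continuous_intros)
  have pP: "norm (complex_of_real (\<psi> x)) \<le> P" "norm (complex_of_real (partial_deriv i \<psi> x)) \<le> P" for x
   using P by auto
  obtain r where r: "0 < r" "(\<Union>x\<in>K. cball x r) \<subseteq> U"
   using compact_subset_open_imp_cball_epsilon_subset[OF K(1) U K(2)] by blast
  define K' where "K' = (\<Union>x\<in>K. cball x r)"
  have K': "compact K'" "K' \<subseteq> U" "\<And>x. x \<in> K \<Longrightarrow> cball x r \<subseteq> K'" "K \<subseteq> K'"
   using compact_minkowski_sum_cball[OF K(1), of r] r by (auto simp: K'_def)
  \<comment> \<open>Dropping the first kernels makes all radii at most \<open>r\<close>, so that
    every ball about a point of \<open>K\<close> stays in \<open>K'\<close>.\<close>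
  obtain N where N: "1 / real (Suc N) \<le> r"
   using reals_Archimedean[OF r(1)] by (auto simp: inverse_eq_divide intro: less_imp_le)
  define \<rho> :: "nat \<Rightarrow> real ^ 'd \<Rightarrow> real" where "\<rho> n = mollifier (n + N)" for n
  define rr where "rr n = 1 / real (Suc (n + N))" for n
  have \<rho>: "density_kernel (\<rho> n) (rr n)" "C_order k (\<rho> n)" for n k
   unfolding \<rho>_def rr_def by (rule mollifier)+
  have rr: "rr \<longlonglongrightarrow> 0" "rr n \<le> 1" "rr n \<le> r" for n
  proof -
   show "rr \<longlonglongrightarrow> 0" unfolding rr_def by (rule LIMSEQ_ignore_initial_segment[OF mollifier_radius(1)])
   show "rr n \<le> 1" unfolding rr_def by (rule mollifier_radius(2))
   have "rr n \<le> 1 / real (Suc N)" unfolding rr_def by (simp add: frac_le)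
   then show "rr n \<le> r" using N by linarith
  qed
  have cb: "cball x (rr n) \<subseteq> K'" if "x \<in> K" for x n
   using K'(3)[OF that] rr(3)[of n] by (meson order_trans subset_cball)
  have zext0: "x \<notin> K' \<Longrightarrow> zero_extend K' f x = 0" for x and f :: "real ^ 'd \<Rightarrow> complex" by (simp add: zero_extend_def)
  define \<Phi> where "\<Phi> n = conv (zero_extend K' \<phi>) (\<rho> n)" for n
  define D\<Phi> where "D\<Phi> n = conv (zero_extend K' \<phi>) (partial_deriv i (\<rho> n))" for n
  define G where "G n = conv (zero_extend K' (\<lambda>x. g x $ i)) (\<rho> n)" for n
  define T where "T n = conv (zero_extend K' (\<lambda>x. complex_of_real (s x))) (\<rho> n)" for n
  define DT where "DT n = conv (zero_extend K' (\<lambda>x. complex_of_real (s x))) (partial_deriv i (\<rho> n))" for n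
  define S where "S n = conv (zero_extend K' (\<lambda>x. \<sigma> x $ i)) (\<rho> n)" for n
  note ci = zero_extend_integrable[OF l(1) K'(1,2)] zero_extend_integrable[OF lg(1)[of i] K'(1,2)]
    zero_extend_integrable[OF l(3) K'(1,2)] zero_extend_integrable[OF lg(2)[of i] K'(1,2)]
  note L1 = conv_L1_tendsto[of \<rho> rr, OF \<rho>(1) rr(1,2) _ K'(1) zext0]
  have C1\<Phi>: "C1_along (axis i 1) (\<Phi> n) (D\<Phi> n)" for n
   unfolding \<Phi>_def D\<Phi>_def by (rule C1_along_conv_kernel[OF \<rho> ci(1)])
  have C1T: "C1_along (axis i 1) (\<lambda>x. Re (T n x)) (\<lambda>x. Re (DT n x))" for n
   unfolding T_def DT_def by (intro C1_along_Re C1_along_conv_kernel[OF \<rho> ci(3)])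
  have DG: "D\<Phi> n x = G n x" "DT n x = S n x" if "x \<in> K" for n x
   unfolding D\<Phi>_def G_def DT_def S_def
   by (rule conv_partial_deriv[OF \<phi> K'(1,2) \<rho> cb[OF that]], rule conv_partial_deriv[OF s K'(1,2) \<rho> cb[OF that]])
  obtain B where B: "\<And>x. x \<in> K' \<Longrightarrow> \<bar>s x\<bar> \<le> B" using sb[OF K'(1,2)] by blast
  obtain B' where B': "\<And>x i. x \<in> K' \<Longrightarrow> norm (\<sigma> x $ i) \<le> B'" using \<sigma>b[OF K'(1,2)] by blast
  have Tb: "\<bar>Re (T n x)\<bar> \<le> \<bar>B\<bar>" for n x
  proof -
   have "norm (T n x) \<le> \<bar>B\<bar>" unfolding T_def
   proof (rule norm_conv_le_bound[OF \<rho>(1) ci(3)], rule AE_I2)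
    fix y show "norm (zero_extend K' (\<lambda>x. complex_of_real (s x)) y) \<le> \<bar>B\<bar>"
     using B[of y] by (cases "y \<in> K'") (auto simp: zero_extend_def)
   qed
   then show ?thesis using abs_Re_le_cmod[of "T n x"] by linarith
  qed
  have Sb: "\<bar>Re (S n x)\<bar> \<le> \<bar>B'\<bar>" for n x
  proof -
   have "norm (S n x) \<le> \<bar>B'\<bar>" unfolding S_def
   proof (rule norm_conv_le_bound[OF \<rho>(1) ci(4)], rule AE_I2)
    fix y show "norm (zero_extend K' (\<lambda>x. \<sigma> x $ i) y) \<le> \<bar>B'\<bar>"
    proof (cases "y \<in> K'")
     case True
     then show ?thesis using B'[OF True, of i] by (simp add: zero_extend_def)
    qed (simp add: zero_extend_def)
   qed
   then show ?thesis using abs_Re_le_cmod[of "S n x"] by linarith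
  qed
  obtain M where M: "0 \<le> M" "\<And>t. \<bar>t\<bar> \<le> \<bar>B\<bar> \<Longrightarrow> norm (m t) \<le> M" "\<And>t. \<bar>t\<bar> \<le> \<bar>B\<bar> \<Longrightarrow> norm (m' t) \<le> M"
   using bdd[of "\<bar>B\<bar>"] by blast
  \<comment> \<open>The two errors are added before a subsequence is chosen, which yields a single
    one for both s and its derivative.\<close>
  obtain q where q: "strict_mono q" "AE x in lebesgue. (\<lambda>k. T (q k) x - zero_extend K' (\<lambda>x. complex_of_real (s x)) x) \<longlonglongrightarrow> 0"
   "AE x in lebesgue. (\<lambda>k. S (q k) x - zero_extend K' (\<lambda>x. \<sigma> x $ i) x) \<longlonglongrightarrow> 0"
  proof -
   define u where "u n x = norm (T n x - zero_extend K' (\<lambda>x. complex_of_real (s x)) x) + norm (S n x - zero_extend K' (\<lambda>x. \<sigma> x $ i) x)" for n x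
   have ui: "integrable lebesgue (u n)" for n
    unfolding u_def T_def S_def by (intro Bochner_Integration.integrable_add L1(1) ci)
   have "(\<lambda>n. (LINT x|lebesgue. norm (T n x - zero_extend K' (\<lambda>x. complex_of_real (s x)) x)) + (LINT x|lebesgue. norm (S n x - zero_extend K' (\<lambda>x. \<sigma> x $ i) x))) \<longlonglongrightarrow> 0 + 0"
    unfolding T_def S_def by (intro tendsto_add L1(2) ci)
   moreover have "(LINT x|lebesgue. norm (u n x)) = (LINT x|lebesgue. norm (T n x - zero_extend K' (\<lambda>x. complex_of_real (s x)) x)) + (LINT x|lebesgue. norm (S n x - zero_extend K' (\<lambda>x. \<sigma> x $ i) x))" for n
    unfolding u_def T_def S_def
    by (subst Bochner_Integration.integral_add[symmetric]) (auto intro: L1(1) ci)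
   ultimately have u0: "(\<lambda>n. LINT x|lebesgue. norm (u n x)) \<longlonglongrightarrow> 0" by simp
   obtain q where q: "strict_mono q" "AE x in lebesgue. (\<lambda>k. u (q k) x) \<longlonglongrightarrow> 0"
    using tendsto_L1_AE_subseq[OF ui u0] by blast
   have "AE x in lebesgue. (\<lambda>k. T (q k) x - zero_extend K' (\<lambda>x. complex_of_real (s x)) x) \<longlonglongrightarrow> 0"
    using q(2) by eventually_elim (erule Lim_null_comparison[rotated], simp add: u_def)
   moreover have "AE x in lebesgue. (\<lambda>k. S (q k) x - zero_extend K' (\<lambda>x. \<sigma> x $ i) x) \<longlonglongrightarrow> 0"
    using q(2) by eventually_elim (erule Lim_null_comparison[rotated], simp add: u_def)
   ultimately show ?thesis using that q(1) by blast
  qed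
  define \<eta>1 \<eta>2 where "\<eta>1 x = complex_of_real (partial_deriv i \<psi> x)" and "\<eta>2 x = complex_of_real (\<psi> x)" for x
  \<comment> \<open>The limits of m and of the derivative of m along the mollified s, cut to
    \<open>K\<close> so that they are bounded on the whole space.\<close>
  define m1 m2 where "m1 = zero_extend K (\<lambda>x. m (s x))" and "m2 = zero_extend K (\<lambda>x. complex_of_real (Re (\<sigma> x $ i)) * m' (s x))"
  have m1b: "norm (m1 x) \<le> M" for x
  proof (cases "x \<in> K")
   case True
   then have "\<bar>s x\<bar> \<le> \<bar>B\<bar>" using B[of x] K'(4) by auto
   from M(2)[OF this] True show ?thesis by (simp add: m1_def zero_extend_def)
  qed (simp add: m1_def zero_extend_def M)
  have m2b: "norm (m2 x) \<le> \<bar>B'\<bar> * M" for x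
  proof (cases "x \<in> K")
   case True
   then have "\<bar>s x\<bar> \<le> \<bar>B\<bar>" "\<bar>Re (\<sigma> x $ i)\<bar> \<le> \<bar>B'\<bar>"
    using B[of x] B'[of x i] K'(4) abs_Re_le_cmod[of "\<sigma> x $ i"] by (auto intro: order_trans)
   with M(3)[of "s x"] M(1) show ?thesis using True
    by (auto simp: m2_def zero_extend_def norm_mult intro!: mult_mono)
  qed (simp add: m2_def zero_extend_def M)
  have e1: "f * m (s x) * \<eta>1 x = f * (m1 x * \<eta>1 x)" "f * (complex_of_real (Re (\<sigma> x $ i)) * m' (s x)) * \<eta>2 x = f * (m2 x * \<eta>2 x)"
    "f * m (s x) * \<eta>2 x = f * (m1 x * \<eta>2 x)" for f x
   using K(3)[of x] K(4)[of x] by (cases "x \<in> K"; simp add: m1_def m2_def zero_extend_def \<eta>1_def \<eta>2_def)+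
  have lc: "locally_integrable U (\<Phi> n)" "locally_integrable U (D\<Phi> n)" for n
   using C1\<Phi>[of n] by (auto simp: C1_along_def intro: locally_integrable_continuous)
  \<comment> \<open>First limit: \<open>\<Phi> n\<close> is fixed, it and its derivative are bounded
    on the compact set \<open>K\<close>, and dominated convergence applies.\<close>
  have ibp: "(LINT x|lebesgue. \<Phi> n x * (m1 x * \<eta>1 x)) = - (LINT x|lebesgue. D\<Phi> n x * (m1 x * \<eta>2 x) + \<Phi> n x * (m2 x * \<eta>2 x))" for n
  proof -
   have cK: "compact (\<Phi> n ` K)" "compact (D\<Phi> n ` K)"
    using C1\<Phi>[of n] by (auto simp: C1_along_def intro!: compact_continuous_image K(1) intro: continuous_on_subset)
   then obtain F1 F2 where "\<forall>y\<in>\<Phi> n ` K. norm y \<le> F1" "\<forall>y\<in>D\<Phi> n ` K. norm y \<le> F2"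
    using compact_imp_bounded[OF cK(1)] compact_imp_bounded[OF cK(2)] unfolding bounded_iff by blast
   then have F: "norm (\<Phi> n x) \<le> F1" "norm (D\<Phi> n x) \<le> F2" if "x \<in> K" for x using that by auto
   let ?t = "\<lambda>k x. Re (T (q k) x)" and ?d = "\<lambda>k x. Re (DT (q k) x)"
   have ck: "C1_along (axis i 1) (\<lambda>x. \<Phi> n x * m (?t k x)) (\<lambda>x. \<Phi> n x * (?d k x *\<^sub>R m' (?t k x)) + D\<Phi> n x * m (?t k x))" for k
    by (intro C1_along_mult[OF C1\<Phi>] C1_along_compose[OF C1T m])
   have eqk: "(LINT x|lebesgue. \<Phi> n x * m (?t k x) * \<eta>1 x) = - (LINT x|lebesgue. (\<Phi> n x * (?d k x *\<^sub>R m' (?t k x)) + D\<Phi> n x * m (?t k x)) * \<eta>2 x)" for k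
    using integration_by_parts_test[OF ck \<psi>, of k] K(2-4)
    by (subst (asm) (1 2) set_integral_support) (auto simp: \<eta>1_def \<eta>2_def subset_eq)
   have ckc: "continuous_on UNIV (\<lambda>x. \<Phi> n x * m (?t k x) * \<eta>1 x)"
     "continuous_on UNIV (\<lambda>x. (\<Phi> n x * (?d k x *\<^sub>R m' (?t k x)) + D\<Phi> n x * m (?t k x)) * \<eta>2 x)" for k
    unfolding \<eta>1_def \<eta>2_def using ck[of k] pc unfolding C1_along_def by (auto intro!: continuous_on_mult continuous_on_of_real)
   have iK: "integrable lebesgue (\<lambda>x. c * indicator K x :: real)" for c
    using lmeasurable_compact[OF K(1)] by (auto simp: fmeasurable_def)
   have mt: "norm (m (?t k x)) \<le> M" "norm (m' (?t k x)) \<le> M" for k x using M(2,3) Tb by auto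
   have P': "norm (\<eta>1 x) \<le> P" "norm (\<eta>2 x) \<le> P" for x using pP by (auto simp: \<eta>1_def \<eta>2_def)
   have zK: "\<eta>1 x = 0" "\<eta>2 x = 0" "m1 x = 0" "m2 x = 0" if "x \<notin> K" for x
    using K(3,4) that by (auto simp: \<eta>1_def \<eta>2_def m1_def m2_def zero_extend_def)
   have lims: "AE x in lebesgue. x \<in> K \<longrightarrow> (\<lambda>k. m (?t k x)) \<longlonglongrightarrow> m1 x \<and> (\<lambda>k. ?d k x *\<^sub>R m' (?t k x)) \<longlonglongrightarrow> m2 x"
    using q(2,3)
   proof (eventually_elim, intro impI)
    fix x assume x: "x \<in> K" and a: "(\<lambda>k. T (q k) x - zero_extend K' (\<lambda>x. complex_of_real (s x)) x) \<longlonglongrightarrow> 0"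
     and b: "(\<lambda>k. S (q k) x - zero_extend K' (\<lambda>x. \<sigma> x $ i) x) \<longlonglongrightarrow> 0"
    have x': "x \<in> K'" using x K'(4) by auto
    have "(\<lambda>k. T (q k) x) \<longlonglongrightarrow> complex_of_real (s x)" using a x' by (simp add: zero_extend_def LIM_zero_iff)
    then have ta: "(\<lambda>k. ?t k x) \<longlonglongrightarrow> s x" using tendsto_Re by fastforce
    have "(\<lambda>k. DT (q k) x) \<longlonglongrightarrow> \<sigma> x $ i" using b x' unfolding DG(2)[OF x] by (simp add: zero_extend_def LIM_zero_iff)
    then have tb: "(\<lambda>k. ?d k x) \<longlonglongrightarrow> Re (\<sigma> x $ i)" by (rule tendsto_Re)
    have "(\<lambda>k. m (?t k x)) \<longlonglongrightarrow> m (s x)" by (rule continuous_on_tendsto_compose[OF mc ta]) auto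
    moreover have "(\<lambda>k. m' (?t k x)) \<longlonglongrightarrow> m' (s x)" by (rule continuous_on_tendsto_compose[OF m(2) ta]) auto
    ultimately show "(\<lambda>k. m (?t k x)) \<longlonglongrightarrow> m1 x \<and> (\<lambda>k. ?d k x *\<^sub>R m' (?t k x)) \<longlonglongrightarrow> m2 x"
     using x tb by (auto simp: m1_def m2_def zero_extend_def simp flip: scaleR_conv_of_real intro!: tendsto_scaleR)
   qed
   have mi: "(\<lambda>x. \<Phi> n x * (m1 x * \<eta>1 x)) \<in> borel_measurable lebesgue"
    "(\<lambda>x. (\<Phi> n x * m2 x + D\<Phi> n x * m1 x) * \<eta>2 x) \<in> borel_measurable lebesgue"
   proof -
    have "(\<lambda>x. \<Phi> n x * (m2 x * \<eta>2 x) + D\<Phi> n x * (m1 x * \<eta>2 x)) \<in> borel_measurable lebesgue"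
     using main(1)[OF K(1,2) lc(2) pm(1) pP(1), of n] main(2)[OF K(1,2) lc(1) pm(1) pP(1), of n i]
     unfolding m1_def m2_def \<eta>2_def by (intro borel_measurable_add borel_measurable_integrable)
    then show "(\<lambda>x. (\<Phi> n x * m2 x + D\<Phi> n x * m1 x) * \<eta>2 x) \<in> borel_measurable lebesgue"
     by (simp add: algebra_simps)
    show "(\<lambda>x. \<Phi> n x * (m1 x * \<eta>1 x)) \<in> borel_measurable lebesgue"
     using main(1)[OF K(1,2) lc(1) pm(2) pP(2), of n] unfolding m1_def \<eta>1_def by (rule borel_measurable_integrable)
   qed
   have A: "(\<lambda>k. LINT x|lebesgue. \<Phi> n x * m (?t k x) * \<eta>1 x) \<longlonglongrightarrow> (LINT x|lebesgue. \<Phi> n x * (m1 x * \<eta>1 x))"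
   proof (rule integral_dominated_convergence[OF _ _ iK[of "F1 * M * P"]])
    show "AE x in lebesgue. (\<lambda>k. \<Phi> n x * m (?t k x) * \<eta>1 x) \<longlonglongrightarrow> \<Phi> n x * (m1 x * \<eta>1 x)"
     using lims
    proof eventually_elim
     fix x assume "x \<in> K \<longrightarrow> (\<lambda>k. m (?t k x)) \<longlonglongrightarrow> m1 x \<and> (\<lambda>k. ?d k x *\<^sub>R m' (?t k x)) \<longlonglongrightarrow> m2 x"
     then show "(\<lambda>k. \<Phi> n x * m (?t k x) * \<eta>1 x) \<longlonglongrightarrow> \<Phi> n x * (m1 x * \<eta>1 x)"
      unfolding mult.assoc[symmetric]
      by (cases "x \<in> K") (auto simp: zK intro!: tendsto_mult)
    qed
    show "AE x in lebesgue. norm (\<Phi> n x * m (?t k x) * \<eta>1 x) \<le> F1 * M * P * indicator K x" for k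
    proof (rule AE_I2)
     fix x show "norm (\<Phi> n x * m (?t k x) * \<eta>1 x) \<le> F1 * M * P * indicator K x"
     proof (cases "x \<in> K")
      case True
      have "0 \<le> F1" using F(1)[OF True] norm_ge_zero order_trans by blast
      then have "norm (\<Phi> n x) * norm (m (?t k x)) * norm (\<eta>1 x) \<le> F1 * M * P"
       using F(1)[OF True] mt P' M(1) by (intro mult_mono) auto
      then show ?thesis using True by (simp add: norm_mult)
     qed (simp add: zK)
    qed
   qed (use mi(1) ckc(1) borel_measurable_lebesgue_continuous in blast)+
   have Bq: "(\<lambda>k. LINT x|lebesgue. (\<Phi> n x * (?d k x *\<^sub>R m' (?t k x)) + D\<Phi> n x * m (?t k x)) * \<eta>2 x) \<longlonglongrightarrow> (LINT x|lebesgue. (\<Phi> n x * m2 x + D\<Phi> n x * m1 x) * \<eta>2 x)"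
   proof (rule integral_dominated_convergence[OF _ _ iK[of "(F1 * (\<bar>B'\<bar> * M) + F2 * M) * P"]])
    show "AE x in lebesgue. (\<lambda>k. (\<Phi> n x * (?d k x *\<^sub>R m' (?t k x)) + D\<Phi> n x * m (?t k x)) * \<eta>2 x) \<longlonglongrightarrow> (\<Phi> n x * m2 x + D\<Phi> n x * m1 x) * \<eta>2 x"
     using lims
    proof eventually_elim
     fix x assume "x \<in> K \<longrightarrow> (\<lambda>k. m (?t k x)) \<longlonglongrightarrow> m1 x \<and> (\<lambda>k. ?d k x *\<^sub>R m' (?t k x)) \<longlonglongrightarrow> m2 x"
     then show "(\<lambda>k. (\<Phi> n x * (?d k x *\<^sub>R m' (?t k x)) + D\<Phi> n x * m (?t k x)) * \<eta>2 x) \<longlonglongrightarrow> (\<Phi> n x * m2 x + D\<Phi> n x * m1 x) * \<eta>2 x"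
      by (cases "x \<in> K") (auto simp: zK simp del: mult_scaleR_right intro!: tendsto_mult tendsto_add)
    qed
    show "AE x in lebesgue. norm ((\<Phi> n x * (?d k x *\<^sub>R m' (?t k x)) + D\<Phi> n x * m (?t k x)) * \<eta>2 x) \<le> (F1 * (\<bar>B'\<bar> * M) + F2 * M) * P * indicator K x" for k
    proof (rule AE_I2)
     fix x show "norm ((\<Phi> n x * (?d k x *\<^sub>R m' (?t k x)) + D\<Phi> n x * m (?t k x)) * \<eta>2 x) \<le> (F1 * (\<bar>B'\<bar> * M) + F2 * M) * P * indicator K x"
     proof (cases "x \<in> K")
      case True
      have F0: "0 \<le> F1" "0 \<le> F2" using F[OF True] norm_ge_zero order_trans by blast+
      have "norm (\<Phi> n x * (?d k x *\<^sub>R m' (?t k x)) + D\<Phi> n x * m (?t k x)) \<le> norm (\<Phi> n x) * (\<bar>?d k x\<bar> * norm (m' (?t k x))) + norm (D\<Phi> n x) * norm (m (?t k x))"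
       by (rule order_trans[OF norm_triangle_ineq]) (simp add: norm_mult)
      also have "\<dots> \<le> F1 * (\<bar>B'\<bar> * M) + F2 * M"
       using F[OF True] mt M(1) F0 Sb[of "q k" x] unfolding DG(2)[OF True] by (intro add_mono mult_mono) auto
      finally have "norm (\<Phi> n x * (?d k x *\<^sub>R m' (?t k x)) + D\<Phi> n x * m (?t k x)) * norm (\<eta>2 x) \<le> (F1 * (\<bar>B'\<bar> * M) + F2 * M) * P"
       using P'(2)[of x] F0 M(1) by (intro mult_mono) auto
      then show ?thesis using True by (simp add: norm_mult)
     qed (simp add: zK)
    qed
   qed (use mi(2) ckc(2) borel_measurable_lebesgue_continuous in blast)+
   have "(LINT x|lebesgue. \<Phi> n x * (m1 x * \<eta>1 x)) = - (LINT x|lebesgue. (\<Phi> n x * m2 x + D\<Phi> n x * m1 x) * \<eta>2 x)"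
    using LIMSEQ_unique[OF A tendsto_minus[OF Bq, folded eqk]] .
   then show ?thesis by (simp add: algebra_simps)
  qed
  define F where "F = (\<lambda>x. g x $ i * (m1 x * \<eta>2 x) + \<phi> x * (m2 x * \<eta>2 x))"
  define un where "un n x = norm (\<Phi> n x - zero_extend K' \<phi> x) + norm (G n x - zero_extend K' (\<lambda>x. g x $ i) x)" for n x
  have uni: "integrable lebesgue (un n)" for n
   unfolding un_def \<Phi>_def G_def by (intro Bochner_Integration.integrable_add L1(1) ci)
  have un0: "(\<lambda>n. LINT x|lebesgue. un n x) \<longlonglongrightarrow> 0"
  proof -
   have "(\<lambda>n. (LINT x|lebesgue. norm (\<Phi> n x - zero_extend K' \<phi> x)) + (LINT x|lebesgue. norm (G n x - zero_extend K' (\<lambda>x. g x $ i) x))) \<longlonglongrightarrow> 0 + 0"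
    unfolding \<Phi>_def G_def by (intro tendsto_add L1(2) ci)
   moreover have "(LINT x|lebesgue. un n x) = (LINT x|lebesgue. norm (\<Phi> n x - zero_extend K' \<phi> x)) + (LINT x|lebesgue. norm (G n x - zero_extend K' (\<lambda>x. g x $ i) x))" for n
    unfolding un_def \<Phi>_def G_def
    by (rule Bochner_Integration.integral_add) (auto intro: L1(1) ci)
   ultimately show ?thesis by simp
  qed
  have dist: "norm (\<Phi> n x - \<phi> x) \<le> un n x" "norm (D\<Phi> n x - g x $ i) \<le> un n x" if "x \<in> K" for n x
   using that K'(4) unfolding DG(1)[OF that] by (auto simp: un_def zero_extend_def)
  have un_nn: "0 \<le> un n x" for n x by (simp add: un_def)
  have P'': "norm (\<eta>1 x) \<le> P" "norm (\<eta>2 x) \<le> P" for x using pP by (auto simp: \<eta>1_def \<eta>2_def)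
  have zK: "m1 x = 0" "m2 x = 0" if "x \<notin> K" for x using that by (auto simp: m1_def m2_def zero_extend_def)
  \<comment> \<open>Second limit: \<open>m1\<close> and \<open>m2\<close> are bounded, so the error
    is a constant times \<open>un n\<close>, whose integral tends to 0.\<close>
  have I1: "(\<lambda>n. LINT x|lebesgue. \<Phi> n x * (m1 x * \<eta>1 x)) \<longlonglongrightarrow> (LINT x|lebesgue. \<phi> x * (m1 x * \<eta>1 x))"
  proof (rule integral_L1_limit[OF uni un0])
   show "integrable lebesgue (\<lambda>x. \<Phi> n x * (m1 x * \<eta>1 x))" for n
    unfolding m1_def \<eta>1_def by (rule main(1)[OF K(1,2) lc(1) pm(2) pP(2)])
   show "integrable lebesgue (\<lambda>x. \<phi> x * (m1 x * \<eta>1 x))"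
    unfolding m1_def \<eta>1_def by (rule main(1)[OF K(1,2) l(1) pm(2) pP(2)])
   show "norm (\<Phi> n x * (m1 x * \<eta>1 x) - \<phi> x * (m1 x * \<eta>1 x)) \<le> (M * P) * un n x" for n x
   proof (cases "x \<in> K")
    case True
    have "norm (\<Phi> n x - \<phi> x) * (norm (m1 x) * norm (\<eta>1 x)) \<le> un n x * (M * P)"
     using dist(1)[OF True] m1b P''(1) M(1) P(1) un_nn by (intro mult_mono) auto
    then show ?thesis by (simp add: norm_mult mult.commute flip: left_diff_distrib)
   qed (use zK un_nn M P in simp)
  qed
  have I2: "(\<lambda>n. LINT x|lebesgue. D\<Phi> n x * (m1 x * \<eta>2 x) + \<Phi> n x * (m2 x * \<eta>2 x)) \<longlonglongrightarrow> (LINT x|lebesgue. F x)"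
  proof (rule integral_L1_limit[OF uni un0])
   show "integrable lebesgue (\<lambda>x. D\<Phi> n x * (m1 x * \<eta>2 x) + \<Phi> n x * (m2 x * \<eta>2 x))" for n
    unfolding m1_def m2_def \<eta>2_def
    by (intro Bochner_Integration.integrable_add main(1)[OF K(1,2) lc(2) pm(1) pP(1)] main(2)[OF K(1,2) lc(1) pm(1) pP(1)])
   show "integrable lebesgue (\<lambda>x. F x)"
    unfolding F_def m1_def m2_def \<eta>2_def
    by (intro Bochner_Integration.integrable_add main(1)[OF K(1,2) lg(1) pm(1) pP(1)] main(2)[OF K(1,2) l(1) pm(1) pP(1)])
   show "norm (D\<Phi> n x * (m1 x * \<eta>2 x) + \<Phi> n x * (m2 x * \<eta>2 x) - F x) \<le> (M * P + (\<bar>B'\<bar> * M) * P) * un n x" for n x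
   proof (cases "x \<in> K")
    case True
    have "D\<Phi> n x * (m1 x * \<eta>2 x) + \<Phi> n x * (m2 x * \<eta>2 x) - F x = (D\<Phi> n x - g x $ i) * (m1 x * \<eta>2 x) + (\<Phi> n x - \<phi> x) * (m2 x * \<eta>2 x)"
     by (simp add: F_def algebra_simps)
    also have "norm \<dots> \<le> norm (D\<Phi> n x - g x $ i) * (norm (m1 x) * norm (\<eta>2 x)) + norm (\<Phi> n x - \<phi> x) * (norm (m2 x) * norm (\<eta>2 x))"
     by (rule order_trans[OF norm_triangle_ineq]) (simp add: norm_mult)
    also have "\<dots> \<le> un n x * (M * P) + un n x * ((\<bar>B'\<bar> * M) * P)"
     using dist[OF True, of n] m1b[of x] m2b[of x] P''(2)[of x] M(1) P(1) un_nn[of n x]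
     by (intro add_mono mult_mono mult_nonneg_nonneg) auto
    finally show ?thesis by (simp add: algebra_simps)
   next
    case False
    then show ?thesis using un_nn[of n x] M P by (auto simp: zK F_def intro!: mult_nonneg_nonneg add_nonneg_nonneg)
   qed
  qed
  have "(LINT x|lebesgue. \<phi> x * (m1 x * \<eta>1 x)) = - (LINT x|lebesgue. F x)"
   using LIMSEQ_unique[OF I1 tendsto_minus[OF I2, folded ibp]] .
  moreover have "(LINT x|lebesgue. \<phi> x * m (s x) * complex_of_real (partial_deriv i \<psi> x)) = (LINT x|lebesgue. \<phi> x * (m1 x * \<eta>1 x))"
   by (rule Bochner_Integration.integral_cong[OF refl]) (simp only: e1 \<eta>1_def[symmetric])
  moreover have "(LINT x|lebesgue. (\<chi> i. g x $ i * m (s x) + \<phi> x * (complex_of_real (Re (\<sigma> x $ i)) * m' (s x))) $ i * complex_of_real (\<psi> x)) = (LINT x|lebesgue. F x)"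
   by (rule Bochner_Integration.integral_cong[OF refl])
     (simp only: F_def vec_lambda_beta distrib_right \<eta>2_def[symmetric] e1)
  ultimately show "(LINT x|lebesgue. \<phi> x * m (s x) * complex_of_real (partial_deriv i \<psi> x)) =
    - (LINT x|lebesgue. (\<chi> i. g x $ i * m (s x) + \<phi> x * (complex_of_real (Re (\<sigma> x $ i)) * m' (s x))) $ i * complex_of_real (\<psi> x))"
   by (simp only:)
 qed
qed

section \<open>Weighted Sobolev spaces\<close>

text \<open>Both conditions on a weight in one, with real constants in place of extended infima and
  suprema.\<close>

definition tame_weight :: "(real ^ 'd) set \<Rightarrow> (real ^ 'd \<Rightarrow> real) \<Rightarrow> bool" where
 "tame_weight U w \<longleftrightarrow> w \<in> borel_measurable (lebesgue_on U) \<and> (\<forall>x\<in>U. 0 < w x) \<and>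
   (\<forall>K. compact K \<and> K \<subseteq> U \<longrightarrow> (\<exists>c C. 0 < c \<and> (\<forall>x\<in>K. c \<le> w x \<and> w x \<le> C)))"

lemma tame_weightI:
 assumes "weight_function U w" "compactly_bounded U w"
 shows "tame_weight U w"
proof -
 have "\<exists>c C. 0 < c \<and> (\<forall>x\<in>K. c \<le> w x \<and> w x \<le> C)" if K: "compact K \<and> K \<subseteq> U" for K
 proof -
  have *: "0 < (INF x\<in>K. ereal (w x))" "(SUP x\<in>K. ereal (w x)) < \<infinity>"
   using assms(2) K by (auto simp: compactly_bounded_def)
  obtain c where c: "0 < ereal c" "ereal c < (INF x\<in>K. ereal (w x))" using ereal_dense2[OF *(1)] by auto
  obtain C where C: "(SUP x\<in>K. ereal (w x)) < ereal C" using ereal_dense2[OF *(2)] by auto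
  have "c \<le> w x \<and> w x \<le> C" if "x \<in> K" for x
  proof
   have "ereal c < ereal (w x)" using c(2) INF_lower[OF that, of "\<lambda>x. ereal (w x)"] by (rule less_le_trans)
   then show "c \<le> w x" by simp
   have "ereal (w x) < ereal C" using SUP_upper[OF that, of "\<lambda>x. ereal (w x)"] C by (rule le_less_trans)
   then show "w x \<le> C" by simp
  qed
  then show ?thesis using c(1) by (intro exI[of _ c] exI[of _ C]) auto
 qed
 then show ?thesis using assms(1) by (auto simp: tame_weight_def weight_function_def)
qed

lemma tame_weightD:
 assumes "tame_weight U w"
 shows "w \<in> borel_measurable (lebesgue_on U)" "\<And>x. x \<in> U \<Longrightarrow> 0 < w x"
  "\<And>K. compact K \<Longrightarrow> K \<subseteq> U \<Longrightarrow> \<exists>c C. 0 < c \<and> (\<forall>x\<in>K. c \<le> w x \<and> w x \<le> C)"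
 using assms unfolding tame_weight_def by blast+

lemma tame_weight_interp:
 assumes "tame_weight U w0" "tame_weight U w1" "0 < \<theta>" "\<theta> < 1"
 shows "tame_weight U (interp_weight w0 w1 \<theta>)"
 unfolding tame_weight_def
proof (intro conjI ballI allI impI)
 show "interp_weight w0 w1 \<theta> \<in> borel_measurable (lebesgue_on U)"
  using tame_weightD(1)[OF assms(1)] tame_weightD(1)[OF assms(2)] unfolding interp_weight_def by measurable
 show "0 < interp_weight w0 w1 \<theta> x" if "x \<in> U" for x
  using tame_weightD(2)[OF assms(1) that] tame_weightD(2)[OF assms(2) that] by (simp add: interp_weight_def)
 fix K assume K: "compact K \<and> K \<subseteq> U"
 then obtain c0 C0 where 0: "0 < c0" "\<And>x. x \<in> K \<Longrightarrow> c0 \<le> w0 x \<and> w0 x \<le> C0" using tame_weightD(3)[OF assms(1)] by meson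
 obtain c1 C1 where 1: "0 < c1" "\<And>x. x \<in> K \<Longrightarrow> c1 \<le> w1 x \<and> w1 x \<le> C1" using K tame_weightD(3)[OF assms(2)] by meson
 show "\<exists>c C. 0 < c \<and> (\<forall>x\<in>K. c \<le> interp_weight w0 w1 \<theta> x \<and> interp_weight w0 w1 \<theta> x \<le> C)"
 proof (intro exI conjI ballI)
  show "0 < c0 powr (1 - \<theta>) * c1 powr \<theta>" using 0(1) 1(1) by simp
  fix x assume x: "x \<in> K"
  show "c0 powr (1 - \<theta>) * c1 powr \<theta> \<le> interp_weight w0 w1 \<theta> x"
   unfolding interp_weight_def using 0(1) 0(2)[OF x] 1(1) 1(2)[OF x] assms(3,4)
   by (intro mult_mono powr_mono2) auto
  show "interp_weight w0 w1 \<theta> x \<le> C0 powr (1 - \<theta>) * C1 powr \<theta>"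
   unfolding interp_weight_def using 0(1) 0(2)[OF x] 1(1) 1(2)[OF x] assms(3,4)
   by (intro mult_mono powr_mono2) auto
 qed
qed

text \<open>The endpoint weights differ from the interpolated one by exponentials of the logarithmic
  ratio. Both inclusions rest on this: the modulus of exp ((z - \<theta>) s) depends on Re z alone
  and hits these factors on the sides of the strip.\<close>

lemma interp_weight_exp:
 assumes "0 < w0 x" "0 < w1 x"
 shows "w0 x = interp_weight w0 w1 \<theta> x * exp (\<theta> * ln (w0 x / w1 x))"
  "w1 x = interp_weight w0 w1 \<theta> x * exp ((\<theta> - 1) * ln (w0 x / w1 x))"
 using assms by (auto simp: interp_weight_def powr_def ln_div simp flip: exp_add) (simp_all add: algebra_simps)

lemma integrable_weighted_add:
 fixes u v :: "'a \<Rightarrow> 'b::{banach, second_countable_topology}"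
 assumes "u \<in> borel_measurable M" "v \<in> borel_measurable M" "w \<in> borel_measurable M" "0 \<le> p"
  "integrable M (\<lambda>x. norm (u x) powr p * w x)" "integrable M (\<lambda>x. norm (v x) powr p * w x)"
 shows "integrable M (\<lambda>x. norm (u x + v x) powr p * w x)"
proof (rule Bochner_Integration.integrable_bound)
 show "integrable M (\<lambda>x. 2 powr p * (norm (norm (u x) powr p * w x) + norm (norm (v x) powr p * w x)))"
  using assms by auto
 show "(\<lambda>x. norm (u x + v x) powr p * w x) \<in> borel_measurable M" using assms(1-3) by measurable
 show "AE x in M. norm (norm (u x + v x) powr p * w x) \<le> norm (2 powr p * (norm (norm (u x) powr p * w x) + norm (norm (v x) powr p * w x)))"
 proof (rule AE_I2)
  fix x
  have "norm (u x + v x) powr p * \<bar>w x\<bar> \<le> 2 powr p * (norm (u x) powr p + norm (v x) powr p) * \<bar>w x\<bar>"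
   by (intro mult_right_mono norm_add_powr_le assms(4)) auto
  then show "norm (norm (u x + v x) powr p * w x) \<le> norm (2 powr p * (norm (norm (u x) powr p * w x) + norm (norm (v x) powr p * w x)))"
   by (simp add: abs_mult algebra_simps)
 qed
qed

lemma W1pD:
 assumes "open U" "tame_weight U w" "\<phi> \<in> W1p U w p"
 shows "has_weak_gradient U \<phi> (weak_gradient U \<phi>)"
  "\<phi> \<in> borel_measurable (lebesgue_on U)" "(\<lambda>x. weak_gradient U \<phi> x $ i) \<in> borel_measurable (lebesgue_on U)"
  "integrable (lebesgue_on U) (\<lambda>x. norm (\<phi> x) powr p * w x)"
  "integrable (lebesgue_on U) (\<lambda>x. norm (weak_gradient U \<phi> x $ i) powr p * w x)"
proof -
 obtain g where "has_weak_gradient U \<phi> g" using assms(3) by (auto simp: W1p_def)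
 from weak_gradient_AE(1)[OF assms(1) this] show wg: "has_weak_gradient U \<phi> (weak_gradient U \<phi>)" .
 then show "\<phi> \<in> borel_measurable (lebesgue_on U)" "(\<lambda>x. weak_gradient U \<phi> x $ i) \<in> borel_measurable (lebesgue_on U)"
  unfolding has_weak_gradient_def
  by (auto intro!: locally_integrable_measurable[OF assms(1)] locally_integrable_component)
 show "integrable (lebesgue_on U) (\<lambda>x. norm (\<phi> x) powr p * w x)"
  "integrable (lebesgue_on U) (\<lambda>x. norm (weak_gradient U \<phi> x $ i) powr p * w x)"
  using W1p_iff[OF assms(1) wg tame_weightD(1)[OF assms(2)]] assms(3) by auto
qed

lemma W1pI:
 assumes "open U" "tame_weight U w" "has_weak_gradient U \<phi> g"
  "integrable (lebesgue_on U) (\<lambda>x. norm (\<phi> x) powr p * w x)"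
  "\<And>i. integrable (lebesgue_on U) (\<lambda>x. norm (g x $ i) powr p * w x)"
 shows "\<phi> \<in> W1p U w p"
 using W1p_iff[OF assms(1,3) tame_weightD(1)[OF assms(2)]] assms(4,5) by auto

lemma W1p_add:
 assumes "open U" "tame_weight U w" "0 \<le> p" "\<phi> \<in> W1p U w p" "\<psi> \<in> W1p U w p"
 shows "(\<lambda>x. \<phi> x + \<psi> x) \<in> W1p U w p"
proof -
 note a = W1pD[OF assms(1,2,4)] and b = W1pD[OF assms(1,2,5)]
 show ?thesis
  by (rule W1pI[OF assms(1,2) has_weak_gradient_add[OF a(1) b(1)]])
    (auto intro!: integrable_weighted_add a b tame_weightD(1)[OF assms(2)] assms(3))
qed

lemma W1p_cmult:
 fixes c :: complex
 assumes "open U" "tame_weight U w" "\<phi> \<in> W1p U w p"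
 shows "(\<lambda>x. c * \<phi> x) \<in> W1p U w p"
proof -
 note a = W1pD[OF assms]
 show ?thesis
  by (rule W1pI[OF assms(1,2) has_weak_gradient_cmult[OF a(1)]])
    (use a(4,5) in \<open>auto simp: norm_mult powr_mult mult.assoc intro!: integrable_mult_right\<close>)
qed

lemma W1p_diff:
 assumes "open U" "tame_weight U w" "0 \<le> p" "\<phi> \<in> W1p U w p" "\<psi> \<in> W1p U w p"
 shows "(\<lambda>x. \<phi> x - \<psi> x) \<in> W1p U w p"
 using W1p_add[OF assms(1-4) W1p_cmult[OF assms(1,2,5), of "- 1"]] by simp

lemma energy_nonneg:
 assumes "tame_weight U w" "U \<in> sets lebesgue"
 shows "0 \<le> energy U w p \<phi> g"
 unfolding energy_def using tame_weightD(2)[OF assms(1)]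
 by (intro add_nonneg_nonneg sum_nonneg integral_nonneg_AE) (auto simp: AE_lebesgue_on_iff[OF assms(2)] less_imp_le)

lemma W1p_norm_powr:
 assumes "open U" "tame_weight U w" "has_weak_gradient U \<phi> g" "1 \<le> p"
 shows "W1p_norm U w p \<phi> powr p = energy U w p \<phi> g"
 unfolding W1p_norm_eq[OF assms(1,3) tame_weightD(1)[OF assms(2)]]
 using energy_nonneg[OF assms(2) open_sets_lebesgue[OF assms(1)], of p \<phi> g] assms(4)
 by (simp add: powr_powr)

lemma W1p_norm_nonneg: "0 \<le> W1p_norm U w p \<phi>"
 by (simp add: W1p_norm_def Lp_norm_def)

text \<open>Indexing by \<open>'d option\<close> treats a function and its partial derivatives
  alike, so that the upper inclusion needs one argument for all components.\<close>

definition jet :: "(real ^ 'd) set \<Rightarrow> 'd option \<Rightarrow> (real ^ 'd \<Rightarrow> complex) \<Rightarrow> real ^ 'd \<Rightarrow> complex" where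
 "jet U j \<phi> x = with_gradient \<phi> (weak_gradient U \<phi>) x $ j"

lemma jet_simps: "jet U None \<phi> x = \<phi> x" "jet U (Some i) \<phi> x = weak_gradient U \<phi> x $ i"
 by (simp_all add: jet_def with_gradient_def)

lemma jet_AE:
 assumes "open U" "has_weak_gradient U \<phi> g"
 shows "AE x in lebesgue_on U. jet U j \<phi> x = with_gradient \<phi> g x $ j"
 using weak_gradient_AE(2)[OF assms] by eventually_elim (cases j; simp add: jet_def with_gradient_def)

lemma jet_measurable:
 assumes "open U" "has_weak_gradient U \<phi> g"
 shows "jet U j \<phi> \<in> borel_measurable (lebesgue_on U)"
 using weak_gradient_AE(1)[OF assms] unfolding has_weak_gradient_def
 by (cases j) (auto simp: jet_simps[abs_def] intro!: locally_integrable_measurable[OF assms(1)] locally_integrable_component)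

lemma jet_W1p:
 assumes "open U" "tame_weight U w" "\<phi> \<in> W1p U w p" "1 \<le> p"
 shows "integrable (lebesgue_on U) (\<lambda>x. norm (jet U j \<phi> x) powr p * w x)"
  "(\<integral>x. norm (jet U j \<phi> x) powr p * w x \<partial>lebesgue_on U) \<le> W1p_norm U w p \<phi> powr p"
proof -
 note a = W1pD[OF assms(1-3)]
 show "integrable (lebesgue_on U) (\<lambda>x. norm (jet U j \<phi> x) powr p * w x)"
  using a(4,5) by (cases j) (auto simp: jet_simps)
 have nn: "0 \<le> (\<integral>x. norm (F x) powr p * w x \<partial>lebesgue_on U)" for F :: "real ^ 'a \<Rightarrow> complex"
  using tame_weightD(2)[OF assms(2)]
  by (intro integral_nonneg_AE) (auto simp: AE_lebesgue_on_iff[OF open_sets_lebesgue[OF assms(1)]] less_imp_le)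
 show "(\<integral>x. norm (jet U j \<phi> x) powr p * w x \<partial>lebesgue_on U) \<le> W1p_norm U w p \<phi> powr p"
  unfolding W1p_norm_powr[OF assms(1,2) a(1) assms(4)] energy_def
 proof (cases j)
  case None
  then show "(\<integral>x. norm (jet U j \<phi> x) powr p * w x \<partial>lebesgue_on U) \<le> (\<integral>x. norm (\<phi> x) powr p * w x \<partial>lebesgue_on U) +
   (\<Sum>i\<in>UNIV. \<integral>x. norm (weak_gradient U \<phi> x $ i) powr p * w x \<partial>lebesgue_on U)"
   by (simp add: jet_simps sum_nonneg nn)
 next
  case (Some i)
  have "(\<integral>x. norm (weak_gradient U \<phi> x $ i) powr p * w x \<partial>lebesgue_on U) \<le>
   (\<Sum>i\<in>UNIV. \<integral>x. norm (weak_gradient U \<phi> x $ i) powr p * w x \<partial>lebesgue_on U)"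
   by (rule member_le_sum) (auto simp: nn)
  with Some show "(\<integral>x. norm (jet U j \<phi> x) powr p * w x \<partial>lebesgue_on U) \<le> (\<integral>x. norm (\<phi> x) powr p * w x \<partial>lebesgue_on U) +
   (\<Sum>i\<in>UNIV. \<integral>x. norm (weak_gradient U \<phi> x $ i) powr p * w x \<partial>lebesgue_on U)"
   using nn[of \<phi>] by (simp add: jet_simps)
 qed
qed

lemma jet_add:
 assumes "open U" "has_weak_gradient U \<phi> g" "has_weak_gradient U \<psi> h"
 shows "AE x in lebesgue_on U. jet U j (\<lambda>x. \<phi> x + \<psi> x) x = jet U j \<phi> x + jet U j \<psi> x"
 using jet_AE[OF assms(1) has_weak_gradient_add[OF assms(2,3)], of j] jet_AE[OF assms(1,2), of j] jet_AE[OF assms(1,3), of j]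
 by eventually_elim (cases j; simp add: with_gradient_def)

lemma jet_cmult:
 fixes c :: complex
 assumes "open U" "has_weak_gradient U \<phi> g"
 shows "AE x in lebesgue_on U. jet U j (\<lambda>x. c * \<phi> x) x = c * jet U j \<phi> x"
 using jet_AE[OF assms(1) has_weak_gradient_cmult[OF assms(2), of c], of j] jet_AE[OF assms(1,2), of j]
 by eventually_elim (cases j; simp add: with_gradient_def)

section \<open>The sum of the two spaces and local integrability\<close>

lemma sum_space_weak_gradient:
 assumes "open U" "v \<in> sum_space (W1p U w0 p) (W1p U w1 p)"
 shows "has_weak_gradient U v (weak_gradient U v)"
proof -
 obtain a b g h where "v = (\<lambda>x. a x + b x)" "has_weak_gradient U a g" "has_weak_gradient U b h"
  using assms(2) by (auto simp: sum_space_def W1p_def)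
 then have "has_weak_gradient U v (\<lambda>x. g x + h x)" using has_weak_gradient_add by blast
 then show ?thesis by (rule weak_gradient_AE(1)[OF assms(1)])
qed

lemma sum_space_add:
 assumes U: "open U" "tame_weight U w0" "tame_weight U w1" "0 \<le> p"
  and "u \<in> sum_space (W1p U w0 p) (W1p U w1 p)" "v \<in> sum_space (W1p U w0 p) (W1p U w1 p)"
 shows "(\<lambda>x. u x + v x) \<in> sum_space (W1p U w0 p) (W1p U w1 p)"
proof -
 obtain a b a' b' where *: "u = (\<lambda>x. a x + b x)" "v = (\<lambda>x. a' x + b' x)" "a \<in> W1p U w0 p" "a' \<in> W1p U w0 p"
   "b \<in> W1p U w1 p" "b' \<in> W1p U w1 p"
  using assms(5,6) by (auto simp: sum_space_def)
 show ?thesis unfolding sum_space_def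
  by (intro CollectI bexI[of _ "\<lambda>x. a x + a' x"] bexI[of _ "\<lambda>x. b x + b' x"] W1p_add U *)
    (simp add: * algebra_simps)
qed

lemma sum_space_cmult:
 fixes c :: complex
 assumes U: "open U" "tame_weight U w0" "tame_weight U w1"
  and "u \<in> sum_space (W1p U w0 p) (W1p U w1 p)"
 shows "(\<lambda>x. c * u x) \<in> sum_space (W1p U w0 p) (W1p U w1 p)"
proof -
 obtain a b where *: "u = (\<lambda>x. a x + b x)" "a \<in> W1p U w0 p" "b \<in> W1p U w1 p"
  using assms(4) by (auto simp: sum_space_def)
 show ?thesis unfolding sum_space_def
  by (intro CollectI bexI[of _ "\<lambda>x. c * a x"] bexI[of _ "\<lambda>x. c * b x"] W1p_cmult U *)
    (simp add: * algebra_simps)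
qed

text \<open>Replaces Hoelder's inequality on \<open>K\<close>, including p = 1: the pointwise
  estimate |u| <= t + t^(1 - p) |u|^p with a free parameter t is integrated, and t is then
  chosen.\<close>

lemma local_L1_bound:
 fixes w :: "real ^ 'd \<Rightarrow> real"
 assumes U: "open U" and w: "tame_weight U w" and K: "compact K" "K \<subseteq> U" and p: "1 \<le> p"
 obtains C where "0 \<le> C"
  "\<And>u :: real ^ 'd \<Rightarrow> complex. u \<in> borel_measurable (lebesgue_on U) \<Longrightarrow> integrable (lebesgue_on U) (\<lambda>x. norm (u x) powr p * w x) \<Longrightarrow>
   integrable (lebesgue_on U) (\<lambda>x. indicator K x * norm (u x)) \<and>
   (\<integral>x. indicator K x * norm (u x) \<partial>lebesgue_on U) \<le> C * (\<integral>x. norm (u x) powr p * w x \<partial>lebesgue_on U) powr (1 / p)"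
proof -
 obtain c where c: "0 < c" "\<And>x. x \<in> K \<Longrightarrow> c \<le> w x" using tame_weightD(3)[OF w K] by blast
 have UL: "U \<in> sets lebesgue" by (rule open_sets_lebesgue[OF U])
 have Km: "indicator K \<in> borel_measurable (lebesgue_on U)"
  using compact_sets_lebesgue[OF K(1)] by (intro measurable_restrict_space1) auto
 define \<mu> where "\<mu> = (\<integral>x. indicator K x \<partial>lebesgue_on U :: real)"
 have Ki: "integrable (lebesgue_on U) (\<lambda>x. indicator K x :: real)"
 proof -
  have "integrable lebesgue (\<lambda>x. indicator U x *\<^sub>R (indicator K x :: real)) = integrable lebesgue (\<lambda>x. indicator K x :: real)"
   by (intro Bochner_Integration.integrable_cong) (use K(2) in \<open>auto simp: indicator_def\<close>)
  then show ?thesis using lmeasurable_compact[OF K(1)] UL by (subst integrable_restrict_space) (auto simp: fmeasurable_def)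
 qed
 have \<mu>: "0 \<le> \<mu>" by (simp add: \<mu>_def)
 show ?thesis
 proof (rule that[of "\<mu> + 1 / c"])
  show "0 \<le> \<mu> + 1 / c" using \<mu> c by simp
  fix u :: "real ^ 'd \<Rightarrow> complex"
  assume u: "u \<in> borel_measurable (lebesgue_on U)" and i: "integrable (lebesgue_on U) (\<lambda>x. norm (u x) powr p * w x)"
  define A where "A = (\<integral>x. norm (u x) powr p * w x \<partial>lebesgue_on U)"
  have w0: "0 \<le> norm (u x) powr p * w x" if "x \<in> U" for x using tame_weightD(2)[OF w that] by simp
  have A: "0 \<le> A" unfolding A_def by (intro integral_nonneg_AE) (auto simp: AE_lebesgue_on_iff[OF UL] w0)
  \<comment> \<open>This is a <= 1 + a^p for a = |u| / t; on \<open>K\<close> the lower bound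
    \<open>c\<close> of the weight lets w / c be inserted.\<close>
  have le: "indicator K x * norm (u x) \<le> t * indicator K x + (t powr (1 - p) / c) * (norm (u x) powr p * w x)"
   if "0 < t" "x \<in> U" for t x
  proof (cases "x \<in> K")
   case True
   have "norm (u x) / t \<le> 1 + (norm (u x) / t) powr p" using p that by (intro le_1_plus_powr) auto
   then have "norm (u x) \<le> t * (1 + (norm (u x) / t) powr p)" using that by (simp add: field_simps)
   also have "\<dots> = t + t powr (1 - p) * norm (u x) powr p"
    using that by (simp add: powr_divide powr_diff field_simps)
   also have "\<dots> \<le> t + t powr (1 - p) * (norm (u x) powr p * (w x / c))"
   proof (intro add_left_mono mult_left_mono)
    have "1 \<le> w x / c" using c(1) c(2)[OF True] by simp
    then have "norm (u x) powr p * 1 \<le> norm (u x) powr p * (w x / c)" by (rule mult_left_mono) simp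
    then show "norm (u x) powr p \<le> norm (u x) powr p * (w x / c)" by simp
   qed simp
   finally show ?thesis using True by (simp add: mult.commute mult.left_commute)
  next
   case False
   then show ?thesis using c(1) w0[OF that(2)] by simp
  qed
  have ii: "integrable (lebesgue_on U) (\<lambda>x. t * indicator K x + (t powr (1 - p) / c) * (norm (u x) powr p * w x))" for t
   by (intro Bochner_Integration.integrable_add integrable_mult_right Ki i)
  show "integrable (lebesgue_on U) (\<lambda>x. indicator K x * norm (u x)) \<and>
   (\<integral>x. indicator K x * norm (u x) \<partial>lebesgue_on U) \<le> (\<mu> + 1 / c) * (\<integral>x. norm (u x) powr p * w x \<partial>lebesgue_on U) powr (1 / p)"
  proof
   show int: "integrable (lebesgue_on U) (\<lambda>x. indicator K x * norm (u x))"
   proof (rule Bochner_Integration.integrable_bound[OF ii[of 1]])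
    show "(\<lambda>x. indicator K x * norm (u x)) \<in> borel_measurable (lebesgue_on U)" using Km u by measurable
    show "AE x in lebesgue_on U. norm (indicator K x * norm (u x)) \<le> norm (1 * indicator K x + (1 powr (1 - p) / c) * (norm (u x) powr p * w x))"
     unfolding AE_lebesgue_on_iff[OF UL] using le[of 1] by (intro AE_I2) (auto intro: order_trans[OF _ abs_ge_self])
   qed
   have bd: "(\<integral>x. indicator K x * norm (u x) \<partial>lebesgue_on U) \<le> t * \<mu> + (t powr (1 - p) / c) * A" if "0 < t" for t
   proof -
    have "(\<integral>x. indicator K x * norm (u x) \<partial>lebesgue_on U) \<le> (\<integral>x. t * indicator K x + (t powr (1 - p) / c) * (norm (u x) powr p * w x) \<partial>lebesgue_on U)"
     by (rule integral_mono_AE[OF int ii]) (use le[OF that] in \<open>auto simp: AE_lebesgue_on_iff[OF UL]\<close>)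
    also have "\<dots> = t * \<mu> + (t powr (1 - p) / c) * A"
     unfolding \<mu>_def A_def by (subst Bochner_Integration.integral_add[OF integrable_mult_right[OF Ki] integrable_mult_right[OF i]]) simp
    finally show ?thesis .
   qed
   show "(\<integral>x. indicator K x * norm (u x) \<partial>lebesgue_on U) \<le> (\<mu> + 1 / c) * (\<integral>x. norm (u x) powr p * w x \<partial>lebesgue_on U) powr (1 / p)"
   proof (cases "A = 0")
    case True
    \<comment> \<open>If the weighted norm is 0 the second term disappears and t may be taken
      arbitrarily small.\<close>
    have "(\<integral>x. indicator K x * norm (u x) \<partial>lebesgue_on U) \<le> 0"
    proof (rule field_le_epsilon)
     fix e :: real assume e: "0 < e"
     have "(\<integral>x. indicator K x * norm (u x) \<partial>lebesgue_on U) \<le> (e / (\<mu> + 1)) * \<mu>"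
      using bd[of "e / (\<mu> + 1)"] e \<mu> True by simp
     also have "\<dots> \<le> e" using e \<mu> by (simp add: field_simps)
     finally show "(\<integral>x. indicator K x * norm (u x) \<partial>lebesgue_on U) \<le> 0 + e" by simp
    qed
    also have "0 \<le> (\<mu> + 1 / c) * (\<integral>x. norm (u x) powr p * w x \<partial>lebesgue_on U) powr (1 / p)"
     using \<mu> c by simp
    finally show ?thesis .
   next
    case False
    then have A: "0 < A" using A by simp
    \<comment> \<open>For t equal to the weighted norm both terms are multiples of t, which gives
      the linear bound.\<close>
    define t where "t = A powr (1 / p)"
    have t: "0 < t" using A by (simp add: t_def)
    have "A = t powr p" using A p by (simp add: t_def powr_powr)
    then have "(t powr (1 - p) / c) * A = t / c" using t by (simp add: powr_diff)
    with bd[OF t] have "(\<integral>x. indicator K x * norm (u x) \<partial>lebesgue_on U) \<le> t * \<mu> + t / c" by (simp only:)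
    also have "\<dots> = (\<mu> + 1 / c) * t" by (simp add: algebra_simps)
    finally show ?thesis unfolding t_def A_def .
   qed
  qed
 qed
qed

section \<open>Complex interpolation: the upper inclusion\<close>

lemma strip_interior: "z \<in> interior strip \<longleftrightarrow> 0 < Re z \<and> Re z < 1"
proof
 assume "z \<in> interior strip"
 then obtain e where e: "0 < e" "ball z e \<subseteq> strip" using mem_interior by blast
 have "z - complex_of_real (e / 2) \<in> ball z e" "z + complex_of_real (e / 2) \<in> ball z e"
  using e(1) by (auto simp: dist_norm)
 then have "z - complex_of_real (e / 2) \<in> strip" "z + complex_of_real (e / 2) \<in> strip" using e(2) by blast+
 then show "0 < Re z \<and> Re z < 1" using e(1) by (auto simp: strip_def)
next
 assume z: "0 < Re z \<and> Re z < 1"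
 have "open ({z. 0 < Re z} \<inter> {z. Re z < 1})"
  by (intro open_Int open_halfspace_Re_gt open_halfspace_Re_lt)
 moreover have "{z. 0 < Re z} \<inter> {z. Re z < 1} \<subseteq> strip" by (auto simp: strip_def)
 ultimately show "z \<in> interior strip" using z by (auto simp: interior_def)
qed

text \<open>On the strip exp (e (z^2 - 1)) has modulus at most exp (- e (Im z)^2). This factor turns
  boundedness into decay, so the maximum principle on a tall rectangle applies; e tends to 0 at the
  end.\<close>

lemma strip_maximum_principle:
 assumes hol: "h holomorphic_on interior strip" and cont: "continuous_on strip h"
  and bd: "\<And>z. z \<in> strip \<Longrightarrow> norm (h z) \<le> M"
  and le: "\<And>t. norm (h (Complex 0 t)) \<le> C" "\<And>t. norm (h (Complex 1 t)) \<le> C"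
  and \<xi>: "\<xi> \<in> strip"
 shows "norm (h \<xi>) \<le> C"
proof -
 have "0 \<le> C" using le(1)[of 0] norm_ge_zero order_trans by blast
 have "0 \<le> M" using bd[OF \<xi>] norm_ge_zero order_trans by blast
 have key: "norm (h \<xi>) * exp (e * ((Re \<xi>)\<^sup>2 - (Im \<xi>)\<^sup>2 - 1)) \<le> C + \<delta>" if e: "0 < e" and \<delta>: "0 < \<delta>" for e \<delta> :: real
 proof -
  define H where "H z = h z * exp (complex_of_real e * (z\<^sup>2 - 1))" for z
  have nH: "norm (H z) = norm (h z) * exp (e * ((Re z)\<^sup>2 - (Im z)\<^sup>2 - 1))" for z
   by (simp add: H_def norm_mult power2_eq_square)
  \<comment> \<open>A height at which the decay beats the global bound \<open>M\<close> and which
    puts \<xi> into the rectangle.\<close>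
  obtain R where R: "\<bar>Im \<xi>\<bar> \<le> R" "0 \<le> R" "M * exp (- (e * R\<^sup>2)) \<le> \<delta>"
  proof -
   have "((\<lambda>R. M * exp (- (e * R\<^sup>2))) \<longlongrightarrow> M * 0) at_top"
   proof (intro tendsto_mult tendsto_const filterlim_compose[OF exp_at_bot])
    have "filterlim (\<lambda>R::real. e * R\<^sup>2) at_top at_top"
     by (rule filterlim_tendsto_pos_mult_at_top[OF tendsto_const e filterlim_pow_at_top]) (auto simp: filterlim_ident)
    then show "filterlim (\<lambda>R::real. - (e * R\<^sup>2)) at_bot at_top" by (simp add: filterlim_uminus_at_top)
   qed
   then have "\<forall>\<^sub>F R in at_top. M * exp (- (e * R\<^sup>2)) < \<delta>" using \<delta> by (intro order_tendstoD(2)[where y = "M * 0"]) auto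
   then have "\<forall>\<^sub>F R in at_top. M * exp (- (e * R\<^sup>2)) < \<delta> \<and> \<bar>Im \<xi>\<bar> \<le> R \<and> 0 \<le> R"
    by (intro eventually_conj eventually_ge_at_top)
   then obtain R where "M * exp (- (e * R\<^sup>2)) < \<delta> \<and> \<bar>Im \<xi>\<bar> \<le> R \<and> 0 \<le> R"
    by (metis (mono_tags, lifting) eventually_at_top_linorder order_refl)
   then show ?thesis using that by auto
  qed
  let ?S = "cbox (Complex 0 (- R)) (Complex 1 R)"
  have sub: "?S \<subseteq> strip" by (auto simp: in_cbox_complex_iff strip_def)
  have "norm (H \<xi>) \<le> C + \<delta>"
  proof (rule maximum_modulus_frontier[of H ?S])
   have "h holomorphic_on interior ?S" using hol holomorphic_on_subset interior_mono[OF sub] by blast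
   then show "H holomorphic_on interior ?S" unfolding H_def by (intro holomorphic_intros)
   show "continuous_on (closure ?S) H" unfolding H_def
    using continuous_on_subset[OF cont sub] by (auto intro!: continuous_intros)
   show "bounded ?S" by (rule bounded_cbox)
   show "\<xi> \<in> ?S" using \<xi> R(1) by (auto simp: in_cbox_complex_iff strip_def)
   fix z assume "z \<in> frontier ?S"
   then have z: "z \<in> ?S" "z \<notin> box (Complex 0 (- R)) (Complex 1 R)" by (auto simp: frontier_cbox)
   then have zs: "0 \<le> Re z" "Re z \<le> 1" by (auto simp: in_cbox_complex_iff)
   then have "(Re z)\<^sup>2 \<le> 1" by (simp add: abs_square_le_1)
   then have ex: "exp (e * ((Re z)\<^sup>2 - (Im z)\<^sup>2 - 1)) \<le> exp (- (e * (Im z)\<^sup>2))"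
    using e by (simp add: algebra_simps)
   have zs': "z \<in> strip" using zs by (simp add: strip_def)
   consider "Re z = 0" | "Re z = 1" | "\<bar>Im z\<bar> = R"
    using z by (fastforce simp: in_cbox_complex_iff in_box_complex_iff)
   then show "norm (H z) \<le> C + \<delta>"
   proof cases
    case 3
    have "norm (H z) \<le> M * exp (- (e * (Im z)\<^sup>2))"
     unfolding nH using bd[OF zs'] ex \<open>0 \<le> M\<close> by (intro mult_mono) auto
    also have "(Im z)\<^sup>2 = R\<^sup>2" using 3 by (metis power2_abs)
    finally show ?thesis using R(3) \<open>0 \<le> C\<close> by linarith
   next
    case 1
    then have "norm (h z) \<le> C" using le(1)[of "Im z"] by (metis complex_surj)
    moreover have "exp (e * ((Re z)\<^sup>2 - (Im z)\<^sup>2 - 1)) \<le> 1" by (rule order_trans[OF ex]) (use e in simp)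
    ultimately have "norm (H z) \<le> C * 1" unfolding nH using \<open>0 \<le> C\<close> by (intro mult_mono) auto
    then show ?thesis using \<delta> by simp
   next
    case 2
    then have "norm (h z) \<le> C" using le(2)[of "Im z"] by (metis complex_surj)
    moreover have "exp (e * ((Re z)\<^sup>2 - (Im z)\<^sup>2 - 1)) \<le> 1" by (rule order_trans[OF ex]) (use e in simp)
    ultimately have "norm (H z) \<le> C * 1" unfolding nH using \<open>0 \<le> C\<close> by (intro mult_mono) auto
    then show ?thesis using \<delta> by simp
   qed
  qed
  then show ?thesis by (simp add: nH)
 qed
 have key2: "norm (h \<xi>) * exp (e * ((Re \<xi>)\<^sup>2 - (Im \<xi>)\<^sup>2 - 1)) \<le> C" if "0 < e" for e
  by (rule field_le_epsilon) (rule key[OF that])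
 have "((\<lambda>e. norm (h \<xi>) * exp (e * ((Re \<xi>)\<^sup>2 - (Im \<xi>)\<^sup>2 - 1))) \<longlongrightarrow> norm (h \<xi>) * exp (0 * ((Re \<xi>)\<^sup>2 - (Im \<xi>)\<^sup>2 - 1))) (at_right 0)"
  by (intro tendsto_intros)
 then have "norm (h \<xi>) * exp (0 * ((Re \<xi>)\<^sup>2 - (Im \<xi>)\<^sup>2 - 1)) \<le> C"
  by (rule tendsto_upperbound) (auto simp: eventually_at_filter key2)
 then show ?thesis by simp
qed

section \<open>Differentiation under the integral sign\<close>

lemma norm_exp_minus_1_le: "norm (exp (z::complex) - 1) \<le> norm z * exp (norm z)"
proof -
 have "norm (exp z - 1) \<le> exp \<bar>Re z\<bar> * norm z" using Taylor_exp[of z 0] by simp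
 also have "\<dots> \<le> exp (norm z) * norm z" by (intro mult_right_mono) (auto simp: abs_Re_le_cmod)
 finally show ?thesis by (simp add: mult.commute)
qed

text \<open>\<open>s\<close> is controlled only where \<open>g\<close> is non-zero, because in use
  \<open>g\<close> carries the cutoff to a compact set. The bound of
  \<open>norm_exp_minus_1_le\<close> dominates the difference quotients of the exponential.\<close>

lemma has_field_derivative_integral_exp:
 fixes g :: "'a \<Rightarrow> complex" and s :: "'a \<Rightarrow> real"
 assumes g: "integrable M g" and s: "s \<in> borel_measurable M" and S: "\<And>x. x \<in> space M \<Longrightarrow> g x \<noteq> 0 \<Longrightarrow> \<bar>s x\<bar> \<le> S"
 shows "((\<lambda>w. LINT x|M. g x * exp ((w - \<theta>) * complex_of_real (s x))) has_field_derivative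
   (LINT x|M. g x * (complex_of_real (s x) * exp ((z - \<theta>) * complex_of_real (s x))))) (at z)"
  "\<And>w. integrable M (\<lambda>x. g x * exp ((w - \<theta>) * complex_of_real (s x)))"
proof -
 have "0 \<le> \<bar>S\<bar>" by simp
 have S': "\<bar>s x\<bar> \<le> \<bar>S\<bar>" if "x \<in> space M" "g x \<noteq> 0" for x using S[OF that] by linarith
 have gm[measurable]: "g \<in> borel_measurable M" using g by auto
 note [measurable] = s
 have expb: "norm (g x * exp ((w - \<theta>) * complex_of_real (s x))) \<le> norm (g x) * exp (norm (w - \<theta>) * \<bar>S\<bar>)" if "x \<in> space M" for x w
 proof (cases "g x = 0")
  case False
  have "Re ((w - \<theta>) * complex_of_real (s x)) \<le> norm ((w - \<theta>) * complex_of_real (s x))" by (rule complex_Re_le_cmod)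
  also have "\<dots> \<le> norm (w - \<theta>) * \<bar>S\<bar>" using S'[OF that False] by (simp add: norm_mult mult_left_mono)
  finally show ?thesis unfolding norm_mult norm_exp_eq_Re by (intro mult_left_mono) auto
 qed simp
 show int: "integrable M (\<lambda>x. g x * exp ((w - \<theta>) * complex_of_real (s x)))" for w
 proof (rule Bochner_Integration.integrable_bound)
  show "integrable M (\<lambda>x. norm (g x) * exp (norm (w - \<theta>) * \<bar>S\<bar>))" using g by auto
  show "AE x in M. norm (g x * exp ((w - \<theta>) * complex_of_real (s x))) \<le> norm (norm (g x) * exp (norm (w - \<theta>) * \<bar>S\<bar>))"
   using expb by (intro AE_I2) (simp add: norm_mult)
 qed measurable
 let ?I = "\<lambda>w. LINT x|M. g x * exp ((w - \<theta>) * complex_of_real (s x))"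
 show "(?I has_field_derivative (LINT x|M. g x * (complex_of_real (s x) * exp ((z - \<theta>) * complex_of_real (s x))))) (at z)"
  unfolding has_field_derivative_iff tendsto_at_iff_sequentially
 proof (intro allI impI)
  fix X :: "nat \<Rightarrow> complex" assume X: "\<forall>n. X n \<in> UNIV - {z}" "X \<longlonglongrightarrow> z"
  obtain R where R: "\<And>n. norm (X n - z) \<le> R" "0 \<le> R"
  proof -
   have "(\<lambda>n. X n - z) \<longlonglongrightarrow> z - z" by (intro tendsto_intros X(2))
   then have "Bseq (\<lambda>n. X n - z)" using convergent_imp_Bseq convergentI by blast
   then obtain R where "0 < R" "\<And>n. norm (X n - z) \<le> R" by (auto simp: Bseq_def)
   then show ?thesis using that[of R] by auto
  qed
  define q where "q n x = (exp ((X n - \<theta>) * complex_of_real (s x)) - exp ((z - \<theta>) * complex_of_real (s x))) / (X n - z)" for n x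
  have "(\<lambda>n. LINT x|M. g x * q n x) \<longlonglongrightarrow> (LINT x|M. g x * (complex_of_real (s x) * exp ((z - \<theta>) * complex_of_real (s x))))"
  proof (rule integral_dominated_convergence[where w = "\<lambda>x. norm (g x) * (\<bar>S\<bar> * exp (R * \<bar>S\<bar>) * exp (norm (z - \<theta>) * \<bar>S\<bar>))"])
   show "integrable M (\<lambda>x. norm (g x) * (\<bar>S\<bar> * exp (R * \<bar>S\<bar>) * exp (norm (z - \<theta>) * \<bar>S\<bar>)))" using g by auto
   show "(\<lambda>x. g x * q n x) \<in> borel_measurable M" for n unfolding q_def by measurable
   show "AE x in M. (\<lambda>n. g x * q n x) \<longlonglongrightarrow> g x * (complex_of_real (s x) * exp ((z - \<theta>) * complex_of_real (s x)))"
   proof (rule AE_I2)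
    fix x
    have "((\<lambda>w. exp ((w - \<theta>) * complex_of_real (s x))) has_field_derivative exp ((z - \<theta>) * complex_of_real (s x)) * complex_of_real (s x)) (at z)"
     by (auto intro!: derivative_eq_intros)
    then have "(\<lambda>n. q n x) \<longlonglongrightarrow> exp ((z - \<theta>) * complex_of_real (s x)) * complex_of_real (s x)"
     using X unfolding has_field_derivative_iff tendsto_at_iff_sequentially q_def o_def by blast
    then show "(\<lambda>n. g x * q n x) \<longlonglongrightarrow> g x * (complex_of_real (s x) * exp ((z - \<theta>) * complex_of_real (s x)))"
     by (intro tendsto_mult tendsto_const) (simp add: mult.commute)
   qed
   show "AE x in M. norm (g x * q n x) \<le> norm (g x) * (\<bar>S\<bar> * exp (R * \<bar>S\<bar>) * exp (norm (z - \<theta>) * \<bar>S\<bar>))" for n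
   proof (rule AE_I2)
    fix x assume x: "x \<in> space M"
    show "norm (g x * q n x) \<le> norm (g x) * (\<bar>S\<bar> * exp (R * \<bar>S\<bar>) * exp (norm (z - \<theta>) * \<bar>S\<bar>))"
    proof (cases "g x = 0")
     case False
     note sb = S'[OF x False]
     have nz: "X n - z \<noteq> 0" using X(1) by auto
     have "q n x = (exp ((X n - z) * complex_of_real (s x)) - 1) / (X n - z) * exp ((z - \<theta>) * complex_of_real (s x))"
      by (simp add: q_def diff_divide_distrib algebra_simps flip: exp_add)
     also have "norm \<dots> = norm (exp ((X n - z) * complex_of_real (s x)) - 1) / norm (X n - z) * norm (exp ((z - \<theta>) * complex_of_real (s x)))"
      by (simp add: norm_mult norm_divide)
     also have "\<dots> \<le> (\<bar>S\<bar> * exp (R * \<bar>S\<bar>)) * exp (norm (z - \<theta>) * \<bar>S\<bar>)"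
     proof (intro mult_mono)
      have "norm (exp ((X n - z) * complex_of_real (s x)) - 1) \<le> norm ((X n - z) * complex_of_real (s x)) * exp (norm ((X n - z) * complex_of_real (s x)))"
       by (rule norm_exp_minus_1_le)
      also have "\<dots> \<le> (norm (X n - z) * \<bar>S\<bar>) * exp (R * \<bar>S\<bar>)"
       unfolding norm_mult using sb R by (intro mult_mono exp_le_cancel_iff[THEN iffD2]) auto
      finally show "norm (exp ((X n - z) * complex_of_real (s x)) - 1) / norm (X n - z) \<le> \<bar>S\<bar> * exp (R * \<bar>S\<bar>)"
       using nz by (simp add: field_simps)
      have "Re ((z - \<theta>) * complex_of_real (s x)) \<le> norm ((z - \<theta>) * complex_of_real (s x))" by (rule complex_Re_le_cmod)
      also have "\<dots> \<le> norm (z - \<theta>) * \<bar>S\<bar>" using sb by (simp add: norm_mult mult_left_mono)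
      finally show "norm (exp ((z - \<theta>) * complex_of_real (s x))) \<le> exp (norm (z - \<theta>) * \<bar>S\<bar>)" by (simp add: norm_exp_eq_Re)
     qed auto
     finally show ?thesis unfolding norm_mult by (intro mult_left_mono) auto
    qed simp
   qed
  qed measurable
  moreover have "(LINT x|M. g x * q n x) = (?I (X n) - ?I z) / (X n - z)" for n
  proof -
   have "(LINT x|M. g x * q n x) = (LINT x|M. (g x * exp ((X n - \<theta>) * complex_of_real (s x)) - g x * exp ((z - \<theta>) * complex_of_real (s x))) / (X n - z))"
    by (rule Bochner_Integration.integral_cong[OF refl]) (simp add: q_def right_diff_distrib)
   also have "\<dots> = (?I (X n) - ?I z) / (X n - z)"
    by (simp add: Bochner_Integration.integral_diff[OF int int])
   finally show ?thesis .
  qed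
  ultimately show "((\<lambda>y. (?I y - ?I z) / (y - z)) \<circ> X) \<longlonglongrightarrow> (LINT x|M. g x * (complex_of_real (s x) * exp ((z - \<theta>) * complex_of_real (s x))))"
   by (simp add: o_def)
 qed
qed

lemma borel_complex_of_real: "complex_of_real \<in> borel_measurable borel"
 by (intro borel_measurable_continuous_onI continuous_intros)

lemma borel_complex_exp_of_real: "(\<lambda>t. exp (c * complex_of_real t)) \<in> borel_measurable borel"
 by (intro borel_measurable_continuous_onI continuous_intros)

lemma borel_measurable_norm_powr: "(\<lambda>z::complex. norm z powr p) \<in> borel_measurable borel"
 by measurable

section \<open>Functionals on the sum space given by bounded kernels of compact support\<close>

lemma sum_norm_lower:
 assumes "v \<in> sum_space A0 A1"
  and "\<And>a0 a1. a0 \<in> A0 \<Longrightarrow> a1 \<in> A1 \<Longrightarrow> v = (\<lambda>x. a0 x + a1 x) \<Longrightarrow> c \<le> N0 a0 + N1 a1"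
 shows "c \<le> sum_norm A0 N0 A1 N1 v"
 unfolding sum_norm_def by (rule cInf_greatest) (use assms in \<open>auto simp: sum_space_def\<close>)

locale jet_functional =
 fixes U :: "(real ^ 'd) set" and w0 w1 :: "real ^ 'd \<Rightarrow> real" and p :: real and j :: "'d option" and K :: "(real ^ 'd) set"
 assumes U: "open U" and w0: "tame_weight U w0" and w1: "tame_weight U w1" and p: "1 \<le> p"
  and K: "compact K" "K \<subseteq> U"
begin

abbreviation "A0 \<equiv> W1p U w0 p"
abbreviation "A1 \<equiv> W1p U w1 p"
abbreviation "V \<equiv> sum_space A0 A1"
abbreviation "sn \<equiv> sum_norm A0 (W1p_norm U w0 p) A1 (W1p_norm U w1 p)"
abbreviation "pairing k v \<equiv> (\<integral>x. jet U j v x * k x \<partial>lebesgue_on U)"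

definition kernel :: "real \<Rightarrow> (real ^ 'd \<Rightarrow> complex) \<Rightarrow> bool" where
 "kernel P k \<longleftrightarrow> k \<in> borel_measurable (lebesgue_on U) \<and> (\<forall>x\<in>U. norm (k x) \<le> P * indicator K x)"

lemma UL: "U \<in> sets lebesgue"
 by (rule open_sets_lebesgue[OF U])

lemma V_grad: "v \<in> V \<Longrightarrow> has_weak_gradient U v (weak_gradient U v)"
 by (rule sum_space_weak_gradient[OF U])

text \<open>On \<open>K\<close> each of the two weighted norms dominates the L^1 norm of every
  component. So each decomposition of v bounds the pairing, and the infimum over all decompositions
  gives the sum norm. The constant depends on neither v nor k nor P, which is needed when the kernel
  moves with z.\<close>

lemma pairing_bound:
 obtains C where "0 \<le> C"
  "\<And>v k P. v \<in> V \<Longrightarrow> kernel P k \<Longrightarrow> 0 \<le> P \<Longrightarrow> integrable (lebesgue_on U) (\<lambda>x. jet U j v x * k x) \<and> norm (pairing k v) \<le> P * C * sn v"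
proof -
 obtain C0 where C0: "0 \<le> C0" "\<And>u :: real ^ 'd \<Rightarrow> complex. u \<in> borel_measurable (lebesgue_on U) \<Longrightarrow> integrable (lebesgue_on U) (\<lambda>x. norm (u x) powr p * w0 x) \<Longrightarrow>
   integrable (lebesgue_on U) (\<lambda>x. indicator K x * norm (u x)) \<and>
   (\<integral>x. indicator K x * norm (u x) \<partial>lebesgue_on U) \<le> C0 * (\<integral>x. norm (u x) powr p * w0 x \<partial>lebesgue_on U) powr (1 / p)"
  using local_L1_bound[OF U w0 K p] by blast
 obtain C1 where C1: "0 \<le> C1" "\<And>u :: real ^ 'd \<Rightarrow> complex. u \<in> borel_measurable (lebesgue_on U) \<Longrightarrow> integrable (lebesgue_on U) (\<lambda>x. norm (u x) powr p * w1 x) \<Longrightarrow>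
   integrable (lebesgue_on U) (\<lambda>x. indicator K x * norm (u x)) \<and>
   (\<integral>x. indicator K x * norm (u x) \<partial>lebesgue_on U) \<le> C1 * (\<integral>x. norm (u x) powr p * w1 x \<partial>lebesgue_on U) powr (1 / p)"
  using local_L1_bound[OF U w1 K p] by blast
 have one: "integrable (lebesgue_on U) (\<lambda>x. indicator K x * norm (jet U j a x)) \<and>
   (\<integral>x. indicator K x * norm (jet U j a x) \<partial>lebesgue_on U) \<le> C * W1p_norm U w p a"
  if w: "tame_weight U w" and a: "a \<in> W1p U w p" and C: "0 \<le> C"
   and bd: "\<And>u :: real ^ 'd \<Rightarrow> complex. u \<in> borel_measurable (lebesgue_on U) \<Longrightarrow> integrable (lebesgue_on U) (\<lambda>x. norm (u x) powr p * w x) \<Longrightarrow>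
   integrable (lebesgue_on U) (\<lambda>x. indicator K x * norm (u x)) \<and>
   (\<integral>x. indicator K x * norm (u x) \<partial>lebesgue_on U) \<le> C * (\<integral>x. norm (u x) powr p * w x \<partial>lebesgue_on U) powr (1 / p)" for w a C
 proof -
  note b = bd[OF jet_measurable[OF U W1pD(1)[OF U w a]] jet_W1p(1)[OF U w a p], of j]
  have nn: "0 \<le> (\<integral>x. norm (jet U j a x) powr p * w x \<partial>lebesgue_on U)"
   using tame_weightD(2)[OF w] by (intro integral_nonneg_AE) (auto simp: AE_lebesgue_on_iff[OF UL] less_imp_le)
  have "(\<integral>x. norm (jet U j a x) powr p * w x \<partial>lebesgue_on U) powr (1 / p) \<le> (W1p_norm U w p a powr p) powr (1 / p)"
   using nn p by (intro powr_mono2 jet_W1p(2)[OF U w a p]) auto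
  also have "\<dots> = W1p_norm U w p a" using W1p_norm_nonneg[of U w p a] p by (simp add: powr_powr)
  finally have "C * (\<integral>x. norm (jet U j a x) powr p * w x \<partial>lebesgue_on U) powr (1 / p) \<le> C * W1p_norm U w p a"
   by (rule mult_left_mono[OF _ C])
  then show ?thesis using b by (auto intro: order_trans)
 qed
 show ?thesis
 proof (rule that[of "C0 + C1"])
  show "0 \<le> C0 + C1" using C0 C1 by simp
  fix v k and P :: real
  assume v: "v \<in> V" and k: "kernel P k" and P: "0 \<le> P"
  have km: "k \<in> borel_measurable (lebesgue_on U)" and kb: "\<And>x. x \<in> U \<Longrightarrow> norm (k x) \<le> P * indicator K x"
   using k by (auto simp: kernel_def)
  have jm: "jet U j v \<in> borel_measurable (lebesgue_on U)" by (rule jet_measurable[OF U V_grad[OF v]])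
  have dec: "integrable (lebesgue_on U) (\<lambda>x. jet U j v x * k x) \<and> norm (pairing k v) \<le> P * (C0 + C1) * (W1p_norm U w0 p a0 + W1p_norm U w1 p a1)"
   if a: "a0 \<in> A0" "a1 \<in> A1" "v = (\<lambda>x. a0 x + a1 x)" for a0 a1
  proof -
   note b0 = one[OF w0 a(1) C0(1) C0(2)] and b1 = one[OF w1 a(2) C1(1) C1(2)]
   have i: "integrable (lebesgue_on U) (\<lambda>x. P * (indicator K x * norm (jet U j a0 x) + indicator K x * norm (jet U j a1 x)))"
    using b0 b1 by (intro integrable_mult_right Bochner_Integration.integrable_add) auto
   have "AE x in lebesgue_on U. jet U j v x = jet U j a0 x + jet U j a1 x"
    unfolding a(3) by (rule jet_add[OF U W1pD(1)[OF U w0 a(1)] W1pD(1)[OF U w1 a(2)]])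
   moreover have "AE x in lebesgue_on U. x \<in> U" by (simp add: AE_lebesgue_on_iff[OF UL])
   ultimately have le: "AE x in lebesgue_on U. norm (jet U j v x * k x) \<le> P * (indicator K x * norm (jet U j a0 x) + indicator K x * norm (jet U j a1 x))"
   proof eventually_elim
    fix x assume x: "jet U j v x = jet U j a0 x + jet U j a1 x" "x \<in> U"
    have "norm (jet U j v x) * norm (k x) \<le> (norm (jet U j a0 x) + norm (jet U j a1 x)) * (P * indicator K x)"
     using kb[OF x(2)] by (intro mult_mono) (auto simp: x(1) norm_triangle_ineq)
    then show "norm (jet U j v x * k x) \<le> P * (indicator K x * norm (jet U j a0 x) + indicator K x * norm (jet U j a1 x))"
     by (simp add: norm_mult algebra_simps)
   qed
   have int: "integrable (lebesgue_on U) (\<lambda>x. jet U j v x * k x)"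
   proof (rule Bochner_Integration.integrable_bound[OF i])
    show "(\<lambda>x. jet U j v x * k x) \<in> borel_measurable (lebesgue_on U)" using jm km by measurable
    show "AE x in lebesgue_on U. norm (jet U j v x * k x) \<le> norm (P * (indicator K x * norm (jet U j a0 x) + indicator K x * norm (jet U j a1 x)))"
     using le by eventually_elim (rule order_trans, assumption, simp)
   qed
   have "norm (pairing k v) \<le> (\<integral>x. norm (jet U j v x * k x) \<partial>lebesgue_on U)" by (rule integral_norm_bound)
   also have "\<dots> \<le> (\<integral>x. P * (indicator K x * norm (jet U j a0 x) + indicator K x * norm (jet U j a1 x)) \<partial>lebesgue_on U)"
    by (rule integral_mono_AE[OF integrable_norm[OF int] i le])
   also have "\<dots> = P * ((\<integral>x. indicator K x * norm (jet U j a0 x) \<partial>lebesgue_on U) + (\<integral>x. indicator K x * norm (jet U j a1 x) \<partial>lebesgue_on U))"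
    using b0 b1 by simp
   also have "\<dots> \<le> P * (C0 * W1p_norm U w0 p a0 + C1 * W1p_norm U w1 p a1)"
    using b0 b1 P by (intro mult_left_mono add_mono) auto
   also have "\<dots> \<le> P * ((C0 + C1) * W1p_norm U w0 p a0 + (C0 + C1) * W1p_norm U w1 p a1)"
    using C0(1) C1(1) P by (intro mult_left_mono add_mono mult_right_mono W1p_norm_nonneg) auto
   finally show ?thesis using int by (simp add: algebra_simps)
  qed
  have int: "integrable (lebesgue_on U) (\<lambda>x. jet U j v x * k x)"
   using v dec unfolding sum_space_def by blast
  have "norm (pairing k v) \<le> P * (C0 + C1) * sn v"
  proof (cases "P * (C0 + C1) = 0")
   case True
   then show ?thesis using v dec unfolding sum_space_def by fastforce
  next
   case False
   then have pos: "0 < P * (C0 + C1)" using P C0(1) C1(1) by (simp add: zero_less_mult_iff less_le)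
   have "norm (pairing k v) / (P * (C0 + C1)) \<le> sn v"
   proof (rule sum_norm_lower[OF v])
    fix a0 a1 assume "a0 \<in> A0" "a1 \<in> A1" "v = (\<lambda>x. a0 x + a1 x)"
    from dec[OF this] show "norm (pairing k v) / (P * (C0 + C1)) \<le> W1p_norm U w0 p a0 + W1p_norm U w1 p a1"
     using pos by (simp add: pos_divide_le_eq mult.commute)
   qed
   then show ?thesis using pos by (simp add: pos_divide_le_eq mult.commute)
  qed
  then show "integrable (lebesgue_on U) (\<lambda>x. jet U j v x * k x) \<and> norm (pairing k v) \<le> P * (C0 + C1) * sn v" using int by simp
 qed
qed

lemma pairing_integrable: "v \<in> V \<Longrightarrow> kernel P k \<Longrightarrow> 0 \<le> P \<Longrightarrow> integrable (lebesgue_on U) (\<lambda>x. jet U j v x * k x)"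
 using pairing_bound by metis

lemma pairing_bound_ex:
 "\<exists>C. 0 \<le> C \<and> (\<forall>v k P. v \<in> V \<longrightarrow> kernel P k \<longrightarrow> 0 \<le> P \<longrightarrow> norm (pairing k v) \<le> P * C * sn v)"
proof (rule pairing_bound)
 fix C assume C: "0 \<le> C" "\<And>v k P. v \<in> V \<Longrightarrow> kernel P k \<Longrightarrow> 0 \<le> P \<Longrightarrow>
   integrable (lebesgue_on U) (\<lambda>x. jet U j v x * k x) \<and> norm (pairing k v) \<le> P * C * sn v"
 show ?thesis by (intro exI[of _ C] conjI allI impI) (use C in auto)
qed

lemma V_add: "u \<in> V \<Longrightarrow> v \<in> V \<Longrightarrow> (\<lambda>x. u x + v x) \<in> V"
 using p by (intro sum_space_add U w0 w1) auto

lemma V_cmult: "u \<in> V \<Longrightarrow> (\<lambda>x. c * u x) \<in> V"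
 by (intro sum_space_cmult U w0 w1)

lemma V_diff: "u \<in> V \<Longrightarrow> v \<in> V \<Longrightarrow> (\<lambda>x. u x - v x) \<in> V"
 using V_add[of u "\<lambda>x. (- 1) * v x"] V_cmult[of v "- 1"] by simp

lemma pairing_add:
 assumes "u \<in> V" "v \<in> V" "kernel P k" "0 \<le> P"
 shows "pairing k (\<lambda>x. u x + v x) = pairing k u + pairing k v"
proof -
 have "pairing k (\<lambda>x. u x + v x) = (\<integral>x. jet U j u x * k x + jet U j v x * k x \<partial>lebesgue_on U)"
 proof (rule integral_cong_AE)
  show "AE x in lebesgue_on U. jet U j (\<lambda>x. u x + v x) x * k x = jet U j u x * k x + jet U j v x * k x"
   using jet_add[OF U V_grad[OF assms(1)] V_grad[OF assms(2)], of j] by eventually_elim (simp add: distrib_right)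
  show "(\<lambda>x. jet U j (\<lambda>x. u x + v x) x * k x) \<in> borel_measurable (lebesgue_on U)"
   by (rule borel_measurable_integrable[OF pairing_integrable[OF V_add[OF assms(1,2)] assms(3,4)]])
  show "(\<lambda>x. jet U j u x * k x + jet U j v x * k x) \<in> borel_measurable (lebesgue_on U)"
   by (intro borel_measurable_add borel_measurable_integrable pairing_integrable[OF _ assms(3,4)] assms)
 qed
 then show ?thesis using pairing_integrable[OF _ assms(3,4)] assms(1,2) by simp
qed

lemma pairing_cmult:
 assumes "u \<in> V" "kernel P k" "0 \<le> P"
 shows "pairing k (\<lambda>x. c * u x) = c * pairing k u"
proof -
 have "pairing k (\<lambda>x. c * u x) = (\<integral>x. c * (jet U j u x * k x) \<partial>lebesgue_on U)"
 proof (rule integral_cong_AE)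
  show "AE x in lebesgue_on U. jet U j (\<lambda>x. c * u x) x * k x = c * (jet U j u x * k x)"
   using jet_cmult[OF U V_grad[OF assms(1)], of j c] by eventually_elim simp
  show "(\<lambda>x. jet U j (\<lambda>x. c * u x) x * k x) \<in> borel_measurable (lebesgue_on U)"
   by (rule borel_measurable_integrable[OF pairing_integrable[OF V_cmult[OF assms(1)] assms(2,3)]])
  show "(\<lambda>x. c * (jet U j u x * k x)) \<in> borel_measurable (lebesgue_on U)"
   by (intro borel_measurable_times borel_measurable_const borel_measurable_integrable pairing_integrable[OF _ assms(2,3)] assms)
 qed
 then show ?thesis by simp
qed

lemma pairing_diff:
 assumes "u \<in> V" "v \<in> V" "kernel P k" "0 \<le> P"
 shows "pairing k (\<lambda>x. u x - v x) = pairing k u - pairing k v"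
 using pairing_add[OF assms(1) V_cmult[OF assms(2), of "- 1"] assms(3,4)] pairing_cmult[OF assms(2-4), of "- 1"] by simp

end

text \<open>Let u be the component at \<theta>, and test f z against the kernel |u|^(p - 1) w cnj
  (sgn u), truncated and multiplied by exp (- (z - \<theta>) s / p). At \<theta> the pairing is the
  truncated integral A of |u|^p w; on the sides of the strip the exponential turns w into
  \<open>w0\<close> or \<open>w1\<close>, whose norms of f are bounded. The maximum principle
  compares the two, and the truncation is removed by monotone convergence.\<close>

lemma interpolation_component_integrable:
 fixes w0 w1 :: "real ^ 'd \<Rightarrow> real"
 assumes U: "open U" and w0: "tame_weight U w0" and w1: "tame_weight U w1" and p: "1 \<le> p"
  and \<theta>: "0 < \<theta>" "\<theta> < 1"
  and f: "f \<in> calderon_functions (W1p U w0 p) (W1p_norm U w0 p) (W1p U w1 p) (W1p_norm U w1 p)"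
 shows "integrable (lebesgue_on U) (\<lambda>x. norm (jet U j (f \<theta>) x) powr p * interp_weight w0 w1 \<theta> x)"
proof -
 define w where "w = interp_weight w0 w1 \<theta>"
 have w: "tame_weight U w" unfolding w_def by (rule tame_weight_interp[OF w0 w1 \<theta>])
 have UL: "U \<in> sets lebesgue" by (rule open_sets_lebesgue[OF U])
 define s where "s x = ln (w0 x / w1 x)" for x
 have sm: "s \<in> borel_measurable (lebesgue_on U)"
  unfolding s_def[abs_def] using tame_weightD(1)[OF w0] tame_weightD(1)[OF w1] by measurable
 have ws: "w0 x = w x * exp (\<theta> * s x)" "w1 x = w x * exp ((\<theta> - 1) * s x)" if "x \<in> U" for x
  using interp_weight_exp[of w0 x w1 \<theta>, OF tame_weightD(2)[OF w0 that] tame_weightD(2)[OF w1 that]] by (simp_all add: w_def s_def)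
 let ?A0 = "W1p U w0 p" and ?A1 = "W1p U w1 p"
 let ?N0 = "W1p_norm U w0 p" and ?N1 = "W1p_norm U w1 p"
 have fV: "f z \<in> sum_space ?A0 ?A1" if "z \<in> strip" for z using f that by (auto simp: calderon_functions_def)
 obtain B0 where B0: "\<And>t. ?N0 (f (Complex 0 t)) \<le> B0" "\<And>t. f (Complex 0 t) \<in> ?A0"
  using f by (auto simp: calderon_functions_def bounded_in_def)
 obtain B1 where B1: "\<And>t. ?N1 (f (Complex 1 t)) \<le> B1" "\<And>t. f (Complex 1 t) \<in> ?A1"
  using f by (auto simp: calderon_functions_def bounded_in_def)
 define B where "B = max B0 B1"
 have "0 \<le> B" using order_trans[OF W1p_norm_nonneg B0(1)[of 0]] by (simp add: B_def)
 obtain Bs where Bs: "\<And>z. z \<in> strip \<Longrightarrow> sum_norm ?A0 ?N0 ?A1 ?N1 (f z) \<le> Bs"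
  using f by (auto simp: calderon_functions_def bounded_in_def)
 have \<theta>s: "complex_of_real \<theta> \<in> strip" using \<theta> by (simp add: strip_def)
 define u where "u = jet U j (f \<theta>)"
 have um: "u \<in> borel_measurable (lebesgue_on U)"
  unfolding u_def by (rule jet_measurable[OF U sum_space_weak_gradient[OF U fV[OF \<theta>s]]])
 obtain E where "exhaustion U E" using exhaustion_exists[OF U] by blast
 note E = exhaustionD[OF this]
 \<comment> \<open>Truncation to a compact set and to values of size at most n makes the kernel
   bounded and A finite.\<close>
 define G where "G n x \<longleftrightarrow> x \<in> E n \<and> norm (u x) \<le> real n" for n x
 define a where "a n x = (if G n x then norm (u x) powr p * w x else 0)" for n x
 have Em: "E n \<in> sets (lebesgue_on U)" for n
  using compact_sets_lebesgue[OF E(1)] E(2)[of n] by (simp add: sets_restrict_space_iff UL)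
 have nm: "(\<lambda>x. norm (u x)) \<in> borel_measurable (lebesgue_on U)"
  by (rule measurable_compose[OF um borel_measurable_norm])
 have Gm: "{x \<in> space (lebesgue_on U). G n x} \<in> sets (lebesgue_on U)" for n
 proof -
  have eq: "{x \<in> space (lebesgue_on U). G n x} = E n \<inter> {x \<in> space (lebesgue_on U). norm (u x) \<le> real n}"
   using E(2)[of n] by (auto simp: G_def space_restrict_space)
  have "{x \<in> space (lebesgue_on U). norm (u x) \<le> real n} \<in> sets (lebesgue_on U)"      using nm unfolding borel_measurable_iff_le by blast
  from sets.Int[OF Em this] show ?thesis unfolding eq .
 qed
 have upm: "(\<lambda>x. norm (u x) powr q) \<in> borel_measurable (lebesgue_on U)" for q
  by (rule measurable_compose[OF um borel_measurable_norm_powr])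
 have uwm: "(\<lambda>x. norm (u x) powr p * w x) \<in> borel_measurable (lebesgue_on U)"
  by (rule borel_measurable_times[OF upm tame_weightD(1)[OF w]])
 have key: "integrable (lebesgue_on U) (a n) \<and> (\<integral>x. a n x \<partial>lebesgue_on U) \<le> B powr p" for n
 proof -
  interpret jet_functional U w0 w1 p j "E n" using U w0 w1 p E(1,2) by unfold_locales
  obtain c C where cC: "0 < c" "\<And>x. x \<in> E n \<Longrightarrow> c \<le> w x \<and> w x \<le> C" using tame_weightD(3)[OF w E(1,2)] by meson
  obtain c0 C0 where c0: "0 < c0" "\<And>x. x \<in> E n \<Longrightarrow> c0 \<le> w0 x \<and> w0 x \<le> C0" using tame_weightD(3)[OF w0 E(1,2)] by meson
  obtain c1 C1 where c1: "0 < c1" "\<And>x. x \<in> E n \<Longrightarrow> c1 \<le> w1 x \<and> w1 x \<le> C1" using tame_weightD(3)[OF w1 E(1,2)] by meson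
  define S where "S = \<bar>ln (C0 / c1)\<bar> + \<bar>ln (c0 / C1)\<bar>"
  have sS: "\<bar>s x\<bar> \<le> S" if x: "x \<in> E n" for x
  proof -
   have h: "0 < w0 x" "0 < w1 x" "c0 \<le> w0 x" "w0 x \<le> C0" "c1 \<le> w1 x" "w1 x \<le> C1" using c0 c1 x by (auto intro: less_le_trans)
   have "w0 x / w1 x \<le> C0 / c1" "c0 / C1 \<le> w0 x / w1 x" using h c0(1) c1(1) by (auto intro!: frac_le)
   moreover have "0 < c0 / C1" using c0(1) h by auto
   ultimately have "s x \<le> ln (C0 / c1)" "ln (c0 / C1) \<le> s x"
    unfolding s_def using h by (auto intro!: ln_mono)
   then show ?thesis unfolding S_def by linarith
  qed
  \<comment> \<open>The extremal kernel: where G holds, \<open>u x * \<beta> x\<close> is |u|^p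
    w.\<close>
  define \<beta> where "\<beta> x = (if G n x then complex_of_real (norm (u x) powr (p - 1) * w x) * cnj (sgn (u x)) else 0)" for x
  have n\<beta>: "norm (\<beta> x) = (if G n x then norm (u x) powr (p - 1) * w x else 0)" if "x \<in> U" for x
   using tame_weightD(2)[OF w that] by (auto simp: \<beta>_def norm_mult norm_sgn)
  have \<beta>m: "\<beta> \<in> borel_measurable (lebesgue_on U)"
  proof -
   have m1: "(\<lambda>x. norm (u x) powr (p - 1) * w x / norm (u x)) \<in> borel_measurable (lebesgue_on U)"
    by (intro borel_measurable_divide borel_measurable_times upm tame_weightD(1)[OF w] nm)
   have "cnj \<in> borel_measurable borel"
    by (rule borel_measurable_continuous_onI[OF continuous_on_cnj[OF continuous_on_id]])
   then have m2: "(\<lambda>x. cnj (u x)) \<in> borel_measurable (lebesgue_on U)" by (rule measurable_compose[OF um])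
   have "(\<lambda>x. complex_of_real (norm (u x) powr (p - 1) * w x / norm (u x)) * cnj (u x)) \<in> borel_measurable (lebesgue_on U)"
    by (rule borel_measurable_times[OF measurable_compose[OF m1 borel_complex_of_real] m2])
   also have "(\<lambda>x. complex_of_real (norm (u x) powr (p - 1) * w x / norm (u x)) * cnj (u x)) =
     (\<lambda>x. complex_of_real (norm (u x) powr (p - 1) * w x) * cnj (sgn (u x)))"
    by (simp add: sgn_div_norm scaleR_conv_of_real divide_inverse mult.assoc)
   finally have \<beta>0: "(\<lambda>x. complex_of_real (norm (u x) powr (p - 1) * w x) * cnj (sgn (u x))) \<in> borel_measurable (lebesgue_on U)" .
   show ?thesis unfolding \<beta>_def[abs_def] by (rule measurable_If[OF \<beta>0 borel_measurable_const Gm])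
  qed
  define Pb where "Pb = real n powr (p - 1) * \<bar>C\<bar>"
  have \<beta>b: "norm (\<beta> x) \<le> Pb * indicator (E n) x" if x: "x \<in> U" for x
  proof (cases "G n x")
   case True
   then have "x \<in> E n" "norm (u x) \<le> real n" by (auto simp: G_def)
   moreover have "w x \<le> \<bar>C\<bar>" using cC(2)[OF \<open>x \<in> E n\<close>] by linarith
   ultimately show ?thesis unfolding n\<beta>[OF x] using True p tame_weightD(2)[OF w x]
    by (auto simp: Pb_def intro!: mult_mono powr_mono2)
  qed (simp add: n\<beta>[OF x] Pb_def)
  \<comment> \<open>With this sign and divisor, exp ((Re z - \<theta>) sp)^p * w equals
    \<open>w0\<close> for Re z = 0 and \<open>w1\<close> for Re z = 1.\<close>
  define sp where "sp x = - s x / p" for x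
  have spm: "sp \<in> borel_measurable (lebesgue_on U)" unfolding sp_def[abs_def]
   by (rule borel_measurable_divide[OF borel_measurable_uminus[OF sm] borel_measurable_const])
  have spS: "\<bar>sp x\<bar> \<le> S" if "x \<in> E n" for x
  proof -
   have "\<bar>s x\<bar> / p \<le> \<bar>s x\<bar>" using p by (simp add: divide_le_eq mult_le_cancel_left1)
   then show ?thesis using sS[OF that] p by (simp add: sp_def)
  qed
  define k where "k z x = \<beta> x * exp ((z - complex_of_real \<theta>) * complex_of_real (sp x))" for z :: complex and x
  have km: "k z \<in> borel_measurable (lebesgue_on U)" for z
   unfolding k_def[abs_def]
   by (rule borel_measurable_times[OF \<beta>m measurable_compose[OF spm borel_complex_exp_of_real]])
  have kn: "norm (k z x) = norm (\<beta> x) * exp ((Re z - \<theta>) * sp x)" for z x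
   by (simp add: k_def norm_mult)
  define P where "P = Pb * exp S"
  have P: "0 \<le> P" by (simp add: P_def Pb_def)
  have kk: "kernel P (k z)" if z: "z \<in> strip" for z
   unfolding kernel_def
  proof (intro conjI km ballI)
   fix x assume x: "x \<in> U"
   show "norm (k z x) \<le> P * indicator (E n) x"
   proof (cases "x \<in> E n")
    case True
    have "(Re z - \<theta>) * sp x \<le> \<bar>Re z - \<theta>\<bar> * \<bar>sp x\<bar>" by (metis abs_ge_self abs_mult)
    also have "\<dots> \<le> 1 * S" using z \<theta> spS[OF True] by (intro mult_mono) (auto simp: strip_def)
    finally have ee: "exp ((Re z - \<theta>) * sp x) \<le> exp S" by simp
    have "norm (\<beta> x) \<le> Pb" using \<beta>b[OF x] True by simp
    from mult_mono[OF this ee] have "norm (k z x) \<le> P" unfolding kn P_def by (simp add: Pb_def)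
    then show ?thesis using True by simp
   qed (use \<beta>b[OF x] in \<open>simp add: kn\<close>)
  qed
  have \<beta>k: "kernel Pb \<beta>" using \<beta>m \<beta>b by (simp add: kernel_def)
  have Pb: "0 \<le> Pb" by (simp add: Pb_def)
  obtain Cn where Cn0: "0 \<le> Cn" "\<forall>v k P. v \<in> V \<longrightarrow> kernel P k \<longrightarrow> 0 \<le> P \<longrightarrow> norm (pairing k v) \<le> P * Cn * sn v"
   using pairing_bound_ex by (elim exE conjE)
  have Cn: "0 \<le> Cn" "\<And>v k P. v \<in> V \<Longrightarrow> kernel P k \<Longrightarrow> 0 \<le> P \<Longrightarrow> norm (pairing k v) \<le> P * Cn * sn v"
   using Cn0 by blast+
  define h where "h z = pairing (k z) (f z)" for z
  have ent: "((\<lambda>z. pairing (k z) v) has_field_derivative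
    (\<integral>x. (jet U j v x * \<beta> x) * (complex_of_real (sp x) * exp ((z - complex_of_real \<theta>) * complex_of_real (sp x))) \<partial>lebesgue_on U)) (at z)"
   if v: "v \<in> V" for v z
  proof -
   have sb: "\<bar>sp x\<bar> \<le> S" if "x \<in> space (lebesgue_on U)" "jet U j v x * \<beta> x \<noteq> 0" for x
   proof -
    have "\<beta> x \<noteq> 0" using that by auto
    then have "x \<in> E n" by (auto simp: \<beta>_def G_def split: if_splits)
    then show ?thesis by (rule spS)
   qed
   have "((\<lambda>w. \<integral>x. (jet U j v x * \<beta> x) * exp ((w - complex_of_real \<theta>) * complex_of_real (sp x)) \<partial>lebesgue_on U) has_field_derivative
    (\<integral>x. (jet U j v x * \<beta> x) * (complex_of_real (sp x) * exp ((z - complex_of_real \<theta>) * complex_of_real (sp x))) \<partial>lebesgue_on U)) (at z)"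
    by (rule has_field_derivative_integral_exp(1)[OF pairing_integrable[OF v \<beta>k Pb] spm sb])
   then show ?thesis by (simp add: k_def mult.assoc)
  qed
  have entc: "(\<lambda>z. pairing (k z) v) \<midarrow>z\<rightarrow> pairing (k z) v" if "v \<in> V" for v z
   using DERIV_isCont[OF ent[OF that]] by (simp add: isCont_def)
  have hb: "norm (h z) \<le> P * Cn * \<bar>Bs\<bar>" if z: "z \<in> strip" for z
  proof -
   have "norm (h z) \<le> P * Cn * sn (f z)" unfolding h_def by (rule Cn(2)[OF fV[OF z] kk[OF z] P])
   also have "\<dots> \<le> P * Cn * \<bar>Bs\<bar>" using Bs[OF z] P Cn(1) by (intro mult_left_mono) auto
   finally show ?thesis .
  qed
  \<comment> \<open>The increment splits into the moved function against the moved kernel, which the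
    sum norm controls uniformly in the kernel, and the fixed function f z against the moved
    kernel.\<close>
  have hcont: "continuous_on strip h"
   unfolding continuous_on_def
  proof
   fix z assume z: "z \<in> strip"
   have "((\<lambda>w. h w - pairing (k w) (f z)) \<longlongrightarrow> 0) (at z within strip)"
   proof (rule Lim_null_comparison)
    have "continuous_in sn strip f" using f by (simp add: calderon_functions_def)
    then have "((\<lambda>w. sn (\<lambda>x. f w x - f z x)) \<longlongrightarrow> 0) (at z within strip)" using z by (simp add: continuous_in_def)
    from tendsto_mult[OF tendsto_const this, of "P * Cn"]
    show "((\<lambda>w. P * Cn * sn (\<lambda>x. f w x - f z x)) \<longlongrightarrow> 0) (at z within strip)" by simp
    show "\<forall>\<^sub>F w in at z within strip. norm (h w - pairing (k w) (f z)) \<le> P * Cn * sn (\<lambda>x. f w x - f z x)"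
     unfolding eventually_at_filter
    proof (intro always_eventually allI impI)
     fix w assume w: "w \<in> strip"
     have "h w - pairing (k w) (f z) = pairing (k w) (\<lambda>x. f w x - f z x)"
      unfolding h_def by (rule pairing_diff[OF fV[OF w] fV[OF z] kk[OF w] P, symmetric])
     then show "norm (h w - pairing (k w) (f z)) \<le> P * Cn * sn (\<lambda>x. f w x - f z x)"
      using Cn(2)[OF V_diff[OF fV[OF w] fV[OF z]] kk[OF w] P] by simp
    qed
   qed
   moreover have "((\<lambda>w. pairing (k w) (f z)) \<longlongrightarrow> pairing (k z) (f z)) (at z within strip)"
    using entc[OF fV[OF z]] by (rule tendsto_within_subset) auto
   ultimately have "((\<lambda>w. (h w - pairing (k w) (f z)) + pairing (k w) (f z)) \<longlongrightarrow> 0 + pairing (k z) (f z)) (at z within strip)"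
    by (rule tendsto_add)
   then show "(h \<longlongrightarrow> h z) (at z within strip)" by (simp add: h_def[abs_def])
  qed
  have hhol: "h holomorphic_on interior strip"
   unfolding holomorphic_on_def
  proof
   fix z assume zi: "z \<in> interior strip"
   then have z: "z \<in> strip" using interior_subset by blast
   have "analytic_in V sn (interior strip) f" using f by (simp add: calderon_functions_def)
   then obtain D where D: "D \<in> V" "((\<lambda>w. sn (\<lambda>x. (f w x - f z x) / (w - z) - D x)) \<longlongrightarrow> 0) (at z)"
    using zi unfolding analytic_in_def by blast
   let ?H = "\<integral>x. (jet U j (f z) x * \<beta> x) * (complex_of_real (sp x) * exp ((z - complex_of_real \<theta>) * complex_of_real (sp x))) \<partial>lebesgue_on U"
   have ev: "\<forall>\<^sub>F w in at z. w \<in> strip \<and> w \<noteq> z"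
    using eventually_at_in_open[OF open_interior zi] by eventually_elim (use interior_subset in blast)
   \<comment> \<open>Product rule: the quotient of f is paired with the moving kernel, the quotient
     of the kernel with f z. The first is compared with its limit \<open>D\<close> in the sum
     norm.\<close>
   have "((\<lambda>w. (h w - h z) / (w - z)) \<longlongrightarrow> 0 + pairing (k z) D + ?H) (at z)"
   proof (rule Lim_transform_eventually)
    show "((\<lambda>w. pairing (k w) (\<lambda>x. (f w x - f z x) / (w - z) - D x) + pairing (k w) D + (pairing (k w) (f z) - pairing (k z) (f z)) / (w - z)) \<longlongrightarrow> 0 + pairing (k z) D + ?H) (at z)"
    proof (intro tendsto_add entc D(1))
     show "((\<lambda>w. (pairing (k w) (f z) - pairing (k z) (f z)) / (w - z)) \<longlongrightarrow> ?H) (at z)"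
      using ent[OF fV[OF z], of z] unfolding has_field_derivative_iff .
     show "((\<lambda>w. pairing (k w) (\<lambda>x. (f w x - f z x) / (w - z) - D x)) \<longlongrightarrow> 0) (at z)"
     proof (rule Lim_null_comparison)
      from tendsto_mult[OF tendsto_const D(2), of "P * Cn"]
      show "((\<lambda>w. P * Cn * sn (\<lambda>x. (f w x - f z x) / (w - z) - D x)) \<longlongrightarrow> 0) (at z)" by simp
      show "\<forall>\<^sub>F w in at z. norm (pairing (k w) (\<lambda>x. (f w x - f z x) / (w - z) - D x)) \<le> P * Cn * sn (\<lambda>x. (f w x - f z x) / (w - z) - D x)"
       using ev
      proof eventually_elim
       fix w assume w: "w \<in> strip \<and> w \<noteq> z"
       have "(\<lambda>x. (1 / (w - z)) * (f w x - f z x)) \<in> V" using w by (intro V_cmult V_diff fV z) auto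
       then have "(\<lambda>x. (f w x - f z x) / (w - z) - D x) \<in> V" using D(1) by (intro V_diff) simp_all
       then show "norm (pairing (k w) (\<lambda>x. (f w x - f z x) / (w - z) - D x)) \<le> P * Cn * sn (\<lambda>x. (f w x - f z x) / (w - z) - D x)"
        using kk w P by (intro Cn(2)) auto
      qed
     qed
    qed
    show "\<forall>\<^sub>F w in at z. pairing (k w) (\<lambda>x. (f w x - f z x) / (w - z) - D x) + pairing (k w) D + (pairing (k w) (f z) - pairing (k z) (f z)) / (w - z) = (h w - h z) / (w - z)"
     using ev
    proof eventually_elim
     fix w assume w: "w \<in> strip \<and> w \<noteq> z"
     then have kw: "kernel P (k w)" and fw: "f w \<in> V" using kk fV by auto
     have q: "(\<lambda>x. (f w x - f z x) / (w - z)) \<in> V" using V_cmult[OF V_diff[OF fw fV[OF z]], of "1 / (w - z)"] by simp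
     have "pairing (k w) (\<lambda>x. (f w x - f z x) / (w - z) - D x) + pairing (k w) D = pairing (k w) (\<lambda>x. (f w x - f z x) / (w - z))"
      using pairing_diff[OF q D(1) kw P] by simp
     also have "\<dots> = (pairing (k w) (f w) - pairing (k w) (f z)) / (w - z)"
      using pairing_cmult[OF V_diff[OF fw fV[OF z]] kw P, of "1 / (w - z)"] pairing_diff[OF fw fV[OF z] kw P] by simp
     finally show "pairing (k w) (\<lambda>x. (f w x - f z x) / (w - z) - D x) + pairing (k w) D + (pairing (k w) (f z) - pairing (k z) (f z)) / (w - z) = (h w - h z) / (w - z)"
      by (simp add: h_def add_divide_distrib[symmetric])
    qed
   qed
   then have "(h has_field_derivative (0 + pairing (k z) D + ?H)) (at z)" unfolding has_field_derivative_iff .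
   then show "h field_differentiable (at z within interior strip)"
    using field_differentiable_def field_differentiable_at_within by blast
  qed
  have ai: "integrable (lebesgue_on U) (a n)" and hA: "h \<theta> = complex_of_real (\<integral>x. a n x \<partial>lebesgue_on U)"
  proof -
   have e: "jet U j (f \<theta>) x * k \<theta> x = complex_of_real (a n x)" for x
   proof (cases "G n x")
    case True
    have "u x * cnj (sgn (u x)) = complex_of_real (norm (u x))"
    proof -
     have "u x * cnj (sgn (u x)) = (u x * cnj (u x)) / complex_of_real (norm (u x))"
      by (simp add: sgn_div_norm scaleR_conv_of_real divide_inverse mult.commute)
     also have "\<dots> = complex_of_real ((norm (u x))\<^sup>2) / complex_of_real (norm (u x))"
      by (simp only: complex_norm_square)
     finally show ?thesis by (simp add: power2_eq_square)
    qed
    then have "u x * \<beta> x = complex_of_real (norm (u x) powr (p - 1) * w x) * complex_of_real (norm (u x))"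
     using True by (simp add: \<beta>_def)
    also have "\<dots> = complex_of_real (norm (u x) powr p * w x)"
    proof -
     have "norm (u x) powr (p - 1) * norm (u x) = norm (u x) powr p"
      using p by (cases "u x = 0") (auto simp: powr_diff)
     then show ?thesis by (metis mult.assoc mult.commute of_real_mult)
    qed
    finally show ?thesis using True by (simp add: k_def a_def u_def)
   qed (simp add: k_def a_def \<beta>_def)
   have "integrable (lebesgue_on U) (\<lambda>x. complex_of_real (a n x))"
    using pairing_integrable[OF fV[OF \<theta>s] kk[OF \<theta>s] P] by (simp add: e)
   then show "integrable (lebesgue_on U) (a n)" by (simp add: complex_of_real_integrable_eq)
   show "h \<theta> = complex_of_real (\<integral>x. a n x \<partial>lebesgue_on U)"
    by (simp add: h_def e integral_complex_of_real)
  qed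
  define A where "A = (\<integral>x. a n x \<partial>lebesgue_on U)"
  have an0: "0 \<le> a n x" if "x \<in> U" for x using tame_weightD(2)[OF w that] by (simp add: a_def)
  have A0: "0 \<le> A" unfolding A_def by (intro integral_nonneg_AE) (simp add: AE_lebesgue_on_iff[OF UL] an0)
  \<comment> \<open>\<open>young_powr\<close> is used with the exponential attached to v and with b
    = |u|: the first term becomes the integral of |v|^p against \<open>W\<close>, the second a
    multiple of \<open>A\<close>.\<close>
  have bdry: "norm (pairing (k z) v) \<le> B powr p / p + (1 - 1 / p) * A"
   if W: "tame_weight U W" and v: "v \<in> W1p U W p" "W1p_norm U W p v \<le> B" and vV: "v \<in> V" and zs: "z \<in> strip"
    and Wz: "\<And>x. x \<in> U \<Longrightarrow> exp ((Re z - \<theta>) * sp x) powr p * w x = W x" for W v z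
  proof -
   have int: "integrable (lebesgue_on U) (\<lambda>x. jet U j v x * k z x)" by (rule pairing_integrable[OF vV kk[OF zs] P])
   have "norm (pairing (k z) v) \<le> (\<integral>x. norm (jet U j v x * k z x) \<partial>lebesgue_on U)" by (rule integral_norm_bound)
   also have "\<dots> \<le> (\<integral>x. (1 / p) * (norm (jet U j v x) powr p * W x) + (1 - 1 / p) * a n x \<partial>lebesgue_on U)"
   proof (rule integral_mono_AE[OF integrable_norm[OF int]])
    show "integrable (lebesgue_on U) (\<lambda>x. (1 / p) * (norm (jet U j v x) powr p * W x) + (1 - 1 / p) * a n x)"
     by (intro Bochner_Integration.integrable_add integrable_mult_right jet_W1p(1)[OF U W v(1) p] ai)
    show "AE x in lebesgue_on U. norm (jet U j v x * k z x) \<le> (1 / p) * (norm (jet U j v x) powr p * W x) + (1 - 1 / p) * a n x"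
     unfolding AE_lebesgue_on_iff[OF UL]
    proof (intro AE_I2 impI)
     fix x assume x: "x \<in> U"
     show "norm (jet U j v x * k z x) \<le> (1 / p) * (norm (jet U j v x) powr p * W x) + (1 - 1 / p) * a n x"
     proof (cases "G n x")
      case True
      let ?e = "exp ((Re z - \<theta>) * sp x)"
      have "norm (jet U j v x * k z x) = (norm (jet U j v x) * ?e * norm (u x) powr (p - 1)) * w x"
       using True by (simp add: norm_mult kn n\<beta>[OF x])
      also have "\<dots> \<le> ((norm (jet U j v x) * ?e) powr p / p + (1 - 1 / p) * norm (u x) powr p) * w x"
       using p tame_weightD(2)[OF w x] by (intro mult_right_mono young_powr) auto
      also have "\<dots> = (1 / p) * (norm (jet U j v x) powr p * (?e powr p * w x)) + (1 - 1 / p) * a n x"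
       using True by (simp add: powr_mult a_def algebra_simps)
      finally show ?thesis by (simp add: Wz[OF x])
     next
      case False
      then have "norm (jet U j v x * k z x) = 0" unfolding norm_mult kn n\<beta>[OF x] by simp
      moreover have "0 \<le> (1 / p) * (norm (jet U j v x) powr p * W x) + (1 - 1 / p) * a n x"
       using p tame_weightD(2)[OF W x] an0[OF x] by (intro add_nonneg_nonneg mult_nonneg_nonneg) auto
      ultimately show ?thesis by (simp only:)
     qed
    qed
   qed
   also have "\<dots> = (1 / p) * (\<integral>x. norm (jet U j v x) powr p * W x \<partial>lebesgue_on U) + (1 - 1 / p) * A"
    unfolding A_def by (subst Bochner_Integration.integral_add[OF integrable_mult_right[OF jet_W1p(1)[OF U W v(1) p]] integrable_mult_right[OF ai]]) simp
   also have "\<dots> \<le> (1 / p) * B powr p + (1 - 1 / p) * A"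
   proof (intro add_right_mono mult_left_mono)
    have "(\<integral>x. norm (jet U j v x) powr p * W x \<partial>lebesgue_on U) \<le> W1p_norm U W p v powr p" by (rule jet_W1p(2)[OF U W v(1) p])
    also have "\<dots> \<le> B powr p" using v(2) p by (intro powr_mono2 W1p_norm_nonneg) auto
    finally show "(\<integral>x. norm (jet U j v x) powr p * W x \<partial>lebesgue_on U) \<le> B powr p" .
   qed (use p in simp)
   finally show ?thesis by simp
  qed
  have e0: "exp ((0 - \<theta>) * sp x) powr p * w x = w0 x" "exp ((1 - \<theta>) * sp x) powr p * w x = w1 x" if x: "x \<in> U" for x
   unfolding ws[OF x] using p by (simp_all add: sp_def exp_powr_real field_simps)
  have "norm (h \<theta>) \<le> B powr p / p + (1 - 1 / p) * A"
  proof (rule strip_maximum_principle[OF hhol hcont hb _ _ \<theta>s])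
   fix t
   have st: "Complex 0 t \<in> strip" "Complex 1 t \<in> strip" by (auto simp: strip_def)
   show "norm (h (Complex 0 t)) \<le> B powr p / p + (1 - 1 / p) * A" unfolding h_def
   proof (rule bdry[OF w0 B0(2) _ fV[OF st(1)] st(1)])
    show "W1p_norm U w0 p (f (Complex 0 t)) \<le> B" using B0(1)[of t] by (simp add: B_def)
   qed (use e0(1) in simp)
   show "norm (h (Complex 1 t)) \<le> B powr p / p + (1 - 1 / p) * A" unfolding h_def
   proof (rule bdry[OF w1 B1(2) _ fV[OF st(2)] st(2)])
    show "W1p_norm U w1 p (f (Complex 1 t)) \<le> B" using B1(1)[of t] by (simp add: B_def)
   qed (use e0(2) in simp)
  qed
  moreover have "norm (h \<theta>) = A" unfolding hA using A0 by (simp add: A_def[symmetric])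
  \<comment> \<open>As A is finite, its multiple on the right can be absorbed; the resulting bound
    B^p no longer depends on n.\<close>
  ultimately have "A \<le> B powr p / p + (1 - 1 / p) * A" by simp
  then have "A / p \<le> B powr p / p" by (simp add: left_diff_distrib)
  then have "A \<le> B powr p" using p by (simp add: divide_le_cancel)
  then show ?thesis using ai by (simp add: A_def)
 qed
 have am0: "0 \<le> a n x" if "x \<in> U" for n x using tame_weightD(2)[OF w that] by (simp add: a_def)
 have EE: "E m \<subseteq> E n" if "m \<le> n" for m n
  using that by (induction rule: dec_induct) (use E(3) interior_subset in blast)+
 have mono: "a m x \<le> a n x" if "m \<le> n" "x \<in> U" for m n x
 proof -
  have "real m \<le> real n" using that(1) by simp
  then have "G n x" if "G m x" using that EE[OF \<open>m \<le> n\<close>] unfolding G_def by auto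
  then show ?thesis using am0[OF that(2), of n] by (cases "G m x"; cases "G n x") (auto simp: a_def)
 qed
 have lim: "(\<lambda>n. a n x) \<longlonglongrightarrow> norm (u x) powr p * w x" if x: "x \<in> U" for x
 proof (rule tendsto_eventually)
  obtain N where N: "x \<in> E N" using x unfolding E(4)[symmetric] by blast
  show "\<forall>\<^sub>F n in sequentially. a n x = norm (u x) powr p * w x"
   using eventually_ge_at_top[of "max N (nat \<lceil>norm (u x)\<rceil>)"]
  proof eventually_elim
   fix n assume n: "max N (nat \<lceil>norm (u x)\<rceil>) \<le> n"
   then have "x \<in> E n" using EE[of N n] N by auto
   moreover have "norm (u x) \<le> real n" using n by linarith
   ultimately show "a n x = norm (u x) powr p * w x" by (simp add: a_def G_def)
  qed
 qed
 have "incseq (\<lambda>n. \<integral>x. a n x \<partial>lebesgue_on U)"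
  unfolding incseq_def
  by (intro allI impI integral_mono_AE) (use key mono in \<open>auto simp: AE_lebesgue_on_iff[OF UL]\<close>)
 then obtain L where "(\<lambda>n. \<integral>x. a n x \<partial>lebesgue_on U) \<longlonglongrightarrow> L"
  using incseq_convergent[of "\<lambda>n. \<integral>x. a n x \<partial>lebesgue_on U" "B powr p"] key by blast
 then have "integrable (lebesgue_on U) (\<lambda>x. norm (u x) powr p * w x)"
 proof (rule integrable_monotone_convergence[rotated 3])
  show "integrable (lebesgue_on U) (a n)" for n using key by blast
  show "AE x in lebesgue_on U. mono (\<lambda>n. a n x)" by (auto simp: AE_lebesgue_on_iff[OF UL] mono_def intro: mono)
  show "AE x in lebesgue_on U. (\<lambda>n. a n x) \<longlonglongrightarrow> norm (u x) powr p * w x" by (auto simp: AE_lebesgue_on_iff[OF UL] intro: lim)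
  show "(\<lambda>x. norm (u x) powr p * w x) \<in> borel_measurable (lebesgue_on U)" by (rule uwm)
 qed
 then show ?thesis by (simp add: u_def w_def)
qed

lemma complex_interpolation_subset_W1p:
 fixes w0 w1 :: "real ^ 'd \<Rightarrow> real"
 assumes U: "open U" and w0: "tame_weight U w0" and w1: "tame_weight U w1" and p: "1 \<le> p"
  and \<theta>: "0 < \<theta>" "\<theta> < 1"
 shows "complex_interpolation (W1p U w0 p) (W1p_norm U w0 p) (W1p U w1 p) (W1p_norm U w1 p) \<theta>
  \<subseteq> W1p U (interp_weight w0 w1 \<theta>) p"
proof
 fix \<phi> assume "\<phi> \<in> complex_interpolation (W1p U w0 p) (W1p_norm U w0 p) (W1p U w1 p) (W1p_norm U w1 p) \<theta>"
 then obtain f where f: "f \<in> calderon_functions (W1p U w0 p) (W1p_norm U w0 p) (W1p U w1 p) (W1p_norm U w1 p)"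
  and \<phi>: "\<phi> = f \<theta>" by (auto simp: complex_interpolation_def)
 have "complex_of_real \<theta> \<in> strip" using \<theta> by (simp add: strip_def)
 then have "\<phi> \<in> sum_space (W1p U w0 p) (W1p U w1 p)" using f by (auto simp: \<phi> calderon_functions_def)
 from sum_space_weak_gradient[OF U this]
 show "\<phi> \<in> W1p U (interp_weight w0 w1 \<theta>) p"
 proof (rule W1pI[OF U tame_weight_interp[OF w0 w1 \<theta>]])
  show "integrable (lebesgue_on U) (\<lambda>x. norm (\<phi> x) powr p * interp_weight w0 w1 \<theta> x)"
   using interpolation_component_integrable[OF U w0 w1 p \<theta> f, of None] by (simp add: jet_simps \<phi>)
  show "integrable (lebesgue_on U) (\<lambda>x. norm (weak_gradient U \<phi> x $ i) powr p * interp_weight w0 w1 \<theta> x)" for i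
   using interpolation_component_integrable[OF U w0 w1 p \<theta> f, of "Some i"] by (simp add: jet_simps \<phi>)
 qed
qed

section \<open>Complex interpolation: the lower inclusion\<close>

lemma weighted_dominated_tendsto_0:
 fixes F :: "nat \<Rightarrow> 'a \<Rightarrow> complex"
 assumes m: "\<And>n. (\<lambda>x. norm (F n x) powr p * w x) \<in> borel_measurable M" and w: "AE x in M. 0 \<le> w x" and p: "0 < p"
  and H: "integrable M H" "\<And>n. AE x in M. norm (F n x) powr p * w x \<le> H x" and lim: "\<And>x. (\<lambda>n. F n x) \<longlonglongrightarrow> 0"
 shows "\<And>n. integrable M (\<lambda>x. norm (F n x) powr p * w x)" "(\<lambda>n. \<integral>x. norm (F n x) powr p * w x \<partial>M) \<longlonglongrightarrow> 0"
proof -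
 have le: "AE x in M. norm (norm (F n x) powr p * w x) \<le> H x" for n
  using H(2)[of n] w by eventually_elim (simp add: abs_mult)
 then have "AE x in M. norm (norm (F n x) powr p * w x) \<le> norm (H x)" for n
  using le[of n] unfolding real_norm_def by eventually_elim (rule order_trans[OF _ abs_ge_self])
 then show "integrable M (\<lambda>x. norm (F n x) powr p * w x)" for n
  by (intro Bochner_Integration.integrable_bound[OF H(1) m])
 have "(\<lambda>n. \<integral>x. norm (F n x) powr p * w x \<partial>M) \<longlonglongrightarrow> (\<integral>x. 0 \<partial>M)"
 proof (rule integral_dominated_convergence[OF _ m H(1) AE_I2 le])
  show "(\<lambda>n. norm (F n x) powr p * w x) \<longlonglongrightarrow> 0" for x
   using tendsto_mult[OF tendsto_norm_powr_0[OF lim[of x] p] tendsto_const[of "w x"]] by simp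
 qed simp
 then show "(\<lambda>n. \<integral>x. norm (F n x) powr p * w x \<partial>M) \<longlonglongrightarrow> 0" by simp
qed

text \<open>On a compact set the ratio stays above a positive constant a, and the logarithm has
  Lipschitz constant 1 / a beyond it.\<close>

lemma locally_lipschitz_ln_ratio:
 assumes w0: "tame_weight U w0" and w1: "tame_weight U w1" and r: "locally_lipschitz U (\<lambda>x. w0 x / w1 x)"
 shows "locally_lipschitz U (\<lambda>x. ln (w0 x / w1 x))"
 unfolding locally_lipschitz_def
proof (intro allI impI)
 fix K assume K: "compact K \<and> K \<subseteq> U"
 obtain L where L: "L-lipschitz_on K (\<lambda>x. w0 x / w1 x)" using r K by (auto simp: locally_lipschitz_def)
 obtain c0 C0 where c0: "0 < c0" "\<And>x. x \<in> K \<Longrightarrow> c0 \<le> w0 x \<and> w0 x \<le> C0" using K tame_weightD(3)[OF w0] by meson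
 obtain c1 C1 where c1: "0 < c1" "\<And>x. x \<in> K \<Longrightarrow> c1 \<le> w1 x \<and> w1 x \<le> C1" using K tame_weightD(3)[OF w1] by meson
 \<comment> \<open>The absolute value and the summand 1 keep the denominator positive whatever
   \<open>C1\<close> is, in particular when \<open>K\<close> is empty.\<close>
 define a where "a = c0 / (\<bar>C1\<bar> + 1)"
 have a: "0 < a" using c0(1) by (simp add: a_def add_nonneg_pos)
 have ra: "a \<le> w0 x / w1 x" if "x \<in> K" for x
  unfolding a_def using c0(1) c0(2)[OF that] c1(1) c1(2)[OF that] by (intro frac_le) auto
 have one: "ln u - ln v \<le> \<bar>u - v\<bar> / a" if "a \<le> u" "a \<le> v" for u v :: real
 proof -
  have "ln u - ln v \<le> (u - v) / v" using a that by (intro ln_diff_le) auto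
  also have "\<dots> \<le> \<bar>u - v\<bar> / v" using a that by (intro divide_right_mono) auto
  also have "\<dots> \<le> \<bar>u - v\<bar> / a" using a that by (intro divide_left_mono) auto
  finally show ?thesis .
 qed
 have L0: "0 \<le> L" using L lipschitz_on_nonneg by blast
 have "(L / a)-lipschitz_on K (\<lambda>x. ln (w0 x / w1 x))"
 proof (rule lipschitz_onI)
  fix x y assume xy: "x \<in> K" "y \<in> K"
  have "\<bar>ln (w0 x / w1 x) - ln (w0 y / w1 y)\<bar> \<le> \<bar>w0 x / w1 x - w0 y / w1 y\<bar> / a"
   using one[OF ra[OF xy(1)] ra[OF xy(2)]] one[OF ra[OF xy(2)] ra[OF xy(1)]]
   by (simp add: abs_le_iff abs_minus_commute)
  also have "\<dots> \<le> (L * dist x y) / a"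
   using lipschitz_onD[OF L xy] a by (intro divide_right_mono) (auto simp: dist_real_def)
  finally show "dist (ln (w0 x / w1 x)) (ln (w0 y / w1 y)) \<le> L / a * dist x y" by (simp add: dist_real_def)
 qed (use a L0 in simp)
 then show "\<exists>L. L-lipschitz_on K (\<lambda>x. ln (w0 x / w1 x))" by blast
qed

text \<open>A bound on a multiplier \<open>m\<close> of \<open>ln (w0 / w1)\<close> and its derivative which makes multiplication
 bounded from the space with weight \<open>w\<close> to the one with weight \<open>w (w0 / w1) powr \<kappa>\<close>.\<close>

definition multiplier :: "real \<Rightarrow> real \<Rightarrow> real \<Rightarrow> (real \<Rightarrow> complex) \<Rightarrow> (real \<Rightarrow> complex) \<Rightarrow> bool" where
 "multiplier p \<kappa> C m m' \<longleftrightarrow> (\<forall>t. (m has_vector_derivative m' t) (at t)) \<and> continuous_on UNIV m' \<and>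
   (\<forall>t. exp (\<kappa> * t / p) * norm (m t) \<le> C) \<and> (\<forall>t. exp (\<kappa> * t / p) * norm (m' t) \<le> C)"

section \<open>Multiplication by functions of the logarithmic weight ratio\<close>

locale interpolation_pair =
 fixes U :: "(real ^ 'd) set" and w0 w1 :: "real ^ 'd \<Rightarrow> real" and p \<theta> :: real
 assumes U: "open U" and w0: "tame_weight U w0" and w1: "tame_weight U w1"
  and r: "locally_lipschitz U (\<lambda>x. w0 x / w1 x)" and p: "1 \<le> p" and \<theta>: "0 < \<theta>" "\<theta> < 1"
begin

abbreviation "w \<equiv> interp_weight w0 w1 \<theta>"
abbreviation "V \<equiv> abs_grad_log_ratio U w0 w1"
definition s where "s x = ln (w0 x / w1 x)"
text \<open>The i-th partial derivative of \<open>\<phi> x * m (s x)\<close> by the product rule.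
  The gradient of the real function \<open>s\<close> is stored as a complex vector, hence the real
  part.\<close>

abbreviation mult_grad where
 "mult_grad \<phi> \<sigma> m m' i x \<equiv> weak_gradient U \<phi> x $ i * m (s x) + \<phi> x * (complex_of_real (Re (\<sigma> x $ i)) * m' (s x))"

lemma UL: "U \<in> sets lebesgue" by (rule open_sets_lebesgue[OF U])
lemma w: "tame_weight U w" by (rule tame_weight_interp[OF w0 w1 \<theta>])
lemma wm: "w \<in> borel_measurable (lebesgue_on U)" by (rule tame_weightD(1)[OF w])
lemma w_pos: "x \<in> U \<Longrightarrow> 0 < w x" by (rule tame_weightD(2)[OF w])
lemma p0: "0 < p" "0 \<le> p" using p by auto

lemma s_lip: "locally_lipschitz U s"
 using locally_lipschitz_ln_ratio[OF w0 w1 r] by (simp add: s_def[abs_def])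

lemma s_bounded: "compact K \<Longrightarrow> K \<subseteq> U \<Longrightarrow> \<exists>B. \<forall>x\<in>K. \<bar>s x\<bar> \<le> B"
proof -
 assume K: "compact K" "K \<subseteq> U"
 obtain L where "L-lipschitz_on K s" using s_lip K by (auto simp: locally_lipschitz_def)
 then have "continuous_on K s" by (rule lipschitz_on_continuous_on)
 then have "bounded (s ` K)" using K(1) compact_continuous_image compact_imp_bounded by blast
 then show ?thesis by (auto simp: bounded_iff)
qed

text \<open>\<open>V\<close> is defined through the selected gradient; here it is tied to a
  representative that is bounded on compact sets.\<close>

lemma grad_s:
 obtains \<sigma> where "has_weak_gradient U (\<lambda>x. complex_of_real (s x)) \<sigma>"
  "\<And>K. compact K \<Longrightarrow> K \<subseteq> U \<Longrightarrow> \<exists>B. \<forall>x\<in>K. \<forall>i. norm (\<sigma> x $ i) \<le> B"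
  "AE x in lebesgue_on U. V x = norm (\<sigma> x)"
proof -
 obtain \<sigma> where \<sigma>: "has_weak_gradient U (\<lambda>x. complex_of_real (s x)) \<sigma>"
  and b: "\<And>K. compact K \<Longrightarrow> K \<subseteq> U \<Longrightarrow> \<exists>B. \<forall>x\<in>K. \<forall>i. norm (\<sigma> x $ i) \<le> B"
  using has_weak_gradient_locally_lipschitz[OF U s_lip] by blast
 have "AE x in lebesgue_on U. V x = norm (\<sigma> x)"
  using weak_gradient_AE(2)[OF U \<sigma>] by eventually_elim (simp add: abs_grad_log_ratio_def s_def)
 then show ?thesis using that \<sigma> b by blast
qed

lemma V_nonneg: "0 \<le> V x" by (simp add: abs_grad_log_ratio_def)

lemma V_measurable: "V \<in> borel_measurable (lebesgue_on U)"
proof (rule grad_s)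
 fix \<sigma> assume "has_weak_gradient U (\<lambda>x. complex_of_real (s x)) \<sigma>"
 from weak_gradient_AE(1)[OF U this]
 have "locally_integrable U (weak_gradient U (\<lambda>x. complex_of_real (s x)))" by (simp add: has_weak_gradient_def)
 from measurable_compose[OF locally_integrable_measurable[OF U this] borel_measurable_norm]
 show ?thesis by (simp add: abs_grad_log_ratio_def[abs_def] s_def[abs_def])
qed

lemma calW_iff:
 "\<phi> \<in> calW U \<theta> w0 w1 p \<longleftrightarrow> \<phi> \<in> W1p U w p \<and> integrable (lebesgue_on U) (\<lambda>x. norm (\<phi> x) powr p * V x powr p * w x)"
proof (cases "\<phi> \<in> W1p U w p")
 case True
 have \<phi>m: "\<phi> \<in> borel_measurable (lebesgue_on U)" by (rule W1pD(2)[OF U w True])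
 have "(\<lambda>x. \<phi> x * complex_of_real (V x)) \<in> borel_measurable (lebesgue_on U)"
  by (intro borel_measurable_times \<phi>m measurable_compose[OF V_measurable borel_complex_of_real])
 then have "(\<lambda>x. (vec (\<phi> x * complex_of_real (V x)) :: complex ^ 1)) \<in> borel_measurable (lebesgue_on U)"
  by (intro borel_measurable_vec_componentwise) simp
 then show ?thesis using True V_nonneg
  by (simp add: calW_def Lp_scalar_def Lp_space_def norm_mult powr_mult)
qed (simp add: calW_def)

lemma calWD:
 assumes "\<phi> \<in> calW U \<theta> w0 w1 p"
 shows "\<phi> \<in> W1p U w p" "integrable (lebesgue_on U) (\<lambda>x. norm (\<phi> x) powr p * V x powr p * w x)"
 using assms by (simp_all add: calW_iff)

lemma calW_diff:
 assumes "\<phi> \<in> calW U \<theta> w0 w1 p" "\<psi> \<in> calW U \<theta> w0 w1 p"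
 shows "(\<lambda>x. \<phi> x - \<psi> x) \<in> calW U \<theta> w0 w1 p"
proof -
 note a = calWD[OF assms(1)] and b = calWD[OF assms(2)]
 have m: "(\<lambda>x. V x powr p * w x) \<in> borel_measurable (lebesgue_on U)" using V_measurable wm by measurable
 have "integrable (lebesgue_on U) (\<lambda>x. norm (\<phi> x + (- 1) * \<psi> x) powr p * (V x powr p * w x))"
  by (rule integrable_weighted_add[OF _ _ m p0(2)])
    (use a b W1pD(2)[OF U w a(1)] W1pD(2)[OF U w b(1)] in \<open>auto simp: mult.assoc\<close>)
 then show ?thesis using W1p_diff[OF U w p0(2) a(1) b(1)] by (simp add: calW_iff mult.assoc)
qed

lemma calW_norm_powr:
 assumes "\<phi> \<in> calW U \<theta> w0 w1 p"
 shows "calW_norm U \<theta> w0 w1 p \<phi> powr p =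
  energy U w p \<phi> (weak_gradient U \<phi>) + (\<integral>x. norm (\<phi> x) powr p * V x powr p * w x \<partial>lebesgue_on U)"
  "0 \<le> (\<integral>x. norm (\<phi> x) powr p * V x powr p * w x \<partial>lebesgue_on U)"
proof -
 show nn: "0 \<le> (\<integral>x. norm (\<phi> x) powr p * V x powr p * w x \<partial>lebesgue_on U)"
  using w_pos by (intro integral_nonneg_AE) (auto simp: AE_lebesgue_on_iff[OF UL] less_imp_le)
 have e: "W1p_norm U w p \<phi> powr p = energy U w p \<phi> (weak_gradient U \<phi>)"
  by (rule W1p_norm_powr[OF U w W1pD(1)[OF U w calWD(1)[OF assms]] p])
 show "calW_norm U \<theta> w0 w1 p \<phi> powr p =
  energy U w p \<phi> (weak_gradient U \<phi>) + (\<integral>x. norm (\<phi> x) powr p * V x powr p * w x \<partial>lebesgue_on U)"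
  unfolding calW_norm_def e using nn energy_nonneg[OF w UL, of p \<phi> "weak_gradient U \<phi>"] p0 by (simp add: powr_powr)
qed

text \<open>exp (\<kappa> s) is the p-th power of exp (\<kappa> s / p), the factor built into the
  bound of a multiplier, so the change of weight is paid for by that bound.\<close>

lemma multiplier_pointwise:
 assumes m: "multiplier p \<kappa> C m m'" and W: "W = w x * exp (\<kappa> * s x)" and x: "x \<in> U"
 shows "norm (a * m (s x)) powr p * W \<le> C powr p * (norm a powr p * w x)"
  "norm (a * m (s x) + b * (complex_of_real c * m' (s x))) powr p * W
   \<le> 2 powr p * C powr p * (norm a powr p * w x + norm b powr p * \<bar>c\<bar> powr p * w x)"
proof -
 have e: "exp (\<kappa> * s x) = exp (\<kappa> * s x / p) powr p" using p0 by (simp add: exp_powr_real)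
 have one: "norm (a * M) powr p * W \<le> C powr p * (norm a powr p * w x)" if "exp (\<kappa> * s x / p) * norm M \<le> C" for a M :: complex
 proof -
  have "norm (a * M) powr p * W = (norm a powr p * w x) * (exp (\<kappa> * s x / p) * norm M) powr p"
   unfolding W e by (simp add: norm_mult powr_mult)
  also have "\<dots> \<le> (norm a powr p * w x) * C powr p"
   using that p0 w_pos[OF x] by (intro mult_left_mono powr_mono2) auto
  finally show ?thesis by (simp add: mult.commute)
 qed
 show "norm (a * m (s x)) powr p * W \<le> C powr p * (norm a powr p * w x)"
  by (rule one) (use m in \<open>simp add: multiplier_def\<close>)
 have "norm (a * m (s x) + b * (complex_of_real c * m' (s x))) powr p * W
   \<le> 2 powr p * (norm (a * m (s x)) powr p + norm (b * (complex_of_real c * m' (s x))) powr p) * W"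
  using w_pos[OF x] by (intro mult_right_mono norm_add_powr_le p0) (simp add: W)
 also have "\<dots> = 2 powr p * (norm (a * m (s x)) powr p * W + norm ((b * complex_of_real c) * m' (s x)) powr p * W)"
  by (simp add: algebra_simps)
 also have "\<dots> \<le> 2 powr p * (C powr p * (norm a powr p * w x) + C powr p * (norm (b * complex_of_real c) powr p * w x))"
  using m by (intro mult_left_mono add_mono one) (auto simp: multiplier_def)
 finally show "norm (a * m (s x) + b * (complex_of_real c * m' (s x))) powr p * W
   \<le> 2 powr p * C powr p * (norm a powr p * w x + norm b powr p * \<bar>c\<bar> powr p * w x)"
  by (simp add: norm_mult powr_mult algebra_simps)
qed

text \<open>The representative \<sigma> comes before the multipliers, so that one choice serves a
  whole sequence of them in a limit. The almost everywhere bounds provide the dominating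
  functions.\<close>

lemma multiplier_integrals:
 assumes \<phi>: "\<phi> \<in> calW U \<theta> w0 w1 p" and W: "tame_weight U W" "\<And>x. x \<in> U \<Longrightarrow> W x = w x * exp (\<kappa> * s x)"
 obtains \<sigma> where
  "AE x in lebesgue_on U. V x = norm (\<sigma> x)"
  "\<And>C m m'. multiplier p \<kappa> C m m' \<Longrightarrow> has_weak_gradient U (\<lambda>x. \<phi> x * m (s x))
   (\<lambda>x. \<chi> i. mult_grad \<phi> \<sigma> m m' i x)"
  "\<And>C m m'. multiplier p \<kappa> C m m' \<Longrightarrow> integrable (lebesgue_on U) (\<lambda>x. norm (\<phi> x * m (s x)) powr p * W x)"
  "\<And>C m m'. multiplier p \<kappa> C m m' \<Longrightarrow> AE x in lebesgue_on U. norm (\<phi> x * m (s x)) powr p * W x \<le> C powr p * (norm (\<phi> x) powr p * w x)"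
  "\<And>C m m' i. multiplier p \<kappa> C m m' \<Longrightarrow> integrable (lebesgue_on U) (\<lambda>x. norm (mult_grad \<phi> \<sigma> m m' i x) powr p * W x)"
  "\<And>C m m' i. multiplier p \<kappa> C m m' \<Longrightarrow> AE x in lebesgue_on U. norm (mult_grad \<phi> \<sigma> m m' i x) powr p * W x
    \<le> 2 powr p * C powr p * (norm (weak_gradient U \<phi> x $ i) powr p * w x + norm (\<phi> x) powr p * V x powr p * w x)"
proof (rule grad_s)
 fix \<sigma> assume \<sigma>: "has_weak_gradient U (\<lambda>x. complex_of_real (s x)) \<sigma>"
  "\<And>K. compact K \<Longrightarrow> K \<subseteq> U \<Longrightarrow> \<exists>B. \<forall>x\<in>K. \<forall>i. norm (\<sigma> x $ i) \<le> B"
  "AE x in lebesgue_on U. V x = norm (\<sigma> x)"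
 note a = calWD[OF \<phi>] and b = W1pD[OF U w calWD(1)[OF \<phi>]]
 show thesis
 proof (rule that[of \<sigma>])
  show "AE x in lebesgue_on U. V x = norm (\<sigma> x)" by (rule \<sigma>(3))
  fix C m m' assume m: "multiplier p \<kappa> C m m'"
  have md: "\<And>t. (m has_vector_derivative m' t) (at t)" "continuous_on UNIV m'" using m by (auto simp: multiplier_def)
  show wg: "has_weak_gradient U (\<lambda>x. \<phi> x * m (s x))
   (\<lambda>x. \<chi> i. mult_grad \<phi> \<sigma> m m' i x)"
   by (rule has_weak_gradient_mult_compose[OF U b(1) \<sigma>(1) s_bounded \<sigma>(2) md])
  have lm: "(\<lambda>x. \<phi> x * m (s x)) \<in> borel_measurable (lebesgue_on U)"
   "(\<lambda>x. mult_grad \<phi> \<sigma> m m' i x) \<in> borel_measurable (lebesgue_on U)" for i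
   using locally_integrable_measurable[OF U] locally_integrable_component[of U _ i] wg unfolding has_weak_gradient_def by fastforce+
  show 1: "AE x in lebesgue_on U. norm (\<phi> x * m (s x)) powr p * W x \<le> C powr p * (norm (\<phi> x) powr p * w x)"
   using multiplier_pointwise(1)[OF m W(2)] by (auto simp: AE_lebesgue_on_iff[OF UL])
  have W0: "AE x in lebesgue_on U. 0 \<le> W x" using tame_weightD(2)[OF W(1)] by (auto simp: AE_lebesgue_on_iff[OF UL] less_imp_le)
  show "integrable (lebesgue_on U) (\<lambda>x. norm (\<phi> x * m (s x)) powr p * W x)"
  proof (rule Bochner_Integration.integrable_bound)
   show "integrable (lebesgue_on U) (\<lambda>x. C powr p * (norm (\<phi> x) powr p * w x))" using b(4) by simp
   show "(\<lambda>x. norm (\<phi> x * m (s x)) powr p * W x) \<in> borel_measurable (lebesgue_on U)"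
    by (rule borel_measurable_times[OF measurable_compose[OF lm(1) borel_measurable_norm_powr] tame_weightD(1)[OF W(1)]])
   show "AE x in lebesgue_on U. norm (norm (\<phi> x * m (s x)) powr p * W x) \<le> norm (C powr p * (norm (\<phi> x) powr p * w x))"
    using 1 W0
   proof eventually_elim
    fix x assume "norm (\<phi> x * m (s x)) powr p * W x \<le> C powr p * (norm (\<phi> x) powr p * w x)" "0 \<le> W x"
    then show "norm (norm (\<phi> x * m (s x)) powr p * W x) \<le> norm (C powr p * (norm (\<phi> x) powr p * w x))"
     by (simp only: real_norm_def abs_of_nonneg mult_nonneg_nonneg powr_ge_zero)
   qed
  qed
  fix i
  have "AE x in lebesgue_on U. x \<in> U" by (simp add: AE_lebesgue_on_iff[OF UL])
  then show 2: "AE x in lebesgue_on U. norm (mult_grad \<phi> \<sigma> m m' i x) powr p * W x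
    \<le> 2 powr p * C powr p * (norm (weak_gradient U \<phi> x $ i) powr p * w x + norm (\<phi> x) powr p * V x powr p * w x)"
   using \<sigma>(3)
  proof eventually_elim
   fix x assume x: "x \<in> U" and Vx: "V x = norm (\<sigma> x)"
   have "\<bar>Re (\<sigma> x $ i)\<bar> \<le> V x"
    using abs_Re_le_cmod[of "\<sigma> x $ i"] Finite_Cartesian_Product.norm_nth_le[of "\<sigma> x" i] Vx by linarith
   then have "\<bar>Re (\<sigma> x $ i)\<bar> powr p \<le> V x powr p" using p0 by (intro powr_mono2) auto
   then have "2 powr p * C powr p * (norm (weak_gradient U \<phi> x $ i) powr p * w x + norm (\<phi> x) powr p * \<bar>Re (\<sigma> x $ i)\<bar> powr p * w x)
    \<le> 2 powr p * C powr p * (norm (weak_gradient U \<phi> x $ i) powr p * w x + norm (\<phi> x) powr p * V x powr p * w x)"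
    using w_pos[OF x] by (intro mult_left_mono add_left_mono mult_right_mono) auto
   then show "norm (mult_grad \<phi> \<sigma> m m' i x) powr p * W x
    \<le> 2 powr p * C powr p * (norm (weak_gradient U \<phi> x $ i) powr p * w x + norm (\<phi> x) powr p * V x powr p * w x)"
    by (rule order_trans[OF multiplier_pointwise(2)[OF m W(2)[OF x] x]])
  qed
  show "integrable (lebesgue_on U) (\<lambda>x. norm (mult_grad \<phi> \<sigma> m m' i x) powr p * W x)"
  proof (rule Bochner_Integration.integrable_bound)
   show "integrable (lebesgue_on U) (\<lambda>x. 2 powr p * C powr p * (norm (weak_gradient U \<phi> x $ i) powr p * w x + norm (\<phi> x) powr p * V x powr p * w x))"
    using b(5) a(2) by simp
   show "(\<lambda>x. norm (mult_grad \<phi> \<sigma> m m' i x) powr p * W x) \<in> borel_measurable (lebesgue_on U)"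
    by (rule borel_measurable_times[OF measurable_compose[OF lm(2) borel_measurable_norm_powr] tame_weightD(1)[OF W(1)]])
   show "AE x in lebesgue_on U. norm (norm (mult_grad \<phi> \<sigma> m m' i x) powr p * W x)
     \<le> norm (2 powr p * C powr p * (norm (weak_gradient U \<phi> x $ i) powr p * w x + norm (\<phi> x) powr p * V x powr p * w x))"
    using 2 W0
   proof eventually_elim
    fix x assume h: "norm (mult_grad \<phi> \<sigma> m m' i x) powr p * W x
     \<le> 2 powr p * C powr p * (norm (weak_gradient U \<phi> x $ i) powr p * w x + norm (\<phi> x) powr p * V x powr p * w x)" "0 \<le> W x"
    have "norm (norm (mult_grad \<phi> \<sigma> m m' i x) powr p * W x)
     = norm (mult_grad \<phi> \<sigma> m m' i x) powr p * W x"
     using h(2) by (simp add: abs_mult)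
    also note h(1)
    finally show "norm (norm (mult_grad \<phi> \<sigma> m m' i x) powr p * W x)
     \<le> norm (2 powr p * C powr p * (norm (weak_gradient U \<phi> x $ i) powr p * w x + norm (\<phi> x) powr p * V x powr p * w x))"
     unfolding real_norm_def by (rule order_trans[OF _ abs_ge_self])
   qed
  qed
 qed
qed

text \<open>The factor 1 + d arises because the term with the gradient of \<open>s\<close> occurs in
  each of the d partial derivatives, while the norm of \<open>calW\<close> counts it once.\<close>

lemma multiplier_W1p:
 assumes \<phi>: "\<phi> \<in> calW U \<theta> w0 w1 p" and W: "tame_weight U W" "\<And>x. x \<in> U \<Longrightarrow> W x = w x * exp (\<kappa> * s x)"
  and m: "multiplier p \<kappa> C m m'"
 shows "(\<lambda>x. \<phi> x * m (s x)) \<in> W1p U W p"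
  "W1p_norm U W p (\<lambda>x. \<phi> x * m (s x)) powr p \<le> 2 powr p * C powr p * (1 + real CARD('d)) * calW_norm U \<theta> w0 w1 p \<phi> powr p"
proof (rule_tac [!] multiplier_integrals[OF \<phi> W])
 fix \<sigma> :: "real ^ 'd \<Rightarrow> complex ^ 'd"
 assume "\<And>C m m'. multiplier p \<kappa> C m m' \<Longrightarrow> has_weak_gradient U (\<lambda>x. \<phi> x * m (s x))
   (\<lambda>x. \<chi> i. mult_grad \<phi> \<sigma> m m' i x)"
  and "\<And>C m m'. multiplier p \<kappa> C m m' \<Longrightarrow> integrable (lebesgue_on U) (\<lambda>x. norm (\<phi> x * m (s x)) powr p * W x)"
  and "\<And>C m m'. multiplier p \<kappa> C m m' \<Longrightarrow> AE x in lebesgue_on U. norm (\<phi> x * m (s x)) powr p * W x \<le> C powr p * (norm (\<phi> x) powr p * w x)"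
  and "\<And>C m m' i. multiplier p \<kappa> C m m' \<Longrightarrow> integrable (lebesgue_on U) (\<lambda>x. norm (mult_grad \<phi> \<sigma> m m' i x) powr p * W x)"
  and "\<And>C m m' i. multiplier p \<kappa> C m m' \<Longrightarrow> AE x in lebesgue_on U. norm (mult_grad \<phi> \<sigma> m m' i x) powr p * W x
    \<le> 2 powr p * C powr p * (norm (weak_gradient U \<phi> x $ i) powr p * w x + norm (\<phi> x) powr p * V x powr p * w x)"
 note h = this[OF m]
 note a = calWD[OF \<phi>] and b = W1pD[OF U w calWD(1)[OF \<phi>]]
 show "(\<lambda>x. \<phi> x * m (s x)) \<in> W1p U W p"
  by (rule W1pI[OF U W(1) h(1)]) (use h(2,4) in simp_all)
 define I J where "I = (\<integral>x. norm (\<phi> x) powr p * w x \<partial>lebesgue_on U)" and "J = (\<integral>x. norm (\<phi> x) powr p * V x powr p * w x \<partial>lebesgue_on U)"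
 define G where "G i = (\<integral>x. norm (weak_gradient U \<phi> x $ i) powr p * w x \<partial>lebesgue_on U)" for i
 have nn: "0 \<le> I" "0 \<le> G i" for i
  unfolding I_def G_def using w_pos by (auto intro!: integral_nonneg_AE simp: AE_lebesgue_on_iff[OF UL] less_imp_le)
 have J: "0 \<le> J" unfolding J_def by (rule calW_norm_powr(2)[OF \<phi>])
 define c where "c = 2 powr p * C powr p"
 have c: "C powr p \<le> c" "0 \<le> c"
 proof -
  have "1 * C powr p \<le> 2 powr p * C powr p" using p0 by (intro mult_right_mono ge_one_powr_ge_zero) auto
  then show "C powr p \<le> c" "0 \<le> c" by (simp_all add: c_def)
 qed
 have 1: "(\<integral>x. norm (\<phi> x * m (s x)) powr p * W x \<partial>lebesgue_on U) \<le> C powr p * I"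
  using integral_mono_AE[OF h(2) integrable_mult_right[OF b(4)] h(3)] by (simp add: I_def)
 have 2: "(\<integral>x. norm (mult_grad \<phi> \<sigma> m m' i x) powr p * W x \<partial>lebesgue_on U) \<le> c * (G i + J)" for i
  using integral_mono_AE[OF h(4)[of i] integrable_mult_right[OF Bochner_Integration.integrable_add[OF b(5) a(2)]] h(5)[of i]] b(5) a(2)
  by (simp add: G_def J_def c_def)
 have "W1p_norm U W p (\<lambda>x. \<phi> x * m (s x)) powr p =
   (\<integral>x. norm (\<phi> x * m (s x)) powr p * W x \<partial>lebesgue_on U) +
   (\<Sum>i\<in>UNIV. \<integral>x. norm (mult_grad \<phi> \<sigma> m m' i x) powr p * W x \<partial>lebesgue_on U)"
  unfolding W1p_norm_powr[OF U W(1) h(1) p] energy_def by simp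
 also have "\<dots> \<le> c * I + (\<Sum>i\<in>UNIV. c * (G i + J))"
 proof (intro add_mono sum_mono 2)
  show "(\<integral>x. norm (\<phi> x * m (s x)) powr p * W x \<partial>lebesgue_on U) \<le> c * I"
   using 1 mult_right_mono[OF c(1) nn(1)] by linarith
 qed
 also have "\<dots> = c * (I + (\<Sum>i\<in>UNIV. G i) + real CARD('d) * J)"
  by (simp add: sum_distrib_left sum.distrib algebra_simps)
 also have "\<dots> \<le> c * ((1 + real CARD('d)) * (I + (\<Sum>i\<in>UNIV. G i) + J))"
 proof (rule mult_left_mono[OF _ c(2)])
  have "0 \<le> (\<Sum>i\<in>UNIV. G i)" by (intro sum_nonneg nn)
  then show "I + (\<Sum>i\<in>UNIV. G i) + real CARD('d) * J \<le> (1 + real CARD('d)) * (I + (\<Sum>i\<in>UNIV. G i) + J)"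
   using nn(1) J by (simp add: distrib_right distrib_left)
 qed
 also have "I + (\<Sum>i\<in>UNIV. G i) + J = calW_norm U \<theta> w0 w1 p \<phi> powr p"
  unfolding calW_norm_powr(1)[OF \<phi>] energy_def I_def G_def J_def by simp
 finally show "W1p_norm U W p (\<lambda>x. \<phi> x * m (s x)) powr p \<le> 2 powr p * C powr p * (1 + real CARD('d)) * calW_norm U \<theta> w0 w1 p \<phi> powr p"
  by (simp add: c_def mult.assoc)
qed

text \<open>The common constant C gives a dominating function, so pointwise convergence of the
  multipliers and of their derivatives is enough.\<close>

lemma multiplier_tendsto_0:
 assumes \<phi>: "\<phi> \<in> calW U \<theta> w0 w1 p" and W: "tame_weight U W" "\<And>x. x \<in> U \<Longrightarrow> W x = w x * exp (\<kappa> * s x)"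
  and m: "\<And>k. multiplier p \<kappa> C (m k) (m' k)" and lim: "\<And>t. (\<lambda>k. m k t) \<longlonglongrightarrow> 0" "\<And>t. (\<lambda>k. m' k t) \<longlonglongrightarrow> 0"
 shows "(\<lambda>k. W1p_norm U W p (\<lambda>x. \<phi> x * m k (s x))) \<longlonglongrightarrow> 0"
proof (rule multiplier_integrals[OF \<phi> W])
 fix \<sigma> :: "real ^ 'd \<Rightarrow> complex ^ 'd"
 assume "\<And>C m m'. multiplier p \<kappa> C m m' \<Longrightarrow> has_weak_gradient U (\<lambda>x. \<phi> x * m (s x))
   (\<lambda>x. \<chi> i. mult_grad \<phi> \<sigma> m m' i x)"
  and "\<And>C m m'. multiplier p \<kappa> C m m' \<Longrightarrow> integrable (lebesgue_on U) (\<lambda>x. norm (\<phi> x * m (s x)) powr p * W x)"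
  and "\<And>C m m'. multiplier p \<kappa> C m m' \<Longrightarrow> AE x in lebesgue_on U. norm (\<phi> x * m (s x)) powr p * W x \<le> C powr p * (norm (\<phi> x) powr p * w x)"
  and "\<And>C m m' i. multiplier p \<kappa> C m m' \<Longrightarrow> integrable (lebesgue_on U) (\<lambda>x. norm (mult_grad \<phi> \<sigma> m m' i x) powr p * W x)"
  and "\<And>C m m' i. multiplier p \<kappa> C m m' \<Longrightarrow> AE x in lebesgue_on U. norm (mult_grad \<phi> \<sigma> m m' i x) powr p * W x
    \<le> 2 powr p * C powr p * (norm (weak_gradient U \<phi> x $ i) powr p * w x + norm (\<phi> x) powr p * V x powr p * w x)"
 note h = this[OF m]
 note a = calWD[OF \<phi>] and b = W1pD[OF U w calWD(1)[OF \<phi>]]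
 have W0: "AE x in lebesgue_on U. 0 \<le> W x" using tame_weightD(2)[OF W(1)] by (auto simp: AE_lebesgue_on_iff[OF UL] less_imp_le)
 have dct: "(\<lambda>k. \<integral>x. norm (F k x) powr p * W x \<partial>lebesgue_on U) \<longlonglongrightarrow> 0"
  if i: "\<And>k. integrable (lebesgue_on U) (\<lambda>x. norm (F k x) powr p * W x)" and H: "integrable (lebesgue_on U) H"
   and le: "\<And>k. AE x in lebesgue_on U. norm (F k x) powr p * W x \<le> H x" and z: "\<And>x. (\<lambda>k. F k x) \<longlonglongrightarrow> 0"
  for F :: "nat \<Rightarrow> real ^ 'd \<Rightarrow> complex" and H
  by (rule weighted_dominated_tendsto_0(2)[OF borel_measurable_integrable[OF i] W0 p0(1) H le z])
 have 1: "(\<lambda>k. \<integral>x. norm (\<phi> x * m k (s x)) powr p * W x \<partial>lebesgue_on U) \<longlonglongrightarrow> 0"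
 proof (rule dct[OF h(2) integrable_mult_right[OF b(4)] h(3)])
  show "(\<lambda>k. \<phi> x * m k (s x)) \<longlonglongrightarrow> 0" for x using tendsto_mult[OF tendsto_const lim(1)] by simp
 qed
 have 2: "(\<lambda>k. \<integral>x. norm (mult_grad \<phi> \<sigma> (m k) (m' k) i x) powr p * W x \<partial>lebesgue_on U) \<longlonglongrightarrow> 0" for i
 proof (rule dct[OF h(4) integrable_mult_right[OF Bochner_Integration.integrable_add[OF b(5) a(2)]] h(5)])
  fix x
  have "(\<lambda>k. mult_grad \<phi> \<sigma> (m k) (m' k) i x) \<longlonglongrightarrow>
    weak_gradient U \<phi> x $ i * 0 + \<phi> x * (complex_of_real (Re (\<sigma> x $ i)) * 0)"
   by (intro tendsto_add tendsto_mult tendsto_const lim)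
  then show "(\<lambda>k. mult_grad \<phi> \<sigma> (m k) (m' k) i x) \<longlonglongrightarrow> 0" by simp
 qed
 have "(\<lambda>k. (\<integral>x. norm (\<phi> x * m k (s x)) powr p * W x \<partial>lebesgue_on U) +
   (\<Sum>i\<in>UNIV. \<integral>x. norm (mult_grad \<phi> \<sigma> (m k) (m' k) i x) powr p * W x \<partial>lebesgue_on U)) \<longlonglongrightarrow> 0 + (\<Sum>i\<in>(UNIV :: 'd set). 0)"
  by (intro tendsto_add tendsto_sum 1 2)
 then have E: "(\<lambda>k. W1p_norm U W p (\<lambda>x. \<phi> x * m k (s x)) powr p) \<longlonglongrightarrow> 0"
  unfolding W1p_norm_powr[OF U W(1) h(1) p] energy_def by simp
 have "(\<lambda>k. norm (W1p_norm U W p (\<lambda>x. \<phi> x * m k (s x)) powr p) powr (1 / p)) \<longlonglongrightarrow> 0"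
  using p0 by (intro tendsto_norm_powr_0[OF E]) simp
 moreover have "norm (W1p_norm U W p (\<lambda>x. \<phi> x * m k (s x)) powr p) powr (1 / p) = W1p_norm U W p (\<lambda>x. \<phi> x * m k (s x))" for k
  using W1p_norm_nonneg[of U W p "\<lambda>x. \<phi> x * m k (s x)"] p0 by (simp add: powr_powr)
 ultimately show ?thesis by simp
qed

end

section \<open>Multipliers preserve the closure of \<open>Lip_c\<close>\<close>

context interpolation_pair
begin

text \<open>\<open>h\<close> is Lipschitz only on compact sets, while the product must be Lipschitz
  on all of \<open>U\<close>. A compact r-neighbourhood \<open>K'\<close> of the support
  \<open>K\<close> separates near points, treated by the product rule, from far ones, where the
  distance is at least r and boundedness suffices.\<close>

lemma Lip_c_mult_lipschitz:
 assumes \<psi>: "\<psi> \<in> Lip_c U" and h: "\<And>K. compact K \<Longrightarrow> K \<subseteq> U \<Longrightarrow> \<exists>L. L-lipschitz_on K (h :: real ^ 'd \<Rightarrow> complex)"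
 shows "(\<lambda>x. \<psi> x * h x) \<in> Lip_c U"
proof -
 define K where "K = closure {x\<in>U. \<psi> x \<noteq> 0}"
 obtain L1 where L1: "L1-lipschitz_on U \<psi>" using \<psi> by (auto simp: Lip_c_def)
 have K: "compact K" "K \<subseteq> U" using \<psi> by (auto simp: Lip_c_def K_def)
 have z: "\<psi> x = 0" if "x \<in> U" "x \<notin> K" for x
  using that closure_subset[of "{x\<in>U. \<psi> x \<noteq> 0}"] by (auto simp: K_def)
 obtain r where r: "0 < r" "(\<Union>x\<in>K. cball x r) \<subseteq> U"
  using compact_subset_open_imp_cball_epsilon_subset[OF K(1) U K(2)] by blast
 define K' where "K' = (\<Union>x\<in>K. cball x r)"
 have K': "compact K'" "K' \<subseteq> U" "K \<subseteq> K'" using compact_minkowski_sum_cball[OF K(1), of r] r by (auto simp: K'_def)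
 obtain L2 where L2: "L2-lipschitz_on K' h" using h[OF K'(1,2)] by blast
 have "bounded (h ` K')" "bounded (\<psi> ` K')"
  using compact_continuous_image[OF lipschitz_on_continuous_on[OF L2] K'(1)]
   compact_continuous_image[OF continuous_on_subset[OF lipschitz_on_continuous_on[OF L1] K'(2)] K'(1)]
  by (auto intro: compact_imp_bounded)
 then obtain B1 B2 where "\<forall>y\<in>h ` K'. norm y \<le> B1" "\<forall>y\<in>\<psi> ` K'. norm y \<le> B2" unfolding bounded_iff by blast
 then have B: "norm (h x) \<le> \<bar>B1\<bar>" "norm (\<psi> x) \<le> \<bar>B2\<bar>" if "x \<in> K'" for x
  using that by (auto intro: order_trans[OF _ abs_ge_self])
 have L0: "0 \<le> L1" "0 \<le> L2" using L1 L2 lipschitz_on_nonneg by blast+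
 \<comment> \<open>The first two constants come from the product rule on \<open>K'\<close>, the last
   one from a point of \<open>K\<close> paired with a point of \<open>U\<close> outside
   \<open>K'\<close>, where the product vanishes.\<close>
 define M where "M = \<bar>B1\<bar> * L1 + \<bar>B2\<bar> * L2 + \<bar>B1\<bar> * \<bar>B2\<bar> / r"
 have one: "norm (\<psi> x * h x - \<psi> y * h y) \<le> M * dist x y" if x: "x \<in> K" and y: "y \<in> U" for x y
 proof (cases "y \<in> K'")
  case True
  have x': "x \<in> K'" "x \<in> U" using x K' K by auto
  have "\<psi> x * h x - \<psi> y * h y = (\<psi> x - \<psi> y) * h x + \<psi> y * (h x - h y)" by (simp add: algebra_simps)
  also have "norm \<dots> \<le> norm (\<psi> x - \<psi> y) * norm (h x) + norm (\<psi> y) * norm (h x - h y)"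
   by (rule order_trans[OF norm_triangle_ineq]) (simp add: norm_mult)
  also have "\<dots> \<le> (L1 * dist x y) * \<bar>B1\<bar> + \<bar>B2\<bar> * (L2 * dist x y)"
   using lipschitz_onD[OF L1 x'(2) y] lipschitz_onD[OF L2 x'(1) True] B(1)[OF x'(1)] B(2)[OF True] L0
   by (intro add_mono mult_mono) (auto simp: dist_norm)
  also have "\<dots> \<le> M * dist x y"
  proof -
   have "0 \<le> \<bar>B1\<bar> * \<bar>B2\<bar> / r * dist x y" using r(1) by simp
   then show ?thesis by (simp add: M_def algebra_simps)
  qed
  finally show ?thesis .
 next
  case False
  have "y \<notin> cball x r" using False x by (auto simp: K'_def)
  then have d: "r \<le> dist x y" by simp
  have "\<psi> y = 0" using z[OF y] False K'(3) by blast
  then have "norm (\<psi> x * h x - \<psi> y * h y) = norm (\<psi> x) * norm (h x)" by (simp add: norm_mult)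
  also have "\<dots> \<le> \<bar>B2\<bar> * \<bar>B1\<bar>" using B x K'(3) by (intro mult_mono) auto
  also have "\<dots> = (\<bar>B1\<bar> * \<bar>B2\<bar> / r) * r" using r(1) by simp
  also have "\<dots> \<le> (\<bar>B1\<bar> * \<bar>B2\<bar> / r) * dist x y" using d r(1) by (intro mult_left_mono) auto
  also have "\<dots> \<le> M * dist x y" using L0 by (intro mult_right_mono) (auto simp: M_def)
  finally show ?thesis .
 qed
 have M0: "0 \<le> M" using L0 r(1) by (simp add: M_def)
 have "M-lipschitz_on U (\<lambda>x. \<psi> x * h x)"
 proof (rule lipschitz_onI[OF _ M0])
  fix x y assume xy: "x \<in> U" "y \<in> U"
  consider "x \<in> K" | "y \<in> K" | "x \<notin> K" "y \<notin> K" by blast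
  then show "dist (\<psi> x * h x) (\<psi> y * h y) \<le> M * dist x y"
  proof cases
   case 1 then show ?thesis using one[OF 1 xy(2)] by (simp add: dist_norm)
  next
   case 2 then show ?thesis using one[OF 2 xy(1)] by (simp add: dist_norm norm_minus_commute)
  next
   case 3 then show ?thesis using z xy M0 by simp
  qed
 qed
 moreover have "closure {x\<in>U. \<psi> x * h x \<noteq> 0} \<subseteq> K" unfolding K_def by (rule closure_mono) auto
 moreover from this have "compact (closure {x\<in>U. \<psi> x * h x \<noteq> 0})"
  using K(1) by (meson bounded_subset closed_closure compact_eq_bounded_closed)
 ultimately show ?thesis using K(2) by (auto simp: Lip_c_def)
qed

lemma multiplier_lipschitz:
 assumes m: "multiplier p \<kappa> C m m'" and K: "compact K" "K \<subseteq> U"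
 shows "\<exists>L. L-lipschitz_on K (\<lambda>x. m (s x))"
proof -
 obtain B where B: "\<And>x. x \<in> K \<Longrightarrow> \<bar>s x\<bar> \<le> B" using s_bounded[OF K] by blast
 obtain L where L: "L-lipschitz_on K s" using s_lip K by (auto simp: locally_lipschitz_def)
 have md: "\<And>t. (m has_vector_derivative m' t) (at t)" "continuous_on UNIV m'" using m by (auto simp: multiplier_def)
 have "compact (m' ` {-B..B})" by (intro compact_continuous_image continuous_on_subset[OF md(2)]) auto
 then have "bounded (m' ` {-B..B})" by (rule compact_imp_bounded)
 then obtain M where "\<forall>y\<in>m' ` {-B..B}. norm y \<le> M" unfolding bounded_iff by blast
 then have M: "norm (m' t) \<le> \<bar>M\<bar>" if "t \<in> {-B..B}" for t using that by (auto intro: order_trans[OF _ abs_ge_self])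
 have mv: "norm (m u - m v) \<le> \<bar>M\<bar> * norm (u - v)" if "u \<in> {-B..B}" "v \<in> {-B..B}" for u v
 proof (rule differentiable_bound[of "{-B..B}" m "\<lambda>t h. h *\<^sub>R m' t"])
  fix t assume t: "t \<in> {-B..B}"
  show "(m has_derivative (\<lambda>h. h *\<^sub>R m' t)) (at t within {-B..B})"
   using md(1)[of t] by (simp add: has_vector_derivative_def has_derivative_at_withinI)
  show "onorm (\<lambda>h. h *\<^sub>R m' t) \<le> \<bar>M\<bar>"
   by (rule onorm_le) (use M[OF t] in \<open>simp add: mult.commute[of "\<bar>M\<bar>"] mult_left_mono\<close>)
 qed (use that in auto)
 have "(\<bar>M\<bar> * L)-lipschitz_on K (\<lambda>x. m (s x))"
 proof (rule lipschitz_onI)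
  fix x y assume xy: "x \<in> K" "y \<in> K"
  have "norm (m (s x) - m (s y)) \<le> \<bar>M\<bar> * norm (s x - s y)"
   using B[OF xy(1)] B[OF xy(2)] by (intro mv) (auto simp: abs_le_iff)
  also have "\<dots> \<le> \<bar>M\<bar> * (L * dist x y)"
   using lipschitz_onD[OF L xy] by (intro mult_left_mono) (auto simp: dist_norm)
  finally show "dist (m (s x)) (m (s y)) \<le> \<bar>M\<bar> * L * dist x y" by (simp add: dist_norm mult.assoc)
 qed (use lipschitz_on_nonneg[OF L] in simp)
 then show ?thesis by blast
qed

text \<open>Multiplication is bounded between the norms and maps \<open>Lip_c\<close> into itself,
  so it carries approximations to approximations.\<close>

lemma multiplier_W1p_0:
 assumes \<phi>: "\<phi> \<in> calW_0 U \<theta> w0 w1 p" and W: "tame_weight U W" "\<And>x. x \<in> U \<Longrightarrow> W x = w x * exp (\<kappa> * s x)"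
  and m: "multiplier p \<kappa> C m m'"
 shows "(\<lambda>x. \<phi> x * m (s x)) \<in> W1p_0 U W p"
 unfolding W1p_0_def closure_in_def
proof (intro CollectI conjI allI impI)
 have \<phi>W: "\<phi> \<in> calW U \<theta> w0 w1 p" using \<phi> by (simp add: calW_0_def closure_in_def)
 show "(\<lambda>x. \<phi> x * m (s x)) \<in> W1p U W p" by (rule multiplier_W1p(1)[OF \<phi>W W m])
 fix e :: real assume e: "0 < e"
 \<comment> \<open>The added 1 makes the constant positive also when \<open>C\<close> is 0.\<close>
 define A where "A = 2 powr p * C powr p * (1 + real CARD('d)) + 1"
 have A: "0 < A" unfolding A_def by (intro add_nonneg_pos mult_nonneg_nonneg) auto
 define \<delta> where "\<delta> = e / A powr (1 / p)"
 have \<delta>: "0 < \<delta>" using e A by (simp add: \<delta>_def)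
 obtain \<psi> where \<psi>: "\<psi> \<in> Lip_c U" "\<psi> \<in> calW U \<theta> w0 w1 p" "calW_norm U \<theta> w0 w1 p (\<lambda>x. \<phi> x - \<psi> x) < \<delta>"
  using \<phi> \<delta> unfolding calW_0_def closure_in_def by blast
 have N0: "0 \<le> calW_norm U \<theta> w0 w1 p (\<lambda>x. \<phi> x - \<psi> x)" by (simp add: calW_norm_def)
 have "(\<lambda>x. \<psi> x * m (s x)) \<in> Lip_c U"
  by (rule Lip_c_mult_lipschitz[OF \<psi>(1)]) (rule multiplier_lipschitz[OF m])
 moreover have "(\<lambda>x. \<psi> x * m (s x)) \<in> W1p U W p" by (rule multiplier_W1p(1)[OF \<psi>(2) W m])
 moreover have "W1p_norm U W p (\<lambda>x. \<phi> x * m (s x) - \<psi> x * m (s x)) < e"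
 proof -
  let ?N = "W1p_norm U W p (\<lambda>x. (\<phi> x - \<psi> x) * m (s x))" and ?M = "calW_norm U \<theta> w0 w1 p (\<lambda>x. \<phi> x - \<psi> x)"
  have "?N powr p \<le> 2 powr p * C powr p * (1 + real CARD('d)) * ?M powr p"
   by (rule multiplier_W1p(2)[OF calW_diff[OF \<phi>W \<psi>(2)] W m])
  also have "\<dots> \<le> A * ?M powr p" by (intro mult_right_mono) (auto simp: A_def)
  finally have "?N powr p \<le> A * ?M powr p" .
  then have "(?N powr p) powr (1 / p) \<le> (A * ?M powr p) powr (1 / p)" using p0 by (intro powr_mono2) auto
  then have "?N \<le> A powr (1 / p) * ?M"
   using W1p_norm_nonneg[of U W p "\<lambda>x. (\<phi> x - \<psi> x) * m (s x)"] N0 p0 A by (simp add: powr_powr powr_mult)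
  also have "\<dots> < A powr (1 / p) * \<delta>" using \<psi>(3) A by (intro mult_strict_left_mono) auto
  also have "\<dots> = e" using A by (simp add: \<delta>_def)
  finally show ?thesis by (simp add: left_diff_distrib)
 qed
 ultimately show "\<exists>\<psi>\<in>Lip_c U \<inter> W1p U W p. W1p_norm U W p (\<lambda>x. \<phi> x * m (s x) - \<psi> x) < e"
  by (intro bexI[of _ "\<lambda>x. \<psi> x * m (s x)"]) auto
qed

text \<open>The analytic family of multipliers \<open>exp ((z - \<theta>) t / p + (z - \<theta>)\<^sup>2) a(t)\<close>; the Gaussian factor compensates
 the linear growth in \<open>Im z\<close> produced by differentiation in \<open>t\<close>.\<close>

definition cutoff_profile :: "real \<Rightarrow> (real \<Rightarrow> real) \<Rightarrow> (real \<Rightarrow> real) \<Rightarrow> real \<Rightarrow> real \<Rightarrow> bool" where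
 "cutoff_profile \<kappa> a a' x0 x1 \<longleftrightarrow> 0 \<le> x0 \<and> x1 \<le> 1 \<and> (\<forall>t. (a has_real_derivative a' t) (at t)) \<and> continuous_on UNIV a' \<and>
   (\<forall>t. 0 \<le> a t \<and> \<bar>a' t\<bar> \<le> a t) \<and> (\<forall>\<xi>\<in>{x0..x1}. \<forall>t. exp ((\<kappa> + \<xi> - \<theta>) * t / p) * a t \<le> 1)"

definition expo :: "complex \<Rightarrow> real \<Rightarrow> complex" where
 "expo z t = exp ((z - complex_of_real \<theta>) * complex_of_real (t / p) + (z - complex_of_real \<theta>)\<^sup>2)"

text \<open>In these names a prime stands for the derivative in the real variable t and the prefix
  \<open>d\<close> for the complex derivative in z; \<open>dfam'\<close> is the mixed
  derivative.\<close>

definition fam :: "(real \<Rightarrow> real) \<Rightarrow> complex \<Rightarrow> real \<Rightarrow> complex" where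
 "fam a z t = expo z t * complex_of_real (a t)"

definition fam' :: "(real \<Rightarrow> real) \<Rightarrow> (real \<Rightarrow> real) \<Rightarrow> complex \<Rightarrow> real \<Rightarrow> complex" where
 "fam' a a' z t = expo z t * ((z - complex_of_real \<theta>) / complex_of_real p * complex_of_real (a t) + complex_of_real (a' t))"

definition dfam :: "(real \<Rightarrow> real) \<Rightarrow> complex \<Rightarrow> real \<Rightarrow> complex" where
 "dfam a z t = fam a z t * (complex_of_real (t / p) + 2 * (z - complex_of_real \<theta>))"

definition dfam' :: "(real \<Rightarrow> real) \<Rightarrow> (real \<Rightarrow> real) \<Rightarrow> complex \<Rightarrow> real \<Rightarrow> complex" where
 "dfam' a a' z t = fam' a a' z t * (complex_of_real (t / p) + 2 * (z - complex_of_real \<theta>)) + fam a z t / complex_of_real p"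

section \<open>Estimates for the analytic family\<close>

lemma expo_deriv_z: "((\<lambda>z. expo z t) has_field_derivative expo z t * (complex_of_real (t / p) + 2 * (z - complex_of_real \<theta>))) (at z)"
 unfolding expo_def using p0 by (auto intro!: derivative_eq_intros simp: power2_eq_square algebra_simps)

lemma expo_deriv_t: "((\<lambda>t. expo z t) has_vector_derivative expo z t * ((z - complex_of_real \<theta>) / complex_of_real p)) (at t)"
proof -
 have "((\<lambda>u. exp ((z - complex_of_real \<theta>) * (u / complex_of_real p) + (z - complex_of_real \<theta>)\<^sup>2)) has_field_derivative
   exp ((z - complex_of_real \<theta>) * (complex_of_real t / complex_of_real p) + (z - complex_of_real \<theta>)\<^sup>2) * ((z - complex_of_real \<theta>) / complex_of_real p)) (at (complex_of_real t))"
  using p0 by (auto intro!: derivative_eq_intros)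
 from has_vector_derivative_real_field[OF this] show ?thesis by (simp add: expo_def)
qed

lemma fam_deriv_t:
 assumes "cutoff_profile \<kappa> a a' x0 x1"
 shows "(fam a z has_vector_derivative fam' a a' z t) (at t)" "(dfam a z has_vector_derivative dfam' a a' z t) (at t)"
  "continuous_on UNIV (fam' a a' z)" "continuous_on UNIV (dfam' a a' z)"
proof -
 have a: "(a has_real_derivative a' t) (at t)" "continuous_on UNIV a'" for t using assms by (auto simp: cutoff_profile_def)
 have ac: "continuous_on UNIV a" using a(1) DERIV_isCont by (auto simp: continuous_on_eq_continuous_at)
 have av: "((\<lambda>t. complex_of_real (a t)) has_vector_derivative complex_of_real (a' t)) (at t)" for t
  by (rule has_vector_derivative_of_real[OF a(1)])
 have ec: "continuous_on UNIV (expo z)" unfolding expo_def[abs_def] using p0 by (intro continuous_intros) auto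
 show 1: "(fam a z has_vector_derivative fam' a a' z t) (at t)" for t
  using has_vector_derivative_mult[OF expo_deriv_t[of z t] av[of t]]
  unfolding fam_def[abs_def] fam'_def by (simp add: algebra_simps)
 have lin: "((\<lambda>t. complex_of_real (t / p) + 2 * (z - complex_of_real \<theta>)) has_vector_derivative 1 / complex_of_real p) (at t)" for t
 proof -
  have "((\<lambda>u. u / complex_of_real p + 2 * (z - complex_of_real \<theta>)) has_field_derivative 1 / complex_of_real p) (at (complex_of_real t))"
   using p0 by (auto intro!: derivative_eq_intros)
  from has_vector_derivative_real_field[OF this] show ?thesis by simp
 qed
 show "(dfam a z has_vector_derivative dfam' a a' z t) (at t)"
  using has_vector_derivative_mult[OF 1[of t] lin[of t]]
  unfolding dfam_def[abs_def] dfam'_def by (simp add: algebra_simps)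
 show fc: "continuous_on UNIV (fam' a a' z)"
  unfolding fam'_def[abs_def] using p0 by (intro continuous_intros ec ac a(2)) auto
 show "continuous_on UNIV (dfam' a a' z)"
  unfolding dfam'_def[abs_def] fam_def using p0 by (intro continuous_intros ec ac fc) auto
qed

lemma fam_deriv_z:
 "((\<lambda>z. fam a z t) has_field_derivative dfam a z t) (at z)"
 "((\<lambda>z. fam' a a' z t) has_field_derivative dfam' a a' z t) (at z)"
proof -
 show "((\<lambda>z. fam a z t) has_field_derivative dfam a z t) (at z)"
  unfolding fam_def dfam_def
  by (rule DERIV_cong[OF DERIV_cmult_right[OF expo_deriv_z]]) (simp add: algebra_simps)
 have "((\<lambda>z. (z - complex_of_real \<theta>) / complex_of_real p * complex_of_real (a t) + complex_of_real (a' t)) has_field_derivative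
   complex_of_real (a t) / complex_of_real p) (at z)"
  using p0 by (auto intro!: derivative_eq_intros)
 from DERIV_mult[OF expo_deriv_z[of t z] this]
 show "((\<lambda>z. fam' a a' z t) has_field_derivative dfam' a a' z t) (at z)"
  unfolding fam'_def dfam'_def fam_def
  by (rule DERIV_cong) (simp only: mult.commute mult.left_commute mult.assoc times_divide_eq_left times_divide_eq_right)
qed

lemma expo_norm: "norm (expo z t) = exp ((Re z - \<theta>) * t / p) * exp ((Re z - \<theta>)\<^sup>2 - (Im z)\<^sup>2)"
 by (simp add: expo_def power2_eq_square flip: exp_add)

text \<open>The profile absorbs the exponential in t on each vertical line of its range. What
  remains is the Gaussian factor, where 1 bounds (Re z - \<theta>)^2.\<close>

lemma expo_profile_le:
 assumes "cutoff_profile \<kappa> a a' x0 x1" "Re z \<in> {x0..x1}"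
 shows "exp (\<kappa> * t / p) * (norm (expo z t) * a t) \<le> exp (1 - (Im z)\<^sup>2)"
proof -
 have x: "0 \<le> Re z" "Re z \<le> 1" using assms by (auto simp: cutoff_profile_def)
 have "\<bar>Re z - \<theta>\<bar> \<le> 1" using x \<theta> by linarith
 then have q: "(Re z - \<theta>)\<^sup>2 \<le> 1" by (simp add: abs_square_le_1)
 have a: "exp ((\<kappa> + Re z - \<theta>) * t / p) * a t \<le> 1" "0 \<le> a t" using assms by (auto simp: cutoff_profile_def)
 have "exp (\<kappa> * t / p) * (norm (expo z t) * a t) = (exp ((\<kappa> + Re z - \<theta>) * t / p) * a t) * exp ((Re z - \<theta>)\<^sup>2 - (Im z)\<^sup>2)"
  unfolding expo_norm by (simp add: add_divide_distrib diff_divide_distrib algebra_simps flip: exp_add)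
 also have "\<dots> \<le> 1 * exp (1 - (Im z)\<^sup>2)" using a q by (intro mult_mono) auto
 finally show ?thesis by simp
qed

text \<open>Differentiation in t brings down (z - \<theta>) / p, of size at most 1 + |Im z|, and
  \<open>a'\<close>, bounded by \<open>a\<close>. The inequality 2 + |y| <= 3 exp (y^2) lets the
  Gaussian absorb the growth, which leaves the constant 3 e.\<close>

lemma fam_multiplier:
 assumes c: "cutoff_profile \<kappa> a a' x0 x1" and z: "Re z \<in> {x0..x1}"
 shows "multiplier p \<kappa> (3 * exp 1) (fam a z) (fam' a a' z)"
 unfolding multiplier_def
proof (intro conjI allI)
 show "(fam a z has_vector_derivative fam' a a' z t) (at t)" for t by (rule fam_deriv_t(1)[OF c])
 show "continuous_on UNIV (fam' a a' z)" by (rule fam_deriv_t(3)[OF c])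
 fix t
 have a: "0 \<le> a t" "\<bar>a' t\<bar> \<le> a t" using c by (auto simp: cutoff_profile_def)
 note e = expo_profile_le[OF c z, of t]
 have e1: "exp (1 - (Im z)\<^sup>2) \<le> exp 1" by simp
 have "exp (\<kappa> * t / p) * norm (fam a z t) = exp (\<kappa> * t / p) * (norm (expo z t) * a t)"
  using a(1) by (simp add: fam_def norm_mult)
 also have "\<dots> \<le> 3 * exp 1" using e e1 by (smt (verit) exp_gt_zero)
 finally show "exp (\<kappa> * t / p) * norm (fam a z t) \<le> 3 * exp 1" .
 have x: "0 \<le> Re z" "Re z \<le> 1" using c z by (auto simp: cutoff_profile_def)
 have zc: "norm (z - complex_of_real \<theta>) \<le> 1 + \<bar>Im z\<bar>"
  using cmod_le[of "z - complex_of_real \<theta>"] x \<theta> by simp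
 have "norm ((z - complex_of_real \<theta>) / complex_of_real p * complex_of_real (a t) + complex_of_real (a' t)) \<le> norm (z - complex_of_real \<theta>) / p * a t + \<bar>a' t\<bar>"
  by (rule order_trans[OF norm_triangle_ineq]) (use a p0 in \<open>simp add: norm_mult norm_divide\<close>)
 also have "\<dots> \<le> (1 + \<bar>Im z\<bar>) * a t + a t"
 proof (intro add_mono mult_right_mono a)
  have "norm (z - complex_of_real \<theta>) / p \<le> norm (z - complex_of_real \<theta>) / 1" using p by (intro divide_left_mono) auto
  then show "norm (z - complex_of_real \<theta>) / p \<le> 1 + \<bar>Im z\<bar>" using zc by simp
 qed
 also have "\<dots> = (2 + \<bar>Im z\<bar>) * a t" by (simp add: algebra_simps)
 finally have "exp (\<kappa> * t / p) * norm (fam' a a' z t) \<le> exp (\<kappa> * t / p) * (norm (expo z t) * ((2 + \<bar>Im z\<bar>) * a t))"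
  unfolding fam'_def norm_mult[of "expo z t"] by (intro mult_left_mono) auto
 also have "\<dots> = (exp (\<kappa> * t / p) * (norm (expo z t) * a t)) * (2 + \<bar>Im z\<bar>)" by (simp add: algebra_simps)
 also have "\<dots> \<le> exp (1 - (Im z)\<^sup>2) * (2 + \<bar>Im z\<bar>)" by (intro mult_right_mono e) auto
 also have "\<dots> \<le> exp (1 - (Im z)\<^sup>2) * (3 * exp ((Im z)\<^sup>2))"
 proof (rule mult_left_mono)
  have "\<bar>Im z\<bar> \<le> 1 + (Im z)\<^sup>2" using le_1_plus_powr[of "\<bar>Im z\<bar>" 2] by (cases "Im z = 0") (auto simp: powr_numeral)
  then have "2 + \<bar>Im z\<bar> \<le> 3 * (1 + (Im z)\<^sup>2)" using zero_le_power2[of "Im z"] by argo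
  also have "\<dots> \<le> 3 * exp ((Im z)\<^sup>2)" using exp_ge_add_one_self[of "(Im z)\<^sup>2"] by (intro mult_left_mono) auto
  finally show "2 + \<bar>Im z\<bar> \<le> 3 * exp ((Im z)\<^sup>2)" .
 qed simp
 also have "\<dots> = 3 * exp 1" by (simp flip: exp_add)
 finally show "exp (\<kappa> * t / p) * norm (fam' a a' z t) \<le> 3 * exp 1" .
qed

lemma multiplier_diff:
 assumes "multiplier p \<kappa> C m m'" "multiplier p \<kappa> D n n'"
 shows "multiplier p \<kappa> (C + D) (\<lambda>t. m t - n t) (\<lambda>t. m' t - n' t)"
 unfolding multiplier_def
proof (intro conjI allI)
 show "((\<lambda>t. m t - n t) has_vector_derivative m' t - n' t) (at t)" for t
  using assms by (auto simp: multiplier_def intro: has_vector_derivative_diff)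
 show "continuous_on UNIV (\<lambda>t. m' t - n' t)" using assms by (auto simp: multiplier_def intro: continuous_intros)
 have "exp (\<kappa> * t / p) * norm (u - v) \<le> C + D" if "exp (\<kappa> * t / p) * norm u \<le> C" "exp (\<kappa> * t / p) * norm v \<le> D" for t and u v :: complex
 proof -
  have "exp (\<kappa> * t / p) * norm (u - v) \<le> exp (\<kappa> * t / p) * (norm u + norm v)" by (intro mult_left_mono norm_triangle_ineq4) auto
  then show ?thesis using that by (simp add: distrib_left)
 qed
 then show "exp (\<kappa> * t / p) * norm (m t - n t) \<le> C + D" "exp (\<kappa> * t / p) * norm (m' t - n' t) \<le> C + D" for t
  using assms unfolding multiplier_def by blast+
qed

text \<open>For fixed t continuity in z is plain; the multiplier bound, uniform over the strip,
  upgrades it to continuity in norm.\<close>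

lemma fam_continuity:
 assumes \<phi>: "\<phi> \<in> calW U \<theta> w0 w1 p" and W: "tame_weight U W" "\<And>x. x \<in> U \<Longrightarrow> W x = w x * exp (\<kappa> * s x)"
  and c: "cutoff_profile \<kappa> a a' x0 x1" and Z: "\<And>n. Re (Z n) \<in> {x0..x1}" "Re z \<in> {x0..x1}" "Z \<longlonglongrightarrow> z"
 shows "(\<lambda>n. W1p_norm U W p (\<lambda>x. \<phi> x * (fam a (Z n) (s x) - fam a z (s x)))) \<longlonglongrightarrow> 0"
proof (rule multiplier_tendsto_0[OF \<phi> W multiplier_diff[OF fam_multiplier[OF c Z(1)] fam_multiplier[OF c Z(2)]]])
 fix t
 have "isCont (\<lambda>z. fam a z t) z" "isCont (\<lambda>z. fam' a a' z t) z"
  by (rule DERIV_isCont[OF fam_deriv_z(1)], rule DERIV_isCont[OF fam_deriv_z(2)])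
 then show "(\<lambda>n. fam a (Z n) t - fam a z t) \<longlonglongrightarrow> 0" "(\<lambda>n. fam' a a' (Z n) t - fam' a a' z t) \<longlonglongrightarrow> 0"
  using isCont_tendsto_compose[OF _ Z(3)] by (auto intro!: LIM_zero)
qed

text \<open>In the constant, 2 / \<delta> + 2 R bounds the factor t / p + 2 (z - \<theta>) produced
  by differentiation in z, R + 1 the additional factor in the t-derivative, and the final 1 the term
  \<open>fam / p\<close>.\<close>

lemma dfam_bound:
 assumes c: "cutoff_profile \<kappa> a a' x0 x1" and \<delta>: "0 < \<delta>" and z: "Re z - \<delta> \<in> {x0..x1}" "Re z + \<delta> \<in> {x0..x1}"
  and R: "norm (z - complex_of_real \<theta>) \<le> R"
 shows "exp (\<kappa> * t / p) * norm (dfam a z t) \<le> exp 1 * ((2 / \<delta> + 2 * R) * (R + 1) + 1)"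
  "exp (\<kappa> * t / p) * norm (dfam' a a' z t) \<le> exp 1 * ((2 / \<delta> + 2 * R) * (R + 1) + 1)"
proof -
 have R0: "0 \<le> R" using R norm_ge_zero order_trans by blast
 have zr: "Re z \<in> {x0..x1}" using z \<delta> by auto
 have a: "0 \<le> a t" "\<bar>a' t\<bar> \<le> a t" using c by (auto simp: cutoff_profile_def)
 let ?E = "exp (\<kappa> * t / p) * (norm (expo z t) * a t)"
 have E0: "0 \<le> ?E" using a by simp
 have Ele: "?E \<le> exp 1" using expo_profile_le[OF c zr, of t] by (rule order_trans) simp
 have x: "0 \<le> Re z" "Re z \<le> 1" using c zr by (auto simp: cutoff_profile_def)
 have "\<bar>Re z - \<theta>\<bar> \<le> 1" using x \<theta> by linarith
 then have q: "(Re z - \<theta>)\<^sup>2 \<le> 1" by (simp add: abs_square_le_1)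
 \<comment> \<open>The unbounded factor t is traded for exp (\<delta> t / p) + exp (- \<delta> t /
   p), that is, for shifting Re z by \<delta> to either side, where the bound of the profile still
   holds.\<close>
 have tE: "\<bar>t / p\<bar> * ?E \<le> (2 / \<delta>) * exp 1"
 proof -
  have "\<delta> * \<bar>t / p\<bar> \<le> exp (\<delta> * \<bar>t / p\<bar>)" using exp_ge_add_one_self[of "\<delta> * \<bar>t / p\<bar>"] by linarith
  also have "\<dots> \<le> exp (\<delta> * (t / p)) + exp (- (\<delta> * (t / p)))" by (cases "0 \<le> t / p") (auto simp: abs_if)
  finally have "\<delta> * \<bar>t / p\<bar> * ?E \<le> (exp (\<delta> * (t / p)) + exp (- (\<delta> * (t / p)))) * ?E"
   using E0 by (intro mult_right_mono)
  also have "\<dots> = (exp ((\<kappa> + (Re z + \<delta>) - \<theta>) * t / p) * a t + exp ((\<kappa> + (Re z - \<delta>) - \<theta>) * t / p) * a t) * exp ((Re z - \<theta>)\<^sup>2 - (Im z)\<^sup>2)"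
  proof -
   have e1: "exp ((\<kappa> + (Re z + \<delta>) - \<theta>) * t / p) = exp (\<delta> * (t / p)) * (exp (\<kappa> * t / p) * exp ((Re z - \<theta>) * t / p))"
    "exp ((\<kappa> + (Re z - \<delta>) - \<theta>) * t / p) = exp (- (\<delta> * (t / p))) * (exp (\<kappa> * t / p) * exp ((Re z - \<theta>) * t / p))"
    unfolding exp_add[symmetric] by (simp_all add: add_divide_distrib diff_divide_distrib algebra_simps)
   show ?thesis unfolding expo_norm e1 by (simp add: algebra_simps)
  qed
  also have "\<dots> \<le> (1 + 1) * exp 1"
  proof -
   have "(Re z - \<theta>)\<^sup>2 - (Im z)\<^sup>2 \<le> 1" using q zero_le_power2[of "Im z"] by argo
   then show ?thesis using c z a unfolding cutoff_profile_def by (intro mult_mono add_mono) auto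
  qed
  finally have "\<delta> * (\<bar>t / p\<bar> * ?E) \<le> 2 * exp 1" by (simp only: mult.assoc) simp
  then show ?thesis using \<delta> by (simp add: field_simps)
 qed
 let ?L = "complex_of_real (t / p) + 2 * (z - complex_of_real \<theta>)"
 have L: "norm ?L \<le> \<bar>t / p\<bar> + 2 * R"
  by (rule order_trans[OF norm_triangle_ineq]) (simp only: norm_mult norm_of_real norm_numeral add_left_mono mult_left_mono R zero_le_numeral)
 have EL: "?E * norm ?L \<le> exp 1 * (2 / \<delta> + 2 * R)"
 proof -
  have "?E * norm ?L \<le> ?E * (\<bar>t / p\<bar> + 2 * R)" by (intro mult_left_mono L E0)
  also have "\<dots> = \<bar>t / p\<bar> * ?E + 2 * R * ?E" by (simp only: distrib_left mult.commute mult.left_commute mult.assoc)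
  also have "\<dots> \<le> (2 / \<delta>) * exp 1 + 2 * R * exp 1" using R0 by (intro add_mono tE mult_left_mono Ele) auto
  finally show ?thesis by (simp add: algebra_simps)
 qed
 have "exp (\<kappa> * t / p) * norm (dfam a z t) = ?E * norm ?L"
  using a(1) by (simp add: dfam_def fam_def norm_mult)
 also have "\<dots> \<le> exp 1 * (2 / \<delta> + 2 * R)" by (rule EL)
 also have "\<dots> \<le> exp 1 * ((2 / \<delta> + 2 * R) * (R + 1) + 1)"
 proof (rule mult_left_mono)
  have "(2 / \<delta> + 2 * R) * 1 \<le> (2 / \<delta> + 2 * R) * (R + 1)" using R0 \<delta> by (intro mult_left_mono) auto
  then show "2 / \<delta> + 2 * R \<le> (2 / \<delta> + 2 * R) * (R + 1) + 1" by simp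
 qed simp
 finally show "exp (\<kappa> * t / p) * norm (dfam a z t) \<le> exp 1 * ((2 / \<delta> + 2 * R) * (R + 1) + 1)" .
 have "norm ((z - complex_of_real \<theta>) / complex_of_real p * complex_of_real (a t) + complex_of_real (a' t)) \<le> norm (z - complex_of_real \<theta>) / p * a t + \<bar>a' t\<bar>"
  by (rule order_trans[OF norm_triangle_ineq]) (use a p0 in \<open>simp add: norm_mult norm_divide\<close>)
 also have "\<dots> \<le> R * a t + 1 * a t"
  unfolding mult_1
 proof (intro add_mono mult_right_mono a)
  have "norm (z - complex_of_real \<theta>) / p \<le> norm (z - complex_of_real \<theta>) / 1" using p by (intro divide_left_mono) auto
  then show "norm (z - complex_of_real \<theta>) / p \<le> R" using R by simp
 qed
 also have "\<dots> = a t * (R + 1)" by (simp add: algebra_simps)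
 finally have G: "norm (fam' a a' z t) \<le> norm (expo z t) * a t * (R + 1)"
  unfolding fam'_def norm_mult[of "expo z t"] mult.assoc by (intro mult_left_mono) auto
 have "norm (dfam' a a' z t) \<le> norm (fam' a a' z t) * norm ?L + norm (fam a z t) / p"
  unfolding dfam'_def by (rule order_trans[OF norm_triangle_ineq]) (use p0 in \<open>simp add: norm_mult norm_divide\<close>)
 also have "\<dots> \<le> (norm (expo z t) * a t * (R + 1)) * norm ?L + norm (expo z t) * a t"
 proof (intro add_mono mult_right_mono G norm_ge_zero)
  have f: "norm (fam a z t) = norm (expo z t) * a t" using a(1) by (simp add: fam_def norm_mult)
  have "norm (fam a z t) / p \<le> norm (fam a z t) / 1" using p by (intro divide_left_mono) auto
  then show "norm (fam a z t) / p \<le> norm (expo z t) * a t" by (simp add: f)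
 qed
 finally have "exp (\<kappa> * t / p) * norm (dfam' a a' z t) \<le> exp (\<kappa> * t / p) * ((norm (expo z t) * a t * (R + 1)) * norm ?L + norm (expo z t) * a t)"
  by (intro mult_left_mono) auto
 also have "\<dots> = (?E * norm ?L) * (R + 1) + ?E" by (simp only: distrib_left mult.commute mult.left_commute mult.assoc)
 also have "\<dots> \<le> (exp 1 * (2 / \<delta> + 2 * R)) * (R + 1) + exp 1"
  using R0 by (intro add_mono mult_right_mono EL Ele) auto
 finally show "exp (\<kappa> * t / p) * norm (dfam' a a' z t) \<le> exp 1 * ((2 / \<delta> + 2 * R) * (R + 1) + 1)" by (simp add: algebra_simps)
qed

text \<open>The mean value inequality on a small ball bounds difference quotients in z by the bound
  C on the derivative, uniformly in t; subtracting the derivative costs another C.\<close>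

lemma fam_analytic:
 assumes c: "cutoff_profile \<kappa> a a' x0 x1" and z: "x0 < Re z" "Re z < x1"
 obtains \<delta> C where "0 < \<delta>" "multiplier p \<kappa> C (dfam a z) (dfam' a a' z)"
  "\<forall>v\<in>ball z \<delta> - {z}. multiplier p \<kappa> (C + C) (\<lambda>t. (fam a v t - fam a z t) / (v - z) - dfam a z t) (\<lambda>t. (fam' a a' v t - fam' a a' z t) / (v - z) - dfam' a a' z t)"
proof -
 \<comment> \<open>Half the distance to the ends, so that a point of the ball can be shifted by a
   further \<delta> without leaving the interval.\<close>
 define \<delta> where "\<delta> = min (Re z - x0) (x1 - Re z) / 2"
 have \<delta>: "0 < \<delta>" "2 * \<delta> \<le> Re z - x0" "2 * \<delta> \<le> x1 - Re z" using z by (auto simp: \<delta>_def)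
 define R where "R = norm (z - complex_of_real \<theta>) + \<delta>"
 define C where "C = exp 1 * ((2 / \<delta> + 2 * R) * (R + 1) + 1)"
 have bz: "Re v - \<delta> \<in> {x0..x1}" "Re v + \<delta> \<in> {x0..x1}" "Re v \<in> {x0..x1}" "norm (v - complex_of_real \<theta>) \<le> R" if "v \<in> ball z \<delta>" for v
 proof -
  have n: "norm (z - v) < \<delta>" using that by (simp add: dist_norm)
  have "\<bar>Re z - Re v\<bar> < \<delta>" using abs_Re_le_cmod[of "z - v"] n by simp
  then show "Re v - \<delta> \<in> {x0..x1}" "Re v + \<delta> \<in> {x0..x1}" "Re v \<in> {x0..x1}" using \<delta> by auto
  have "norm (v - complex_of_real \<theta>) \<le> norm (v - z) + norm (z - complex_of_real \<theta>)" using norm_triangle_ineq[of "v - z" "z - complex_of_real \<theta>"] by simp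
  then show "norm (v - complex_of_real \<theta>) \<le> R" using n by (simp add: R_def norm_minus_commute)
 qed
 have db: "exp (\<kappa> * t / p) * norm (dfam a v t) \<le> C" "exp (\<kappa> * t / p) * norm (dfam' a a' v t) \<le> C" if "v \<in> ball z \<delta>" for v t
  unfolding C_def by (rule dfam_bound[OF c \<delta>(1) bz(1,2,4)[OF that]])+
 have zb: "z \<in> ball z \<delta>" using \<delta>(1) by simp
 have md: "multiplier p \<kappa> C (dfam a z) (dfam' a a' z)"
  unfolding multiplier_def using fam_deriv_t(2,4)[OF c] db[OF zb] by blast
 show ?thesis
 proof (rule that[OF \<delta>(1) md], intro ballI)
  fix v assume "v \<in> ball z \<delta> - {z}"
  then have v: "v \<in> ball z \<delta>" "v \<noteq> z" by auto
  have mvt: "exp (\<kappa> * t / p) * norm ((F v - F z) / (v - z)) \<le> C"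
   if F: "\<And>u. (F has_field_derivative F' u) (at u)" "\<And>u. u \<in> ball z \<delta> \<Longrightarrow> exp (\<kappa> * t / p) * norm (F' u) \<le> C" for F F' t
  proof -
   have "norm (F v - F z) \<le> (C * exp (- (\<kappa> * t / p))) * norm (v - z)"
   proof (rule field_differentiable_bound[OF convex_ball[of z \<delta>] _ _ v(1) zb])
    fix u assume u: "u \<in> ball z \<delta>"
    show "(F has_field_derivative F' u) (at u within ball z \<delta>)" using F(1) by (rule DERIV_subset) auto
    have "norm (F' u) = (exp (\<kappa> * t / p) * norm (F' u)) * exp (- (\<kappa> * t / p))" by (simp add: exp_minus)
    also have "\<dots> \<le> C * exp (- (\<kappa> * t / p))" by (intro mult_right_mono F(2)[OF u]) auto
    finally show "norm (F' u) \<le> C * exp (- (\<kappa> * t / p))" .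
   qed
   then have "norm ((F v - F z) / (v - z)) \<le> C * exp (- (\<kappa> * t / p))" using v(2) by (simp add: norm_divide divide_le_eq)
   then have "exp (\<kappa> * t / p) * norm ((F v - F z) / (v - z)) \<le> exp (\<kappa> * t / p) * (C * exp (- (\<kappa> * t / p)))" by (intro mult_left_mono) auto
   also have "\<dots> = C * (exp (\<kappa> * t / p) * exp (- (\<kappa> * t / p)))" by simp
   also have "\<dots> = C" unfolding exp_add[symmetric] by simp
   finally show ?thesis .
  qed
  have mq: "multiplier p \<kappa> C (\<lambda>t. (fam a v t - fam a z t) / (v - z)) (\<lambda>t. (fam' a a' v t - fam' a a' z t) / (v - z))"
   unfolding multiplier_def
  proof (intro conjI allI)
   show "((\<lambda>t. (fam a v t - fam a z t) / (v - z)) has_vector_derivative (fam' a a' v t - fam' a a' z t) / (v - z)) (at t)" for t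
    by (intro has_vector_derivative_divide has_vector_derivative_diff fam_deriv_t(1)[OF c])
   show "continuous_on UNIV (\<lambda>t. (fam' a a' v t - fam' a a' z t) / (v - z))"
    using v(2) by (intro continuous_on_divide continuous_on_diff continuous_on_const fam_deriv_t(3)[OF c]) auto
   show "exp (\<kappa> * t / p) * norm ((fam a v t - fam a z t) / (v - z)) \<le> C" for t
    by (rule mvt[OF fam_deriv_z(1) db(1)])
   show "exp (\<kappa> * t / p) * norm ((fam' a a' v t - fam' a a' z t) / (v - z)) \<le> C" for t
    by (rule mvt[OF fam_deriv_z(2) db(2)])
  qed
  show "multiplier p \<kappa> (C + C) (\<lambda>t. (fam a v t - fam a z t) / (v - z) - dfam a z t) (\<lambda>t. (fam' a a' v t - fam' a a' z t) / (v - z) - dfam' a a' z t)"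
   by (rule multiplier_diff[OF mq md])
 qed
qed

lemma fam_difference_quotient:
 assumes \<phi>: "\<phi> \<in> calW U \<theta> w0 w1 p" and W: "tame_weight U W" "\<And>x. x \<in> U \<Longrightarrow> W x = w x * exp (\<kappa> * s x)"
  and Z: "\<And>n. Z n \<noteq> z" "Z \<longlonglongrightarrow> z"
  and m: "\<And>n. multiplier p \<kappa> C (\<lambda>t. (fam a (Z n) t - fam a z t) / (Z n - z) - dfam a z t) (\<lambda>t. (fam' a a' (Z n) t - fam' a a' z t) / (Z n - z) - dfam' a a' z t)"
 shows "(\<lambda>n. W1p_norm U W p (\<lambda>x. \<phi> x * ((fam a (Z n) (s x) - fam a z (s x)) / (Z n - z) - dfam a z (s x)))) \<longlonglongrightarrow> 0"
proof (rule multiplier_tendsto_0[OF \<phi> W m])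
 fix t
 have "(\<lambda>n. (fam a (Z n) t - fam a z t) / (Z n - z)) \<longlonglongrightarrow> dfam a z t"
  using fam_deriv_z(1)[of a t z] Z unfolding has_field_derivative_iff tendsto_at_iff_sequentially o_def by blast
 then show "(\<lambda>n. (fam a (Z n) t - fam a z t) / (Z n - z) - dfam a z t) \<longlonglongrightarrow> 0" by (rule LIM_zero)
 have "(\<lambda>n. (fam' a a' (Z n) t - fam' a a' z t) / (Z n - z)) \<longlonglongrightarrow> dfam' a a' z t"
  using fam_deriv_z(2)[of a a' t z] Z unfolding has_field_derivative_iff tendsto_at_iff_sequentially o_def by blast
 then show "(\<lambda>n. (fam' a a' (Z n) t - fam' a a' z t) / (Z n - z) - dfam' a a' z t) \<longlonglongrightarrow> 0" by (rule LIM_zero)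
qed

end

section \<open>Convergence in the sum space\<close>

lemma sum_spaceI: "a0 \<in> A0 \<Longrightarrow> a1 \<in> A1 \<Longrightarrow> (\<lambda>x. a0 x + a1 x) \<in> sum_space A0 A1"
 by (auto simp: sum_space_def)

lemma sum_norm_upper:
 assumes "a0 \<in> A0" "a1 \<in> A1" "v = (\<lambda>x. a0 x + a1 x)" "\<And>u. 0 \<le> N0 u" "\<And>u. 0 \<le> N1 u"
 shows "0 \<le> sum_norm A0 N0 A1 N1 v" "sum_norm A0 N0 A1 N1 v \<le> N0 a0 + N1 a1"
proof -
 have "v \<in> sum_space A0 A1" using assms(1-3) unfolding sum_space_def by blast
 then show "0 \<le> sum_norm A0 N0 A1 N1 v" by (rule sum_norm_lower) (simp add: assms add_nonneg_nonneg)
 show "sum_norm A0 N0 A1 N1 v \<le> N0 a0 + N1 a1"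
  unfolding sum_norm_def
 proof (rule cInf_lower)
  show "bdd_below {N0 a0 + N1 a1 |a0 a1. a0 \<in> A0 \<and> a1 \<in> A1 \<and> v = (\<lambda>x. a0 x + a1 x)}"
   using assms(4,5) by (intro bdd_belowI[of _ 0]) (auto intro: add_nonneg_nonneg)
 qed (use assms(1-3) in blast)
qed

lemma sum_norm_tendsto_0:
 assumes "\<And>n. a0 n \<in> A0" "\<And>n. a1 n \<in> A1" "\<And>n. v n = (\<lambda>x. a0 n x + a1 n x)" "\<And>u. 0 \<le> N0 u" "\<And>u. 0 \<le> N1 u"
  and "(\<lambda>n. N0 (a0 n)) \<longlonglongrightarrow> 0" "(\<lambda>n. N1 (a1 n)) \<longlonglongrightarrow> 0"
 shows "(\<lambda>n. sum_norm A0 N0 A1 N1 (v n)) \<longlonglongrightarrow> 0"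
proof (rule tendsto_sandwich[OF _ _ tendsto_const])
 show "(\<lambda>n. N0 (a0 n) + N1 (a1 n)) \<longlonglongrightarrow> 0" using tendsto_add[OF assms(6,7)] by simp
 show "\<forall>\<^sub>F n in sequentially. 0 \<le> sum_norm A0 N0 A1 N1 (v n)"
  by (intro always_eventually allI sum_norm_upper(1)[OF assms(1) assms(2) assms(3) assms(4) assms(5)])
 show "\<forall>\<^sub>F n in sequentially. sum_norm A0 N0 A1 N1 (v n) \<le> N0 (a0 n) + N1 (a1 n)"
  by (intro always_eventually allI sum_norm_upper(2)[OF assms(1) assms(2) assms(3) assms(4) assms(5)])
qed

section \<open>The partition of unity and the function on the strip\<close>

context interpolation_pair
begin

lemma weight_exp:
 assumes "x \<in> U"
 shows "w0 x = w x * exp (\<theta> * s x)" "w1 x = w x * exp ((\<theta> - 1) * s x)"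
 using interp_weight_exp[of w0 x w1 \<theta>] tame_weightD(2)[OF w0 assms] tame_weightD(2)[OF w1 assms] by (simp_all add: s_def)

text \<open>The logistic function: \<open>eta t + eta (- t)\<close> is 1, the derivative is bounded
  by the function itself, and the decay like exp (- t) absorbs every exp (c t) with c in
  [0, 1].\<close>

definition eta where "eta t = 1 / (1 + exp (t :: real))"
definition eta' where "eta' t = - exp t / (1 + exp (t :: real))\<^sup>2"

lemma eta_deriv: "(eta has_real_derivative eta' t) (at t)"
proof -
 have "1 + exp t \<noteq> 0" using exp_gt_zero[of t] by linarith
 then show ?thesis unfolding eta_def[abs_def] eta'_def
  by (auto intro!: derivative_eq_intros simp: power2_eq_square field_simps)
qed

lemma eta'_continuous: "continuous_on UNIV eta'"
proof -
 have "1 + exp t \<noteq> (0 :: real)" for t using exp_gt_zero[of t] by linarith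
 then show ?thesis unfolding eta'_def[abs_def] by (intro continuous_intros) auto
qed

lemma eta_bound: "0 \<le> eta t" "\<bar>eta' t\<bar> \<le> eta t" "eta t + eta (- t) = 1"
proof -
 have e: "0 < exp t" by simp
 then have "0 < 1 + exp t" by linarith
 then show "0 \<le> eta t" "eta t + eta (- t) = 1" by (simp_all add: eta_def exp_minus field_simps)
 have "\<bar>eta' t\<bar> = (exp t / (1 + exp t)) * eta t" using \<open>0 < 1 + exp t\<close> by (simp add: eta'_def eta_def power2_eq_square)
 also have "\<dots> \<le> 1 * eta t" using \<open>0 < 1 + exp t\<close> \<open>0 \<le> eta t\<close> by (intro mult_right_mono) auto
 finally show "\<bar>eta' t\<bar> \<le> eta t" by simp
qed

lemma exp_eta_le:
 assumes "0 \<le> c" "c \<le> 1"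
 shows "exp (c * t) * eta t \<le> 1"
proof -
 have "exp (c * t) \<le> 1 + exp t"
 proof (cases "0 \<le> t")
  case True
  then have "c * t \<le> 1 * t" using assms by (intro mult_right_mono) auto
  then have "exp (c * t) \<le> exp t" by simp
  then show ?thesis by linarith
 next
  case False
  then have "c * t \<le> 0" using assms by (simp add: mult_le_0_iff)
  then have "exp (c * t) \<le> 1" by simp
  then show ?thesis using exp_gt_zero[of t] by linarith
 qed
 moreover have "0 < 1 + exp t" using exp_gt_zero[of t] by linarith
 ultimately show ?thesis by (simp add: eta_def divide_le_eq)
qed

text \<open>For the weight \<open>w0\<close> the exponent reduces to \<xi> / p, which lies in [0, 1]
  because p >= 1.\<close>

lemma profile_0: "cutoff_profile \<theta> eta eta' 0 1"
 unfolding cutoff_profile_def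
proof (intro conjI allI ballI)
 fix \<xi> t :: real assume \<xi>: "\<xi> \<in> {0..1}"
 have "0 \<le> \<xi> / p" "\<xi> / p \<le> 1" using \<xi> p by (auto simp: divide_le_eq)
 from exp_eta_le[OF this, of t]
 show "exp ((\<theta> + \<xi> - \<theta>) * t / p) * eta t \<le> 1" by simp
qed (use eta_deriv eta'_continuous eta_bound in auto)

text \<open>For the weight \<open>w1\<close> the exponent is (\<xi> - 1) / p; it is of the opposite
  sign, hence the reflected cutoff.\<close>

lemma profile_1: "cutoff_profile (\<theta> - 1) (\<lambda>t. eta (- t)) (\<lambda>t. - eta' (- t)) 0 1"
 unfolding cutoff_profile_def
proof (intro conjI allI ballI)
 show "((\<lambda>t. eta (- t)) has_real_derivative - eta' (- t)) (at t)" for t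
  using DERIV_mirror[of eta "eta' (- t)" t] eta_deriv by simp
 show "continuous_on UNIV (\<lambda>t. - eta' (- t))"
  by (intro continuous_on_minus continuous_on_compose2[OF eta'_continuous]) (auto intro: continuous_intros)
 fix \<xi> t :: real assume \<xi>: "\<xi> \<in> {0..1}"
 have "0 \<le> (1 - \<xi>) / p" "(1 - \<xi>) / p \<le> 1" using \<xi> p by (auto simp: divide_le_eq)
 from exp_eta_le[OF this, of "- t"]
 have "exp ((1 - \<xi>) / p * (- t)) * eta (- t) \<le> 1" .
 moreover have "(1 - \<xi>) / p * (- t) = (\<theta> - 1 + \<xi> - \<theta>) * t / p" using p0 by (simp add: field_simps)
 ultimately show "exp ((\<theta> - 1 + \<xi> - \<theta>) * t / p) * eta (- t) \<le> 1" by simp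
qed (use eta_bound in auto)

text \<open>On the line Re z = \<xi> the exponent vanishes and the constant 1 is admissible. It is
  applied with \<xi> = 0 and \<xi> = 1, where f must lie in one endpoint space without being
  split.\<close>

lemma profile_const:
 assumes "\<kappa> = \<theta> - \<xi>" "0 \<le> \<xi>" "\<xi> \<le> 1"
 shows "cutoff_profile \<kappa> (\<lambda>t. 1) (\<lambda>t. 0) \<xi> \<xi>"
 using assms by (auto simp: cutoff_profile_def)

lemma fam_split: "expo z t = fam eta z t + fam (\<lambda>t. eta (- t)) z t"
proof -
 have "complex_of_real (eta t) + complex_of_real (eta (- t)) = 1" using eta_bound(3)[of t] by (metis of_real_1 of_real_add)
 then have "expo z t * (complex_of_real (eta t) + complex_of_real (eta (- t))) = expo z t" by simp
 then show ?thesis by (simp add: fam_def distrib_left)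
qed

lemma fam_1: "fam (\<lambda>t. 1) = expo"
 by (intro ext) (simp add: fam_def)

lemma multiplier_root_bound:
 assumes \<phi>: "\<phi> \<in> calW U \<theta> w0 w1 p" and W: "tame_weight U W" "\<And>x. x \<in> U \<Longrightarrow> W x = w x * exp (\<kappa> * s x)"
 shows "\<exists>B. \<forall>m m'. multiplier p \<kappa> C m m' \<longrightarrow> W1p_norm U W p (\<lambda>x. \<phi> x * m (s x)) \<le> B"
proof (intro exI allI impI)
 fix m m' assume "multiplier p \<kappa> C m m'"
 from multiplier_W1p(2)[OF \<phi> W this]
 have "(W1p_norm U W p (\<lambda>x. \<phi> x * m (s x)) powr p) powr (1 / p)
   \<le> (2 powr p * C powr p * (1 + real CARD('d)) * calW_norm U \<theta> w0 w1 p \<phi> powr p) powr (1 / p)"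
  using p0 by (intro powr_mono2) auto
 then show "W1p_norm U W p (\<lambda>x. \<phi> x * m (s x))
   \<le> (2 powr p * C powr p * (1 + real CARD('d)) * calW_norm U \<theta> w0 w1 p \<phi> powr p) powr (1 / p)"
  using W1p_norm_nonneg[of U W p "\<lambda>x. \<phi> x * m (s x)"] p0 by (simp add: powr_powr)
qed

text \<open>The function is \<phi> times \<open>expo z (s x)\<close>. In the strip the part with
  \<open>eta\<close> lies in the space of \<open>w0\<close> and the reflected part in that of
  \<open>w1\<close>, and continuity, boundedness and analyticity are checked on the two parts
  separately. On the boundary lines the undivided function is handled with the constant profile.
  Starting from \<open>calW_0\<close> rather than \<open>calW\<close> puts all parts into the
  closures of \<open>Lip_c\<close>.\<close>

theorem calW_0_subset_complex_interpolation:
 "calW_0 U \<theta> w0 w1 p \<subseteq> complex_interpolation (W1p_0 U w0 p) (W1p_norm U w0 p) (W1p_0 U w1 p) (W1p_norm U w1 p) \<theta>"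
proof
 fix \<phi> assume \<phi>0: "\<phi> \<in> calW_0 U \<theta> w0 w1 p"
 then have \<phi>: "\<phi> \<in> calW U \<theta> w0 w1 p" by (simp add: calW_0_def closure_in_def)
 define f where "f z x = \<phi> x * expo z (s x)" for z x
 let ?e = "\<lambda>t. eta (- t)" and ?e' = "\<lambda>t. - eta' (- t)"
 let ?N = "sum_norm (W1p_0 U w0 p) (W1p_norm U w0 p) (W1p_0 U w1 p) (W1p_norm U w1 p)"
 have mem0: "(\<lambda>x. \<phi> x * m (s x)) \<in> W1p_0 U w0 p" if "multiplier p \<theta> C m m'" for C m m'
  by (rule multiplier_W1p_0[OF \<phi>0 w0 weight_exp(1) that])
 have mem1: "(\<lambda>x. \<phi> x * m (s x)) \<in> W1p_0 U w1 p" if "multiplier p (\<theta> - 1) C m m'" for C m m'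
  by (rule multiplier_W1p_0[OF \<phi>0 w1 weight_exp(2) that])
 have split: "f z = (\<lambda>x. \<phi> x * fam eta z (s x) + \<phi> x * fam ?e z (s x))" for z
  by (intro ext) (simp add: f_def fam_split[of z] distrib_left)
 have strip: "Re z \<in> {0..1}" if "z \<in> strip" for z using that by (simp add: strip_def)
 have bd0: "Re (Complex 0 t) \<in> {0..0}" and bd1: "Re (Complex 1 t) \<in> {1..1}" for t by auto
 have c0: "cutoff_profile \<theta> (\<lambda>t. 1) (\<lambda>t. 0) 0 0" by (rule profile_const) auto
 have c1: "cutoff_profile (\<theta> - 1) (\<lambda>t. 1) (\<lambda>t. 0) 1 1" by (rule profile_const) auto
 have f1: "f z = (\<lambda>x. \<phi> x * fam (\<lambda>t. 1) z (s x))" for z by (intro ext) (simp add: f_def fam_1)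
 obtain B0 where B0: "\<And>m m'. multiplier p \<theta> (3 * exp 1) m m' \<Longrightarrow> W1p_norm U w0 p (\<lambda>x. \<phi> x * m (s x)) \<le> B0"
  using multiplier_root_bound[OF \<phi> w0 weight_exp(1)] by blast
 obtain B1 where B1: "\<And>m m'. multiplier p (\<theta> - 1) (3 * exp 1) m m' \<Longrightarrow> W1p_norm U w1 p (\<lambda>x. \<phi> x * m (s x)) \<le> B1"
  using multiplier_root_bound[OF \<phi> w1 weight_exp(2)] by blast
 have "f \<in> calderon_functions (W1p_0 U w0 p) (W1p_norm U w0 p) (W1p_0 U w1 p) (W1p_norm U w1 p)"
  unfolding calderon_functions_def
 proof (intro CollectI conjI ballI allI)
  fix z :: complex assume z: "z \<in> strip"
  show "f z \<in> sum_space (W1p_0 U w0 p) (W1p_0 U w1 p)"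
   unfolding split[of z]
   by (rule sum_spaceI[OF mem0[OF fam_multiplier[OF profile_0 strip[OF z]]] mem1[OF fam_multiplier[OF profile_1 strip[OF z]]]])
 next
  show "continuous_in ?N strip f"
   unfolding continuous_in_def tendsto_at_iff_sequentially o_def
  proof (intro ballI allI impI)
   fix z :: complex and Z assume z: "z \<in> strip" and Z: "\<forall>i. Z i \<in> strip - {z}" "Z \<longlonglongrightarrow> z"
   have Zn: "Re (Z n) \<in> {0..1}" for n using Z(1) strip by blast
   note zz = strip[OF z]
   show "(\<lambda>n. ?N (\<lambda>x. f (Z n) x - f z x)) \<longlonglongrightarrow> 0"
   proof (rule sum_norm_tendsto_0)
    show "(\<lambda>x. \<phi> x * (fam eta (Z n) (s x) - fam eta z (s x))) \<in> W1p_0 U w0 p" for n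
     by (rule mem0[OF multiplier_diff[OF fam_multiplier[OF profile_0 Zn] fam_multiplier[OF profile_0 zz]]])
    show "(\<lambda>x. \<phi> x * (fam ?e (Z n) (s x) - fam ?e z (s x))) \<in> W1p_0 U w1 p" for n
     by (rule mem1[OF multiplier_diff[OF fam_multiplier[OF profile_1 Zn] fam_multiplier[OF profile_1 zz]]])
    show "(\<lambda>x. f (Z n) x - f z x) = (\<lambda>x. \<phi> x * (fam eta (Z n) (s x) - fam eta z (s x)) + \<phi> x * (fam ?e (Z n) (s x) - fam ?e z (s x)))" for n
     unfolding split by (simp add: algebra_simps)
    show "(\<lambda>n. W1p_norm U w0 p (\<lambda>x. \<phi> x * (fam eta (Z n) (s x) - fam eta z (s x)))) \<longlonglongrightarrow> 0"
     by (rule fam_continuity[OF \<phi> w0 weight_exp(1) profile_0 Zn zz Z(2)])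
    show "(\<lambda>n. W1p_norm U w1 p (\<lambda>x. \<phi> x * (fam ?e (Z n) (s x) - fam ?e z (s x)))) \<longlonglongrightarrow> 0"
     by (rule fam_continuity[OF \<phi> w1 weight_exp(2) profile_1 Zn zz Z(2)])
   qed (rule W1p_norm_nonneg)+
  qed
 next
  show "bounded_in ?N strip f"
   unfolding bounded_in_def
  proof (intro exI ballI)
   fix z :: complex assume z: "z \<in> strip"
   note m0 = fam_multiplier[OF profile_0 strip[OF z]] and m1 = fam_multiplier[OF profile_1 strip[OF z]]
   have "?N (f z) \<le> W1p_norm U w0 p (\<lambda>x. \<phi> x * fam eta z (s x)) + W1p_norm U w1 p (\<lambda>x. \<phi> x * fam ?e z (s x))"
    by (rule sum_norm_upper(2)[OF mem0[OF m0] mem1[OF m1] split W1p_norm_nonneg W1p_norm_nonneg])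
   also have "\<dots> \<le> B0 + B1" by (intro add_mono B0[OF m0] B1[OF m1])
   finally show "?N (f z) \<le> B0 + B1" .
  qed
 next
  show "analytic_in (sum_space (W1p_0 U w0 p) (W1p_0 U w1 p)) ?N (interior strip) f"
   unfolding analytic_in_def
  proof (intro ballI)
   fix z :: complex assume "z \<in> interior strip"
   then have z: "0 < Re z" "Re z < 1" by (simp_all add: strip_interior)
   obtain \<delta>0 C0 where d0: "0 < \<delta>0" "multiplier p \<theta> C0 (dfam eta z) (dfam' eta eta' z)"
    "\<forall>v\<in>ball z \<delta>0 - {z}. multiplier p \<theta> (C0 + C0) (\<lambda>t. (fam eta v t - fam eta z t) / (v - z) - dfam eta z t) (\<lambda>t. (fam' eta eta' v t - fam' eta eta' z t) / (v - z) - dfam' eta eta' z t)"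
    by (rule fam_analytic[OF profile_0 z])
   obtain \<delta>1 C1 where d1: "0 < \<delta>1" "multiplier p (\<theta> - 1) C1 (dfam ?e z) (dfam' ?e ?e' z)"
    "\<forall>v\<in>ball z \<delta>1 - {z}. multiplier p (\<theta> - 1) (C1 + C1) (\<lambda>t. (fam ?e v t - fam ?e z t) / (v - z) - dfam ?e z t) (\<lambda>t. (fam' ?e ?e' v t - fam' ?e ?e' z t) / (v - z) - dfam' ?e ?e' z t)"
    by (rule fam_analytic[OF profile_1 z])
   define D where "D x = \<phi> x * dfam eta z (s x) + \<phi> x * dfam ?e z (s x)" for x
   have D: "D \<in> sum_space (W1p_0 U w0 p) (W1p_0 U w1 p)"
    unfolding D_def[abs_def] by (rule sum_spaceI[OF mem0[OF d0(2)] mem1[OF d1(2)]])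
   define \<delta> where "\<delta> = min \<delta>0 \<delta>1"
   have "((\<lambda>v. ?N (\<lambda>x. (f v x - f z x) / (v - z) - D x)) \<longlongrightarrow> 0) (at z within ball z \<delta>)"
    unfolding tendsto_at_iff_sequentially o_def
   proof (intro allI impI)
    fix Z assume Z: "\<forall>i. Z i \<in> ball z \<delta> - {z}" "Z \<longlonglongrightarrow> z"
    have Zn: "Z n \<in> ball z \<delta>0 - {z}" "Z n \<in> ball z \<delta>1 - {z}" "Z n \<noteq> z" for n using Z(1) by (auto simp: \<delta>_def)
    show "(\<lambda>n. ?N (\<lambda>x. (f (Z n) x - f z x) / (Z n - z) - D x)) \<longlonglongrightarrow> 0"
    proof (rule sum_norm_tendsto_0)
     show "(\<lambda>x. \<phi> x * ((fam eta (Z n) (s x) - fam eta z (s x)) / (Z n - z) - dfam eta z (s x))) \<in> W1p_0 U w0 p" for n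
      by (rule mem0[OF d0(3)[rule_format, OF Zn(1)]])
     show "(\<lambda>x. \<phi> x * ((fam ?e (Z n) (s x) - fam ?e z (s x)) / (Z n - z) - dfam ?e z (s x))) \<in> W1p_0 U w1 p" for n
      by (rule mem1[OF d1(3)[rule_format, OF Zn(2)]])
     show "(\<lambda>x. (f (Z n) x - f z x) / (Z n - z) - D x) = (\<lambda>x. \<phi> x * ((fam eta (Z n) (s x) - fam eta z (s x)) / (Z n - z) - dfam eta z (s x)) +
       \<phi> x * ((fam ?e (Z n) (s x) - fam ?e z (s x)) / (Z n - z) - dfam ?e z (s x)))" for n
      unfolding split D_def by (intro ext) (simp add: add_divide_distrib diff_divide_distrib algebra_simps)
     show "(\<lambda>n. W1p_norm U w0 p (\<lambda>x. \<phi> x * ((fam eta (Z n) (s x) - fam eta z (s x)) / (Z n - z) - dfam eta z (s x)))) \<longlonglongrightarrow> 0"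
      by (rule fam_difference_quotient[OF \<phi> w0 weight_exp(1) Zn(3) Z(2) d0(3)[rule_format, OF Zn(1)]])
     show "(\<lambda>n. W1p_norm U w1 p (\<lambda>x. \<phi> x * ((fam ?e (Z n) (s x) - fam ?e z (s x)) / (Z n - z) - dfam ?e z (s x)))) \<longlonglongrightarrow> 0"
      by (rule fam_difference_quotient[OF \<phi> w1 weight_exp(2) Zn(3) Z(2) d1(3)[rule_format, OF Zn(2)]])
    qed (rule W1p_norm_nonneg)+
   qed
   moreover have "at z within ball z \<delta> = at z"
    using d0(1) d1(1) by (intro at_within_open) (auto simp: \<delta>_def)
   ultimately show "\<exists>D\<in>sum_space (W1p_0 U w0 p) (W1p_0 U w1 p). ((\<lambda>v. ?N (\<lambda>x. (f v x - f z x) / (v - z) - D x)) \<longlongrightarrow> 0) (at z)"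
    using D by (intro bexI[of _ D]) auto
  qed
 next
  show "f (Complex 0 t) \<in> W1p_0 U w0 p" for t
   unfolding f1 by (rule mem0[OF fam_multiplier[OF c0 bd0]])
  show "f (Complex 1 t) \<in> W1p_0 U w1 p" for t
   unfolding f1 by (rule mem1[OF fam_multiplier[OF c1 bd1]])
  have lim: "(\<lambda>n. Complex a (T n)) \<longlonglongrightarrow> Complex a t" if "T \<longlonglongrightarrow> t" for T t a
   by (intro tendsto_Complex tendsto_const that)
  have alg: "\<phi> x * a - \<phi> x * b = \<phi> x * (a - b)" for x a b by (simp add: right_diff_distrib)
  show "continuous_in (W1p_norm U w0 p) UNIV (\<lambda>t. f (Complex 0 t))"
   unfolding continuous_in_def tendsto_at_iff_sequentially o_def f1 alg
   by (intro ballI allI impI fam_continuity[OF \<phi> w0 weight_exp(1) c0 bd0 bd0 lim])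
  show "continuous_in (W1p_norm U w1 p) UNIV (\<lambda>t. f (Complex 1 t))"
   unfolding continuous_in_def tendsto_at_iff_sequentially o_def f1 alg
   by (intro ballI allI impI fam_continuity[OF \<phi> w1 weight_exp(2) c1 bd1 bd1 lim])
  show "bounded_in (W1p_norm U w0 p) UNIV (\<lambda>t. f (Complex 0 t))"
   unfolding bounded_in_def f1 by (intro exI[of _ B0] ballI B0[OF fam_multiplier[OF c0 bd0]])
  show "bounded_in (W1p_norm U w1 p) UNIV (\<lambda>t. f (Complex 1 t))"
   unfolding bounded_in_def f1 by (intro exI[of _ B1] ballI B1[OF fam_multiplier[OF c1 bd1]])
 qed
 moreover have "f (complex_of_real \<theta>) = \<phi>" by (intro ext) (simp add: f_def expo_def)
 ultimately show "\<phi> \<in> complex_interpolation (W1p_0 U w0 p) (W1p_norm U w0 p) (W1p_0 U w1 p) (W1p_norm U w1 p) \<theta>"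
  unfolding complex_interpolation_def by blast
qed

end

section \<open>Density of Lipschitz functions on the whole space\<close>

lemma C1_along_scale:
 fixes F :: "'a::real_normed_vector \<Rightarrow> 'b::real_normed_vector"
 assumes "C1_along e F D"
 shows "C1_along e (\<lambda>x. F (a *\<^sub>R x)) (\<lambda>x. a *\<^sub>R D (a *\<^sub>R x))"
proof -
 have c: "continuous_on UNIV F" "continuous_on UNIV D" using assms by (auto simp: C1_along_def)
 have "((\<lambda>t. F (a *\<^sub>R (x + t *\<^sub>R e))) has_vector_derivative a *\<^sub>R D (a *\<^sub>R x)) (at 0)" for x
 proof -
  have "((\<lambda>t. F (a *\<^sub>R x + t *\<^sub>R e)) \<circ> (\<lambda>t. a * t) has_vector_derivative a *\<^sub>R D (a *\<^sub>R x + (a * 0) *\<^sub>R e)) (at 0)"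
  proof (rule vector_diff_chain_at)
   show "((\<lambda>t. a * t) has_vector_derivative a) (at 0)"
    unfolding has_real_derivative_iff_has_vector_derivative[symmetric] by (auto intro!: derivative_eq_intros)
  qed (rule C1_along_line[OF assms])
  then show ?thesis by (simp add: o_def scaleR_add_right)
 qed
 then show ?thesis unfolding C1_along_def
  by (intro conjI allI continuous_on_compose2[OF c(1)] continuous_intros continuous_on_compose2[OF c(2)]) auto
qed

text \<open>One passes from x to y a coordinate at a time; each of the d steps costs at most B times
  the distance of the two points.\<close>

lemma C1_along_lipschitz:
 fixes F :: "real ^ 'd \<Rightarrow> 'b::real_normed_vector"
 assumes C1: "\<And>i. C1_along (axis i 1) F (D i)" and B: "\<And>i x. norm (D i x) \<le> B" "0 \<le> B"
 shows "(B * real CARD('d))-lipschitz_on UNIV F"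
proof (rule lipschitz_onI)
 fix x y :: "real ^ 'd"
 have key: "norm (F (x + (\<Sum>i\<in>S. h i *\<^sub>R axis i 1)) - F x) \<le> (\<Sum>i\<in>S. B * \<bar>h i\<bar>)" if "finite S" for S h
  using that
 proof (induction S rule: finite_induct)
  case (insert j S)
  let ?z = "x + (\<Sum>i\<in>S. h i *\<^sub>R axis i 1)"
  have "F (x + (\<Sum>i\<in>insert j S. h i *\<^sub>R axis i 1)) - F x = (F (?z + h j *\<^sub>R axis j 1) - F ?z) + (F ?z - F x)"
   using insert.hyps by (simp add: algebra_simps)
  also have "norm \<dots> \<le> B * \<bar>h j\<bar> + (\<Sum>i\<in>S. B * \<bar>h i\<bar>)"
   by (rule order_trans[OF norm_triangle_ineq]) (intro add_mono C1_along_bound[OF C1 B(1)] insert.IH)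
  finally show ?case using insert.hyps by simp
 qed simp
 have "x + (\<Sum>i\<in>UNIV. (y - x) $ i *\<^sub>R axis i 1) = y"
  unfolding scalar_mult_eq_scaleR[symmetric] basis_expansion by simp
 then have "norm (F y - F x) \<le> (\<Sum>i\<in>UNIV. B * \<bar>(y - x) $ i\<bar>)" using key[of UNIV "\<lambda>i. (y - x) $ i"] by simp
 also have "\<dots> \<le> (\<Sum>i\<in>(UNIV :: 'd set). B * norm (y - x))"
  by (intro sum_mono mult_left_mono component_le_norm_cart B(2))
 finally show "dist (F x) (F y) \<le> B * real CARD('d) * dist x y"
  by (simp add: dist_norm norm_minus_commute mult_ac)
qed (use B in simp)

text \<open>One bump, normalised to 1 at the origin, is dilated by n + 1. Dominated convergence asks
  for pointwise convergence to 1 under uniform bounds, so no plateau is built.\<close>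

lemma cutoff_exists:
 obtains \<zeta> :: "nat \<Rightarrow> real ^ 'd \<Rightarrow> real" and D M R where
  "\<And>n i. C1_along (axis i 1) (\<zeta> n) (D n i)" "\<And>n x. \<bar>\<zeta> n x\<bar> \<le> M" "\<And>n i x. \<bar>D n i x\<bar> \<le> M"
  "\<And>x. (\<lambda>n. \<zeta> n x) \<longlonglongrightarrow> 1" "\<And>i x. (\<lambda>n. D n i x) \<longlonglongrightarrow> 0" "\<And>n x. x \<notin> cball 0 (R n) \<Longrightarrow> \<zeta> n x = 0" "0 \<le> M"
proof -
 define b :: "real ^ 'd \<Rightarrow> real" where "b x = bump (-1) 1 1 x / bump (-1) 1 1 (0 :: real ^ 'd)" for x
 have c: "0 < bump (-1) 1 1 (0 :: real ^ 'd)" by (subst bump_pos_iff) (auto simp: mem_box_cart)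
 have b_eq: "b = (\<lambda>x. (1 / bump (-1) 1 1 (0 :: real ^ 'd)) * bump (-1) 1 1 x)" by (simp add: fun_eq_iff b_def)
 have bC: "C_order k b" for k unfolding b_eq by (intro C_order_mult C_order_const C_order_bump)
 have C1: "C1_along (axis i 1) b (partial_deriv i b)" for i by (rule C_order_C1_along[OF bC])
 have bc: "continuous_on UNIV b" "continuous_on UNIV (partial_deriv i b)" for i using C1 by (auto simp: C1_along_def)
 obtain r0 where r0: "cbox (-1) (1 :: real ^ 'd) \<subseteq> cball 0 r0"
  using bounded_cbox[of "-1" "1 :: real ^ 'd"] unfolding bounded_iff by (meson mem_cball_0 subsetI)
 have b0: "b x = 0" if "x \<notin> cball 0 r0" for x
 proof -
  have "x \<notin> box (-1) 1" using that r0 box_subset_cbox by blast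
  then show ?thesis using bump_eq_0[of 1 x "-1" 1] by (simp add: b_def)
 qed
 have d0: "partial_deriv i b x = 0" if "x \<notin> cball 0 r0" for x i
  by (rule C1_along_eq_0[OF C1 closed_cball b0 that])
 obtain B where B: "0 \<le> B" "\<And>x. norm (b x) \<le> B" using continuous_compact_support_bounded[OF bc(1) compact_cball b0] by blast
 have "\<exists>B. 0 \<le> B \<and> (\<forall>x. norm (partial_deriv i b x) \<le> B)" for i
 proof (rule continuous_compact_support_bounded[OF bc(2)[of i] compact_cball d0[where i = i]])
  fix B assume "0 \<le> B" "\<And>x. norm (partial_deriv i b x) \<le> B"
  then show ?thesis by (intro exI[of _ B]) simp
 qed
 then obtain B' where B': "\<And>i. 0 \<le> B' i" "\<And>i x. norm (partial_deriv i b x) \<le> B' i" by metis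
 define M where "M = B + (\<Sum>i\<in>UNIV. B' i)"
 have M: "B \<le> M" "B' i \<le> M" for i
  unfolding M_def using B(1) B'(1) member_le_sum[of i UNIV B'] by (auto intro!: sum_nonneg simp: add_increasing)
 define a where "a n = 1 / real (Suc n)" for n
 have a: "0 < a n" "a n \<le> 1" "a \<longlonglongrightarrow> 0" for n
  unfolding a_def[abs_def] using mollifier_radius(1) by (auto simp: divide_le_eq)
 have M0: "0 \<le> M" using M(1) B(1) by linarith
 have Db: "\<bar>a n *\<^sub>R partial_deriv i b (a n *\<^sub>R x)\<bar> \<le> a n * M" for n i x
  using a(1)[of n] order_trans[OF B'(2) M(2), of i "a n *\<^sub>R x"] by (simp add: abs_mult mult_left_mono)
 show thesis
 proof (rule that[of "\<lambda>n x. b (a n *\<^sub>R x)" "\<lambda>n i x. a n *\<^sub>R partial_deriv i b (a n *\<^sub>R x)" M "\<lambda>n. r0 / a n"])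
  show "C1_along (axis i 1) (\<lambda>x. b (a n *\<^sub>R x)) (\<lambda>x. a n *\<^sub>R partial_deriv i b (a n *\<^sub>R x))" for n i
   by (rule C1_along_scale[OF C1])
  show "\<bar>b (a n *\<^sub>R x)\<bar> \<le> M" for n x using order_trans[OF B(2) M(1)] by simp
  show "\<bar>a n *\<^sub>R partial_deriv i b (a n *\<^sub>R x)\<bar> \<le> M" for n i x
   using Db[of n i x] mult_right_mono[OF a(2) M0, of n] by linarith
  show "(\<lambda>n. b (a n *\<^sub>R x)) \<longlonglongrightarrow> 1" for x
  proof -
   have "(\<lambda>n. a n *\<^sub>R x) \<longlonglongrightarrow> 0 *\<^sub>R x" by (intro tendsto_scaleR a(3) tendsto_const)
   then have "(\<lambda>n. b (a n *\<^sub>R x)) \<longlonglongrightarrow> b 0"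
    using continuous_on_tendsto_compose[OF bc(1), of "\<lambda>n. a n *\<^sub>R x" 0] by simp
   then show ?thesis using c by (simp add: b_def)
  qed
  show "(\<lambda>n. a n *\<^sub>R partial_deriv i b (a n *\<^sub>R x)) \<longlonglongrightarrow> 0" for i x
  proof (rule Lim_null_comparison)
   show "\<forall>\<^sub>F n in sequentially. norm (a n *\<^sub>R partial_deriv i b (a n *\<^sub>R x)) \<le> a n * M" using Db by simp
   show "(\<lambda>n. a n * M) \<longlonglongrightarrow> 0" using tendsto_mult[OF a(3) tendsto_const[of M]] by simp
  qed
  show "b (a n *\<^sub>R x) = 0" if "x \<notin> cball 0 (r0 / a n)" for n x
   by (rule b0) (use that a(1)[of n] in \<open>simp add: divide_less_eq mult.commute not_le\<close>)
 qed (rule M0)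
qed

section \<open>Truncation and mollification with two weights\<close>

lemma norm_mult_powr_weight_le:
 fixes a c :: complex
 assumes "norm c \<le> M" "0 \<le> p" "0 \<le> w"
 shows "norm (a * c) powr p * w \<le> M powr p * (norm a powr p * w)"
proof -
 have "norm (a * c) powr p * w = norm c powr p * (norm a powr p * w)" by (simp add: norm_mult powr_mult)
 also have "\<dots> \<le> M powr p * (norm a powr p * w)" using assms by (intro mult_right_mono powr_mono2) auto
 finally show ?thesis .
qed

text \<open>The function is measured with \<open>u\<close> and its gradient with \<open>w\<close>,
  so that the spaces \<open>W1p\<close> and \<open>calW\<close> are covered by the same argument.
  Integrability of \<phi> against \<open>w\<close> controls the product of \<phi> with the gradient
  of the cutoff.\<close>

lemma weighted_truncation:
 fixes \<phi> :: "real ^ 'd \<Rightarrow> complex" and u w :: "real ^ 'd \<Rightarrow> real"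
 assumes \<phi>: "has_weak_gradient UNIV \<phi> g" and u: "u \<in> borel_measurable lebesgue" "\<And>x. 0 \<le> u x"
  and w: "w \<in> borel_measurable lebesgue" "\<And>x. 0 \<le> w x" and p: "1 \<le> p"
  and I: "integrable lebesgue (\<lambda>x. norm (\<phi> x) powr p * u x)" "integrable lebesgue (\<lambda>x. norm (\<phi> x) powr p * w x)"
   "\<And>i. integrable lebesgue (\<lambda>x. norm (g x $ i) powr p * w x)" and e: "0 < e"
 obtains \<phi>1 g1 R where "has_weak_gradient UNIV \<phi>1 g1" "0 \<le> R" "\<forall>x. x \<notin> cball 0 R \<longrightarrow> \<phi>1 x = 0" "\<forall>x i. x \<notin> cball 0 R \<longrightarrow> g1 x $ i = 0"
  "integrable lebesgue (\<lambda>x. norm (\<phi> x - \<phi>1 x) powr p * u x)" "integrable lebesgue (\<lambda>x. norm (\<phi> x - \<phi>1 x) powr p * w x)"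
  "\<forall>i. integrable lebesgue (\<lambda>x. norm (g x $ i - g1 x $ i) powr p * w x)"
  "(\<integral>x. norm (\<phi> x - \<phi>1 x) powr p * u x \<partial>lebesgue) + (\<Sum>i\<in>UNIV. \<integral>x. norm (g x $ i - g1 x $ i) powr p * w x \<partial>lebesgue) < e"
proof (rule cutoff_exists)
 fix \<zeta> :: "nat \<Rightarrow> real ^ 'd \<Rightarrow> real" and D M R
 assume C1: "\<And>n i. C1_along (axis i 1) (\<zeta> n) (D n i)" and B: "\<And>n x. \<bar>\<zeta> n x\<bar> \<le> M" "\<And>n i x. \<bar>D n i x\<bar> \<le> M"
  and lim: "\<And>x. (\<lambda>n. \<zeta> n x) \<longlonglongrightarrow> 1" "\<And>i x. (\<lambda>n. D n i x) \<longlonglongrightarrow> 0"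
  and R: "\<And>n x. x \<notin> cball 0 (R n) \<Longrightarrow> \<zeta> n x = 0" and M0: "0 \<le> M"
 have p0: "0 < p" "0 \<le> p" using p by auto
 have D0: "D n i x = 0" if "x \<notin> cball 0 (R n)" for n i x by (rule C1_along_eq_0[OF C1 closed_cball R that])
 define \<phi>1 where "\<phi>1 n x = \<phi> x * complex_of_real (\<zeta> n x)" for n x
 define g1 :: "nat \<Rightarrow> real ^ 'd \<Rightarrow> complex ^ 'd" where "g1 n x = (\<chi> i. g x $ i * complex_of_real (\<zeta> n x) + \<phi> x * complex_of_real (D n i x))" for n x
 have wg: "has_weak_gradient UNIV (\<phi>1 n) (g1 n)" for n
 proof -
  have 1: "has_weak_gradient UNIV (\<lambda>x. complex_of_real (\<zeta> n x)) (\<lambda>x. \<chi> i. complex_of_real (D n i x))"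
   by (rule has_weak_gradient_C1) (simp add: C1_along_of_real[OF C1])
  have 2: "\<exists>B. \<forall>x\<in>K. \<bar>\<zeta> n x\<bar> \<le> B" "\<exists>B. \<forall>x\<in>K. \<forall>i. norm ((\<chi> i. complex_of_real (D n i x)) $ i) \<le> B" for K
   using B by (auto intro!: exI[of _ M])
  \<comment> \<open>The chain rule with m the inclusion of the reals into the complex numbers is the
    product rule for \<phi> and the cutoff.\<close>
  have 3: "(complex_of_real has_vector_derivative (\<lambda>t. 1) t) (at t)" "continuous_on UNIV (\<lambda>t :: real. 1 :: complex)" for t
   using has_vector_derivative_of_real[OF DERIV_ident, of "at t"] by auto
  from has_weak_gradient_mult_compose[OF open_UNIV \<phi> 1 2 3]
  show ?thesis by (simp add: \<phi>1_def[abs_def] g1_def[abs_def])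
 qed
 have lm: "\<phi> \<in> borel_measurable lebesgue" "\<phi>1 n \<in> borel_measurable lebesgue"
  "(\<lambda>x. g x $ i) \<in> borel_measurable lebesgue" "(\<lambda>x. g1 n x $ i) \<in> borel_measurable lebesgue" for n i
  using locally_integrable_measurable[OF open_UNIV] locally_integrable_component[of UNIV _ i] \<phi> wg[of n]
  unfolding has_weak_gradient_def lebesgue_on_UNIV_eq by blast+
 have d\<phi>: "\<phi> x - \<phi>1 n x = \<phi> x * complex_of_real (1 - \<zeta> n x)" for n x by (simp add: \<phi>1_def algebra_simps)
 have dg: "g x $ i - g1 n x $ i = g x $ i * complex_of_real (1 - \<zeta> n x) + \<phi> x * complex_of_real (- D n i x)" for n x i
  by (simp add: g1_def algebra_simps)
 have cb: "norm (complex_of_real (1 - \<zeta> n x)) \<le> 1 + M" "norm (complex_of_real (- D n i x)) \<le> 1 + M" for n x i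
  unfolding norm_of_real using B(1)[of n x] B(2)[of n i x] by linarith+
 have wmeas: "(\<lambda>x. norm (f x) powr p * v x) \<in> borel_measurable lebesgue" if "f \<in> borel_measurable lebesgue" "v \<in> borel_measurable lebesgue"
  for f :: "real ^ 'd \<Rightarrow> complex" and v
  by (rule borel_measurable_times[OF measurable_compose[OF that(1) borel_measurable_norm_powr] that(2)])
 have cl: "(\<lambda>n. complex_of_real (1 - \<zeta> n x)) \<longlonglongrightarrow> complex_of_real (1 - 1)" "(\<lambda>n. complex_of_real (- D n i x)) \<longlonglongrightarrow> complex_of_real (- 0)" for x i
  by (intro tendsto_of_real tendsto_diff tendsto_const lim tendsto_minus)+
 have main: "\<And>n. integrable lebesgue (\<lambda>x. norm (\<phi> x - \<phi>1 n x) powr p * v x)" "(\<lambda>n. \<integral>x. norm (\<phi> x - \<phi>1 n x) powr p * v x \<partial>lebesgue) \<longlonglongrightarrow> 0"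
  if v: "v \<in> borel_measurable lebesgue" "\<And>x. 0 \<le> v x" "integrable lebesgue (\<lambda>x. norm (\<phi> x) powr p * v x)" for v :: "real ^ 'd \<Rightarrow> real"
 proof -
  have a: "norm (\<phi> x - \<phi>1 n x) powr p * v x \<le> (1 + M) powr p * (norm (\<phi> x) powr p * v x)" for n x
   unfolding d\<phi> by (rule norm_mult_powr_weight_le[OF cb(1) p0(2) v(2)])
  have b: "(\<lambda>n. \<phi> x - \<phi>1 n x) \<longlonglongrightarrow> 0" for x unfolding d\<phi> using tendsto_mult[OF tendsto_const cl(1)] by simp
  have c: "(\<lambda>x. \<phi> x - \<phi>1 n x) \<in> borel_measurable lebesgue" for n by (intro borel_measurable_diff lm)
  show "\<And>n. integrable lebesgue (\<lambda>x. norm (\<phi> x - \<phi>1 n x) powr p * v x)" "(\<lambda>n. \<integral>x. norm (\<phi> x - \<phi>1 n x) powr p * v x \<partial>lebesgue) \<longlonglongrightarrow> 0"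
   by (rule weighted_dominated_tendsto_0[OF wmeas[OF c v(1)] AE_I2[OF v(2)] p0(1) integrable_mult_right[OF v(3)] AE_I2[OF a] b])+
 qed
 have grad: "\<And>n. integrable lebesgue (\<lambda>x. norm (g x $ i - g1 n x $ i) powr p * w x)" "(\<lambda>n. \<integral>x. norm (g x $ i - g1 n x $ i) powr p * w x \<partial>lebesgue) \<longlonglongrightarrow> 0" for i
 proof -
  define H where "H x = 2 powr p * ((1 + M) powr p * (norm (g x $ i) powr p * w x) + (1 + M) powr p * (norm (\<phi> x) powr p * w x))" for x
  have Hi: "integrable lebesgue H" unfolding H_def[abs_def]
   by (intro integrable_mult_right Bochner_Integration.integrable_add I)
  have a: "norm (g x $ i - g1 n x $ i) powr p * w x \<le> H x" for n x
  proof -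
   let ?a = "g x $ i * complex_of_real (1 - \<zeta> n x)" and ?b = "\<phi> x * complex_of_real (- D n i x)"
   have "norm (?a + ?b) powr p * w x \<le> 2 powr p * (norm ?a powr p + norm ?b powr p) * w x"
    by (intro mult_right_mono norm_add_powr_le p0 w)
   also have "\<dots> = 2 powr p * (norm ?a powr p * w x + norm ?b powr p * w x)" by (simp only: distrib_right mult.assoc)
   also have "\<dots> \<le> H x" unfolding H_def
    by (intro mult_left_mono add_mono norm_mult_powr_weight_le cb p0 w) auto
   finally show ?thesis unfolding dg .
  qed
  have b: "(\<lambda>n. g x $ i - g1 n x $ i) \<longlonglongrightarrow> 0" for x unfolding dg
   using tendsto_add[OF tendsto_mult[OF tendsto_const cl(1)] tendsto_mult[OF tendsto_const cl(2)]] by simp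
  have c: "(\<lambda>x. g x $ i - g1 n x $ i) \<in> borel_measurable lebesgue" for n by (intro borel_measurable_diff lm)
  show "\<And>n. integrable lebesgue (\<lambda>x. norm (g x $ i - g1 n x $ i) powr p * w x)" "(\<lambda>n. \<integral>x. norm (g x $ i - g1 n x $ i) powr p * w x \<partial>lebesgue) \<longlonglongrightarrow> 0"
   by (rule weighted_dominated_tendsto_0[OF wmeas[OF c w(1)] AE_I2[OF w(2)] p0(1) Hi AE_I2[OF a] b])+
 qed
 have "(\<lambda>n. (\<integral>x. norm (\<phi> x - \<phi>1 n x) powr p * u x \<partial>lebesgue) + (\<Sum>i\<in>UNIV. \<integral>x. norm (g x $ i - g1 n x $ i) powr p * w x \<partial>lebesgue)) \<longlonglongrightarrow> 0 + (\<Sum>i\<in>(UNIV :: 'd set). 0)"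
  by (intro tendsto_add tendsto_sum main(2) grad(2) u I)
 then have "\<forall>\<^sub>F n in sequentially. (\<integral>x. norm (\<phi> x - \<phi>1 n x) powr p * u x \<partial>lebesgue) + (\<Sum>i\<in>UNIV. \<integral>x. norm (g x $ i - g1 n x $ i) powr p * w x \<partial>lebesgue) < e"
  using e by (intro order_tendstoD(2)[of _ 0]) simp_all
 then obtain n where n: "(\<integral>x. norm (\<phi> x - \<phi>1 n x) powr p * u x \<partial>lebesgue) + (\<Sum>i\<in>UNIV. \<integral>x. norm (g x $ i - g1 n x $ i) powr p * w x \<partial>lebesgue) < e"
  using eventually_happens by force
 show thesis
 proof (rule that[OF wg[of n] _ _ _ main(1)[OF u I(1)] main(1)[OF w I(2)] _ n])
  show "0 \<le> \<bar>R n\<bar>" by simp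
  have x: "x \<notin> cball 0 (R n)" if "x \<notin> cball 0 \<bar>R n\<bar>" for x :: "real ^ 'd" using that by auto
  show "\<forall>x. x \<notin> cball 0 \<bar>R n\<bar> \<longrightarrow> \<phi>1 n x = 0" using R[OF x] by (simp add: \<phi>1_def)
  show "\<forall>x i. x \<notin> cball 0 \<bar>R n\<bar> \<longrightarrow> g1 n x $ i = 0" using R[OF x] D0[OF x] by (simp add: g1_def)
  show "\<forall>i. integrable lebesgue (\<lambda>x. norm (g x $ i - g1 n x $ i) powr p * w x)" by (intro allI grad(1))
 qed
qed

lemma weighted_integral_le_support:
 fixes f :: "'a::euclidean_space \<Rightarrow> complex"
 assumes f: "f \<in> borel_measurable lebesgue" "integrable lebesgue (\<lambda>x. norm (f x) powr p)" "\<And>x. x \<notin> K \<Longrightarrow> f x = 0"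
  and u: "u \<in> borel_measurable lebesgue" "\<And>x. 0 \<le> u x" "AE x in lebesgue. x \<in> K \<longrightarrow> u x \<le> B" and p: "0 < p"
 shows "integrable lebesgue (\<lambda>x. norm (f x) powr p * u x)"
  "(\<integral>x. norm (f x) powr p * u x \<partial>lebesgue) \<le> B * (\<integral>x. norm (f x) powr p \<partial>lebesgue)"
proof -
 have le: "AE x in lebesgue. norm (f x) powr p * u x \<le> B * norm (f x) powr p"
  using u(3)
 proof eventually_elim
  fix x assume "x \<in> K \<longrightarrow> u x \<le> B"
  then show "norm (f x) powr p * u x \<le> B * norm (f x) powr p"
   using f(3)[of x] p by (cases "x \<in> K") (auto simp: mult.commute[of B] mult_left_mono)
 qed
 show 1: "integrable lebesgue (\<lambda>x. norm (f x) powr p * u x)"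
 proof (rule Bochner_Integration.integrable_bound[OF integrable_mult_right[OF f(2), of B]])
  show "(\<lambda>x. norm (f x) powr p * u x) \<in> borel_measurable lebesgue"
   by (rule borel_measurable_times[OF measurable_compose[OF f(1) borel_measurable_norm_powr] u(1)])
  show "AE x in lebesgue. norm (norm (f x) powr p * u x) \<le> norm (B * norm (f x) powr p)"
   using le
  proof eventually_elim
   fix x assume h: "norm (f x) powr p * u x \<le> B * norm (f x) powr p"
   have "norm (norm (f x) powr p * u x) = norm (f x) powr p * u x" using u(2)[of x] by (simp add: abs_mult)
   also note h
   finally show "norm (norm (f x) powr p * u x) \<le> norm (B * norm (f x) powr p)"
    unfolding real_norm_def by (rule order_trans[OF _ abs_ge_self])
  qed
 qed
 show "(\<integral>x. norm (f x) powr p * u x \<partial>lebesgue) \<le> B * (\<integral>x. norm (f x) powr p \<partial>lebesgue)"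
  using integral_mono_AE[OF 1 integrable_mult_right[OF f(2)] le] by simp
qed

text \<open>The mollifications have radius at most 1, so everything takes place in the ball of
  radius R + 1. There the weights are almost everywhere bounded by \<open>B\<close>, and unweighted
  convergence implies weighted convergence.\<close>

lemma weighted_mollification:
 fixes \<phi> :: "real ^ 'd \<Rightarrow> complex" and u w :: "real ^ 'd \<Rightarrow> real"
 assumes \<phi>: "has_weak_gradient UNIV \<phi> g" and R: "0 \<le> R" "\<And>x. x \<notin> cball 0 R \<Longrightarrow> \<phi> x = 0" "\<And>x i. x \<notin> cball 0 R \<Longrightarrow> g x $ i = 0"
  and I: "integrable lebesgue (\<lambda>x. norm (\<phi> x) powr p)" "\<And>i. integrable lebesgue (\<lambda>x. norm (g x $ i) powr p)"
  and u: "u \<in> borel_measurable lebesgue" "\<And>x. 0 \<le> u x" "AE x in lebesgue. x \<in> cball 0 (R + 1) \<longrightarrow> u x \<le> B"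
  and w: "w \<in> borel_measurable lebesgue" "\<And>x. 0 \<le> w x" "AE x in lebesgue. x \<in> cball 0 (R + 1) \<longrightarrow> w x \<le> B"
  and p: "1 \<le> p" and e: "0 < e"
 obtains \<psi> h where "\<psi> \<in> Lip_c UNIV" "has_weak_gradient UNIV \<psi> h"
  "integrable lebesgue (\<lambda>x. norm (\<psi> x - \<phi> x) powr p * u x)" "\<forall>i. integrable lebesgue (\<lambda>x. norm (h x $ i - g x $ i) powr p * w x)"
  "(\<integral>x. norm (\<psi> x - \<phi> x) powr p * u x \<partial>lebesgue) + (\<Sum>i\<in>UNIV. \<integral>x. norm (h x $ i - g x $ i) powr p * w x \<partial>lebesgue) < e"
proof -
 have p0: "0 < p" using p by simp
 have lm: "\<phi> \<in> borel_measurable lebesgue" "(\<lambda>x. g x $ i) \<in> borel_measurable lebesgue" for i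
  using locally_integrable_measurable[OF open_UNIV] locally_integrable_component[of UNIV _ i] \<phi>
  unfolding has_weak_gradient_def lebesgue_on_UNIV_eq by blast+
 define r :: "nat \<Rightarrow> real" where "r n = 1 / real (Suc n)" for n
 let ?\<rho> = "mollifier :: nat \<Rightarrow> real ^ 'd \<Rightarrow> real"
 have k: "density_kernel (?\<rho> n) (r n)" for n unfolding r_def by (rule mollifier(1))
 have r: "r \<longlonglongrightarrow> 0" "r n \<le> 1" for n unfolding r_def[abs_def] using mollifier_radius by auto
 have \<phi>i: "integrable lebesgue \<phi>" by (rule integrable_of_powr[OF lm(1) p I(1) compact_cball R(2)])
 define \<psi> where "\<psi> n = conv \<phi> (?\<rho> n)" for n
 define h :: "nat \<Rightarrow> real ^ 'd \<Rightarrow> complex ^ 'd" where "h n x = (\<chi> i. conv (\<lambda>x. g x $ i) (?\<rho> n) x)" for n x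
 have C1: "C1_along (axis i 1) (\<psi> n) (\<lambda>x. h n x $ i)" for n i
 proof -
  have "conv \<phi> (partial_deriv i (?\<rho> n)) x = conv (\<lambda>x. g x $ i) (?\<rho> n) x" for x
  proof -
   \<comment> \<open>Large enough to contain both the support of \<phi> and the reach of the kernel
     about x, so that extending by zero outside it changes nothing.\<close>
   define K' where "K' = cball (0 :: real ^ 'd) (R + norm x + 1)"
   have "y \<notin> cball 0 R" if "y \<notin> K'" for y using that norm_ge_zero[of x] unfolding K'_def mem_cball_0 by linarith
   then have z: "zero_extend K' \<phi> = \<phi>" "zero_extend K' (\<lambda>x. g x $ i) = (\<lambda>x. g x $ i)"
    using R(2,3) by (simp_all add: zero_extend_def fun_eq_iff indicator_def)
   have "cball x (r n) \<subseteq> K'"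
   proof
    fix y assume "y \<in> cball x (r n)"
    then have "norm (x - y) \<le> 1" using r(2)[of n] by (simp add: dist_norm)
    then show "y \<in> K'" using norm_triangle_ineq2[of y x] R(1) by (simp add: K'_def norm_minus_commute)
   qed
   from conv_partial_deriv[OF \<phi> _ subset_UNIV k mollifier(2) this, of i] show ?thesis unfolding z by (simp add: K'_def)
  qed
  then have "conv \<phi> (partial_deriv i (?\<rho> n)) = (\<lambda>x. h n x $ i)" by (simp add: h_def fun_eq_iff)
  then show ?thesis using C1_along_conv_kernel[OF k[of n] mollifier(2) \<phi>i, of i] by (simp add: \<psi>_def)
 qed
 have wg: "has_weak_gradient UNIV (\<psi> n) (h n)" for n by (rule has_weak_gradient_C1[OF C1])
 have "x \<notin> cball 0 (R + r n)" if "x \<notin> cball 0 (R + 1)" for n and x :: "real ^ 'd"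
  using that r(2)[of n] by simp
 then have supp: "\<psi> n x = 0" "h n x $ i = 0" if "x \<notin> cball 0 (R + 1)" for n x i
  using conv_support_cball[of R \<phi>, OF R(2) k] conv_support_cball[of R "\<lambda>x. g x $ i", OF R(3) k] that
  by (simp_all add: \<psi>_def h_def)
 have Lip: "\<psi> n \<in> Lip_c UNIV" for n
 proof -
  have hc: "continuous_on UNIV (\<lambda>x. h n x $ i)" for i using C1 by (simp add: C1_along_def)
  have "\<exists>B. 0 \<le> B \<and> (\<forall>x. norm (h n x $ i) \<le> B)" for i
  proof (rule continuous_compact_support_bounded[OF hc[of i] compact_cball supp(2)[where i = i]])
   fix B assume "0 \<le> B" "\<And>x. norm (h n x $ i) \<le> B"
   then show ?thesis by (intro exI[of _ B]) simp
  qed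
  then obtain B' where B': "\<And>i. 0 \<le> B' i" "\<And>i x. norm (h n x $ i) \<le> B' i" by metis
  have "norm (h n x $ i) \<le> (\<Sum>i\<in>UNIV. B' i)" for x i
   using B'(2)[of x i] member_le_sum[of i UNIV B'] B'(1) by (meson UNIV_I finite order_trans)
  then have "((\<Sum>i\<in>UNIV. B' i) * real CARD('d))-lipschitz_on UNIV (\<psi> n)"
   by (rule C1_along_lipschitz[OF C1]) (intro sum_nonneg B'(1))
  moreover have "closure {x. \<psi> n x \<noteq> 0} \<subseteq> cball 0 (R + 1)"
   by (rule closure_minimal) (use supp(1) in blast, simp)
  then have "compact (closure {x. \<psi> n x \<noteq> 0})"
   by (meson bounded_subset closed_closure compact_eq_bounded_closed bounded_cball)
  ultimately show ?thesis unfolding Lip_c_def by auto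
 qed
 have part: "\<And>n. integrable lebesgue (\<lambda>x. norm (conv f (?\<rho> n) x - f x) powr p * v x)"
  "(\<lambda>n. \<integral>x. norm (conv f (?\<rho> n) x - f x) powr p * v x \<partial>lebesgue) \<longlonglongrightarrow> 0"
  if f: "f \<in> borel_measurable lebesgue" "integrable lebesgue (\<lambda>x. norm (f x) powr p)" "\<And>x. x \<notin> cball 0 R \<Longrightarrow> f x = 0"
   and v: "v \<in> borel_measurable lebesgue" "\<And>x. 0 \<le> v x" "AE x in lebesgue. x \<in> cball 0 (R + 1) \<longrightarrow> v x \<le> B"
  for f :: "real ^ 'd \<Rightarrow> complex" and v :: "real ^ 'd \<Rightarrow> real"
 proof -
  note L = conv_Lp_tendsto[OF k r f(1,2) compact_cball[of 0 R] f(3) p]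
  have fi: "integrable lebesgue f" by (rule integrable_of_powr[OF f(1) p f(2) compact_cball f(3)])
  have m: "(\<lambda>x. conv f (?\<rho> n) x - f x) \<in> borel_measurable lebesgue" for n
  proof (intro borel_measurable_diff f(1))
   show "conv f (?\<rho> n) \<in> borel_measurable lebesgue"
    by (rule borel_measurable_lebesgue_continuous)
      (use C1_along_conv_kernel[OF k mollifier(2) fi] in \<open>auto simp: C1_along_def\<close>)
  qed
  have z: "conv f (?\<rho> n) x - f x = 0" if "x \<notin> cball 0 (R + 1)" for n x
  proof -
   have "x \<notin> cball 0 (R + r n)" "x \<notin> cball 0 R" using that r(2)[of n] by auto
   then show ?thesis using conv_support_cball[of R f, OF f(3) k] f(3) by simp
  qed
  note W = weighted_integral_le_support[OF m L(1) z v p0]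
  show "integrable lebesgue (\<lambda>x. norm (conv f (?\<rho> n) x - f x) powr p * v x)" for n by (rule W(1))
  show "(\<lambda>n. \<integral>x. norm (conv f (?\<rho> n) x - f x) powr p * v x \<partial>lebesgue) \<longlonglongrightarrow> 0"
  proof (rule tendsto_sandwich[OF _ _ tendsto_const])
   show "(\<lambda>n. B * (\<integral>x. norm (conv f (?\<rho> n) x - f x) powr p \<partial>lebesgue)) \<longlonglongrightarrow> 0"
    using tendsto_mult[OF tendsto_const[of B] L(2)] by simp
   show "\<forall>\<^sub>F n in sequentially. 0 \<le> (\<integral>x. norm (conv f (?\<rho> n) x - f x) powr p * v x \<partial>lebesgue)"
    by (intro always_eventually allI integral_nonneg_AE AE_I2 mult_nonneg_nonneg v(2)) auto
   show "\<forall>\<^sub>F n in sequentially. (\<integral>x. norm (conv f (?\<rho> n) x - f x) powr p * v x \<partial>lebesgue) \<le> B * (\<integral>x. norm (conv f (?\<rho> n) x - f x) powr p \<partial>lebesgue)"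
    by (intro always_eventually allI W(2))
  qed
 qed
 note P = part[OF lm(1) I(1) R(2) u] and G = part[OF lm(2) I(2) R(3) w]
 have "(\<lambda>n. (\<integral>x. norm (\<psi> n x - \<phi> x) powr p * u x \<partial>lebesgue) + (\<Sum>i\<in>UNIV. \<integral>x. norm (h n x $ i - g x $ i) powr p * w x \<partial>lebesgue)) \<longlonglongrightarrow> 0 + (\<Sum>i\<in>(UNIV :: 'd set). 0)"
  unfolding \<psi>_def h_def vec_lambda_beta by (intro tendsto_add tendsto_sum P(2) G(2))
 then have "\<forall>\<^sub>F n in sequentially. (\<integral>x. norm (\<psi> n x - \<phi> x) powr p * u x \<partial>lebesgue) + (\<Sum>i\<in>UNIV. \<integral>x. norm (h n x $ i - g x $ i) powr p * w x \<partial>lebesgue) < e"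
  using e by (intro order_tendstoD(2)[of _ 0]) simp_all
 then obtain n where n: "(\<integral>x. norm (\<psi> n x - \<phi> x) powr p * u x \<partial>lebesgue) + (\<Sum>i\<in>UNIV. \<integral>x. norm (h n x $ i - g x $ i) powr p * w x \<partial>lebesgue) < e"
  using eventually_happens by force
 show thesis
 proof (rule that[OF Lip wg _ _ n])
  show "integrable lebesgue (\<lambda>x. norm (\<psi> n x - \<phi> x) powr p * u x)" unfolding \<psi>_def by (rule P(1))
  show "\<forall>i. integrable lebesgue (\<lambda>x. norm (h n x $ i - g x $ i) powr p * w x)"
   unfolding h_def vec_lambda_beta by (intro allI G(1))
 qed
qed

lemma weighted_triangle:
 fixes a b c :: "'a \<Rightarrow> complex"
 assumes "integrable M (\<lambda>x. norm (a x - c x) powr p * v x)" "integrable M (\<lambda>x. norm (b x - c x) powr p * v x)"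
  and v: "\<And>x. 0 \<le> v x" and p: "0 \<le> p"
 shows "(\<integral>x. norm (a x - b x) powr p * v x \<partial>M)
  \<le> 2 powr p * ((\<integral>x. norm (a x - c x) powr p * v x \<partial>M) + (\<integral>x. norm (b x - c x) powr p * v x \<partial>M))"
proof -
 have "(\<integral>x. norm (a x - b x) powr p * v x \<partial>M)
  \<le> (\<integral>x. 2 powr p * (norm (a x - c x) powr p * v x + norm (b x - c x) powr p * v x) \<partial>M)"
 proof (rule integral_mono')
  show "integrable M (\<lambda>x. 2 powr p * (norm (a x - c x) powr p * v x + norm (b x - c x) powr p * v x))"
   using assms(1,2) by simp
  fix x
  have "norm ((a x - c x) - (b x - c x)) powr p * v x \<le> 2 powr p * (norm (a x - c x) powr p + norm (b x - c x) powr p) * v x"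
   by (intro mult_right_mono norm_diff_powr_le p v)
  then show "norm (a x - b x) powr p * v x \<le> 2 powr p * (norm (a x - c x) powr p * v x + norm (b x - c x) powr p * v x)"
   by (simp add: algebra_simps)
  show "0 \<le> 2 powr p * (norm (a x - c x) powr p * v x + norm (b x - c x) powr p * v x)"
   using v by (intro mult_nonneg_nonneg add_nonneg_nonneg) auto
 qed
 then show ?thesis using assms(1,2) by simp
qed

lemma integrable_weighted_of_diff:
 fixes a b :: "'a \<Rightarrow> complex"
 assumes "a \<in> borel_measurable M" "b \<in> borel_measurable M" "v \<in> borel_measurable M" "0 \<le> p"
  "integrable M (\<lambda>x. norm (a x) powr p * v x)" "integrable M (\<lambda>x. norm (a x - b x) powr p * v x)"
 shows "integrable M (\<lambda>x. norm (b x) powr p * v x)"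
proof -
 have "integrable M (\<lambda>x. norm (b x - a x) powr p * v x)" using assms(6) by (simp add: norm_minus_commute)
 from integrable_weighted_add[OF assms(1) borel_measurable_diff[OF assms(2,1)] assms(3-5) this] show ?thesis by simp
qed

lemma integrable_weighted_mono:
 fixes f :: "'a \<Rightarrow> complex"
 assumes "f \<in> borel_measurable M" "v \<in> borel_measurable M" "\<And>x. 0 \<le> v x" "\<And>x. v x \<le> u x"
  "integrable M (\<lambda>x. norm (f x) powr p * u x)"
 shows "integrable M (\<lambda>x. norm (f x) powr p * v x)"
proof (rule Bochner_Integration.integrable_bound[OF assms(5)])
 show "(\<lambda>x. norm (f x) powr p * v x) \<in> borel_measurable M"
  by (rule borel_measurable_times[OF measurable_compose[OF assms(1) borel_measurable_norm_powr] assms(2)])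
 have "norm (norm (f x) powr p * v x) \<le> norm (norm (f x) powr p * u x)" for x
  using assms(3)[of x] assms(4)[of x] by (simp add: abs_mult mult_left_mono)
 then show "AE x in M. norm (norm (f x) powr p * v x) \<le> norm (norm (f x) powr p * u x)" by (intro AE_I2)
qed

text \<open>Truncation has to come first: on the resulting ball \<open>w\<close> is bounded below,
  so the truncated function and its gradient are in L^p without weight, as mollification requires.
  Taking for \<open>u\<close> the weight \<open>w\<close>, or \<open>w\<close> enlarged by the extra
  term of \<open>calW\<close>, gives the two density statements.\<close>

lemma Lip_c_dense:
 fixes \<phi> :: "real ^ 'd \<Rightarrow> complex" and u w :: "real ^ 'd \<Rightarrow> real"
 assumes w: "tame_weight UNIV w" and \<phi>: "\<phi> \<in> W1p UNIV w p" and p: "1 \<le> p"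
  and u: "u \<in> borel_measurable lebesgue" "\<And>x. w x \<le> u x" "\<And>R. \<exists>B. AE x in lebesgue. x \<in> cball 0 R \<longrightarrow> u x \<le> B"
  and I: "integrable lebesgue (\<lambda>x. norm (\<phi> x) powr p * u x)" and e: "0 < e"
 obtains \<psi> h where "\<psi> \<in> Lip_c UNIV" "\<psi> \<in> W1p UNIV w p" "integrable lebesgue (\<lambda>x. norm (\<psi> x) powr p * u x)"
  "has_weak_gradient UNIV (\<lambda>x. \<phi> x - \<psi> x) h"
  "(\<integral>x. norm (\<phi> x - \<psi> x) powr p * u x \<partial>lebesgue) + (\<Sum>i\<in>UNIV. \<integral>x. norm (h x $ i) powr p * w x \<partial>lebesgue) < e"
proof -
 have p0: "0 \<le> p" using p by simp
 define g where "g = weak_gradient UNIV \<phi>"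
 note D = W1pD[OF open_UNIV w \<phi>, folded g_def, unfolded lebesgue_on_UNIV_eq]
 have wm: "w \<in> borel_measurable lebesgue" using tame_weightD(1)[OF w] by (simp add: lebesgue_on_UNIV_eq)
 have w0: "0 \<le> w x" for x using tame_weightD(2)[OF w, of x] by simp
 have u0: "0 \<le> u x" for x using w0[of x] u(2)[of x] by linarith
 \<comment> \<open>The errors of truncation and mollification are added and multiplied by the
   constant 2^p of \<open>weighted_triangle\<close>.\<close>
 define e' where "e' = e / (2 * 2 powr p)"
 have e': "0 < e'" using e by (simp add: e'_def)
 obtain \<phi>1 g1 R where A: "has_weak_gradient UNIV \<phi>1 g1" "0 \<le> R" "\<forall>x. x \<notin> cball 0 R \<longrightarrow> \<phi>1 x = 0" "\<forall>x i. x \<notin> cball 0 R \<longrightarrow> g1 x $ i = 0"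
  "integrable lebesgue (\<lambda>x. norm (\<phi> x - \<phi>1 x) powr p * u x)" "integrable lebesgue (\<lambda>x. norm (\<phi> x - \<phi>1 x) powr p * w x)"
  "\<forall>i. integrable lebesgue (\<lambda>x. norm (g x $ i - g1 x $ i) powr p * w x)"
  "(\<integral>x. norm (\<phi> x - \<phi>1 x) powr p * u x \<partial>lebesgue) + (\<Sum>i\<in>UNIV. \<integral>x. norm (g x $ i - g1 x $ i) powr p * w x \<partial>lebesgue) < e'"
  by (rule weighted_truncation[OF D(1) u(1) u0 wm w0 p I D(4,5) e'])
 note 1 = A(1,2) A(3)[rule_format] A(4)[rule_format] A(5,6) A(7)[rule_format] A(8)
 have lm: "f \<in> borel_measurable lebesgue" "(\<lambda>x. k x $ i) \<in> borel_measurable lebesgue" if "has_weak_gradient UNIV f k"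
  for f :: "real ^ 'd \<Rightarrow> complex" and k i
  using locally_integrable_measurable[OF open_UNIV] locally_integrable_component[of UNIV _ i] that
  unfolding has_weak_gradient_def lebesgue_on_UNIV_eq by blast+
 obtain c where c: "0 < c" "\<And>x. x \<in> cball 0 R \<Longrightarrow> c \<le> w x"
  using tame_weightD(3)[OF w compact_cball[of 0 R] subset_UNIV] by blast
 have plain: "integrable lebesgue (\<lambda>x. norm (f x) powr p)"
  if f: "f \<in> borel_measurable lebesgue" "\<And>x. x \<notin> cball 0 R \<Longrightarrow> f x = 0" "integrable lebesgue (\<lambda>x. norm (f x) powr p * w x)"
  for f :: "real ^ 'd \<Rightarrow> complex"
 proof (rule Bochner_Integration.integrable_bound[OF integrable_mult_right[OF f(3), of "1 / c"]])
  show "(\<lambda>x. norm (f x) powr p) \<in> borel_measurable lebesgue" by (rule measurable_compose[OF f(1) borel_measurable_norm_powr])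
  have "norm (norm (f x) powr p) \<le> norm (1 / c * (norm (f x) powr p * w x))" for x
  proof (cases "x \<in> cball 0 R")
   case True
   have "norm (f x) powr p * c \<le> norm (f x) powr p * w x" using c(2)[OF True] by (intro mult_left_mono) auto
   then have "norm (f x) powr p \<le> 1 / c * (norm (f x) powr p * w x)" using c(1) by (simp add: field_simps)
   then show ?thesis unfolding real_norm_def using order_trans[OF _ abs_ge_self] by (simp only: abs_of_nonneg powr_ge_zero)
  next
   case False
   then show ?thesis using f(2) p by simp
  qed
  then show "AE x in lebesgue. norm (norm (f x) powr p) \<le> norm (1 / c * (norm (f x) powr p * w x))" by (intro AE_I2)
 qed
 have I1: "integrable lebesgue (\<lambda>x. norm (\<phi>1 x) powr p)"
  by (rule plain[OF lm(1)[OF 1(1)] 1(3) integrable_weighted_of_diff[OF D(2) lm(1)[OF 1(1)] wm p0 D(4) 1(6)]])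
 have I2: "integrable lebesgue (\<lambda>x. norm (g1 x $ i) powr p)" for i
  by (rule plain[OF lm(2)[OF 1(1)] 1(4) integrable_weighted_of_diff[OF D(3) lm(2)[OF 1(1)] wm p0 D(5) 1(7)]])
 obtain B where Bu: "AE x in lebesgue. x \<in> cball 0 (R + 1) \<longrightarrow> u x \<le> B" using u(3) by blast
 then have Bw: "AE x in lebesgue. x \<in> cball 0 (R + 1) \<longrightarrow> w x \<le> B"
 proof eventually_elim
  fix x :: "real ^ 'd" assume "x \<in> cball 0 (R + 1) \<longrightarrow> u x \<le> B"
  then show "x \<in> cball 0 (R + 1) \<longrightarrow> w x \<le> B" using u(2)[of x] by (meson order_trans)
 qed
 obtain \<psi> h where A: "\<psi> \<in> Lip_c UNIV" "has_weak_gradient UNIV \<psi> h"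
  "integrable lebesgue (\<lambda>x. norm (\<psi> x - \<phi>1 x) powr p * u x)" "\<forall>i. integrable lebesgue (\<lambda>x. norm (h x $ i - g1 x $ i) powr p * w x)"
  "(\<integral>x. norm (\<psi> x - \<phi>1 x) powr p * u x \<partial>lebesgue) + (\<Sum>i\<in>UNIV. \<integral>x. norm (h x $ i - g1 x $ i) powr p * w x \<partial>lebesgue) < e'"
  by (rule weighted_mollification[OF 1(1-4) I1 I2 u(1) u0 Bu wm w0 Bw p e'])
 note 2 = A(1-3) A(4)[rule_format] A(5)
 have swap: "integrable lebesgue (\<lambda>x. norm (b x - a x) powr p * v x)" if "integrable lebesgue (\<lambda>x. norm (a x - b x) powr p * v x)"
  for a b :: "real ^ 'd \<Rightarrow> complex" and v using that by (simp add: norm_minus_commute)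
 have \<phi>1u: "integrable lebesgue (\<lambda>x. norm (\<phi>1 x) powr p * u x)"
  by (rule integrable_weighted_of_diff[OF D(2) lm(1)[OF 1(1)] u(1) p0 I 1(5)])
 have \<psi>u: "integrable lebesgue (\<lambda>x. norm (\<psi> x) powr p * u x)"
  by (rule integrable_weighted_of_diff[OF lm(1)[OF 1(1)] lm(1)[OF 2(2)] u(1) p0 \<phi>1u swap[OF 2(3)]])
 have hw: "integrable lebesgue (\<lambda>x. norm (h x $ i) powr p * w x)" for i
  by (rule integrable_weighted_of_diff[OF lm(2)[OF 1(1)] lm(2)[OF 2(2)] wm p0 _ swap[OF 2(4)]])
    (rule integrable_weighted_of_diff[OF D(3) lm(2)[OF 1(1)] wm p0 D(5) 1(7)])
 have \<psi>W: "\<psi> \<in> W1p UNIV w p"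
  by (rule W1pI[OF open_UNIV w 2(2)])
    (simp_all add: lebesgue_on_UNIV_eq hw integrable_weighted_mono[OF lm(1)[OF 2(2)] wm w0 u(2) \<psi>u])
 have "(\<integral>x. norm (\<phi> x - \<psi> x) powr p * u x \<partial>lebesgue) + (\<Sum>i\<in>UNIV. \<integral>x. norm ((g x - h x) $ i) powr p * w x \<partial>lebesgue)
  \<le> 2 powr p * ((\<integral>x. norm (\<phi> x - \<phi>1 x) powr p * u x \<partial>lebesgue) + (\<integral>x. norm (\<psi> x - \<phi>1 x) powr p * u x \<partial>lebesgue)) +
   (\<Sum>i\<in>UNIV. 2 powr p * ((\<integral>x. norm (g x $ i - g1 x $ i) powr p * w x \<partial>lebesgue) + (\<integral>x. norm (h x $ i - g1 x $ i) powr p * w x \<partial>lebesgue)))"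
  unfolding vector_minus_component
  by (intro add_mono sum_mono weighted_triangle 1 2 u0 w0 p0)
 also have "\<dots> = 2 powr p * (((\<integral>x. norm (\<phi> x - \<phi>1 x) powr p * u x \<partial>lebesgue) + (\<Sum>i\<in>UNIV. \<integral>x. norm (g x $ i - g1 x $ i) powr p * w x \<partial>lebesgue)) +
   ((\<integral>x. norm (\<psi> x - \<phi>1 x) powr p * u x \<partial>lebesgue) + (\<Sum>i\<in>UNIV. \<integral>x. norm (h x $ i - g1 x $ i) powr p * w x \<partial>lebesgue)))"
  by (simp add: sum_distrib_left sum.distrib algebra_simps)
 also have "\<dots> < 2 powr p * (e' + e')" by (intro mult_strict_left_mono add_strict_mono 1 2) simp
 also have "\<dots> = e" by (simp add: e'_def)
 finally show thesis
  by (intro that[OF 2(1) \<psi>W \<psi>u has_weak_gradient_diff[OF D(1) 2(2)]])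
qed

section \<open>Density of Lipschitz functions of compact support in both spaces\<close>

lemma W1p_0_UNIV:
 assumes w: "tame_weight UNIV (w :: real ^ 'd \<Rightarrow> real)" and p: "1 \<le> p"
 shows "W1p_0 UNIV w p = W1p UNIV w p"
proof (intro equalityI subsetI)
 fix \<phi> assume \<phi>: "\<phi> \<in> W1p UNIV w p"
 have wm: "w \<in> borel_measurable lebesgue" using tame_weightD(1)[OF w] by (simp add: lebesgue_on_UNIV_eq)
 have wb: "\<exists>B. AE x in lebesgue. x \<in> cball 0 R \<longrightarrow> w x \<le> B" for R
 proof -
  obtain C where "\<And>x. x \<in> cball 0 R \<Longrightarrow> w x \<le> C" using tame_weightD(3)[OF w compact_cball[of 0 R] subset_UNIV] by blast
  then show ?thesis by (intro exI[of _ C] AE_I2) auto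
 qed
 have I: "integrable lebesgue (\<lambda>x. norm (\<phi> x) powr p * w x)"
  using W1pD(4)[OF open_UNIV w \<phi>] by (simp add: lebesgue_on_UNIV_eq)
 have "\<exists>\<psi>\<in>Lip_c UNIV \<inter> W1p UNIV w p. W1p_norm UNIV w p (\<lambda>x. \<phi> x - \<psi> x) < e" if e: "0 < e" for e
 proof (rule Lip_c_dense[OF w \<phi> p wm order_refl wb I])
  show "0 < e powr p" using e by simp
  fix \<psi> h assume \<psi>: "\<psi> \<in> Lip_c UNIV" "\<psi> \<in> W1p UNIV w p" and h: "has_weak_gradient UNIV (\<lambda>x. \<phi> x - \<psi> x) h"
   "(\<integral>x. norm (\<phi> x - \<psi> x) powr p * w x \<partial>lebesgue) + (\<Sum>i\<in>UNIV. \<integral>x. norm (h x $ i) powr p * w x \<partial>lebesgue) < e powr p"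
  have "W1p_norm UNIV w p (\<lambda>x. \<phi> x - \<psi> x) powr p < e powr p"
   using h(2) unfolding W1p_norm_powr[OF open_UNIV w h(1) p] energy_def lebesgue_on_UNIV_eq .
  then have "W1p_norm UNIV w p (\<lambda>x. \<phi> x - \<psi> x) < e"
   using powr_mono2[of p e] e p by (meson leD leI less_imp_le order_trans zero_le_one)
  then show ?thesis using \<psi> by blast
 qed
 then show "\<phi> \<in> W1p_0 UNIV w p" using \<phi> by (simp add: W1p_0_def closure_in_def)
qed (simp add: W1p_0_def closure_in_def)

text \<open>The p-th power of the norm of \<open>calW\<close> is the energy in which the function
  itself carries the weight w + V^p w. This weight is almost everywhere bounded on balls because the
  gradient of \<open>s\<close> is locally bounded.\<close>

lemma calW_0_UNIV:
 fixes w0 w1 :: "real ^ 'd \<Rightarrow> real"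
 assumes "interpolation_pair UNIV w0 w1 p \<theta>"
 shows "calW_0 UNIV \<theta> w0 w1 p = calW UNIV \<theta> w0 w1 p"
proof (intro equalityI subsetI)
 interpret interpolation_pair UNIV w0 w1 p \<theta> by (rule assms)
 fix \<phi> assume \<phi>: "\<phi> \<in> calW UNIV \<theta> w0 w1 p"
 define u where "u x = w x + V x powr p * w x" for x
 have wm': "w \<in> borel_measurable lebesgue" "V \<in> borel_measurable lebesgue"
  using wm V_measurable by (simp_all add: lebesgue_on_UNIV_eq)
 have um: "u \<in> borel_measurable lebesgue" unfolding u_def[abs_def] using wm' by measurable
 have w0: "0 \<le> w x" for x using w_pos[of x] by simp
 have wu: "w x \<le> u x" for x using w0[of x] by (simp add: u_def)
 have ub: "\<exists>B. AE x in lebesgue. x \<in> cball 0 R \<longrightarrow> u x \<le> B" for R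
 proof (rule grad_s)
  fix \<sigma> :: "real ^ 'd \<Rightarrow> complex ^ 'd"
  assume b: "\<And>K. compact K \<Longrightarrow> K \<subseteq> UNIV \<Longrightarrow> \<exists>B. \<forall>x\<in>K. \<forall>i. norm (\<sigma> x $ i) \<le> B"
   and V: "AE x in lebesgue_on UNIV. V x = norm (\<sigma> x)"
  obtain B where B: "\<And>x i. x \<in> cball 0 R \<Longrightarrow> norm (\<sigma> x $ i) \<le> B" using b[OF compact_cball[of 0 R] subset_UNIV] by blast
  obtain C where C: "\<And>x. x \<in> cball 0 R \<Longrightarrow> w x \<le> C" using tame_weightD(3)[OF w compact_cball[of 0 R] subset_UNIV] by blast
  \<comment> \<open>The Euclidean norm of the gradient is at most the sum of its d components, each
    bounded by \<open>B\<close>.\<close>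
  let ?B = "real CARD('d) * B"
  have "AE x in lebesgue. x \<in> cball 0 R \<longrightarrow> u x \<le> C + ?B powr p * C"
   using V unfolding lebesgue_on_UNIV_eq
  proof eventually_elim
   fix x assume Vx: "V x = norm (\<sigma> x)"
   show "x \<in> cball 0 R \<longrightarrow> u x \<le> C + ?B powr p * C"
   proof
    assume x: "x \<in> cball 0 R"
    have "norm (\<sigma> x) \<le> (\<Sum>i\<in>UNIV. norm (\<sigma> x $ i))" unfolding norm_vec_def by (rule L2_set_le_sum) simp
    also have "\<dots> \<le> (\<Sum>i\<in>(UNIV :: 'd set). B)" by (intro sum_mono B x)
    finally have "V x \<le> ?B" by (simp add: Vx)
    then have "V x powr p \<le> ?B powr p" using p0 V_nonneg by (intro powr_mono2) auto
    then show "u x \<le> C + ?B powr p * C" unfolding u_def using C[OF x] w0[of x] by (intro add_mono mult_mono) auto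
   qed
  qed
  then show ?thesis by blast
 qed
 have split: "norm (f x) powr p * u x = norm (f x) powr p * w x + norm (f x) powr p * V x powr p * w x" for f :: "real ^ 'd \<Rightarrow> complex" and x
  by (simp add: u_def distrib_left mult.assoc)
 have I: "integrable lebesgue (\<lambda>x. norm (f x) powr p * w x)" "integrable lebesgue (\<lambda>x. norm (f x) powr p * V x powr p * w x)"
  if "f \<in> calW UNIV \<theta> w0 w1 p" for f
  using W1pD(4)[OF open_UNIV w calWD(1)[OF that]] calWD(2)[OF that] by (simp_all add: lebesgue_on_UNIV_eq)
 have I\<phi>: "integrable lebesgue (\<lambda>x. norm (\<phi> x) powr p * u x)"
  unfolding split by (intro Bochner_Integration.integrable_add I \<phi>)
 have "\<exists>\<psi>\<in>Lip_c UNIV \<inter> calW UNIV \<theta> w0 w1 p. calW_norm UNIV \<theta> w0 w1 p (\<lambda>x. \<phi> x - \<psi> x) < e" if e: "0 < e" for e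
 proof (rule Lip_c_dense[OF w calWD(1)[OF \<phi>] p um wu ub I\<phi>])
  show "0 < e powr p" using e by simp
  fix \<psi> h assume \<psi>: "\<psi> \<in> Lip_c UNIV" "\<psi> \<in> W1p UNIV w p" "integrable lebesgue (\<lambda>x. norm (\<psi> x) powr p * u x)"
   and h: "has_weak_gradient UNIV (\<lambda>x. \<phi> x - \<psi> x) h"
   "(\<integral>x. norm (\<phi> x - \<psi> x) powr p * u x \<partial>lebesgue) + (\<Sum>i\<in>UNIV. \<integral>x. norm (h x $ i) powr p * w x \<partial>lebesgue) < e powr p"
  have \<psi>m: "\<psi> \<in> borel_measurable lebesgue" using W1pD(2)[OF open_UNIV w \<psi>(2)] by (simp add: lebesgue_on_UNIV_eq)
  have "integrable lebesgue (\<lambda>x. norm (\<psi> x) powr p * (V x powr p * w x))"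
  proof (rule integrable_weighted_mono[OF \<psi>m _ _ _ \<psi>(3)])
   show "(\<lambda>x. V x powr p * w x) \<in> borel_measurable lebesgue" using wm' by measurable
  qed (use w0 in \<open>auto simp: u_def\<close>)
  then have \<psi>W: "\<psi> \<in> calW UNIV \<theta> w0 w1 p" using \<psi>(2) by (simp add: calW_iff lebesgue_on_UNIV_eq mult.assoc)
  note d = calW_diff[OF \<phi> \<psi>W]
  have "energy UNIV w p (\<lambda>x. \<phi> x - \<psi> x) (weak_gradient UNIV (\<lambda>x. \<phi> x - \<psi> x)) = energy UNIV w p (\<lambda>x. \<phi> x - \<psi> x) h"
   using W1p_norm_powr[OF open_UNIV w h(1) p] W1p_norm_powr[OF open_UNIV w weak_gradient_AE(1)[OF open_UNIV h(1)] p] by simp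
  then have "calW_norm UNIV \<theta> w0 w1 p (\<lambda>x. \<phi> x - \<psi> x) powr p
   = (\<integral>x. norm (\<phi> x - \<psi> x) powr p * u x \<partial>lebesgue) + (\<Sum>i\<in>UNIV. \<integral>x. norm (h x $ i) powr p * w x \<partial>lebesgue)"
   unfolding calW_norm_powr(1)[OF d] split[of "\<lambda>x. \<phi> x - \<psi> x"] using I[OF d] by (simp add: energy_def lebesgue_on_UNIV_eq)
  also note h(2)
  finally have "calW_norm UNIV \<theta> w0 w1 p (\<lambda>x. \<phi> x - \<psi> x) < e"
   using powr_mono2[of p e] e p by (meson leD leI less_imp_le order_trans zero_le_one)
  then show ?thesis using \<psi>(1) \<psi>W by blast
 qed
 then show "\<phi> \<in> calW_0 UNIV \<theta> w0 w1 p" using \<phi> by (simp add: calW_0_def closure_in_def)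
qed (simp add: calW_0_def closure_in_def)

theorem theorem1p21:
 fixes U :: "(real ^ 'd) set" and w0 w1 :: "real ^ 'd \<Rightarrow> real"
 assumes "open U" and "U \<noteq> {}"
  and "weight_function U w0" and "weight_function U w1"
  and "compactly_bounded U w0" and "compactly_bounded U w1"
  and "locally_lipschitz U (\<lambda>x. w0 x / w1 x)"
 shows
  "(\<forall>p::real. 1 \<le> p \<and>
    W1p_0 U w0 p = W1p U w0 p \<and> W1p_0 U w1 p = W1p U w1 p \<and>
    (\<forall>\<theta>\<in>{0<..<1}. calW_0 U \<theta> w0 w1 p = calW U \<theta> w0 w1 p) \<longrightarrow>
    (\<forall>\<theta>\<in>{0<..<1}.
      complex_interpolation (W1p U w0 p) (W1p_norm U w0 p) (W1p U w1 p) (W1p_norm U w1 p) \<theta>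
       \<subseteq> W1p U (interp_weight w0 w1 \<theta>) p \<and>
      calW_0 U \<theta> w0 w1 p
       \<subseteq> complex_interpolation
         (W1p_0 U w0 p) (W1p_norm U w0 p) (W1p_0 U w1 p) (W1p_norm U w1 p) \<theta> \<and>
      calW U \<theta> w0 w1 p
       \<subseteq> complex_interpolation
         (W1p U w0 p) (W1p_norm U w0 p) (W1p U w1 p) (W1p_norm U w1 p) \<theta>)) \<and>
   (U = UNIV \<longrightarrow>
    (\<forall>p::real. 1 \<le> p \<longrightarrow>
     (W1p_0 U w0 p = W1p U w0 p \<and> W1p_0 U w1 p = W1p U w1 p \<and>
     (\<forall>\<theta>\<in>{0<..<1}. calW_0 U \<theta> w0 w1 p = calW U \<theta> w0 w1 p)) \<and>
     (\<forall>\<theta>\<in>{0<..<1}.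
      calW U \<theta> w0 w1 p
       \<subseteq> complex_interpolation
          (W1p U w0 p) (W1p_norm U w0 p) (W1p U w1 p) (W1p_norm U w1 p) \<theta> \<and>
      complex_interpolation (W1p U w0 p) (W1p_norm U w0 p) (W1p U w1 p) (W1p_norm U w1 p) \<theta>
       \<subseteq> W1p U (interp_weight w0 w1 \<theta>) p)))"
proof -
 have w: "tame_weight U w0" "tame_weight U w1" by (intro tame_weightI assms)+
 have pair: "interpolation_pair U w0 w1 p \<theta>" if "1 \<le> p" "\<theta> \<in> {0<..<1}" for p \<theta>
  using that assms(1,7) w by (simp add: interpolation_pair_def)
 have upper: "complex_interpolation (W1p U w0 p) (W1p_norm U w0 p) (W1p U w1 p) (W1p_norm U w1 p) \<theta>
   \<subseteq> W1p U (interp_weight w0 w1 \<theta>) p" if "1 \<le> p" "\<theta> \<in> {0<..<1}" for p \<theta>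
  using complex_interpolation_subset_W1p[OF assms(1) w that(1)] that(2) by simp
 note lower = interpolation_pair.calW_0_subset_complex_interpolation[OF pair]
 show ?thesis
 proof (intro conjI allI impI ballI)
  fix p \<theta> :: real
  assume "1 \<le> p \<and> W1p_0 U w0 p = W1p U w0 p \<and> W1p_0 U w1 p = W1p U w1 p \<and>
    (\<forall>\<theta>\<in>{0<..<1}. calW_0 U \<theta> w0 w1 p = calW U \<theta> w0 w1 p)" and \<theta>: "\<theta> \<in> {0<..<1}"
  then have p: "1 \<le> p" and eq: "W1p_0 U w0 p = W1p U w0 p" "W1p_0 U w1 p = W1p U w1 p" "calW_0 U \<theta> w0 w1 p = calW U \<theta> w0 w1 p"
   by blast+
  show "complex_interpolation (W1p U w0 p) (W1p_norm U w0 p) (W1p U w1 p) (W1p_norm U w1 p) \<theta>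
    \<subseteq> W1p U (interp_weight w0 w1 \<theta>) p"
   by (rule upper[OF p \<theta>])
  show "calW_0 U \<theta> w0 w1 p \<subseteq> complex_interpolation (W1p_0 U w0 p) (W1p_norm U w0 p) (W1p_0 U w1 p) (W1p_norm U w1 p) \<theta>"
   by (rule lower[OF p \<theta>])
  show "calW U \<theta> w0 w1 p \<subseteq> complex_interpolation (W1p U w0 p) (W1p_norm U w0 p) (W1p U w1 p) (W1p_norm U w1 p) \<theta>"
   \<comment> \<open>The density assumptions turn the inclusion between the closures of
     \<open>Lip_c\<close> into one between the full spaces.\<close>
   using lower[OF p \<theta>] unfolding eq .
 next
  assume U: "U = UNIV"
  fix p :: real assume p: "1 \<le> p"
  show eq: "W1p_0 U w0 p = W1p U w0 p" "W1p_0 U w1 p = W1p U w1 p"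
   using W1p_0_UNIV[OF _ p] w unfolding U by blast+
  fix \<theta> :: real assume \<theta>: "\<theta> \<in> {0<..<1}"
  show eq': "calW_0 U \<theta> w0 w1 p = calW U \<theta> w0 w1 p"
   using calW_0_UNIV pair[OF p \<theta>] unfolding U by blast
  show "complex_interpolation (W1p U w0 p) (W1p_norm U w0 p) (W1p U w1 p) (W1p_norm U w1 p) \<theta>
    \<subseteq> W1p U (interp_weight w0 w1 \<theta>) p"
   by (rule upper[OF p \<theta>])
  show "calW U \<theta> w0 w1 p \<subseteq> complex_interpolation (W1p U w0 p) (W1p_norm U w0 p) (W1p U w1 p) (W1p_norm U w1 p) \<theta>"
   using lower[OF p \<theta>] unfolding eq eq' .
 qed
qed

end
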